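(* Let $K$ be a field, $D$ a Koszul $K$-algebra, $I$ a homogeneous ideal of $D$ and $R=D/I$. Let $c\geq 1$ be an integer with $c\geq \operatorname{slope}_D(R)$. Then $\operatorname{index}(R^{(c)})\geq \operatorname{index}(D^{(c)})$.
   Context: A standard graded $K$-algebra $R$ is an $\mathbb N$-graded algebra with $R_0=K$, finitely generated over $K$ by elements of degree $1$. $D$ is Koszul if it is standard graded and $K$ has a linear resolution over $D$, i.e. $\operatorname{Tor}^D_i(K,K)_j=0$ for $j\ne i$. For a finitely generated graded module $M$ over a standard graded algebra $R$, $t_i^R(M)=\max\{j:\operatorname{Tor}_i^R(M,K)_j\neq0\}$ (and $-\infty$ if $\operatorname{Tor}_i^R(M,K)=0$), and $\operatorname{slope}_R(M)=\sup\{(t_i^R(M)-t_0^R(M))/i : i\in\mathbb N,\ i>0\}$. Thus $\operatorname{slope}_D(R)=\sup\{t_i^D(R)/i: i\ge1\}$. The Veronese subring $R^{(c)}=\bigoplus_{i}R_{ic}$ is regarded as a standard graded $K$-algebra with $R_{ic}$ in degree $i$. The Green-Lazarsfeld index of a standard graded algebra $A$, written as a graded quotient of a standard graded polynomial ring $P$, is $\operatorname{index}(A)=\sup\{p\in\mathbb N: t_i^P(A)\le i+1\text{ for every } i\le p\}\in\mathbb N\cup\{\infty\}$; it does not depend on the choice of $P$. *)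

theory Defs
  imports
    "HOL-Algebra.Module"
    "HOL-Algebra.QuotRing"
    "HOL-Algebra.Generated_Rings"
    "HOL-Algebra.Indexed_Polynomials"
    "HOL-Library.Extended_Nat"
    "HOL-Library.Extended_Real"
begin

section \<open>Graded algebras and modules\<close>

text \<open>
  A single record carries both graded algebras over \<open>K\<close> and graded modules over a graded algebra
  (for the latter the fields \<open>mult\<close> and \<open>one\<close> play no role).  Degrees are integers;
  an \<open>\<nat>\<close>-graded object is one whose components of negative degree are zero.
\<close>

record ('a, 'b) graded = "('a, 'b) module" +
  homog :: "int \<Rightarrow> 'b set"

definition direct_sum_of_homog :: "('a, 'b, 'm) graded_scheme \<Rightarrow> bool" where
  "direct_sum_of_homog M \<longleftrightarrow>
     (\<forall>i. additive_subgroup (homog M i) M) \<and>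
     (\<forall>x\<in>carrier M. \<exists>!f. (\<forall>i. f i \<in> homog M i) \<and> finite {i. f i \<noteq> \<zero>\<^bsub>M\<^esub>} \<and>
        x = (\<Oplus>\<^bsub>M\<^esub> i\<in>{i. f i \<noteq> \<zero>\<^bsub>M\<^esub>}. f i))"

locale standard_graded_algebra =
  fixes K :: "('k, 'z) ring_scheme" and A :: "('k, 'b, 'm) graded_scheme"
  assumes field: "field K"
    and algebra: "algebra K A"
    and decomposition: "direct_sum_of_homog A"
    and nonneg_degrees: "i < 0 \<Longrightarrow> homog A i = {\<zero>\<^bsub>A\<^esub>}"
    and homog_mult: "\<lbrakk> x \<in> homog A i; y \<in> homog A j \<rbrakk> \<Longrightarrow> x \<otimes>\<^bsub>A\<^esub> y \<in> homog A (i + j)"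
    and degree_zero: "bij_betw (\<lambda>a. a \<odot>\<^bsub>A\<^esub> \<one>\<^bsub>A\<^esub>) (carrier K) (homog A 0)"
    and generated_in_degree_one:
      "\<exists>S. finite S \<and> S \<subseteq> homog A 1 \<and> generate_ring A (homog A 0 \<union> S) = carrier A"

definition homogeneous_ideal :: "'b set \<Rightarrow> ('a, 'b, 'm) graded_scheme \<Rightarrow> bool" where
  "homogeneous_ideal I A \<longleftrightarrow> ideal I A \<and> I = Idl\<^bsub>A\<^esub> (I \<inter> (\<Union>i. homog A i))"

definition irrelevant_ideal :: "('a, 'b, 'm) graded_scheme \<Rightarrow> 'b set" where
  "irrelevant_ideal A = Idl\<^bsub>A\<^esub> (\<Union>i\<in>{0<..}. homog A i)"

definition quot_algebra :: "('a, 'b, 'm) graded_scheme \<Rightarrow> 'b set \<Rightarrow> ('a, 'b set) graded" where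
  "quot_algebra A I =
     \<lparr>carrier = carrier (A Quot I), monoid.mult = monoid.mult (A Quot I), one = one (A Quot I),
      zero = zero (A Quot I), add = add (A Quot I),
      smult = (\<lambda>a C. \<Union>x\<in>C. I +>\<^bsub>A\<^esub> (a \<odot>\<^bsub>A\<^esub> x)),
      homog = (\<lambda>i. (\<lambda>x. I +>\<^bsub>A\<^esub> x) ` homog A i)\<rparr>"

text \<open>A target algebra \<open>A\<close> of a ring homomorphism \<open>f\<close>, viewed as a module over the source.\<close>

definition restrict_scalars :: "('r \<Rightarrow> 'b) \<Rightarrow> ('a, 'b, 'm) graded_scheme \<Rightarrow> ('r, 'b) graded" where
  "restrict_scalars f A =
     \<lparr>carrier = carrier A, monoid.mult = monoid.mult A, one = one A, zero = zero A, add = add A,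
      smult = (\<lambda>r x. f r \<otimes>\<^bsub>A\<^esub> x), homog = homog A\<rparr>"

definition quot_module :: "('a, 'b, 'm) graded_scheme \<Rightarrow> 'b set \<Rightarrow> ('b, 'b set) graded" where
  "quot_module A I = restrict_scalars (\<lambda>x. I +>\<^bsub>A\<^esub> x) (quot_algebra A I)"

text \<open>For a standard graded algebra \<open>A\<close> this is \<open>K\<close>, in degree 0, as an \<open>A\<close>-module.\<close>

definition residue_module :: "('a, 'b, 'm) graded_scheme \<Rightarrow> ('b, 'b set) graded" where
  "residue_module A = quot_module A (irrelevant_ideal A)"

definition veronese :: "nat \<Rightarrow> ('a, 'b) graded \<Rightarrow> ('a, 'b) graded" where
  "veronese c A = A\<lparr>
     carrier := {\<Oplus>\<^bsub>A\<^esub> i\<in>S. f i | S f. finite S \<and> (\<forall>i\<in>S. f i \<in> homog A (int c * i))},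
     homog := (\<lambda>i. homog A (int c * i))\<rparr>"


section \<open>Graded Tor with coefficients in the residue field\<close>

text \<open>
  The graded free module with basis \<open>(e n)\<close>, \<open>n \<in> B\<close>, where \<open>e n\<close> has degree \<open>s n\<close>:
  an element is its finitely supported coordinate function, extended by zero outside \<open>B\<close>.
\<close>

definition free_module :: "('a, 'b, 'm) graded_scheme \<Rightarrow> nat set \<Rightarrow> (nat \<Rightarrow> int)
    \<Rightarrow> ('b, nat \<Rightarrow> 'b) graded" where
  "free_module R B s =
     (let C = {x. (\<forall>n. x n \<in> carrier R) \<and> (\<forall>n. n \<notin> B \<longrightarrow> x n = \<zero>\<^bsub>R\<^esub>) \<and>
                  finite {n. x n \<noteq> \<zero>\<^bsub>R\<^esub>}}
      in \<lparr>carrier = C, monoid.mult = undefined, one = undefined,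
          zero = (\<lambda>_. \<zero>\<^bsub>R\<^esub>), add = (\<lambda>x y n. x n \<oplus>\<^bsub>R\<^esub> y n),
          smult = (\<lambda>r x n. r \<otimes>\<^bsub>R\<^esub> x n),
          homog = (\<lambda>j. {x \<in> C. \<forall>n\<in>B. x n \<in> homog R (j - s n)})\<rparr>)"

definition graded_linear :: "('r, 'm) ring_scheme \<Rightarrow> ('r, 'x, 'y) graded_scheme
    \<Rightarrow> ('r, 'z, 'w) graded_scheme \<Rightarrow> ('x \<Rightarrow> 'z) \<Rightarrow> bool" where
  "graded_linear R M N f \<longleftrightarrow>
     f \<in> carrier M \<rightarrow> carrier N \<and>
     (\<forall>x\<in>carrier M. \<forall>y\<in>carrier M. f (x \<oplus>\<^bsub>M\<^esub> y) = f x \<oplus>\<^bsub>N\<^esub> f y) \<and>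
     (\<forall>r\<in>carrier R. \<forall>x\<in>carrier M. f (r \<odot>\<^bsub>M\<^esub> x) = r \<odot>\<^bsub>N\<^esub> f x) \<and>
     (\<forall>j. f ` homog M j \<subseteq> homog N j)"

text \<open>
  A complex of graded free modules with augmentation: \<open>diff i\<close> maps the module in homological
  degree \<open>i + 1\<close> to the one in homological degree \<open>i\<close>.  Countable bases are allowed.  They
  suffice for finitely generated graded modules over a standard graded algebra, whose
  components are finite-dimensional.
\<close>

record ('r, 'm) free_complex =
  gens :: "nat \<Rightarrow> nat set"
  degs :: "nat \<Rightarrow> nat \<Rightarrow> int"
  diff :: "nat \<Rightarrow> (nat \<Rightarrow> 'r) \<Rightarrow> (nat \<Rightarrow> 'r)"
  augm :: "(nat \<Rightarrow> 'r) \<Rightarrow> 'm"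

definition term_at :: "('a, 'r, 'z) graded_scheme \<Rightarrow> ('r, 'm) free_complex \<Rightarrow> nat
    \<Rightarrow> ('r, nat \<Rightarrow> 'r) graded" where
  "term_at R F i = free_module R (gens F i) (degs F i)"

definition graded_free_resolution :: "('a, 'r, 'z) graded_scheme \<Rightarrow> ('r, 'm, 'w) graded_scheme
    \<Rightarrow> ('r, 'm) free_complex \<Rightarrow> bool" where
  "graded_free_resolution R M F \<longleftrightarrow>
     graded_linear R (term_at R F 0) M (augm F) \<and>
     (\<forall>i. graded_linear R (term_at R F (Suc i)) (term_at R F i) (diff F i)) \<and>
     augm F ` carrier (term_at R F 0) = carrier M \<and>
     diff F 0 ` carrier (term_at R F 1) = {x \<in> carrier (term_at R F 0). augm F x = \<zero>\<^bsub>M\<^esub>} \<and>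
     (\<forall>i. diff F (Suc i) ` carrier (term_at R F (Suc (Suc i))) =
        {x \<in> carrier (term_at R F (Suc i)). diff F i x = \<zero>\<^bsub>term_at R F i\<^esub>})"

text \<open>
  For a graded free module \<open>F\<close> and \<open>\<mm> = irrelevant_ideal R\<close>, the tensor product
  \<open>F \<otimes> K = F \<otimes> R/\<mm>\<close> is \<open>F / \<mm>F\<close>, and \<open>\<mm>F\<close> consists of the elements with all coordinates in \<open>\<mm>\<close>.
\<close>

definition irrelevant_part :: "('a, 'r, 'z) graded_scheme \<Rightarrow> ('r, 'm) free_complex \<Rightarrow> nat
    \<Rightarrow> (nat \<Rightarrow> 'r) set" where
  "irrelevant_part R F i = {x \<in> carrier (term_at R F i). \<forall>n. x n \<in> irrelevant_ideal R}"

text \<open>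
  The preimages in degree \<open>j\<close> of \<open>F\<^sub>i\<close> of the cycles and the boundaries of \<open>F \<otimes> K\<close>.  Their
  quotient is the degree \<open>j\<close> part of the homology of \<open>F \<otimes> K\<close> in homological degree \<open>i\<close>.
\<close>

definition tensor_cycles :: "('a, 'r, 'z) graded_scheme \<Rightarrow> ('r, 'm) free_complex \<Rightarrow> nat \<Rightarrow> int
    \<Rightarrow> (nat \<Rightarrow> 'r) set" where
  "tensor_cycles R F i j =
     {x \<in> homog (term_at R F i) j.
        case i of 0 \<Rightarrow> True | Suc k \<Rightarrow> diff F k x \<in> irrelevant_part R F k}"

definition tensor_boundaries :: "('a, 'r, 'z) graded_scheme \<Rightarrow> ('r, 'm) free_complex \<Rightarrow> nat \<Rightarrow> int
    \<Rightarrow> (nat \<Rightarrow> 'r) set" where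
  "tensor_boundaries R F i j =
     {x \<in> homog (term_at R F i) j.
        \<exists>y \<in> homog (term_at R F (Suc i)) j. \<exists>w \<in> irrelevant_part R F i.
          x = diff F i y \<oplus>\<^bsub>term_at R F i\<^esub> w}"

definition Tor :: "('a, 'r, 'z) graded_scheme \<Rightarrow> ('r, 'm, 'w) graded_scheme \<Rightarrow> nat \<Rightarrow> int
    \<Rightarrow> (nat \<Rightarrow> 'r) set monoid" where
  "Tor R M i j =
     (let F = (SOME F. graded_free_resolution R M F)
      in (add_monoid (term_at R F i)\<lparr>carrier := tensor_cycles R F i j\<rparr>)
           Mod tensor_boundaries R F i j)"

definition Tor_nonzero :: "('a, 'r, 'z) graded_scheme \<Rightarrow> ('r, 'm, 'w) graded_scheme \<Rightarrow> nat \<Rightarrow> int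
    \<Rightarrow> bool" where
  "Tor_nonzero R M i j \<longleftrightarrow> carrier (Tor R M i j) \<noteq> {\<one>\<^bsub>Tor R M i j\<^esub>}"


section \<open>Koszul algebras, slope and the Green-Lazarsfeld index\<close>

definition koszul :: "('k, 'z) ring_scheme \<Rightarrow> ('k, 'b, 'm) graded_scheme \<Rightarrow> bool" where
  "koszul K D \<longleftrightarrow> standard_graded_algebra K D \<and>
     (\<forall>i j. j \<noteq> int i \<longrightarrow> \<not> Tor_nonzero D (residue_module D) i j)"

text \<open>
  The supremum is \<open>-\<infinity>\<close> if the Tor module is zero.  If \<open>M\<close> is finitely generated over a standard
  graded algebra, only finitely many degrees occur, so it is a maximum otherwise.
\<close>

definition top_degree :: "('a, 'r, 'z) graded_scheme \<Rightarrow> ('r, 'm, 'w) graded_scheme \<Rightarrow> nat \<Rightarrow> ereal"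
  where
  "top_degree R M i = (SUP j\<in>{j. Tor_nonzero R M i j}. ereal (real_of_int j))"

definition slope :: "('a, 'r, 'z) graded_scheme \<Rightarrow> ('r, 'm, 'w) graded_scheme \<Rightarrow> ereal" where
  "slope R M = (SUP i\<in>{0<..}. (top_degree R M i - top_degree R M 0) / ereal (real i))"

text \<open>
  The polynomial ring over \<open>K\<close> in \<open>n\<close> variables of degree 1.  As in the library's indexed
  polynomials, monomials are multisets of variables.
\<close>

definition poly_algebra :: "('k, 'z) ring_scheme \<Rightarrow> nat \<Rightarrow> ('k, nat multiset \<Rightarrow> 'k) graded" where
  "poly_algebra K n =
     (let C = ring.indexed_pset K {..<n} (carrier K)
      in \<lparr>carrier = C,
          monoid.mult = (\<lambda>p q m. \<Oplus>\<^bsub>K\<^esub> a\<in>{a. a \<subseteq># m}. p a \<otimes>\<^bsub>K\<^esub> q (m - a)),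
          one = ring.indexed_const K \<one>\<^bsub>K\<^esub>,
          zero = ring.indexed_const K \<zero>\<^bsub>K\<^esub>,
          add = ring.indexed_padd K,
          smult = (\<lambda>a p m. a \<otimes>\<^bsub>K\<^esub> p m),
          homog = (\<lambda>j. {p \<in> C. \<forall>m. p m \<noteq> \<zero>\<^bsub>K\<^esub> \<longrightarrow> int (size m) = j})\<rparr>)"

definition graded_presentation :: "('k, 'z) ring_scheme \<Rightarrow> ('k, 'b) graded \<Rightarrow> nat
    \<Rightarrow> ((nat multiset \<Rightarrow> 'k) \<Rightarrow> 'b) \<Rightarrow> bool" where
  "graded_presentation K A n \<phi> \<longleftrightarrow>
     \<phi> \<in> ring_hom (poly_algebra K n) A \<and>
     graded_linear K (poly_algebra K n) A \<phi> \<and>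
     \<phi> ` carrier (poly_algebra K n) = carrier A"

text \<open>The value does not depend on the chosen presentation.\<close>

definition gl_index :: "('k, 'z) ring_scheme \<Rightarrow> ('k, 'b) graded \<Rightarrow> enat" where
  "gl_index K A =
     (let (n, \<phi>) = (SOME (n, \<phi>). graded_presentation K A n \<phi>)
      in Sup {enat p | p. \<forall>i\<le>p.
           top_degree (poly_algebra K n) (restrict_scalars \<phi> A) i \<le> ereal (real (i + 1))})"

end

theory Submission
  imports Defs
begin

text \<open>
  Write \<open>V = D\<^bsup>(c)\<^esup>\<close>. Since \<open>D\<close> is Koszul, the Veronese modules \<open>\<Oplus>\<^sub>j D\<^bsub>cj+e\<^esub>\<close>, \<open>e \<ge> 0\<close>, have linear resolutions over
  \<open>V\<close>. The slope condition together with \<open>t\<^sub>0\<^sup>D(R) \<le> 0\<close> gives \<open>t\<^sub>i\<^sup>D(R) \<le> ci\<close>, so taking the degrees divisible by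
  \<open>c\<close> in a resolution of \<open>R\<close> over \<open>D\<close> yields a resolution of \<open>R\<^bsup>(c)\<^esup>\<close> by Veronese modules generated in degrees at
  most \<open>i\<close>, and hence \<open>t\<^sub>i\<^sup>V(R\<^bsup>(c)\<^esup>) \<le> i\<close>. If \<open>S \<rightarrow> V\<close> is a polynomial presentation with \<open>t\<^sub>i\<^sup>S(V) \<le> i + 1\<close> for
  \<open>i \<le> p\<close>, then resolving the terms of the linear resolution of \<open>R\<^bsup>(c)\<^esup>\<close> over \<open>V\<close> by \<open>S\<close>-modules gives
  \<open>t\<^sub>i\<^sup>S(R\<^bsup>(c)\<^esup>) \<le> i + 1\<close> for \<open>i \<le> p\<close>. As \<open>S\<close> also presents \<open>R\<^bsup>(c)\<^esup>\<close>, the theorem follows once the index is known not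
  to depend on the presentation: any two are linked by adjoining and removing variables, and a new variable \<open>x\<close>
  mapped to the image of a linear form \<open>l\<close> only introduces the nonzerodivisor \<open>x - l\<close> of degree 1, over which the
  smaller polynomial ring has a linear resolution of length 1.
\<close>

subsection \<open>Graded rings and modules\<close>

text \<open>All estimates are phrased by \<open>lin\<close>, the existence of a resolution, minimal
  or not, with bounded generator degrees. Unlike vanishing of Tor, this passes directly through
  exact sequences, direct sums, changes of ring and Veronese functors: each time a cover is written
  down and the claim is applied again to its kernel. \<open>Tor_vanishing_iff_lin\<close> is the
  link with Tor. The definition of Tor picks an arbitrary resolution, so two resolutions have to be
  compared whose syzygies agree only up to free summands; a homotopy equivalence through free
  modules is carried along for this purpose. The constants combine as follows. Degree
  \<open>c\<close> of \<open>D\<close> is degree 1 of the Veronese ring, which turns slope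
  \<open>c\<close> into slope 1. The 1 in \<open>i + 1\<close> is the constant of the Veronese ring
  over the polynomial ring, and a change of rings adds constants, here 0 and 1. Bases are sets of
  naturals, so every syzygy must be spanned by countably many elements in each degree; this is
  linear algebra over the degree 0 part.\<close>

locale graded_ring = cring A for A :: "('a, 'r, 'z) graded_scheme" (structure) +
  assumes homog_subgroup: "additive_subgroup (homog A i) A"
    and one_homog: "\<one> \<in> homog A 0"
    and mult_homog: "x \<in> homog A i \<Longrightarrow> y \<in> homog A j \<Longrightarrow> x \<otimes> y \<in> homog A (i + j)"
begin

lemma homog_carrier: "x \<in> homog A i \<Longrightarrow> x \<in> carrier A"
  using additive_subgroup.a_Hcarr[OF homog_subgroup] .

end

text \<open>
  Only the homogeneous components matter: the carrier may be any ambient module containing them. A graded submodule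
  is thus a regrading of the same carrier.
\<close>

locale graded_module = graded_ring A + module A M
  for A :: "('a, 'r, 'z) graded_scheme" (structure) and M :: "('r, 'm) graded" (structure) +
  assumes M_homog_subgroup: "additive_subgroup (homog M i) M"
    and smult_homog: "a \<in> homog A i \<Longrightarrow> x \<in> homog M j \<Longrightarrow> a \<odot>\<^bsub>M\<^esub> x \<in> homog M (i + j)"
begin

lemma M_homog_carrier: "x \<in> homog M i \<Longrightarrow> x \<in> carrier M"
  using additive_subgroup.a_Hcarr[OF M_homog_subgroup] .

lemma M_homog_zero: "\<zero>\<^bsub>M\<^esub> \<in> homog M i"
  using additive_subgroup.zero_closed[OF M_homog_subgroup] .

lemma M_homog_add: "x \<in> homog M i \<Longrightarrow> y \<in> homog M i \<Longrightarrow> x \<oplus>\<^bsub>M\<^esub> y \<in> homog M i"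
  using additive_subgroup.a_closed[OF M_homog_subgroup] .

lemma M_homog_neg: "x \<in> homog M i \<Longrightarrow> \<ominus>\<^bsub>M\<^esub> x \<in> homog M i"
  using additive_subgroup.a_inv_closed[OF M_homog_subgroup] .

lemma M_homog_diff: "x \<in> homog M i \<Longrightarrow> y \<in> homog M i \<Longrightarrow> x \<ominus>\<^bsub>M\<^esub> y \<in> homog M i"
  unfolding a_minus_def by (intro M_homog_add M_homog_neg)

lemma smult_homog': "a \<in> homog A i \<Longrightarrow> x \<in> homog M j \<Longrightarrow> k = i + j \<Longrightarrow> a \<odot>\<^bsub>M\<^esub> x \<in> homog M k"
  using smult_homog by simp

lemmas M_homog_closed = M_homog_zero M_homog_add M_homog_neg M_homog_diff

end

lemma additive_subgroupI':
  assumes "abelian_group G" "H \<subseteq> carrier G" "\<zero>\<^bsub>G\<^esub> \<in> H"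
    and "\<And>x y. x \<in> H \<Longrightarrow> y \<in> H \<Longrightarrow> x \<oplus>\<^bsub>G\<^esub> y \<in> H" "\<And>x. x \<in> H \<Longrightarrow> \<ominus>\<^bsub>G\<^esub> x \<in> H"
  shows "additive_subgroup H G"
proof -
  interpret abelian_group G by fact
  show ?thesis
    using assms(2-) by (intro additive_subgroup.intro add.subgroupI) (auto simp: a_inv_def)
qed

lemma graded_moduleI:
  assumes "graded_ring A" "module A M"
    and "\<And>j. homog M j \<subseteq> carrier M" "\<And>j. \<zero>\<^bsub>M\<^esub> \<in> homog M j"
    and "\<And>j x y. x \<in> homog M j \<Longrightarrow> y \<in> homog M j \<Longrightarrow> x \<oplus>\<^bsub>M\<^esub> y \<in> homog M j"
    and "\<And>j x. x \<in> homog M j \<Longrightarrow> \<ominus>\<^bsub>M\<^esub> x \<in> homog M j"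
    and "\<And>i j a x. a \<in> homog A i \<Longrightarrow> x \<in> homog M j \<Longrightarrow> a \<odot>\<^bsub>M\<^esub> x \<in> homog M (i + j)"
  shows "graded_module A M"
proof -
  interpret module A M by fact
  show ?thesis
    using assms
    by (intro graded_module.intro graded_module_axioms.intro additive_subgroupI') (auto intro: M.abelian_group_axioms)
qed

subsection \<open>Regrading\<close>

lemma a_inv_regrade [simp]: "a_inv (M\<lparr>homog := H\<rparr>) = a_inv M"
  by (intro ext) (simp add: a_inv_def m_inv_def)

lemma a_minus_regrade [simp]: "a_minus (M\<lparr>homog := H\<rparr>) = a_minus M"
  by (intro ext) (simp add: a_minus_def)

lemma abelian_group_regrade [simp]:
  fixes M :: "('a, 'b, 'c) graded_scheme"
  shows "abelian_group (M\<lparr>homog := H\<rparr>) = abelian_group M"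
  by (simp add: abelian_group_def abelian_monoid_def abelian_group_axioms_def)

lemma module_regrade [simp]: "module A (M\<lparr>homog := H\<rparr>) = module A M"
  by (simp add: module_def module_axioms_def)

lemma regrade_id: "M\<lparr>homog := homog M\<rparr> = (M :: ('a, 'b) graded)"
  by simp

subsection \<open>Graded linear maps\<close>

lemma graded_linearI:
  assumes "\<And>x. x \<in> carrier M \<Longrightarrow> f x \<in> carrier N"
    and "\<And>x y. x \<in> carrier M \<Longrightarrow> y \<in> carrier M \<Longrightarrow> f (x \<oplus>\<^bsub>M\<^esub> y) = f x \<oplus>\<^bsub>N\<^esub> f y"
    and "\<And>r x. r \<in> carrier A \<Longrightarrow> x \<in> carrier M \<Longrightarrow> f (r \<odot>\<^bsub>M\<^esub> x) = r \<odot>\<^bsub>N\<^esub> f x"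
    and "\<And>j x. x \<in> homog M j \<Longrightarrow> f x \<in> homog N j"
  shows "graded_linear A M N f"
  using assms unfolding graded_linear_def by auto

lemma graded_linearD:
  assumes "graded_linear A M N f"
  shows "x \<in> carrier M \<Longrightarrow> f x \<in> carrier N"
    and "x \<in> carrier M \<Longrightarrow> y \<in> carrier M \<Longrightarrow> f (x \<oplus>\<^bsub>M\<^esub> y) = f x \<oplus>\<^bsub>N\<^esub> f y"
    and "r \<in> carrier A \<Longrightarrow> x \<in> carrier M \<Longrightarrow> f (r \<odot>\<^bsub>M\<^esub> x) = r \<odot>\<^bsub>N\<^esub> f x"
    and "x \<in> homog M j \<Longrightarrow> f x \<in> homog N j"
  using assms unfolding graded_linear_def by blast+

lemma graded_linear_comp:
  "graded_linear A M N f \<Longrightarrow> graded_linear A N P g \<Longrightarrow> graded_linear A M P (\<lambda>x. g (f x))"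
  by (rule graded_linearI) (simp_all add: graded_linearD)

lemma graded_linear_zero_neg:
  assumes "graded_module A M" "graded_module A N" "graded_linear A M N f"
  shows "f \<zero>\<^bsub>M\<^esub> = \<zero>\<^bsub>N\<^esub>"
    and "x \<in> carrier M \<Longrightarrow> f (\<ominus>\<^bsub>M\<^esub> x) = \<ominus>\<^bsub>N\<^esub> f x"
    and "x \<in> carrier M \<Longrightarrow> y \<in> carrier M \<Longrightarrow> f (x \<ominus>\<^bsub>M\<^esub> y) = f x \<ominus>\<^bsub>N\<^esub> f y"
proof -
  interpret M: graded_module A M by fact
  interpret N: graded_module A N by fact
  note f = graded_linearD[OF assms(3)]
  have "f \<zero>\<^bsub>M\<^esub> \<oplus>\<^bsub>N\<^esub> f \<zero>\<^bsub>M\<^esub> = f \<zero>\<^bsub>M\<^esub>"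
    using f(2)[of "\<zero>\<^bsub>M\<^esub>" "\<zero>\<^bsub>M\<^esub>"] by simp
  then show z: "f \<zero>\<^bsub>M\<^esub> = \<zero>\<^bsub>N\<^esub>"
    using f(1)[of "\<zero>\<^bsub>M\<^esub>"] by (simp add: N.M.add.r_cancel_one')
  show n: "f (\<ominus>\<^bsub>M\<^esub> x) = \<ominus>\<^bsub>N\<^esub> f x" if "x \<in> carrier M" for x
    using that f(2)[of "\<ominus>\<^bsub>M\<^esub> x" x] z f(1) by (simp add: M.M.l_neg N.M.minus_equality)
  show "x \<in> carrier M \<Longrightarrow> y \<in> carrier M \<Longrightarrow> f (x \<ominus>\<^bsub>M\<^esub> y) = f x \<ominus>\<^bsub>N\<^esub> f y"
    by (simp add: a_minus_def f n)
qed

lemma graded_linear_add: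
  assumes "graded_module A N" "graded_linear A M N f" "graded_linear A M N g"
  shows "graded_linear A M N (\<lambda>x. f x \<oplus>\<^bsub>N\<^esub> g x)"
proof -
  interpret N: graded_module A N by fact
  note fg = graded_linearD[OF assms(2)] graded_linearD[OF assms(3)]
  show ?thesis
    by (rule graded_linearI) (auto simp: fg N.M.a_ac N.smult_r_distr intro!: N.M_homog_add)
qed

lemma graded_linear_neg:
  assumes "graded_module A N" "graded_linear A M N f"
  shows "graded_linear A M N (\<lambda>x. \<ominus>\<^bsub>N\<^esub> f x)"
proof -
  interpret N: graded_module A N by fact
  note f = graded_linearD[OF assms(2)]
  show ?thesis
    by (rule graded_linearI) (auto simp: f N.M.minus_add N.smult_r_minus intro!: N.M_homog_neg)
qed

lemma graded_linear_diff:
  assumes "graded_module A N" "graded_linear A M N f" "graded_linear A M N g"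
  shows "graded_linear A M N (\<lambda>x. f x \<ominus>\<^bsub>N\<^esub> g x)"
  unfolding a_minus_def by (intro graded_linear_add graded_linear_neg assms)

lemma graded_linear_id: "graded_linear A M M (\<lambda>x. x)"
  by (rule graded_linearI) simp_all

text \<open>The carrier and the operations stay those of \<open>M\<close>, so the inclusion is the
  identity, and a map enters only through its zeros among the homogeneous elements: two maps with
  the same zeros there give equal records. Kernels can therefore be rewritten by equations instead
  of being transported along isomorphisms.\<close>

definition kerm :: "('r, 'm) graded \<Rightarrow> ('r, 'n) graded \<Rightarrow> ('m \<Rightarrow> 'n) \<Rightarrow> ('r, 'm) graded" where
  "kerm M N f = M\<lparr>homog := \<lambda>j. {x \<in> homog M j. f x = \<zero>\<^bsub>N\<^esub>}\<rparr>"

lemma kerm_simps [simp]: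
  "carrier (kerm M N f) = carrier M" "zero (kerm M N f) = zero M" "add (kerm M N f) = add M"
  "smult (kerm M N f) = smult M" "a_inv (kerm M N f) = a_inv M" "a_minus (kerm M N f) = a_minus M"
  "homog (kerm M N f) j = {x \<in> homog M j. f x = \<zero>\<^bsub>N\<^esub>}"
  by (simp_all add: kerm_def)

lemma graded_module_kerm:
  assumes "graded_module A M" "graded_module A N" "graded_linear A M N f"
  shows "graded_module A (kerm M N f)"
proof -
  interpret M: graded_module A M by fact
  interpret N: graded_module A N by fact
  note f = graded_linearD[OF assms(3)] graded_linear_zero_neg[OF assms]
  show ?thesis
  proof (rule graded_moduleI)
    show "module A (kerm M N f)" by (simp add: kerm_def M.module_axioms)
  qed (auto simp: f M.M_homog_carrier M.homog_carrier M.M_homog_closed M.smult_homog M.graded_ring_axioms)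
qed

lemma graded_linear_regrade_dom:
  assumes "graded_linear A M N f" "\<And>j x. x \<in> H j \<Longrightarrow> f x \<in> H' j"
  shows "graded_linear A (M\<lparr>homog := H\<rparr>) (N\<lparr>homog := H'\<rparr>) f"
  using assms(2) by (intro graded_linearI) (simp_all add: graded_linearD[OF assms(1)])

subsection \<open>Direct sums and free modules\<close>

definition dunit :: "('r, 'm) graded \<Rightarrow> 'i \<Rightarrow> 'm \<Rightarrow> 'i \<Rightarrow> 'm" where
  "dunit M n a = (\<lambda>k. if k = n then a else \<zero>\<^bsub>M\<^esub>)"

text \<open>The summands are several gradings \<open>H n\<close> of one ambient \<open>M\<close>.
  The index set enters only the homogeneous components, so the carrier is the same for all
  \<open>I\<close> and \<open>H\<close>. By \<open>free_regrade\<close>, kernels in different free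
  modules are then regradings of a single module, as is needed to form their direct sum in
  \<open>lin_dsum_step\<close>.\<close>

definition dsum :: "('r, 'm) graded \<Rightarrow> 'i set \<Rightarrow> ('i \<Rightarrow> int \<Rightarrow> 'm set) \<Rightarrow> ('r, 'i \<Rightarrow> 'm) graded" where
  "dsum M I H =
     (let C = {x. (\<forall>n. x n \<in> carrier M) \<and> finite {n. x n \<noteq> \<zero>\<^bsub>M\<^esub>}}
      in \<lparr>carrier = C, monoid.mult = undefined, one = undefined,
          zero = (\<lambda>_. \<zero>\<^bsub>M\<^esub>), add = (\<lambda>x y n. x n \<oplus>\<^bsub>M\<^esub> y n),
          smult = (\<lambda>r x n. r \<odot>\<^bsub>M\<^esub> x n),
          homog = (\<lambda>j. {x \<in> C. (\<forall>n\<in>I. x n \<in> H n j) \<and> (\<forall>n. n \<notin> I \<longrightarrow> x n = \<zero>\<^bsub>M\<^esub>)})\<rparr>)"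

definition selfm :: "('a, 'r, 'z) graded_scheme \<Rightarrow> ('r, 'r) graded" where
  "selfm A = restrict_scalars (\<lambda>x. x) A"

text \<open>Agrees with \<open>free_module\<close> on homogeneous elements, but the carrier does not
  see the basis: coordinates outside \<open>I\<close> are forced to vanish only in the homogeneous
  components. Maps are therefore controlled on homogeneous elements only.\<close>

definition free :: "('a, 'r, 'z) graded_scheme \<Rightarrow> 'i set \<Rightarrow> ('i \<Rightarrow> int) \<Rightarrow> ('r, 'i \<Rightarrow> 'r) graded" where
  "free A I s = dsum (selfm A) I (\<lambda>n j. homog A (j - s n))"

lemma dsum_simps [simp]:
  "carrier (dsum M I H) = {x. (\<forall>n. x n \<in> carrier M) \<and> finite {n. x n \<noteq> \<zero>\<^bsub>M\<^esub>}}"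
  "zero (dsum M I H) = (\<lambda>_. \<zero>\<^bsub>M\<^esub>)"
  "add (dsum M I H) = (\<lambda>x y n. x n \<oplus>\<^bsub>M\<^esub> y n)"
  "smult (dsum M I H) = (\<lambda>r x n. r \<odot>\<^bsub>M\<^esub> x n)"
  by (simp_all add: dsum_def Let_def)

lemma dsum_homog:
  "homog (dsum M I H) j = {x \<in> carrier (dsum M I H). (\<forall>n\<in>I. x n \<in> H n j) \<and> (\<forall>n. n \<notin> I \<longrightarrow> x n = \<zero>\<^bsub>M\<^esub>)}"
  by (simp add: dsum_def Let_def)

lemma restrict_scalars_simps [simp]:
  "carrier (restrict_scalars f A) = carrier A" "zero (restrict_scalars f A) = zero A"
  "add (restrict_scalars f A) = add A" "smult (restrict_scalars f A) = (\<lambda>r x. f r \<otimes>\<^bsub>A\<^esub> x)"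
  "homog (restrict_scalars f A) = homog A" "monoid.mult (restrict_scalars f A) = monoid.mult A"
  "one (restrict_scalars f A) = one A"
  by (simp_all add: restrict_scalars_def)

lemma selfm_simps [simp]:
  "carrier (selfm A) = carrier A" "zero (selfm A) = zero A" "add (selfm A) = add A"
  "smult (selfm A) = monoid.mult A" "homog (selfm A) = homog A"
  by (simp_all add: selfm_def)

lemma abelian_group_cong:
  assumes "abelian_group G" "carrier G' = carrier G" "add G' = add G" "zero G' = zero G"
  shows "abelian_group G'"
proof -
  interpret abelian_group G by fact
  show ?thesis
    using assms(2-) by (intro abelian_groupI) (auto simp: a_ac intro!: bexI[of _ "\<ominus>\<^bsub>G\<^esub> _"] l_neg)
qed

lemma a_inv_cong:
  assumes "carrier G' = carrier G" "add G' = add G" "zero G' = zero G"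
  shows "a_inv G' = a_inv G"
  using assms by (intro ext) (simp add: a_inv_def m_inv_def)

lemma selfm_a_inv [simp]: "a_inv (selfm A) = a_inv A"
  by (rule a_inv_cong) simp_all

lemma dsum_module:
  fixes M :: "('r, 'm) graded" and I :: "'i set"
  assumes "module R M"
  shows "module R (dsum M I H)"
proof -
  interpret module R M by fact
  have fin: "finite {n. f (x n) (y n) \<noteq> \<zero>\<^bsub>M\<^esub>}" 
    if "finite {n. x n \<noteq> \<zero>\<^bsub>M\<^esub>}" "finite {n. y n \<noteq> \<zero>\<^bsub>M\<^esub>}" "f \<zero>\<^bsub>M\<^esub> \<zero>\<^bsub>M\<^esub> = \<zero>\<^bsub>M\<^esub>" for f :: "'m \<Rightarrow> 'm \<Rightarrow> 'm" and x y :: "'i \<Rightarrow> 'm"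
    by (rule finite_subset[OF _ finite_UnI[OF that(1,2)]]) (use that(3) in auto)
  have ag: "abelian_group (dsum M I H)"
  proof (rule abelian_groupI)
    fix x y assume "x \<in> carrier (dsum M I H)" "y \<in> carrier (dsum M I H)"
    then show "x \<oplus>\<^bsub>dsum M I H\<^esub> y \<in> carrier (dsum M I H)"
      using fin[of x y "\<lambda>x y. x \<oplus>\<^bsub>M\<^esub> y"] by simp
  next
    fix x assume *: "x \<in> carrier (dsum M I H)"
    show "\<exists>y\<in>carrier (dsum M I H). y \<oplus>\<^bsub>dsum M I H\<^esub> x = \<zero>\<^bsub>dsum M I H\<^esub>"
      using * fin[of x x "\<lambda>x _. \<ominus>\<^bsub>M\<^esub> x"]
      by (intro bexI[of _ "\<lambda>n. \<ominus>\<^bsub>M\<^esub> x n"]) (auto simp: M.l_neg)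
  qed (auto simp: M.a_ac)
  show ?thesis
  proof (rule moduleI[OF R.is_cring ag]; clarsimp simp: smult_l_distr smult_r_distr smult_assoc1)
    fix a and x :: "'i \<Rightarrow> 'm" assume "a \<in> carrier R" "\<forall>n. x n \<in> carrier M" "finite {n. x n \<noteq> \<zero>\<^bsub>M\<^esub>}"
    then show "finite {n. a \<odot>\<^bsub>M\<^esub> x n \<noteq> \<zero>\<^bsub>M\<^esub>}"
      using fin[of x x "\<lambda>x _. a \<odot>\<^bsub>M\<^esub> x"] by simp
  qed
qed

lemma dsum_a_inv:
  assumes "module A M" "x \<in> carrier (dsum M I H)"
  shows "\<ominus>\<^bsub>dsum M I H\<^esub> x = (\<lambda>n. \<ominus>\<^bsub>M\<^esub> x n)"
proof -
  interpret M: module A M by fact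
  interpret S: module A "dsum M I H" by (rule dsum_module) fact
  have *: "(\<lambda>n. \<ominus>\<^bsub>M\<^esub> x n) \<in> carrier (dsum M I H)"
    using assms(2) by (auto elim!: finite_subset[rotated])
  show ?thesis
    by (rule S.M.minus_equality[OF _ assms(2) *]) (use assms(2) in \<open>auto simp: M.M.l_neg\<close>)
qed

lemma graded_module_dsum:
  assumes "graded_ring A" "module A M" "\<And>n. n \<in> I \<Longrightarrow> graded_module A (M\<lparr>homog := H n\<rparr>)"
  shows "graded_module A (dsum M I H)"
proof -
  interpret M: module A M by fact
  interpret A: graded_ring A by fact
  interpret S: module A "dsum M I H" by (rule dsum_module) fact
  have H: "\<zero>\<^bsub>M\<^esub> \<in> H n j" "x \<in> H n j \<Longrightarrow> y \<in> H n j \<Longrightarrow> x \<oplus>\<^bsub>M\<^esub> y \<in> H n j"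
    "x \<in> H n j \<Longrightarrow> \<ominus>\<^bsub>M\<^esub> x \<in> H n j" "a \<in> homog A i \<Longrightarrow> x \<in> H n j \<Longrightarrow> a \<odot>\<^bsub>M\<^esub> x \<in> H n (i + j)"
    if "n \<in> I" for n i j x y a
  proof -
    interpret N: graded_module A "M\<lparr>homog := H n\<rparr>" by (rule assms(3)[OF that])
    show "\<zero>\<^bsub>M\<^esub> \<in> H n j" "x \<in> H n j \<Longrightarrow> y \<in> H n j \<Longrightarrow> x \<oplus>\<^bsub>M\<^esub> y \<in> H n j"
      "x \<in> H n j \<Longrightarrow> \<ominus>\<^bsub>M\<^esub> x \<in> H n j" "a \<in> homog A i \<Longrightarrow> x \<in> H n j \<Longrightarrow> a \<odot>\<^bsub>M\<^esub> x \<in> H n (i + j)"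
      using N.M_homog_zero N.M_homog_add N.M_homog_neg N.smult_homog by auto
  qed
  show ?thesis
  proof (rule graded_moduleI[OF assms(1) S.module_axioms])
    fix j x y assume "x \<in> homog (dsum M I H) j" "y \<in> homog (dsum M I H) j"
    then show "x \<oplus>\<^bsub>dsum M I H\<^esub> y \<in> homog (dsum M I H) j"
      using S.M.a_closed[of x y] H(2) by (auto simp: dsum_homog)
  next
    fix j x assume "x \<in> homog (dsum M I H) j"
    then show "\<ominus>\<^bsub>dsum M I H\<^esub> x \<in> homog (dsum M I H) j"
      using S.M.a_inv_closed[of x] H(3) by (auto simp: dsum_homog dsum_a_inv[OF assms(2)])
  next
    fix i j a x assume "a \<in> homog A i" "x \<in> homog (dsum M I H) j"
    then show "a \<odot>\<^bsub>dsum M I H\<^esub> x \<in> homog (dsum M I H) (i + j)"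
      using S.smult_closed[of a x] A.homog_carrier[of a i] H(4) by (auto simp: dsum_homog)
  qed (auto simp: dsum_homog H)
qed

lemma (in graded_ring) selfm_module: "module A (selfm A)"
proof (rule moduleI)
  show "abelian_group (selfm A)" by (rule abelian_group_cong[OF abelian_group_axioms]) simp_all
qed (auto simp: l_distr r_distr m_assoc intro: cring_axioms)

lemma (in graded_ring) graded_module_selfm_shift: "graded_module A ((selfm A)\<lparr>homog := \<lambda>j. homog A (j + e)\<rparr>)"
  using additive_subgroup.a_inv_closed[OF homog_subgroup]
    additive_subgroup.a_closed[OF homog_subgroup] additive_subgroup.zero_closed[OF homog_subgroup] mult_homog homog_carrier
  by (intro graded_moduleI graded_ring_axioms) (auto simp: selfm_module, metis add.assoc)

lemma (in graded_ring) graded_module_selfm: "graded_module A (selfm A)"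
  using graded_module_selfm_shift[of 0] by (simp add: selfm_def restrict_scalars_def)

lemma (in graded_ring) graded_module_free: "graded_module A (free A I s)"
  unfolding free_def using graded_module_selfm_shift[of "- s _"]
  by (intro graded_module_dsum graded_ring_axioms selfm_module) simp

lemma free_simps:
  "carrier (free A I s) = {x. (\<forall>n. x n \<in> carrier A) \<and> finite {n. x n \<noteq> \<zero>\<^bsub>A\<^esub>}}"
  "zero (free A I s) = (\<lambda>_. \<zero>\<^bsub>A\<^esub>)"
  "add (free A I s) = (\<lambda>x y n. x n \<oplus>\<^bsub>A\<^esub> y n)"
  "smult (free A I s) = (\<lambda>r x n. r \<otimes>\<^bsub>A\<^esub> x n)"
  "homog (free A I s) j = {x \<in> carrier (free A I s). (\<forall>n\<in>I. x n \<in> homog A (j - s n)) \<and> (\<forall>n. n \<notin> I \<longrightarrow> x n = \<zero>\<^bsub>A\<^esub>)}"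
  by (simp_all add: free_def dsum_homog)

lemma dunit_carrier:
  assumes "module A M" "a \<in> carrier M"
  shows "dunit M n a \<in> carrier (dsum M I H)"
proof -
  interpret M: module A M by fact
  show ?thesis using assms(2) by (auto simp: dunit_def)
qed

lemma dunit_homog:
  assumes "module A M" "a \<in> carrier M" "a \<in> H n j" "n \<in> I" "\<And>n. n \<in> I \<Longrightarrow> \<zero>\<^bsub>M\<^esub> \<in> H n j"
  shows "dunit M n a \<in> homog (dsum M I H) j"
  using dunit_carrier[OF assms(1,2), of n I H] assms(3-) by (auto simp: dsum_homog dunit_def simp del: dsum_simps)

text \<open>Induction over a finite set containing the support. Setting one coordinate to zero stays
  in degree \<open>j\<close>, so the element is rebuilt by adding \<open>dunit\<close> vectors
  without leaving that degree.\<close>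

lemma dsum_homog_induct:
  assumes M: "module A M" and x: "x \<in> homog (dsum M I H) j" and 0: "P (\<lambda>_. \<zero>\<^bsub>M\<^esub>)"
    and zH: "\<And>n. n \<in> I \<Longrightarrow> \<zero>\<^bsub>M\<^esub> \<in> H n j"
    and step: "\<And>x n a. x \<in> homog (dsum M I H) j \<Longrightarrow> P x \<Longrightarrow> n \<in> I \<Longrightarrow> a \<in> carrier M \<Longrightarrow> a \<in> H n j
      \<Longrightarrow> P (x \<oplus>\<^bsub>dsum M I H\<^esub> dunit M n a)"
  shows "P x"
proof -
  interpret M: module A M by fact
  have "P x" if "finite S" "x \<in> homog (dsum M I H) j" "{n. x n \<noteq> \<zero>\<^bsub>M\<^esub>} \<subseteq> S" for S x
    using that
  proof (induction S arbitrary: x rule: finite_induct)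
    case empty then have "x = (\<lambda>_. \<zero>\<^bsub>M\<^esub>)" by auto
    then show ?case using 0 by simp
  next
    case (insert k S)
    let ?y = "x(k := \<zero>\<^bsub>M\<^esub>)"
    have y: "?y \<in> homog (dsum M I H) j" using insert.prems(1) zH
      by (auto elim!: finite_subset[rotated] simp: M.M.zero_closed dsum_homog)
    have Py: "P ?y" by (rule insert.IH[OF y]) (use insert.prems in auto)
    show ?case
    proof (cases "k \<in> I")
      case True
      have "x = ?y \<oplus>\<^bsub>dsum M I H\<^esub> dunit M k (x k)" "x k \<in> carrier M" "x k \<in> H k j"
        using insert.prems(1) True by (auto simp: dunit_def dsum_homog)
      then show ?thesis using step[OF y Py True] by metis
    next
      case False
      then have "?y = x" using insert.prems(1) by (auto simp: dsum_homog)
      then show ?thesis using Py by simp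
    qed
  qed
  from this[OF _ x order.refl] show ?thesis using x by (simp add: dsum_homog)
qed

definition lincomb :: "('r, 'b) ring_scheme \<Rightarrow> ('r, 'm, 'w) module_scheme \<Rightarrow> ('i \<Rightarrow> 'm) \<Rightarrow> ('i \<Rightarrow> 'r) \<Rightarrow> 'm" where
  "lincomb R M y x = (\<Oplus>\<^bsub>M\<^esub> n\<in>{n. x n \<noteq> \<zero>\<^bsub>R\<^esub>}. x n \<odot>\<^bsub>M\<^esub> y n)"

context module
begin

lemma lincomb_superset:
  assumes "finite S" "{n. x n \<noteq> \<zero>} \<subseteq> S" "\<And>n. x n \<in> carrier R" "\<And>n. y n \<in> carrier M"
  shows "lincomb R M y x = (\<Oplus>\<^bsub>M\<^esub> n\<in>S. x n \<odot>\<^bsub>M\<^esub> y n)"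
  unfolding lincomb_def using assms by (intro M.add.finprod_mono_neutral_cong_left) auto

lemma lincomb_closed:
  assumes "\<And>n. x n \<in> carrier R" "\<And>n. y n \<in> carrier M"
  shows "lincomb R M y x \<in> carrier M"
  unfolding lincomb_def using assms by (intro M.finsum_closed) auto

lemma lincomb_add:
  assumes "finite {n. x n \<noteq> \<zero>}" "finite {n. x' n \<noteq> \<zero>}" "\<And>n. x n \<in> carrier R" "\<And>n. x' n \<in> carrier R" "\<And>n. y n \<in> carrier M"
  shows "lincomb R M y (\<lambda>n. x n \<oplus> x' n) = lincomb R M y x \<oplus>\<^bsub>M\<^esub> lincomb R M y x'"
proof -
  let ?S = "{n. x n \<noteq> \<zero>} \<union> {n. x' n \<noteq> \<zero>}"
  have "lincomb R M y (\<lambda>n. x n \<oplus> x' n) = (\<Oplus>\<^bsub>M\<^esub> n\<in>?S. (x n \<oplus> x' n) \<odot>\<^bsub>M\<^esub> y n)"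
    using assms by (intro lincomb_superset) auto
  also have "\<dots> = (\<Oplus>\<^bsub>M\<^esub> n\<in>?S. x n \<odot>\<^bsub>M\<^esub> y n \<oplus>\<^bsub>M\<^esub> x' n \<odot>\<^bsub>M\<^esub> y n)"
    using assms by (intro M.finsum_cong') (auto simp: smult_l_distr)
  also have "\<dots> = (\<Oplus>\<^bsub>M\<^esub> n\<in>?S. x n \<odot>\<^bsub>M\<^esub> y n) \<oplus>\<^bsub>M\<^esub> (\<Oplus>\<^bsub>M\<^esub> n\<in>?S. x' n \<odot>\<^bsub>M\<^esub> y n)"
    using assms by (intro M.finsum_addf) auto
  also have "\<dots> = lincomb R M y x \<oplus>\<^bsub>M\<^esub> lincomb R M y x'"
    using assms lincomb_superset[of ?S x y] lincomb_superset[of ?S x' y] by auto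
  finally show ?thesis .
qed

lemma lincomb_smult:
  assumes "finite {n. x n \<noteq> \<zero>}" "\<And>n. x n \<in> carrier R" "a \<in> carrier R" "\<And>n. y n \<in> carrier M"
  shows "lincomb R M y (\<lambda>n. a \<otimes> x n) = a \<odot>\<^bsub>M\<^esub> lincomb R M y x"
proof -
  let ?S = "{n. x n \<noteq> \<zero>}"
  have "lincomb R M y (\<lambda>n. a \<otimes> x n) = (\<Oplus>\<^bsub>M\<^esub> n\<in>?S. (a \<otimes> x n) \<odot>\<^bsub>M\<^esub> y n)"
    using assms by (intro lincomb_superset) auto
  also have "\<dots> = (\<Oplus>\<^bsub>M\<^esub> n\<in>?S. a \<odot>\<^bsub>M\<^esub> (x n \<odot>\<^bsub>M\<^esub> y n))"
    using assms by (intro M.finsum_cong') (auto simp: smult_assoc1)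
  also have "\<dots> = a \<odot>\<^bsub>M\<^esub> lincomb R M y x"
    unfolding lincomb_def using assms by (intro finsum_smult_ldistr[symmetric]) auto
  finally show ?thesis .
qed

lemma lincomb_unit:
  assumes "a \<in> carrier R" "\<And>n. y n \<in> carrier M"
  shows "lincomb R M y (\<lambda>k. if k = n then a else \<zero>) = a \<odot>\<^bsub>M\<^esub> y n"
proof -
  have "lincomb R M y (\<lambda>k. if k = n then a else \<zero>) = (\<Oplus>\<^bsub>M\<^esub> k\<in>{n}. (if k = n then a else \<zero>) \<odot>\<^bsub>M\<^esub> y k)"
    using assms by (intro lincomb_superset) auto
  then show ?thesis using assms by simp
qed

end

abbreviation unit_vec :: "('a, 'r, 'z) graded_scheme \<Rightarrow> 'i \<Rightarrow> 'r \<Rightarrow> 'i \<Rightarrow> 'r" where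
  "unit_vec A n a \<equiv> dunit (selfm A) n a"

context graded_ring
begin

lemma homog_zero: "\<zero> \<in> homog A i"
  using additive_subgroup.zero_closed[OF homog_subgroup] .

lemma unit_vec_carrier: "a \<in> carrier A \<Longrightarrow> unit_vec A n a \<in> carrier (free A I s)"
  unfolding free_def using dunit_carrier[OF selfm_module] by (metis selfm_simps(1))

lemma unit_vec_homog: "a \<in> homog A (j - s n) \<Longrightarrow> n \<in> I \<Longrightarrow> unit_vec A n a \<in> homog (free A I s) j"
  unfolding free_def using homog_zero homog_carrier by (intro dunit_homog[OF selfm_module]) auto

lemma unit_vec_smult: "a \<in> carrier A \<Longrightarrow> unit_vec A n a = a \<odot>\<^bsub>free A I s\<^esub> unit_vec A n \<one>"
  by (auto simp: dunit_def free_simps)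

lemma free_homog_induct [consumes 1, case_names zero add]:
  assumes "x \<in> homog (free A I s) j" "P (\<lambda>_. \<zero>)"
    and "\<And>x n a. x \<in> homog (free A I s) j \<Longrightarrow> P x \<Longrightarrow> n \<in> I \<Longrightarrow> a \<in> homog A (j - s n) \<Longrightarrow> P (x \<oplus>\<^bsub>free A I s\<^esub> unit_vec A n a)"
  shows "P x"
  using dsum_homog_induct[OF selfm_module assms(1)[unfolded free_def], of P] assms(2,3) homog_zero
  by (simp add: free_def)

lemma free_lift:
  assumes "graded_module A M" "\<And>n. n \<in> I \<Longrightarrow> y n \<in> homog M (s n)"
  obtains f where "graded_linear A (free A I s) M f"
    "\<And>n a. n \<in> I \<Longrightarrow> a \<in> carrier A \<Longrightarrow> f (unit_vec A n a) = a \<odot>\<^bsub>M\<^esub> y n"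
proof
  interpret M: graded_module A M by fact
  \<comment> \<open>Vectors of the carrier may have coordinates outside \<open>I\<close>; the value
    zero there makes the linear combination defined on the whole carrier.\<close>
  let ?y = "\<lambda>n. if n \<in> I then y n else \<zero>\<^bsub>M\<^esub>"
  let ?f = "lincomb A M ?y"
  have y: "?y n \<in> carrier M" for n using assms(2) M.M_homog_carrier by auto
  have u: "?f (unit_vec A n a) = a \<odot>\<^bsub>M\<^esub> ?y n" if "a \<in> carrier A" for n a
    unfolding dunit_def selfm_simps by (rule M.lincomb_unit[OF that y])
  show "?f (unit_vec A n a) = a \<odot>\<^bsub>M\<^esub> y n" if "n \<in> I" "a \<in> carrier A" for n a
    using u[OF that(2)] that(1) by simp
  have f_add: "?f (x \<oplus>\<^bsub>free A I s\<^esub> x') = ?f x \<oplus>\<^bsub>M\<^esub> ?f x'" if "x \<in> carrier (free A I s)" "x' \<in> carrier (free A I s)" for x x'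
    using that M.lincomb_add[of x x' ?y] y by (simp add: free_simps)
  have zero: "?f (\<lambda>_. \<zero>) = \<zero>\<^bsub>M\<^esub>" by (simp add: lincomb_def)
  show "graded_linear A (free A I s) M ?f"
  proof (rule graded_linearI)
    fix x j assume "x \<in> homog (free A I s) j"
    then show "?f x \<in> homog M j"
    proof (induction rule: free_homog_induct)
      case zero then show ?case using \<open>?f (\<lambda>_. \<zero>) = _\<close> M.M_homog_zero by simp
    next
      case (add x n a)
      have "a \<odot>\<^bsub>M\<^esub> y n \<in> homog M j"
        using M.smult_homog'[OF add(3) assms(2)[OF add(2)]] by simp
      moreover have "x \<in> carrier (free A I s)" using add(1) by (simp add: free_simps)
      ultimately show ?case 
        using add(2,4) u[of a n] homog_carrier[OF add(3)] unit_vec_carrier[of a n I s] 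
          M.M_homog_add f_add by simp
    qed
  next
    show "x \<in> carrier (free A I s) \<Longrightarrow> ?f x \<in> carrier M" for x
      by (intro M.lincomb_closed y) (simp add: free_simps)
    show "r \<in> carrier A \<Longrightarrow> x \<in> carrier (free A I s) \<Longrightarrow> ?f (r \<odot>\<^bsub>free A I s\<^esub> x) = r \<odot>\<^bsub>M\<^esub> ?f x" for r x
      using M.lincomb_smult[of x r ?y] y by (simp add: free_simps)
  qed (rule f_add)
qed

lemma free_homog_carrier: "x \<in> homog (free A I s) j \<Longrightarrow> x \<in> carrier (free A I s)"
  by (simp add: free_simps)

text \<open>Homogeneous elements are sums of unit vectors over \<open>I\<close>. On coordinates
  outside \<open>I\<close> nothing is known, hence the conclusion for homogeneous \<open>x\<close>
  only.\<close>

lemma free_ext: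
  assumes "graded_module A M" "graded_linear A (free A I s) M f" "graded_linear A (free A I s) M g"
    and "\<And>n a. n \<in> I \<Longrightarrow> a \<in> carrier A \<Longrightarrow> f (unit_vec A n a) = g (unit_vec A n a)"
    and "x \<in> homog (free A I s) j"
  shows "f x = g x"
  using assms(5)
proof (induction rule: free_homog_induct)
  case zero
  show ?case using graded_linear_zero_neg(1)[OF graded_module_free assms(1,2)] 
      graded_linear_zero_neg(1)[OF graded_module_free assms(1,3)] by (simp add: free_simps)
next
  case (add x n a)
  then show ?case
    using graded_linearD(2)[OF assms(2)] graded_linearD(2)[OF assms(3)] assms(4) homog_carrier[OF add(3)]
      unit_vec_carrier[of a n I s] free_homog_carrier[OF add(1)] by simp
qed

text \<open>Projectivity of graded free modules: preimages are chosen for the unit vectors only, in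
  the degrees \<open>s n\<close>, and extended linearly. The identity \<open>p (g x) = f x\<close>
  is then checked on unit vectors by \<open>free_ext\<close>.\<close>

lemma free_lift_through:
  assumes "graded_module A M" "graded_module A N" "graded_linear A M N p" "graded_linear A (free A I s) N f"
    and "\<And>n. n \<in> I \<Longrightarrow> f (unit_vec A n \<one>) \<in> p ` homog M (s n)"
  obtains g where "graded_linear A (free A I s) M g" "\<And>j x. x \<in> homog (free A I s) j \<Longrightarrow> p (g x) = f x"
proof -
  have "\<forall>n\<in>I. \<exists>y. y \<in> homog M (s n) \<and> f (unit_vec A n \<one>) = p y"
    using assms(5) by blast
  from bchoice[OF this] obtain y where y: "\<And>n. n \<in> I \<Longrightarrow> y n \<in> homog M (s n) \<and> f (unit_vec A n \<one>) = p (y n)"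
    by blast
  obtain g where g: "graded_linear A (free A I s) M g"
    "\<And>n a. n \<in> I \<Longrightarrow> a \<in> carrier A \<Longrightarrow> g (unit_vec A n a) = a \<odot>\<^bsub>M\<^esub> y n"
    using free_lift[OF assms(1), of I y s] y by blast
  show ?thesis
  proof (rule that[OF g(1)])
    fix j x assume "x \<in> homog (free A I s) j"
    then show "p (g x) = f x"
    proof (rule free_ext[OF assms(2) graded_linear_comp[OF g(1) assms(3)] assms(4), rotated])
      fix n a assume *: "n \<in> I" "a \<in> carrier A"
      interpret M: graded_module A M by fact
      have "p (g (unit_vec A n a)) = a \<odot>\<^bsub>N\<^esub> p (y n)"
        using g(2)[OF *] y[OF *(1)] graded_linearD(3)[OF assms(3) *(2)] M.M_homog_carrier[of "y n" "s n"] by simp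
      also have "\<dots> = f (unit_vec A n a)"
        using y[OF *(1)] graded_linearD(3)[OF assms(4) *(2) unit_vec_carrier[OF one_closed, of n]]
        by (subst unit_vec_smult[OF *(2), of n I s]) simp
      finally show "p (g (unit_vec A n a)) = f (unit_vec A n a)" .
    qed
  qed
qed

end

subsection \<open>Bounded partial resolutions\<close>

text \<open>Surjectivity is required degree by degree and not on carriers, since carriers are merely
  ambient.\<close>

definition cover :: "('a, 'r, 'z) graded_scheme \<Rightarrow> 'i set \<Rightarrow> ('i \<Rightarrow> int) \<Rightarrow> (('i \<Rightarrow> 'r) \<Rightarrow> 'm) \<Rightarrow> ('r, 'm) graded \<Rightarrow> bool" where
  "cover A I s e M \<longleftrightarrow> graded_linear A (free A I s) M e \<and> (\<forall>j. homog M j \<subseteq> e ` homog (free A I s) j)"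

text \<open>
  \<open>lin A q p r M\<close> says that \<open>M\<close> has a graded free resolution whose \<open>i\<close>-th term, \<open>i \<le> p\<close>, is generated in degrees at
  most \<open>r + qi\<close>. All syzygies have the same type, but \<open>M\<close> need not, so the recursion is on \<open>lin0\<close>.
\<close>

primrec lin0 :: "('a, 'r, 'z) graded_scheme \<Rightarrow> int \<Rightarrow> nat \<Rightarrow> int \<Rightarrow> ('r, nat \<Rightarrow> 'r) graded \<Rightarrow> bool" where
  "lin0 A q 0 r M \<longleftrightarrow> (\<exists>(I :: nat set) s e. cover A I s e M \<and> (\<forall>n\<in>I. s n \<le> r))"
| "lin0 A q (Suc p) r M \<longleftrightarrow> (\<exists>(I :: nat set) s e. cover A I s e M \<and> (\<forall>n\<in>I. s n \<le> r) \<and> lin0 A q p (r + q) (kerm (free A I s) M e))"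

definition lin :: "('a, 'r, 'z) graded_scheme \<Rightarrow> int \<Rightarrow> nat \<Rightarrow> int \<Rightarrow> ('r, 'm) graded \<Rightarrow> bool" where
  "lin A q p r M \<longleftrightarrow> (\<exists>(I :: nat set) s e. cover A I s e M \<and> (\<forall>n\<in>I. s n \<le> r) \<and>
     (case p of 0 \<Rightarrow> True | Suc p' \<Rightarrow> lin0 A q p' (r + q) (kerm (free A I s) M e)))"

lemma lin0_eq_lin: "lin0 A q p r M = lin A q p r M"
  by (cases p) (simp_all add: lin_def)

lemma linI:
  assumes "cover A (I :: nat set) s e M" "\<And>n. n \<in> I \<Longrightarrow> s n \<le> r"
    and "\<And>p'. p = Suc p' \<Longrightarrow> lin A q p' (r + q) (kerm (free A I s) M e)"
  shows "lin A q p r M"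
proof (cases p)
  case 0
  then show ?thesis using assms(1,2) by (auto simp: lin_def)
next
  case (Suc p')
  then show ?thesis
    using assms(1,2) assms(3)[OF Suc, folded lin0_eq_lin] unfolding lin_def[of A q p r M] by auto
qed

lemma linE:
  assumes "lin A q p r M"
  obtains I :: "nat set" and s e where "cover A I s e M" "\<And>n. n \<in> I \<Longrightarrow> s n \<le> r"
    "\<And>p'. p = Suc p' \<Longrightarrow> lin A q p' (r + q) (kerm (free A I s) M e)"
proof -
  from assms obtain I :: "nat set" and s e where *: "cover A I s e M" "\<forall>n\<in>I. s n \<le> r"
    "case p of 0 \<Rightarrow> True | Suc p' \<Rightarrow> lin0 A q p' (r + q) (kerm (free A I s) M e)"
    unfolding lin_def by blast
  show ?thesis
    by (rule that[OF *(1)]) (use *(2,3) in \<open>auto simp: lin0_eq_lin\<close>)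
qed

lemma lin_mono0:
  "lin0 A q p r M \<Longrightarrow> p' \<le> p \<Longrightarrow> q \<le> q' \<Longrightarrow> r \<le> r' \<Longrightarrow> lin0 A q' p' r' M"
proof (induction p' arbitrary: p r r' M)
  case 0
  then show ?case by (cases p) (fastforce intro: order.trans)+
next
  case (Suc p')
  then obtain p1 where p: "p = Suc p1" "p' \<le> p1" by (cases p) auto
  from Suc.prems(1) obtain I s e where *: "cover A I s e M" "\<forall>n\<in>I. s n \<le> r" "lin0 A q p1 (r + q) (kerm (free A I s) M e)"
    unfolding p by auto
  have "lin0 A q' p' (r' + q') (kerm (free A I s) M e)"
    by (rule Suc.IH[OF *(3) p(2) Suc.prems(3)]) (use Suc.prems in auto)
  then show ?case using *(1,2) Suc.prems(4) by fastforce
qed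

lemma lin_mono:
  assumes "lin A q p r M" "p' \<le> p" "q \<le> q'" "r \<le> r'"
  shows "lin A q' p' r' M"
  using assms(1)
proof (rule linE)
  fix I :: "nat set" and s e assume *: "cover A I s e M" "\<And>n. n \<in> I \<Longrightarrow> s n \<le> r"
    "\<And>p'. p = Suc p' \<Longrightarrow> lin A q p' (r + q) (kerm (free A I s) M e)"
  show ?thesis
  proof (rule linI[OF *(1)])
    fix p1 assume p1: "p' = Suc p1"
    obtain p2 where p2: "p = Suc p2" "p1 \<le> p2" using assms(2) p1 by (cases p) auto
    show "lin A q' p1 (r' + q') (kerm (free A I s) M e)"
      using lin_mono0[OF *(3)[OF p2(1), folded lin0_eq_lin] p2(2) assms(3), of "r' + q'"] assms(3,4)
      by (simp add: lin0_eq_lin)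
  qed (use *(2) assms(4) in fastforce)
qed

text \<open>Even and odd positions carry the two summands, so that a direct sum of two free modules
  with bases in the naturals is again of the form \<open>free A I s\<close>.\<close>

definition merge :: "(nat \<Rightarrow> 'b) \<Rightarrow> (nat \<Rightarrow> 'b) \<Rightarrow> nat \<Rightarrow> 'b" where
  "merge x y k = (if even k then x (k div 2) else y (k div 2))"

lemma merge_simps [simp]: "merge x y (2 * n) = x n" "merge x y (Suc (2 * n)) = y n"
  by (simp_all add: merge_def)

lemma merge_surj: "merge (\<lambda>n. z (2 * n)) (\<lambda>n. z (Suc (2 * n))) = z"
  by (rule ext) (auto simp: merge_def elim!: evenE oddE)

lemma finite_merge: "finite {n. x n \<noteq> c} \<Longrightarrow> finite {n. y n \<noteq> c} \<Longrightarrow> finite {n. merge x y n \<noteq> c}"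
proof (rule finite_subset)
  show "{n. merge x y n \<noteq> c} \<subseteq> (\<lambda>n. 2 * n) ` {n. x n \<noteq> c} \<union> (\<lambda>n. Suc (2 * n)) ` {n. y n \<noteq> c}"
  proof
    fix k assume "k \<in> {n. merge x y n \<noteq> c}"
    then show "k \<in> (\<lambda>n. 2 * n) ` {n. x n \<noteq> c} \<union> (\<lambda>n. Suc (2 * n)) ` {n. y n \<noteq> c}"
      by (cases "even k") (auto elim!: evenE oddE)
  qed
qed auto

lemma (in graded_module) M_diff_zero_iff: 
  "x \<in> carrier M \<Longrightarrow> y \<in> carrier M \<Longrightarrow> x \<ominus>\<^bsub>M\<^esub> y = \<zero>\<^bsub>M\<^esub> \<longleftrightarrow> x = y"
  by (metis M.add.inv_closed M.minus_equality M.minus_minus M.r_neg a_minus_def)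

context graded_ring
begin

lemma coverD:
  assumes "cover A I s e M"
  shows "graded_linear A (free A I s) M e" 
    and "x \<in> homog M j \<Longrightarrow> \<exists>y \<in> homog (free A I s) j. e y = x"
  using assms unfolding cover_def by auto

lemma graded_module_cover_kernel:
  "graded_module A M \<Longrightarrow> cover A I s e M \<Longrightarrow> graded_module A (kerm (free A I s) M e)"
  by (intro graded_module_kerm graded_module_free coverD)

lemma cover_lift:
  assumes "graded_module A M" "graded_module A N" "graded_linear A M N p" "\<And>j. homog N j \<subseteq> p ` homog M j"
    "graded_linear A (free A I s) N f"
  obtains g where "graded_linear A (free A I s) M g" "\<And>j x. x \<in> homog (free A I s) j \<Longrightarrow> p (g x) = f x"
proof -
  have "f (unit_vec A n \<one>) \<in> p ` homog M (s n)" if "n \<in> I" for n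
    using graded_linearD(4)[OF assms(5) unit_vec_homog[of \<one> "s n" s n I]] that one_homog assms(4) by auto
  then show ?thesis using free_lift_through[OF assms(1-3,5)] that by blast
qed

text \<open>One cover serves both modules: composed with \<open>u\<close> in one direction, lifted
  through \<open>u\<close> by projectivity in the other. The two kernels are equal records since
  \<open>u\<close> is injective on homogeneous elements, so nothing is left to prove about the
  further syzygies.\<close>

lemma lin_iso:
  assumes "graded_module A M" "graded_module A N" "graded_linear A M N u"
    and inj: "\<And>j x. x \<in> homog M j \<Longrightarrow> u x = \<zero>\<^bsub>N\<^esub> \<Longrightarrow> x = \<zero>\<^bsub>M\<^esub>"
    and surj: "\<And>j. homog N j \<subseteq> u ` homog M j"
  shows "lin A q p r M \<longleftrightarrow> lin A q p r N"
proof
  interpret M: graded_module A M by fact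
  interpret N: graded_module A N by fact
  note u = graded_linearD[OF assms(3)] graded_linear_zero_neg[OF assms(1-3)]
  have ker: "kerm (free A I s) M e = kerm (free A I s) N e'" 
    if "graded_linear A (free A I s) M e" "\<And>j x. x \<in> homog (free A I s) j \<Longrightarrow> u (e x) = e' x" 
    for I :: "nat set" and s e e'
  proof -
    have "(e x = \<zero>\<^bsub>M\<^esub>) = (e' x = \<zero>\<^bsub>N\<^esub>)" if "x \<in> homog (free A I s) j" for x j
      using inj[OF graded_linearD(4)[OF \<open>graded_linear A (free A I s) M e\<close> that]] u(5) 
        \<open>\<And>j x. x \<in> homog (free A I s) j \<Longrightarrow> u (e x) = e' x\<close>[OF that] by metis
    then show ?thesis unfolding kerm_def by (intro arg_cong[where f="\<lambda>H. (free A I s)\<lparr>homog := H\<rparr>"] ext) auto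
  qed
  {
    assume "lin A q p r M"
    then show "lin A q p r N"
    proof (rule linE)
      fix I :: "nat set" and s e assume *: "cover A I s e M" "\<And>n. n \<in> I \<Longrightarrow> s n \<le> r"
        "\<And>p'. p = Suc p' \<Longrightarrow> lin A q p' (r + q) (kerm (free A I s) M e)"
      have c: "cover A I s (\<lambda>x. u (e x)) N"
        unfolding cover_def using graded_linear_comp[OF coverD(1)[OF *(1)] assms(3)] surj coverD(2)[OF *(1)] by fast
      show ?thesis 
        by (rule linI[OF c *(2)]) (use *(3) ker[OF coverD(1)[OF *(1)], of "\<lambda>x. u (e x)"] in auto)
    qed
  next
    assume "lin A q p r N"
    then show "lin A q p r M"
    proof (rule linE)
      fix I :: "nat set" and s e assume *: "cover A I s e N" "\<And>n. n \<in> I \<Longrightarrow> s n \<le> r"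
        "\<And>p'. p = Suc p' \<Longrightarrow> lin A q p' (r + q) (kerm (free A I s) N e)"
      obtain g where g: "graded_linear A (free A I s) M g" "\<And>j x. x \<in> homog (free A I s) j \<Longrightarrow> u (g x) = e x"
        using cover_lift[OF assms(1-3) surj coverD(1)[OF *(1)]] by blast
      have "\<exists>y\<in>homog (free A I s) j. g y = x" if x: "x \<in> homog M j" for x j
      proof -
        obtain y where y: "y \<in> homog (free A I s) j" "e y = u x"
          using coverD(2)[OF *(1) u(4)[OF x]] by blast
        have gy: "g y \<in> homog M j" using graded_linearD(4)[OF g(1) y(1)] .
        then have "u (g y \<ominus>\<^bsub>M\<^esub> x) = \<zero>\<^bsub>N\<^esub>"
          using u(7)[of "g y" x] M.M_homog_carrier[OF gy] M.M_homog_carrier[OF x] g(2)[OF y(1)] y(2) u(1)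
            by (simp add: a_minus_def N.M.r_neg)
        then have "g y \<ominus>\<^bsub>M\<^esub> x = \<zero>\<^bsub>M\<^esub>" using inj M.M_homog_diff[OF gy x] by blast
        then have "g y = x" using M.M_diff_zero_iff M.M_homog_carrier[OF gy] M.M_homog_carrier[OF x] by simp
        then show ?thesis using y(1) by blast
      qed
      then have c: "cover A I s g M" unfolding cover_def using g(1) by blast
      show ?thesis
        by (rule linI[OF c *(2)]) (use *(3) ker[OF g(1), of e] g(2) in auto)
    qed
  }
qed

lemma lin_zero0: "graded_module A M \<Longrightarrow> (\<And>j. homog M j \<subseteq> {\<zero>\<^bsub>M\<^esub>}) \<Longrightarrow> lin0 A q p r M"
  and lin_zero: "graded_module A N \<Longrightarrow> (\<And>j. homog N j \<subseteq> {\<zero>\<^bsub>N\<^esub>}) \<Longrightarrow> lin A q p r N"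
proof -
  have c: "cover A ({} :: nat set) (\<lambda>_. 0) (\<lambda>_. \<zero>\<^bsub>M\<^esub>) M" "graded_module A (kerm (free A ({} :: nat set) (\<lambda>_. 0)) M (\<lambda>_. \<zero>\<^bsub>M\<^esub>))" 
    "\<And>j. homog (kerm (free A ({} :: nat set) (\<lambda>_. 0)) M (\<lambda>_. \<zero>\<^bsub>M\<^esub>)) j \<subseteq> {\<zero>\<^bsub>kerm (free A ({} :: nat set) (\<lambda>_. 0)) M (\<lambda>_. \<zero>\<^bsub>M\<^esub>)\<^esub>}"
    if "graded_module A M" "\<And>j. homog M j \<subseteq> {\<zero>\<^bsub>M\<^esub>}" for M :: "('r, 'm) graded"
  proof -
    interpret M: graded_module A M by fact
    have g: "graded_linear A (free A ({} :: nat set) (\<lambda>_. 0)) M (\<lambda>_. \<zero>\<^bsub>M\<^esub>)"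
      by (rule graded_linearI) (auto simp: M.M_homog_zero)
    have "(\<lambda>_. \<zero>) \<in> homog (free A ({} :: nat set) (\<lambda>_. 0)) j" for j by (simp add: free_simps)
    then show "cover A ({} :: nat set) (\<lambda>_. 0) (\<lambda>_. \<zero>\<^bsub>M\<^esub>) M"
      using g that(2) unfolding cover_def by fast
    show "graded_module A (kerm (free A ({} :: nat set) (\<lambda>_. 0)) M (\<lambda>_. \<zero>\<^bsub>M\<^esub>))"
      by (intro graded_module_kerm graded_module_free that g)
  qed (auto simp: free_simps)
  have 1: "lin0 A q p r M" if "graded_module A M" "\<And>j. homog M j \<subseteq> {\<zero>\<^bsub>M\<^esub>}" for M p r
    using that
  proof (induction p arbitrary: M r)
    case 0 then show ?case using c(1)[of M] by fastforce
  next
    case (Suc p)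
    show ?case using c(1)[OF Suc.prems] Suc.IH[OF c(2,3)[OF Suc.prems]] by fastforce
  qed
  then show "graded_module A M \<Longrightarrow> (\<And>j. homog M j \<subseteq> {\<zero>\<^bsub>M\<^esub>}) \<Longrightarrow> lin0 A q p r M" .
  assume N: "graded_module A N" "\<And>j. homog N j \<subseteq> {\<zero>\<^bsub>N\<^esub>}"
  show "lin A q p r N"
    by (rule linI[OF c(1)[OF N]]) (use 1[OF c(2,3)[OF N]] in \<open>auto simp: lin0_eq_lin\<close>)
qed

lemma lin_free:
  assumes "\<And>n. n \<in> I \<Longrightarrow> s n \<le> r"
  shows "lin A q p r (free A (I :: nat set) s)"
proof (rule linI)
  show "cover A I s (\<lambda>x. x) (free A I s)"
    unfolding cover_def using graded_linear_id by blast
  have "graded_module A (kerm (free A I s) (free A I s) (\<lambda>x. x))"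
    by (intro graded_module_kerm graded_module_free graded_linear_id)
  then show "lin A q p' (r + q) (kerm (free A I s) (free A I s) (\<lambda>x. x))" for p'
    by (rule lin_zero) auto
qed (rule assms)

subsection \<open>Short exact sequences\<close>

definition ses :: "('r, 'n) graded \<Rightarrow> ('r, 'g) graded \<Rightarrow> ('r, 'm) graded \<Rightarrow> ('n \<Rightarrow> 'g) \<Rightarrow> ('g \<Rightarrow> 'm) \<Rightarrow> bool" where
  "ses N G M i p \<longleftrightarrow> graded_linear A N G i \<and> graded_linear A G M p \<and>
     (\<forall>j. \<forall>x \<in> homog N j. i x = \<zero>\<^bsub>G\<^esub> \<longrightarrow> x = \<zero>\<^bsub>N\<^esub>) \<and> (\<forall>j. homog M j \<subseteq> p ` homog G j) \<and>
     (\<forall>j. i ` homog N j = {x \<in> homog G j. p x = \<zero>\<^bsub>M\<^esub>})"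

text \<open>The horseshoe lemma, one step: the free covers of \<open>N\<close> and \<open>M\<close>
  are added, and the kernels again form an exact sequence. The induction hypothesis is a premise
  \<open>IH\<close> about modules of type \<open>nat \<Rightarrow> 'r\<close>, because syzygies have
  that type while \<open>N\<close>, \<open>G\<close> and \<open>M\<close> may have any. The same
  step thus proves \<open>horseshoe0\<close> by induction and then \<open>horseshoe\<close> from it;
  later \<open>_step\<close> lemmas follow this pattern.\<close>

lemma horseshoe_step:
  fixes N :: "('r, 'n) graded" and G :: "('r, 'g) graded" and M :: "('r, 'm) graded"
  assumes gm: "graded_module A N" "graded_module A G" "graded_module A M"
    and ses: "ses N G M i \<pi>" and lin: "lin A q p r N" "lin A q p r M"
    and IH: "\<And>p' N' G' M' i' \<pi>'. p = Suc p' \<Longrightarrow> graded_module A (N' :: ('r, nat \<Rightarrow> 'r) graded)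
      \<Longrightarrow> graded_module A (G' :: ('r, nat \<Rightarrow> 'r) graded) \<Longrightarrow> graded_module A (M' :: ('r, nat \<Rightarrow> 'r) graded)
      \<Longrightarrow> ses N' G' M' i' \<pi>' \<Longrightarrow> lin A q p' (r + q) N' \<Longrightarrow> lin A q p' (r + q) M' \<Longrightarrow> lin A q p' (r + q) G'"
  shows "lin A q p r G"
proof -
  interpret N: graded_module A N by fact
  interpret G: graded_module A G by fact
  interpret M: graded_module A M by fact
  have i: "graded_linear A N G i" and pi: "graded_linear A G M \<pi>"
    and inj: "\<And>j x. x \<in> homog N j \<Longrightarrow> i x = \<zero>\<^bsub>G\<^esub> \<Longrightarrow> x = \<zero>\<^bsub>N\<^esub>" and surj: "\<And>j. homog M j \<subseteq> \<pi> ` homog G j"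
    and exact: "\<And>j. i ` homog N j = {x \<in> homog G j. \<pi> x = \<zero>\<^bsub>M\<^esub>}"
    using ses unfolding ses_def by blast+
  note iD = graded_linearD[OF i] graded_linear_zero_neg[OF gm(1,2) i]
  note pD = graded_linearD[OF pi] graded_linear_zero_neg[OF gm(2,3) pi]
  obtain I1 :: "nat set" and s1 e1 where 1: "cover A I1 s1 e1 N" "\<And>n. n \<in> I1 \<Longrightarrow> s1 n \<le> r"
    "\<And>p'. p = Suc p' \<Longrightarrow> lin A q p' (r + q) (kerm (free A I1 s1) N e1)"
    using linE[OF lin(1)] by blast
  obtain I2 :: "nat set" and s2 e2 where 2: "cover A I2 s2 e2 M" "\<And>n. n \<in> I2 \<Longrightarrow> s2 n \<le> r"
    "\<And>p'. p = Suc p' \<Longrightarrow> lin A q p' (r + q) (kerm (free A I2 s2) M e2)"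
    using linE[OF lin(2)] by blast
  note e1 = coverD(1)[OF 1(1)] and e2 = coverD(1)[OF 2(1)]
  note e1D = graded_linearD[OF e1] graded_linear_zero_neg[OF graded_module_free gm(1) e1]
  note e2D = graded_linearD[OF e2] graded_linear_zero_neg[OF graded_module_free gm(3) e2]
  obtain h where h: "graded_linear A (free A I2 s2) G h" "\<And>j x. x \<in> homog (free A I2 s2) j \<Longrightarrow> \<pi> (h x) = e2 x"
    using cover_lift[OF gm(2,3) pi surj e2] by blast
  note hD = graded_linearD[OF h(1)] graded_linear_zero_neg[OF graded_module_free gm(2) h(1)]
  let ?I = "{k. if even k then k div 2 \<in> I1 else k div 2 \<in> I2}" and ?s = "merge s1 s2"
  let ?F = "free A ?I ?s" and ?F1 = "free A I1 s1" and ?F2 = "free A I2 s2"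
  let ?l = "\<lambda>x. merge x (\<lambda>_. \<zero>)"
  let ?pl = "\<lambda>z n. z (2 * n)" and ?pr = "\<lambda>z n. z (Suc (2 * n))"
  interpret F: graded_module A ?F by (rule graded_module_free)
  interpret F1: graded_module A ?F1 by (rule graded_module_free)
  interpret F2: graded_module A ?F2 by (rule graded_module_free)
  have fin: "finite {n. z (2 * n) \<noteq> c}" "finite {n. z (Suc (2 * n)) \<noteq> c}" if "finite {n. z n \<noteq> c}" for z :: "nat \<Rightarrow> 'r" and c
    using finite_vimageI[OF that, of "\<lambda>n. 2 * n"] finite_vimageI[OF that, of "\<lambda>n. Suc (2 * n)"]
    by (auto simp: vimage_def inj_on_def)
  have pl: "graded_linear A ?F ?F1 ?pl"
  proof (rule graded_linearI)
    show "x \<in> homog ?F j \<Longrightarrow> ?pl x \<in> homog ?F1 j" for x j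
      by (auto simp: free_simps fin, metis (no_types, lifting) even_mult_iff even_two_times_div_two dvd_triv_left
          merge_simps(1) nonzero_mult_div_cancel_left numeral_neq_zero)
  qed (auto simp: free_simps fin)
  have pr: "graded_linear A ?F ?F2 ?pr"
  proof (rule graded_linearI)
    fix x j assume x: "x \<in> homog ?F j"
    show "?pr x \<in> homog ?F2 j" using x
      by (auto simp: free_simps fin split: if_splits) (metis (no_types, lifting) Suc_double_not_eq_double even_Suc_div_two
          dvd_triv_left even_Suc merge_simps(2) nonzero_mult_div_cancel_left numeral_neq_zero)+
  qed (auto simp: free_simps fin)
  have lhom: "merge x y \<in> homog ?F j" if "x \<in> homog ?F1 j" "y \<in> homog ?F2 j" for x y j
    using that finite_merge[of x \<zero> y] by (auto simp: free_simps merge_def)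
  have l: "graded_linear A ?F1 ?F ?l"
  proof (rule graded_linearI)
    show "x \<in> homog ?F1 j \<Longrightarrow> ?l x \<in> homog ?F j" for x j
      by (rule lhom) (auto simp: free_simps homog_zero)
    show "x \<in> carrier ?F1 \<Longrightarrow> ?l x \<in> carrier ?F" for x
      using finite_merge[of x \<zero> "\<lambda>_. \<zero>"] by (auto simp: free_simps) (simp add: merge_def)
  qed (auto simp: free_simps merge_def)
  \<comment> \<open>On the part over \<open>N\<close> this is the given cover followed by
    \<open>i\<close>, on the part over \<open>M\<close> the lift \<open>h\<close> of
    \<open>e2\<close> through \<open>\<pi>\<close>.\<close>
  define e where "e = (\<lambda>z. i (e1 (?pl z)) \<oplus>\<^bsub>G\<^esub> h (?pr z))"
  have e: "graded_linear A ?F G e"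
    unfolding e_def
    by (intro graded_linear_add gm graded_linear_comp[OF graded_linear_comp[OF pl e1] i] graded_linear_comp[OF pr h(1)])
  have e_merge: "e (merge x y) = i (e1 x) \<oplus>\<^bsub>G\<^esub> h y" for x y
    by (simp add: e_def)
  have pe: "\<pi> (e z) = e2 (?pr z)" if "z \<in> homog ?F j" for z j
  proof -
    have a: "e1 (?pl z) \<in> homog N j" by (intro e1D graded_linearD(4)[OF pl] that)
    then have "\<pi> (i (e1 (?pl z))) = \<zero>\<^bsub>M\<^esub>" using exact[of j] by blast
    moreover have b: "?pr z \<in> homog ?F2 j" by (intro graded_linearD(4)[OF pr] that)
    ultimately show ?thesis
      using pD(2)[of "i (e1 (?pl z))" "h (?pr z)"] G.M_homog_carrier[OF iD(4)[OF a]] G.M_homog_carrier[OF hD(4)[OF b]]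
        h(2)[OF b] M.M_homog_carrier[OF e2D(4)[OF b]] by (simp add: e_def)
  qed
  have surj_e: "\<exists>z \<in> homog ?F j. e z = g" if g: "g \<in> homog G j" for g j
  proof -
    obtain y where y: "y \<in> homog ?F2 j" "e2 y = \<pi> g" using coverD(2)[OF 2(1) pD(4)[OF g]] by blast
    have "h y \<in> homog G j" by (rule hD(4)[OF y(1)])
    moreover from this have "\<pi> (g \<ominus>\<^bsub>G\<^esub> h y) = \<zero>\<^bsub>M\<^esub>"
      using pD(7)[of g "h y"] h(2)[OF y(1)] y(2) G.M_homog_carrier[OF g] G.M_homog_carrier[of "h y" j] pD(1)
      by (simp add: M.M_diff_zero_iff)
    ultimately obtain n where n: "n \<in> homog N j" "i n = g \<ominus>\<^bsub>G\<^esub> h y" 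
      using exact[of j] G.M_homog_diff[OF g] by (metis (mono_tags, lifting) imageE mem_Collect_eq)
    obtain x where x: "x \<in> homog ?F1 j" "e1 x = n" using coverD(2)[OF 1(1) n(1)] by blast
    have "e (merge x y) = g" using x(2) n(2) G.M_homog_carrier[OF g] G.M_homog_carrier[OF hD(4)[OF y(1)]]
      by (simp add: e_merge a_minus_def G.M.a_assoc G.M.l_neg)
    then show ?thesis using lhom[OF x(1) y(1)] by blast
  qed
  have cov: "cover A ?I ?s e G" unfolding cover_def using e surj_e by blast
  show ?thesis
  proof (rule linI[OF cov])
    show "n \<in> ?I \<Longrightarrow> ?s n \<le> r" for n using 1(2) 2(2) by (auto simp: merge_def split: if_splits)
    fix p' assume p: "p = Suc p'"
    show "lin A q p' (r + q) (kerm ?F G e)"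
    proof (rule IH[OF p _ _ _ _ 1(3)[OF p] 2(3)[OF p]])
      show "ses (kerm ?F1 N e1) (kerm ?F G e) (kerm ?F2 M e2) ?l ?pr"
        unfolding ses_def
      proof (intro conjI allI ballI impI)
        show "graded_linear A (kerm ?F1 N e1) (kerm ?F G e) ?l"
          unfolding kerm_def
        proof (rule graded_linear_regrade_dom[OF l], safe)
          fix x j assume x: "x \<in> homog ?F1 j" "e1 x = \<zero>\<^bsub>N\<^esub>"
          show "?l x \<in> homog ?F j" by (rule graded_linearD(4)[OF l x(1)])
          show "e (?l x) = \<zero>\<^bsub>G\<^esub>" using x(2) iD(5) hD(5) by (simp add: e_merge free_simps)
        qed
        show "graded_linear A (kerm ?F G e) (kerm ?F2 M e2) ?pr"
          unfolding kerm_def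
        proof (rule graded_linear_regrade_dom[OF pr], safe)
          fix x j assume x: "x \<in> homog ?F j" "e x = \<zero>\<^bsub>G\<^esub>"
          show "?pr x \<in> homog ?F2 j" by (rule graded_linearD(4)[OF pr x(1)])
          show "e2 (?pr x) = \<zero>\<^bsub>M\<^esub>" using pe[OF x(1)] x(2) pD(5) by simp
        qed
        show "x = \<zero>\<^bsub>kerm ?F1 N e1\<^esub>" if "?l x = \<zero>\<^bsub>kerm ?F G e\<^esub>" for x
        proof -
          have "?pl (?l x) = (\<lambda>_. \<zero>)" using that by (simp add: free_simps)
          then show ?thesis by (simp add: free_simps)
        qed
        show "homog (kerm ?F2 M e2) j \<subseteq> ?pr ` homog (kerm ?F G e) j" for j
        proof
          fix y assume "y \<in> homog (kerm ?F2 M e2) j"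
          then have y: "y \<in> homog ?F2 j" "e2 y = \<zero>\<^bsub>M\<^esub>" by auto
          \<comment> \<open>\<open>h y\<close> is nonzero in general but lies in the image of
            \<open>i\<close>; an element of \<open>?F1\<close> over the negative of its preimage
            completes \<open>y\<close> to an element of the kernel of \<open>e\<close>.\<close>
          have "h y \<in> {x \<in> homog G j. \<pi> x = \<zero>\<^bsub>M\<^esub>}" using hD(4)[OF y(1)] h(2)[OF y(1)] y(2) by simp
          then obtain n where n: "n \<in> homog N j" "i n = h y" unfolding exact[symmetric] by fastforce
          obtain x where x: "x \<in> homog ?F1 j" "e1 x = \<ominus>\<^bsub>N\<^esub> n" using coverD(2)[OF 1(1) N.M_homog_neg[OF n(1)]] by blast
          have "e (merge x y) = \<zero>\<^bsub>G\<^esub>" using x n iD(6)[OF N.M_homog_carrier[OF n(1)]] G.M_homog_carrier[OF hD(4)[OF y(1)]]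
            by (simp add: e_merge G.M.l_neg)
          moreover have "?pr (merge x y) = y" by simp
          ultimately show "y \<in> ?pr ` homog (kerm ?F G e) j" using lhom[OF x(1) y(1)]
            by (intro image_eqI[of _ _ "merge x y"]) auto
        qed
        show "?l ` homog (kerm ?F1 N e1) j = {x \<in> homog (kerm ?F G e) j. ?pr x = \<zero>\<^bsub>kerm ?F2 M e2\<^esub>}" for j
        proof (intro equalityI subsetI)
          fix z assume "z \<in> ?l ` homog (kerm ?F1 N e1) j"
          then obtain x where x: "x \<in> homog ?F1 j" "e1 x = \<zero>\<^bsub>N\<^esub>" "z = ?l x" by auto
          then show "z \<in> {x \<in> homog (kerm ?F G e) j. ?pr x = \<zero>\<^bsub>kerm ?F2 M e2\<^esub>}"
            using graded_linearD(4)[OF l x(1)] iD(5) hD(5) by (auto simp: e_merge free_simps)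
        next
          fix z assume "z \<in> {x \<in> homog (kerm ?F G e) j. ?pr x = \<zero>\<^bsub>kerm ?F2 M e2\<^esub>}"
          then have z: "z \<in> homog ?F j" "e z = \<zero>\<^bsub>G\<^esub>" "?pr z = (\<lambda>_. \<zero>)" by (auto simp: free_simps)
          then have zz: "z = ?l (?pl z)" using merge_surj[of z] by simp
          have a: "?pl z \<in> homog ?F1 j" by (rule graded_linearD(4)[OF pl z(1)])
          have "i (e1 (?pl z)) = \<zero>\<^bsub>G\<^esub>" using z(2,3) hD(5) G.M_homog_carrier[OF iD(4)[OF e1D(4)[OF a]]]
            by (simp add: e_def free_simps)
          then have "e1 (?pl z) = \<zero>\<^bsub>N\<^esub>" using inj e1D(4)[OF a] by blast
          then show "z \<in> ?l ` homog (kerm ?F1 N e1) j" using a zz by (intro image_eqI[of _ _ "?pl z"]) auto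
        qed
      qed
    qed (intro graded_module_cover_kernel gm 1(1) 2(1) cov)+
  qed
qed

lemma horseshoe0:
  fixes N G M :: "('r, nat \<Rightarrow> 'r) graded"
  assumes "graded_module A N" "graded_module A G" "graded_module A M"
    "ses N G M i \<pi>" "lin A q p r N" "lin A q p r M"
  shows "lin A q p r G"
  using assms
proof (induction p arbitrary: r N G M i \<pi>)
  case 0
  show ?case by (rule horseshoe_step[OF 0]) simp
next
  case (Suc p)
  show ?case by (rule horseshoe_step[OF Suc.prems]) (use Suc.IH in auto)
qed

lemma horseshoe:
  assumes "graded_module A N" "graded_module A G" "graded_module A M"
    "ses N G M i \<pi>" "lin A q p r N" "lin A q p r M"
  shows "lin A q p r G"
  by (rule horseshoe_step[OF assms]) (rule horseshoe0)

text \<open>A cover \<open>e\<close> of \<open>G\<close> followed by \<open>\<pi>\<close> covers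
  \<open>M\<close>, and its kernel is an extension of \<open>kerm G M \<pi>\<close> by the first
  syzygy of \<open>G\<close>, which the horseshoe lemma bounds. This is the mapping cone argument:
  the kernel of \<open>\<pi>\<close> enters one homological step later, whence \<open>r + q\<close>
  and \<open>p'\<close>.\<close>

lemma lin_quotient:
  assumes gm: "graded_module A G" "graded_module A M" and pi: "graded_linear A G M \<pi>" "\<And>j. homog M j \<subseteq> \<pi> ` homog G j"
    and lin: "lin A q p r G" "\<And>p'. p = Suc p' \<Longrightarrow> lin A q p' (r + q) (kerm G M \<pi>)"
  shows "lin A q p r M"
  using lin(1)
proof (rule linE)
  fix I :: "nat set" and s e assume *: "cover A I s e G" "\<And>n. n \<in> I \<Longrightarrow> s n \<le> r"
    "\<And>p'. p = Suc p' \<Longrightarrow> lin A q p' (r + q) (kerm (free A I s) G e)"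
  note pD = graded_linearD[OF pi(1)] graded_linear_zero_neg[OF gm pi(1)]
  note e = coverD(1)[OF *(1)]
  note eD = graded_linearD[OF e]
  interpret G: graded_module A G by fact
  have c: "cover A I s (\<lambda>x. \<pi> (e x)) M"
    unfolding cover_def using graded_linear_comp[OF coverD(1)[OF *(1)] pi(1)] pi(2) coverD(2)[OF *(1)] by fast
  show ?thesis
  proof (rule linI[OF c *(2)])
    fix p' assume p: "p = Suc p'"
    show "lin A q p' (r + q) (kerm (free A I s) M (\<lambda>x. \<pi> (e x)))"
    proof (rule horseshoe[OF _ _ _ _ *(3)[OF p] lin(2)[OF p]])
      show "ses (kerm (free A I s) G e) (kerm (free A I s) M (\<lambda>x. \<pi> (e x))) (kerm G M \<pi>) (\<lambda>x. x) e"
        unfolding ses_def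
      proof (intro conjI allI ballI impI)
        show "graded_linear A (kerm (free A I s) G e) (kerm (free A I s) M (\<lambda>x. \<pi> (e x))) (\<lambda>x. x)"
          unfolding kerm_def by (rule graded_linear_regrade_dom[OF graded_linear_id]) (auto simp: pD)
        show "graded_linear A (kerm (free A I s) M (\<lambda>x. \<pi> (e x))) (kerm G M \<pi>) e"
          unfolding kerm_def by (rule graded_linear_regrade_dom[OF e]) (auto simp: eD)
        show "homog (kerm G M \<pi>) j \<subseteq> e ` homog (kerm (free A I s) M (\<lambda>x. \<pi> (e x))) j" for j
          using coverD(2)[OF *(1)] by fastforce
      qed (auto simp: pD)
    qed (intro graded_module_cover_kernel[OF gm(1) *(1)] graded_module_cover_kernel[OF gm(2) c] graded_module_kerm gm pi(1))+
  qed
qed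

end

section \<open>Kernels of surjections between modules with bounded resolutions\<close>

definition prodm :: "('r, 'm) graded \<Rightarrow> ('r, 'n) graded \<Rightarrow> ('r, 'm \<times> 'n) graded" where
  "prodm M N = \<lparr>carrier = carrier M \<times> carrier N, monoid.mult = undefined, one = undefined, 
     zero = (\<zero>\<^bsub>M\<^esub>, \<zero>\<^bsub>N\<^esub>), add = (\<lambda>x y. (fst x \<oplus>\<^bsub>M\<^esub> fst y, snd x \<oplus>\<^bsub>N\<^esub> snd y)),
     smult = (\<lambda>a x. (a \<odot>\<^bsub>M\<^esub> fst x, a \<odot>\<^bsub>N\<^esub> snd x)), homog = (\<lambda>j. homog M j \<times> homog N j)\<rparr>"

lemma prodm_simps [simp]:
  "carrier (prodm M N) = carrier M \<times> carrier N" "zero (prodm M N) = (\<zero>\<^bsub>M\<^esub>, \<zero>\<^bsub>N\<^esub>)"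
  "add (prodm M N) = (\<lambda>x y. (fst x \<oplus>\<^bsub>M\<^esub> fst y, snd x \<oplus>\<^bsub>N\<^esub> snd y))"
  "smult (prodm M N) = (\<lambda>a x. (a \<odot>\<^bsub>M\<^esub> fst x, a \<odot>\<^bsub>N\<^esub> snd x))"
  "homog (prodm M N) j = homog M j \<times> homog N j"
  by (simp_all add: prodm_def)

context graded_ring
begin

lemma graded_module_prodm:
  assumes "graded_module A M" "graded_module A N"
  shows "graded_module A (prodm M N)"
proof -
  interpret M: graded_module A M by fact
  interpret N: graded_module A N by fact
  have ag: "abelian_group (prodm M N)"
  proof (rule abelian_groupI)
    fix x assume "x \<in> carrier (prodm M N)"
    then show "\<exists>y\<in>carrier (prodm M N). y \<oplus>\<^bsub>prodm M N\<^esub> x = \<zero>\<^bsub>prodm M N\<^esub>"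
      by (intro bexI[of _ "(\<ominus>\<^bsub>M\<^esub> fst x, \<ominus>\<^bsub>N\<^esub> snd x)"]) (auto simp: M.M.l_neg N.M.l_neg)
  qed (auto simp: M.M.a_ac N.M.a_ac)
  then interpret P: abelian_group "prodm M N" .
  have inv: "\<ominus>\<^bsub>prodm M N\<^esub> x = (\<ominus>\<^bsub>M\<^esub> fst x, \<ominus>\<^bsub>N\<^esub> snd x)" if "x \<in> carrier (prodm M N)" for x
    by (rule P.minus_equality) (use that in \<open>auto simp: M.M.l_neg N.M.l_neg\<close>)
  have m: "module A (prodm M N)"
    by (rule moduleI[OF is_cring ag])
      (auto simp: M.smult_l_distr N.smult_l_distr M.smult_r_distr N.smult_r_distr M.smult_assoc1 N.smult_assoc1)
  show ?thesis
    by (rule graded_moduleI[OF graded_ring_axioms m])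
      (auto simp: inv M.M_homog_carrier N.M_homog_carrier M.smult_homog N.smult_homog M.M_homog_closed N.M_homog_closed)
qed

text \<open>Take a free cover of \<open>M\<close> with kernel \<open>Z\<close>. The fibre product of
  \<open>G\<close> and this cover over \<open>M\<close> is an extension of \<open>G\<close> by
  \<open>Z\<close>, and also an extension of the cover by the kernel of \<open>\<pi>\<close>. The
  latter splits because the cover is free, so the fibre product is the wanted kernel plus a free
  module. The horseshoe lemma bounds this sum, and the kernel is its quotient by the free summand.
  The two inequalities place \<open>Z\<close> within the bound \<open>r\<close> and the free summand
  within \<open>r + q\<close>.\<close>

lemma lin_kernel:
  fixes G :: "('r, 'g) graded" and M :: "('r, 'm) graded"
  assumes gm: "graded_module A G" "graded_module A M" and pi: "graded_linear A G M \<pi>" "\<And>j. homog M j \<subseteq> \<pi> ` homog G j"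
    and lin: "lin A q p r G" "lin A q (Suc p) r' M" and r: "r' + q \<le> r" "r' \<le> r + q"
  shows "lin A q p r (kerm G M \<pi>)"
  using lin(2)
proof (rule linE)
  fix I :: "nat set" and s e assume *: "cover A I s e M" "\<And>n. n \<in> I \<Longrightarrow> s n \<le> r'"
    "\<And>p'. Suc p = Suc p' \<Longrightarrow> lin A q p' (r' + q) (kerm (free A I s) M e)"
  let ?C = "free A I s" let ?Z = "kerm ?C M e" let ?N = "kerm G M \<pi>" let ?X = "prodm ?N ?C"
  interpret G: graded_module A G by fact
  interpret M: graded_module A M by fact
  interpret C: graded_module A ?C by (rule graded_module_free)
  note pD = graded_linearD[OF pi(1)] graded_linear_zero_neg[OF gm pi(1)]
  note e = coverD(1)[OF *(1)]
  note eD = graded_linearD[OF e]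
  have gmN: "graded_module A ?N" by (intro graded_module_kerm gm pi)
  have gmZ: "graded_module A ?Z" by (intro graded_module_cover_kernel gm *)
  have gmX: "graded_module A ?X" by (intro graded_module_prodm gmN graded_module_free)
  obtain g where g: "graded_linear A ?C G g" "\<And>j x. x \<in> homog ?C j \<Longrightarrow> \<pi> (g x) = e x"
    using cover_lift[OF gm pi e] by blast
  note gD = graded_linearD[OF g(1)] graded_linear_zero_neg[OF graded_module_free gm(1) g(1)]
  have linX: "lin A q p r ?X"
  proof (rule horseshoe[OF gmZ gmX gm(1)])
    \<comment> \<open>The lift \<open>g\<close> of \<open>e\<close> to \<open>G\<close> provides the
      splitting: a pair \<open>(n, c)\<close> stands for the element \<open>(n + g c, c)\<close> of
      the fibre product, whose projection to \<open>G\<close> has the pairs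
      \<open>(- g z, z)\<close> with \<open>z\<close> in \<open>?Z\<close> as kernel.\<close>
    show "ses ?Z ?X G (\<lambda>z. (\<ominus>\<^bsub>G\<^esub> g z, z)) (\<lambda>x. fst x \<oplus>\<^bsub>G\<^esub> g (snd x))"
      unfolding ses_def
    proof (intro conjI allI ballI impI)
      have N: "\<ominus>\<^bsub>G\<^esub> g x \<in> {x \<in> homog G j. \<pi> x = \<zero>\<^bsub>M\<^esub>}" if "x \<in> homog ?C j" "e x = \<zero>\<^bsub>M\<^esub>" for x j
        using gD(4)[OF that(1)] g(2)[OF that(1)] that(2) pD(6)[of "g x"] G.M_homog_carrier G.M_homog_neg by auto
      show "graded_linear A ?Z ?X (\<lambda>z. (\<ominus>\<^bsub>G\<^esub> g z, z))"
      proof (rule graded_linearI)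
        show "(\<ominus>\<^bsub>G\<^esub> g x, x) \<in> homog ?X j" if "x \<in> homog ?Z j" for x j
          using that N by auto
      qed (auto simp: gD G.M.minus_add G.smult_r_minus)
      have "graded_linear A ?X G (\<lambda>x. g (snd x))" "graded_linear A ?X G fst"
        by (auto intro!: graded_linearI simp: gD)
      then show "graded_linear A ?X G (\<lambda>x. fst x \<oplus>\<^bsub>G\<^esub> g (snd x))" by (intro graded_linear_add gm)
      show "homog G j \<subseteq> (\<lambda>x. fst x \<oplus>\<^bsub>G\<^esub> g (snd x)) ` homog ?X j" for j
      proof
        fix y assume y: "y \<in> homog G j"
        obtain c where c: "c \<in> homog ?C j" "e c = \<pi> y" using coverD(2)[OF *(1) pD(4)[OF y]] by blast
        have gc: "g c \<in> homog G j" by (rule gD(4)[OF c(1)])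
        have "\<pi> (y \<ominus>\<^bsub>G\<^esub> g c) = \<zero>\<^bsub>M\<^esub>"
          using pD(7)[of y "g c"] g(2)[OF c(1)] c(2) G.M_homog_carrier[OF gc] G.M_homog_carrier[OF y] pD(1) 
          by (simp add: a_minus_def M.M.r_neg)
        moreover have "y \<ominus>\<^bsub>G\<^esub> g c \<oplus>\<^bsub>G\<^esub> g c = y" 
          using G.M_homog_carrier[OF gc] G.M_homog_carrier[OF y] by (simp add: a_minus_def G.M.a_assoc G.M.l_neg)
        ultimately show "y \<in> (\<lambda>x. fst x \<oplus>\<^bsub>G\<^esub> g (snd x)) ` homog ?X j"
          using c(1) G.M_homog_diff[OF y gc] by (intro image_eqI[of _ _ "(y \<ominus>\<^bsub>G\<^esub> g c, c)"]) auto
      qed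
      show "(\<lambda>z. (\<ominus>\<^bsub>G\<^esub> g z, z)) ` homog ?Z j = {x \<in> homog ?X j. fst x \<oplus>\<^bsub>G\<^esub> g (snd x) = \<zero>\<^bsub>G\<^esub>}" for j
      proof (intro equalityI subsetI)
        fix x assume "x \<in> (\<lambda>z. (\<ominus>\<^bsub>G\<^esub> g z, z)) ` homog ?Z j"
        then obtain z where z: "z \<in> homog ?C j" "e z = \<zero>\<^bsub>M\<^esub>" "x = (\<ominus>\<^bsub>G\<^esub> g z, z)" by auto
        then show "x \<in> {x \<in> homog ?X j. fst x \<oplus>\<^bsub>G\<^esub> g (snd x) = \<zero>\<^bsub>G\<^esub>}"
          using N[OF z(1,2)] G.M_homog_carrier[OF gD(4)[OF z(1)]] by (simp add: G.M.l_neg)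
      next
        fix x assume "x \<in> {x \<in> homog ?X j. fst x \<oplus>\<^bsub>G\<^esub> g (snd x) = \<zero>\<^bsub>G\<^esub>}"
        then obtain n c where x: "x = (n, c)" "n \<in> homog G j" "\<pi> n = \<zero>\<^bsub>M\<^esub>" "c \<in> homog ?C j" "n \<oplus>\<^bsub>G\<^esub> g c = \<zero>\<^bsub>G\<^esub>" by auto
        have nc: "n = \<ominus>\<^bsub>G\<^esub> g c" "g c = \<ominus>\<^bsub>G\<^esub> n"
          using x(5) G.M_homog_carrier[OF x(2)] G.M_homog_carrier[OF gD(4)[OF x(4)]]
            G.M.minus_equality[of n "g c"] G.M.minus_equality[of "g c" n] G.M.a_comm[of n "g c"] by simp_all
        have "e c = \<zero>\<^bsub>M\<^esub>" using g(2)[OF x(4)] pD(6)[OF G.M_homog_carrier[OF x(2)]] x(3) nc(2) 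
            M.M.minus_equality[of "\<zero>\<^bsub>M\<^esub>" "\<zero>\<^bsub>M\<^esub>"] by simp
        then show "x \<in> (\<lambda>z. (\<ominus>\<^bsub>G\<^esub> g z, z)) ` homog ?Z j" using x(1,4) nc(1) by (intro image_eqI[of _ _ c]) simp_all
      qed
    qed (auto simp: free_simps)
    show "lin A q p r ?Z" by (rule lin_mono[OF *(3)]) (use r in auto)
  qed (rule lin(1))
  have fst: "graded_linear A ?X ?N fst" by (rule graded_linearI) auto
  have z: "\<zero>\<^bsub>?C\<^esub> \<in> homog ?C j" for j by (rule C.M_homog_zero)
  show ?thesis
  proof (rule lin_quotient[OF gmX gmN fst _ linX])
    show "homog ?N j \<subseteq> fst ` homog ?X j" for j using z by force
    fix p'
    have gmK: "graded_module A (kerm ?X ?N fst)" by (intro graded_module_kerm gmX gmN fst)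
    \<comment> \<open>The kernel of the projection to \<open>?N\<close> is a copy of the free
      module. It enters \<open>lin_quotient\<close> one step later, where generator degree
      \<open>r + q\<close> is allowed.\<close>
    have "graded_linear A ?C (kerm ?X ?N fst) (\<lambda>c. (\<zero>\<^bsub>G\<^esub>, c))"
      by (rule graded_linearI) (auto simp: G.M_homog_zero pD)
    then have "lin A q p' (r + q) ?C \<longleftrightarrow> lin A q p' (r + q) (kerm ?X ?N fst)"
      by (rule lin_iso[OF graded_module_free gmK]) auto
    moreover have "lin A q p' (r + q) ?C" by (rule lin_free) (use *(2) r(2) in fastforce)
    ultimately show "lin A q p' (r + q) (kerm ?X ?N fst)" by simp
  qed
qed

end

subsection \<open>Shifts and infinite direct sums\<close>

lemma regrade_regrade [simp]: "(M\<lparr>homog := H\<rparr>)\<lparr>homog := H'\<rparr> = M\<lparr>homog := H'\<rparr>"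
  by simp

lemma free_regrade: "(free A I s)\<lparr>homog := H\<rparr> = (free A I' s')\<lparr>homog := H\<rparr>"
  by (simp add: free_def dsum_def Let_def)

lemma dsum_regrade: "(dsum M I H)\<lparr>homog := \<lambda>j. homog (dsum M I H') (f j)\<rparr> = dsum M I (\<lambda>n j. H' n (f j))"
  by (simp add: dsum_def Let_def)

lemma (in graded_module) graded_module_shift: "graded_module A (M\<lparr>homog := \<lambda>j. homog M (j + e)\<rparr>)"
proof (rule graded_moduleI[OF graded_ring_axioms])
  fix i j a x assume "a \<in> homog A i" "x \<in> homog (M\<lparr>homog := \<lambda>j. homog M (j + e)\<rparr>) j"
  then show "a \<odot>\<^bsub>M\<lparr>homog := \<lambda>j. homog M (j + e)\<rparr>\<^esub> x \<in> homog (M\<lparr>homog := \<lambda>j. homog M (j + e)\<rparr>) (i + j)"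
    using smult_homog'[of a i x "j + e" "i + j + e"] by simp
qed (auto simp: module_axioms M_homog_carrier M_homog_closed)

context graded_ring
begin

lemma lin_shift:
  fixes M :: "('r, 'm) graded"
  assumes "lin A q p r M"
  shows "lin A q p (r - a) (M\<lparr>homog := \<lambda>j. homog M (j + a)\<rparr>)"
proof -
  have free: "free A I (\<lambda>n. s n - a) = (free A I s)\<lparr>homog := \<lambda>j. homog (free A I s) (j + a)\<rparr>" for I :: "nat set" and s
    by (simp add: free_def dsum_regrade algebra_simps)
  have cov: "cover A I (\<lambda>n. s n - a) e (M\<lparr>homog := \<lambda>j. homog M (j + a)\<rparr>)" if "cover A I s e M"
    for I :: "nat set" and s e and M :: "('r, 'n) graded"
    unfolding cover_def free using coverD(2)[OF that] graded_linearD(4)[OF coverD(1)[OF that]]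
    by (auto intro!: graded_linear_regrade_dom[OF coverD(1)[OF that]])
  have ker: "kerm (free A I (\<lambda>n. s n - a)) (M\<lparr>homog := \<lambda>j. homog M (j + a)\<rparr>) e
      = (kerm (free A I s) M e)\<lparr>homog := \<lambda>j. homog (kerm (free A I s) M e) (j + a)\<rparr>"
    for I :: "nat set" and s e and M :: "('r, 'n) graded"
    unfolding free by (simp add: kerm_def)
  have *: "lin A q p (r - a) (M\<lparr>homog := \<lambda>j. homog M (j + a)\<rparr>)" if "lin A q p r M"
    for M :: "('r, nat \<Rightarrow> 'r) graded" and p r
    using that
  proof (induction p arbitrary: M r)
    case 0
    then show ?case
    proof (rule linE)
      fix I :: "nat set" and s e assume "cover A I s e M" "\<And>n. n \<in> I \<Longrightarrow> s n \<le> r"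
      then show ?thesis by (intro linI[OF cov]) auto
    qed
  next
    case (Suc p)
    from Suc.prems show ?case
    proof (rule linE)
      fix I :: "nat set" and s e assume *: "cover A I s e M" "\<And>n. n \<in> I \<Longrightarrow> s n \<le> r"
        "\<And>p'. Suc p = Suc p' \<Longrightarrow> lin A q p' (r + q) (kerm (free A I s) M e)"
      have "lin A q p (r - a + q) (kerm (free A I (\<lambda>n. s n - a)) (M\<lparr>homog := \<lambda>j. homog M (j + a)\<rparr>) e)"
        unfolding ker using Suc.IH[OF *(3)] by (simp add: algebra_simps)
      then show ?thesis using *(2) by (intro linI[OF cov[OF *(1)]]) auto
    qed
  qed
  from assms show ?thesis
  proof (rule linE)
    fix I :: "nat set" and s e assume **: "cover A I s e M" "\<And>n. n \<in> I \<Longrightarrow> s n \<le> r"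
      "\<And>p'. p = Suc p' \<Longrightarrow> lin A q p' (r + q) (kerm (free A I s) M e)"
    have "lin A q p' (r - a + q) (kerm (free A I (\<lambda>n. s n - a)) (M\<lparr>homog := \<lambda>j. homog M (j + a)\<rparr>) e)" if "p = Suc p'" for p'
      unfolding ker using *[OF **(3)[OF that]] by (simp add: algebra_simps)
    then show ?thesis using **(2) by (intro linI[OF cov[OF **(1)]]) auto
  qed
qed

lemma free_base_module: "module A (free A I s)"
  unfolding free_def by (rule dsum_module) (rule selfm_module)

text \<open>The direct sum of covers of the summands. Generator \<open>m\<close> of summand
  \<open>n\<close> receives the number \<open>prod_encode (n, m)\<close>, so that the basis is once
  more a set of naturals; this is why the index set is one as well.\<close>

lemma lin_dsum_step:
  fixes M :: "('r, 'm) graded" and I :: "nat set"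
  assumes M: "module A M" "\<And>n. n \<in> I \<Longrightarrow> graded_module A (M\<lparr>homog := H n\<rparr>)"
    and lin: "\<And>n. n \<in> I \<Longrightarrow> lin A q p r (M\<lparr>homog := H n\<rparr>)"
    and IH: "\<And>p' M' H'. p = Suc p' \<Longrightarrow> module A (M' :: ('r, nat \<Rightarrow> 'r) graded) 
      \<Longrightarrow> (\<And>n. n \<in> I \<Longrightarrow> graded_module A (M'\<lparr>homog := H' n\<rparr>))
      \<Longrightarrow> (\<And>n. n \<in> I \<Longrightarrow> lin A q p' (r + q) (M'\<lparr>homog := H' n\<rparr>)) \<Longrightarrow> lin A q p' (r + q) (dsum M' I H')"
  shows "lin A q p r (dsum M I H)"
proof -
  interpret M: module A M by fact
  let ?M = "\<lambda>n. M\<lparr>homog := H n\<rparr>"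
  have gmS: "graded_module A (dsum M I H)" by (rule graded_module_dsum[OF graded_ring_axioms M])
  have "\<forall>n\<in>I. \<exists>J. \<exists>t e. cover A (J :: nat set) t e (?M n) \<and> (\<forall>m\<in>J. t m \<le> r) \<and>
      (\<forall>p'. p = Suc p' \<longrightarrow> lin A q p' (r + q) (kerm (free A J t) (?M n) e))"
    using linE[OF lin] by metis
  from bchoice[OF this] obtain J where "\<forall>n\<in>I. \<exists>t e. cover A (J n :: nat set) t e (?M n) \<and> (\<forall>m\<in>J n. t m \<le> r) \<and>
      (\<forall>p'. p = Suc p' \<longrightarrow> lin A q p' (r + q) (kerm (free A (J n) t) (?M n) e))" by blast
  from bchoice[OF this] obtain t where "\<forall>n\<in>I. \<exists>e. cover A (J n :: nat set) (t n) e (?M n) \<and> (\<forall>m\<in>J n. t n m \<le> r) \<and>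
      (\<forall>p'. p = Suc p' \<longrightarrow> lin A q p' (r + q) (kerm (free A (J n) (t n)) (?M n) e))" by blast
  from bchoice[OF this] obtain e where e: "\<And>n. n \<in> I \<Longrightarrow> cover A (J n :: nat set) (t n) (e n) (?M n)"
    "\<And>n m. n \<in> I \<Longrightarrow> m \<in> J n \<Longrightarrow> t n m \<le> r" 
    "\<And>n p'. n \<in> I \<Longrightarrow> p = Suc p' \<Longrightarrow> lin A q p' (r + q) (kerm (free A (J n) (t n)) (?M n) (e n))" by blast
  note eD = graded_linearD[OF coverD(1)[OF e(1)]] graded_linear_zero_neg[OF graded_module_free M(2) coverD(1)[OF e(1)]]
  let ?K = "{k. fst (prod_decode k) \<in> I \<and> snd (prod_decode k) \<in> J (fst (prod_decode k))}"
  let ?s = "\<lambda>k. t (fst (prod_decode k)) (snd (prod_decode k))"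
  let ?F = "free A ?K ?s"
  let ?row = "\<lambda>(y :: nat \<Rightarrow> 'r) n m. y (prod_encode (n, m))"
  \<comment> \<open>A vector over \<open>?K\<close> is read as a matrix whose row \<open>n\<close>
    is a vector in the free module covering summand \<open>n\<close>.\<close>
  define E where "E y n = (if n \<in> I then e n (?row y n) else \<zero>\<^bsub>M\<^esub>)" for y n
  have row_carrier: "?row y n \<in> carrier (free A I' s')" if "y \<in> carrier ?F" for y n and I' :: "nat set" and s'
  proof -
    have "finite ((\<lambda>m. prod_encode (n, m)) -` {k. y k \<noteq> \<zero>})"
      using that by (intro finite_vimageI) (auto simp: free_simps inj_on_def)
    then show ?thesis using that by (simp add: free_simps vimage_def)
  qed
  have row_fin: "finite {n. ?row y n \<noteq> (\<lambda>_. \<zero>)}" if "y \<in> carrier ?F" for y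
  proof (rule finite_subset)
    show "{n. ?row y n \<noteq> (\<lambda>_. \<zero>)} \<subseteq> (\<lambda>k. fst (prod_decode k)) ` {k. y k \<noteq> \<zero>}"
    proof
      fix n assume "n \<in> {n. ?row y n \<noteq> (\<lambda>_. \<zero>)}"
      then obtain m where "y (prod_encode (n, m)) \<noteq> \<zero>" by auto
      then show "n \<in> (\<lambda>k. fst (prod_decode k)) ` {k. y k \<noteq> \<zero>}"
        by (intro image_eqI[of _ _ "prod_encode (n, m)"]) auto
    qed
  qed (use that in \<open>auto simp: free_simps\<close>)
  have row_homog: "?row y n \<in> homog (free A (J n) (t n)) j" if "y \<in> homog ?F j" "n \<in> I" for y n j
  proof -
    have "y k \<in> homog A (j - ?s k)" if "k \<in> ?K" for k using \<open>y \<in> homog ?F j\<close> that by (simp add: free_simps)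
    from this[of "prod_encode (n, _)"] have "\<forall>m\<in>J n. ?row y n m \<in> homog A (j - t n m)" using that(2) by simp
    moreover have "y (prod_encode (n, m)) = \<zero>" if "m \<notin> J n" for m using \<open>y \<in> homog ?F j\<close> that by (simp add: free_simps)
    ultimately show ?thesis
      using row_carrier[OF free_homog_carrier[OF that(1)], of n "J n" "t n"] by (simp add: free_simps(5))
  qed
  have row_out: "?row y n = (\<lambda>_. \<zero>)" if "y \<in> homog ?F j" "n \<notin> I" for y n j
    using that by (simp add: free_simps)
  have E_carrier: "E y \<in> carrier (dsum M I H)" if y: "y \<in> carrier ?F" for y
  proof -
    have "finite {n. E y n \<noteq> \<zero>\<^bsub>M\<^esub>}"
      by (rule finite_subset[OF _ row_fin[OF y]]) (use eD(5) in \<open>auto simp: E_def free_simps\<close>)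
    moreover have "E y n \<in> carrier M" for n using eD(1)[OF _ row_carrier[OF y]] by (simp add: E_def)
    ultimately show ?thesis by simp
  qed
  have E: "graded_linear A ?F (dsum M I H) E"
  proof (rule graded_linearI)
    fix x y assume "x \<in> carrier ?F" "y \<in> carrier ?F"
    then show "E (x \<oplus>\<^bsub>?F\<^esub> y) = E x \<oplus>\<^bsub>dsum M I H\<^esub> E y"
      using eD(2)[OF _ row_carrier row_carrier] by (auto simp: E_def free_simps)
  next
    fix a x assume "a \<in> carrier A" "x \<in> carrier ?F"
    then show "E (a \<odot>\<^bsub>?F\<^esub> x) = a \<odot>\<^bsub>dsum M I H\<^esub> E x"
      using eD(3)[OF _ _ row_carrier] by (auto simp: E_def free_simps)
  next
    fix x j assume x: "x \<in> homog ?F j"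
    show "E x \<in> homog (dsum M I H) j"
      using E_carrier[OF free_homog_carrier[OF x]] eD(4)[OF _ row_homog[OF x]] 
      by (simp add: dsum_homog) (simp add: E_def)
  qed (rule E_carrier)
  have unrow: "(\<lambda>k. z (fst (prod_decode k)) (snd (prod_decode k))) \<in> carrier ?F" 
    if "finite {n. z n \<noteq> (\<lambda>_. \<zero>)}" "\<And>n m. z n m \<in> carrier A" "\<And>n. finite {m. z n m \<noteq> \<zero>}" for z
  proof -
    let ?S = "Sigma {n. z n \<noteq> (\<lambda>_. \<zero>)} (\<lambda>n. {m. z n m \<noteq> \<zero>})"
    have "finite (prod_encode ` ?S)" using that by auto
    moreover have "{k. z (fst (prod_decode k)) (snd (prod_decode k)) \<noteq> \<zero>} \<subseteq> prod_encode ` ?S"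
    proof
      fix k assume "k \<in> {k. z (fst (prod_decode k)) (snd (prod_decode k)) \<noteq> \<zero>}"
      then show "k \<in> prod_encode ` ?S"
        by (intro image_eqI[of _ _ "prod_decode k"]) (auto simp: mem_Times_iff mem_Sigma_iff split_beta
            intro!: SigmaI[of "fst (prod_decode k)" _ "snd (prod_decode k)", simplified])
    qed
    ultimately show ?thesis using that(2) by (auto simp: free_simps intro: finite_subset)
  qed
  have cov: "cover A ?K ?s E (dsum M I H)"
    unfolding cover_def
  proof (intro conjI allI E subsetI)
    fix j x assume x: "x \<in> homog (dsum M I H) j"
    \<comment> \<open>Zero entries of \<open>x\<close> get the preimage zero: this keeps the family
      \<open>z\<close> finitely supported, so that it can be flattened to an element of
      \<open>?F\<close>.\<close>
    have "\<forall>n. \<exists>y. y \<in> carrier (free A (J n) (t n)) \<and> (x n = \<zero>\<^bsub>M\<^esub> \<longrightarrow> y = (\<lambda>_. \<zero>)) \<and>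
       (n \<in> I \<longrightarrow> y \<in> homog (free A (J n) (t n)) j \<and> e n y = x n) \<and> (n \<notin> I \<longrightarrow> y = (\<lambda>_. \<zero>))"
    proof
      fix n
      have z: "(\<lambda>_. \<zero>) \<in> homog (free A (J n) (t n)) j" by (simp add: free_simps homog_zero)
      show "\<exists>y. y \<in> carrier (free A (J n) (t n)) \<and> (x n = \<zero>\<^bsub>M\<^esub> \<longrightarrow> y = (\<lambda>_. \<zero>)) \<and>
       (n \<in> I \<longrightarrow> y \<in> homog (free A (J n) (t n)) j \<and> e n y = x n) \<and> (n \<notin> I \<longrightarrow> y = (\<lambda>_. \<zero>))"
      proof (cases "n \<notin> I \<or> x n = \<zero>\<^bsub>M\<^esub>")
        case True
        then show ?thesis using z free_homog_carrier[OF z] eD(5)[of n]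
          by (intro exI[of _ "\<lambda>_. \<zero>"]) (auto simp: free_simps(2))
      next
        case False
        then have "x n \<in> homog (?M n) j" using x by (simp add: dsum_homog)
        then show ?thesis using coverD(2)[OF e(1), of n "x n" j] False free_homog_carrier by blast
      qed
    qed
    from choice[OF this] obtain z where z: "\<And>n. z n \<in> carrier (free A (J n) (t n))" "\<And>n. x n = \<zero>\<^bsub>M\<^esub> \<Longrightarrow> z n = (\<lambda>_. \<zero>)"
      "\<And>n. n \<in> I \<Longrightarrow> z n \<in> homog (free A (J n) (t n)) j \<and> e n (z n) = x n" "\<And>n. n \<notin> I \<Longrightarrow> z n = (\<lambda>_. \<zero>)" by blast
    let ?y = "\<lambda>k. z (fst (prod_decode k)) (snd (prod_decode k))"
    have "finite {n. z n \<noteq> (\<lambda>_. \<zero>)}"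
      by (rule finite_subset[of _ "{n. x n \<noteq> \<zero>\<^bsub>M\<^esub>}"]) (use z(2) x in \<open>auto simp: dsum_homog\<close>)
    then have yc: "?y \<in> carrier ?F" using z(1) by (intro unrow) (auto simp: free_simps)
    have yh: "?y \<in> homog ?F j"
    proof -
      have "?y k \<in> homog A (j - ?s k)" if "k \<in> ?K" for k
        using z(3)[of "fst (prod_decode k)"] that by (simp add: free_simps)
      moreover have "?y k = \<zero>" if "k \<notin> ?K" for k
        using z(3,4)[of "fst (prod_decode k)"] that by (cases "fst (prod_decode k) \<in> I") (simp_all add: free_simps)
      ultimately show ?thesis using yc by (simp add: free_simps(5))
    qed
    have "E ?y n = x n" for n
      using z(3)[of n] x by (auto simp: E_def dsum_homog)
    then show "x \<in> E ` homog ?F j" using yh by (intro image_eqI[of _ _ ?y]) auto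
  qed
  show ?thesis
  proof (rule linI[OF cov])
    show "?s k \<le> r" if "k \<in> ?K" for k using e(2) that by auto
    fix p' assume p: "p = Suc p'"
    \<comment> \<open>All free modules share carrier and operations. Any basis, here the empty one,
      provides an ambient module of which the kernels for all \<open>n\<close> are
      regradings.\<close>
    let ?B = "free A ({} :: nat set) (\<lambda>_. 0)"
    let ?H = "\<lambda>n. homog (kerm (free A (J n) (t n)) (?M n) (e n))"
    have B: "?B\<lparr>homog := ?H n\<rparr> = kerm (free A (J n) (t n)) (?M n) (e n)" for n
      unfolding kerm_def by (simp add: free_regrade[where I="{}" and I'="J n" and s'="t n"])
    have gmB: "graded_module A (?B\<lparr>homog := ?H n\<rparr>)" if "n \<in> I" for n
      unfolding B by (intro graded_module_cover_kernel[OF M(2)] e(1) that)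
    have linB: "lin A q p' (r + q) (dsum ?B I ?H)"
    proof (rule IH[OF p free_base_module gmB])
      show "lin A q p' (r + q) (?B\<lparr>homog := ?H n\<rparr>)" if "n \<in> I" for n unfolding B by (rule e(3)[OF that p])
    qed
    have "lin A q p' (r + q) (kerm ?F (dsum M I H) E) \<longleftrightarrow> lin A q p' (r + q) (dsum ?B I ?H)"
    proof (rule lin_iso)
      show "graded_module A (kerm ?F (dsum M I H) E)" by (rule graded_module_cover_kernel[OF gmS cov])
      show "graded_module A (dsum ?B I ?H)" by (rule graded_module_dsum[OF graded_ring_axioms free_base_module gmB])
      show "graded_linear A (kerm ?F (dsum M I H) E) (dsum ?B I ?H) ?row"
      proof (rule graded_linearI)
        show c: "?row y \<in> carrier (dsum ?B I ?H)" if "y \<in> carrier (kerm ?F (dsum M I H) E)" for y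
          using row_carrier[of y] row_fin[of y] that by (auto simp: free_simps)
        fix y j assume "y \<in> homog (kerm ?F (dsum M I H) E) j"
        then have y: "y \<in> homog ?F j" "E y = (\<lambda>_. \<zero>\<^bsub>M\<^esub>)" by auto
        have "?row y n \<in> ?H n j" if "n \<in> I" for n
          using row_homog[OF y(1) that] fun_cong[OF y(2), of n] that by (simp add: E_def)
        then show "?row y \<in> homog (dsum ?B I ?H) j"
          using c[of y] free_homog_carrier[OF y(1)] row_out[OF y(1)] unfolding dsum_homog by (simp add: free_simps(2))
      qed (simp_all add: free_simps)
      show "y = \<zero>\<^bsub>kerm ?F (dsum M I H) E\<^esub>" if "?row y = \<zero>\<^bsub>dsum ?B I ?H\<^esub>" for y
      proof
        fix k
        show "y k = \<zero>\<^bsub>kerm ?F (dsum M I H) E\<^esub> k"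
          using fun_cong[OF fun_cong[OF that], of "fst (prod_decode k)" "snd (prod_decode k)"] by (simp add: free_simps)
      qed
      show "homog (dsum ?B I ?H) j \<subseteq> ?row ` homog (kerm ?F (dsum M I H) E) j" for j
      proof
        fix z assume z: "z \<in> homog (dsum ?B I ?H) j"
        let ?y = "\<lambda>k. z (fst (prod_decode k)) (snd (prod_decode k))"
        have zc: "\<And>n. z n \<in> carrier ?B" "finite {n. z n \<noteq> (\<lambda>_. \<zero>)}" "\<And>n. n \<in> I \<Longrightarrow> z n \<in> ?H n j" "\<And>n. n \<notin> I \<Longrightarrow> z n = (\<lambda>_. \<zero>)"
          using z unfolding dsum_homog by (auto simp: free_simps)
        have yc: "?y \<in> carrier ?F" by (rule unrow) (use zc(1,2) in \<open>auto simp: free_simps\<close>)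
        have yh: "?y \<in> homog ?F j"
        proof -
          have "?y k \<in> homog A (j - ?s k)" if "k \<in> ?K" for k
            using zc(3)[of "fst (prod_decode k)"] that by (simp add: free_simps)
          moreover have "?y k = \<zero>" if "k \<notin> ?K" for k
            using zc(3,4)[of "fst (prod_decode k)"] that by (cases "fst (prod_decode k) \<in> I") (simp_all add: free_simps)
          ultimately show ?thesis using yc by (simp add: free_simps(5))
        qed
        have "E ?y = (\<lambda>_. \<zero>\<^bsub>M\<^esub>)" using zc(3) by (auto simp: E_def)
        then show "z \<in> ?row ` homog (kerm ?F (dsum M I H) E) j" using yh by (intro image_eqI[of _ _ ?y]) auto
      qed
    qed
    then show "lin A q p' (r + q) (kerm ?F (dsum M I H) E)" using linB by simp
  qed
qed

lemma lin_dsum0: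
  fixes M :: "('r, nat \<Rightarrow> 'r) graded" and I :: "nat set"
  assumes "module A M" "\<And>n. n \<in> I \<Longrightarrow> graded_module A (M\<lparr>homog := H n\<rparr>)"
    "\<And>n. n \<in> I \<Longrightarrow> lin A q p r (M\<lparr>homog := H n\<rparr>)"
  shows "lin A q p r (dsum M I H)"
  using assms
proof (induction p arbitrary: M H r)
  case 0 show ?case by (rule lin_dsum_step[OF 0]) simp_all
next
  case (Suc p)
  show ?case
  proof (rule lin_dsum_step[OF Suc.prems])
    fix p' M' H' assume "Suc p = Suc p'" "module A (M' :: ('r, nat \<Rightarrow> 'r) graded)" "\<And>n. n \<in> I \<Longrightarrow> graded_module A (M'\<lparr>homog := H' n\<rparr>)"
      "\<And>n. n \<in> I \<Longrightarrow> lin A q p' (r + q) (M'\<lparr>homog := H' n\<rparr>)"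
    then show "lin A q p' (r + q) (dsum M' I H')" using Suc.IH[of M' H' "r + q"] by simp
  qed
qed

lemma lin_dsum:
  fixes I :: "nat set"
  assumes "module A M" "\<And>n. n \<in> I \<Longrightarrow> graded_module A (M\<lparr>homog := H n\<rparr>)"
    "\<And>n. n \<in> I \<Longrightarrow> lin A q p r (M\<lparr>homog := H n\<rparr>)"
  shows "lin A q p r (dsum M I H)"
proof (rule lin_dsum_step[OF assms])
  fix p' M' H' assume "p = Suc p'" "module A (M' :: ('r, nat \<Rightarrow> 'r) graded)" "\<And>n. n \<in> I \<Longrightarrow> graded_module A (M'\<lparr>homog := H' n\<rparr>)"
    "\<And>n. n \<in> I \<Longrightarrow> lin A q p' (r + q) (M'\<lparr>homog := H' n\<rparr>)"
  then show "lin A q p' (r + q) (dsum M' I H')" by (intro lin_dsum0)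
qed

end

subsection \<open>Veronese functors\<close>

lemma cring_regrade [simp]:
  fixes A :: "('a, 'b, 'c) graded_scheme"
  shows "cring (A\<lparr>homog := H\<rparr>) = cring A"
proof -
  have *: "cring (A\<lparr>homog := H\<rparr>)" if "cring A" for A :: "('a, 'b, 'c) graded_scheme" and H
  proof -
    interpret cring A by fact
    show ?thesis
      by (intro cringI comm_monoidI) (auto simp: abelian_group_axioms m_assoc l_distr intro: m_comm)
  qed
  show ?thesis using *[of A H] *[of "A\<lparr>homog := H\<rparr>" "homog A"] by auto
qed

lemma module_ring_regrade [simp]:
  fixes A :: "('a, 'b, 'c) graded_scheme"
  shows "Module.module (A\<lparr>homog := H\<rparr>) M = Module.module A M"
  by (simp add: module_def module_axioms_def)

lemma additive_subgroup_regrade [simp]: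
  fixes A :: "('a, 'b, 'c) graded_scheme"
  shows "additive_subgroup S (A\<lparr>homog := H\<rparr>) = additive_subgroup S A"
  by (simp add: additive_subgroup_def)

lemma graded_linear_ring_regrade [simp]:
  fixes A :: "('a, 'b, 'c) graded_scheme"
  shows "graded_linear (A\<lparr>homog := H\<rparr>) M N f = graded_linear A M N f"
  by (simp add: graded_linear_def)

lemma kerm_regrade:
  "kerm (M\<lparr>homog := \<lambda>j. homog M (f j)\<rparr>) (N\<lparr>homog := \<lambda>j. homog N (f j)\<rparr>) e
    = (kerm M N e)\<lparr>homog := \<lambda>j. homog (kerm M N e) (f j)\<rparr>"
  by (simp add: kerm_def)

text \<open>
  By the convention on carriers, the Veronese subring can be replaced by all of \<open>A\<close> with the components of degree
  \<open>ci\<close>, and no change of the carriers of modules is needed.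
\<close>

definition vring :: "int \<Rightarrow> ('a, 'r, 'z) graded_scheme \<Rightarrow> ('a, 'r, 'z) graded_scheme" where
  "vring c A = A\<lparr>homog := \<lambda>i. homog A (c * i)\<rparr>"

lemma vring_simps [simp]:
  "carrier (vring c A) = carrier A" "zero (vring c A) = zero A" "add (vring c A) = add A"
  "monoid.mult (vring c A) = monoid.mult A" "one (vring c A) = one A" "homog (vring c A) i = homog A (c * i)"
  "Module.module (vring c A) M = Module.module A M" "graded_linear (vring c A) M N f = graded_linear A M N f"
  by (simp_all add: vring_def)

context graded_ring
begin

lemma graded_ring_vring: "graded_ring (vring c A)"
proof (intro graded_ring.intro graded_ring_axioms.intro)
  show "cring (vring c A)" by (simp add: vring_def is_cring)
  show "additive_subgroup (homog (vring c A) i) (vring c A)" for i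
    by (simp add: vring_def homog_subgroup)
  show "x \<otimes>\<^bsub>vring c A\<^esub> y \<in> homog (vring c A) (i + j)" 
    if "x \<in> homog (vring c A) i" "y \<in> homog (vring c A) j" for x y i j
    using mult_homog[of x "c * i" y "c * j"] that by (simp add: algebra_simps)
qed (simp add: one_homog)

lemma graded_module_vring:
  assumes "graded_module A M"
  shows "graded_module (vring c A) (M\<lparr>homog := \<lambda>j. homog M (c * j + e)\<rparr>)"
proof -
  interpret M: graded_module A M by fact
  show ?thesis
  proof (rule graded_moduleI[OF graded_ring_vring])
    fix i j a x assume "a \<in> homog (vring c A) i" "x \<in> homog (M\<lparr>homog := \<lambda>j. homog M (c * j + e)\<rparr>) j"
    then show "a \<odot>\<^bsub>M\<lparr>homog := \<lambda>j. homog M (c * j + e)\<rparr>\<^esub> x \<in> homog (M\<lparr>homog := \<lambda>j. homog M (c * j + e)\<rparr>) (i + j)"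
      using M.smult_homog'[of a "c * i" x "c * j + e" "c * (i + j) + e"] by (simp add: algebra_simps)
  qed (auto simp: M.module_axioms M.M_homog_carrier M.M_homog_closed)
qed

text \<open>Taking the components of degree \<open>c * j\<close> is exact. It turns a free summand
  generated in degree \<open>s n \<le> c * r\<close> into a shifted Veronese module, which by
  \<open>E\<close> has a linear resolution over \<open>vring c A\<close> starting in degree at most
  \<open>r\<close>. Resolving every term in this way and gluing with \<open>lin_quotient\<close>
  converts steps of \<open>c\<close> into steps of 1.\<close>

lemma veronese_lin_step:
  fixes M :: "('r, 'm) graded"
  assumes E: "\<And>e. 0 \<le> e \<Longrightarrow> lin (vring c A) 1 p 0 ((selfm A)\<lparr>homog := \<lambda>j. homog A (c * j + e)\<rparr>)"
    and M: "graded_module A M" and lin: "lin A c p (c * r) M"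
    and IH: "\<And>p' M'. p = Suc p' \<Longrightarrow> graded_module A (M' :: ('r, nat \<Rightarrow> 'r) graded) \<Longrightarrow> lin A c p' (c * (r + 1)) M'
       \<Longrightarrow> lin (vring c A) 1 p' (r + 1) (M'\<lparr>homog := \<lambda>j. homog M' (c * j)\<rparr>)"
  shows "lin (vring c A) 1 p r (M\<lparr>homog := \<lambda>j. homog M (c * j)\<rparr>)"
  using lin
proof (rule linE)
  interpret V: graded_ring "vring c A" by (rule graded_ring_vring)
  fix I :: "nat set" and s e assume *: "cover A I s e M" "\<And>n. n \<in> I \<Longrightarrow> s n \<le> c * r"
    "\<And>p'. p = Suc p' \<Longrightarrow> lin A c p' (c * r + c) (kerm (free A I s) M e)"
  let ?F = "free A I s" let ?Fv = "?F\<lparr>homog := \<lambda>j. homog ?F (c * j)\<rparr>"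
  let ?Mv = "M\<lparr>homog := \<lambda>j. homog M (c * j)\<rparr>"
  have gmM: "graded_module (vring c A) ?Mv" using graded_module_vring[OF M, where c = c and e = 0] by simp
  have gmF: "graded_module (vring c A) ?Fv" using graded_module_vring[OF graded_module_free, where c = c and e = 0] by simp
  have Fv: "?Fv = dsum (selfm A) I (\<lambda>n j. homog A (c * j - s n))"
    by (simp add: free_def dsum_regrade)
  have linF: "lin (vring c A) 1 p r ?Fv"
    unfolding Fv
  proof (rule V.lin_dsum)
    fix n assume n: "n \<in> I"
    show "graded_module (vring c A) ((selfm A)\<lparr>homog := \<lambda>j. homog A (c * j - s n)\<rparr>)"
      using graded_module_vring[OF graded_module_selfm, where c = c and e = "- s n"] by simp
    \<comment> \<open>The offset \<open>- s n\<close> may be negative, whereas \<open>E\<close> asks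
      for nonnegative offsets. It is \<open>c * r - s n\<close> minus \<open>c * r\<close>, that is,
      a nonnegative offset followed by a shift by \<open>- r\<close>.\<close>
    show "lin (vring c A) 1 p r ((selfm A)\<lparr>homog := \<lambda>j. homog A (c * j - s n)\<rparr>)"
      using V.lin_shift[OF E[of "c * r - s n"], of "- r"] *(2)[OF n] by (simp add: algebra_simps)
  qed (simp add: selfm_module)
  have e: "graded_linear (vring c A) ?Fv ?Mv e"
    using graded_linearD(4)[OF coverD(1)[OF *(1)]] 
    by (simp add: graded_linear_regrade_dom[OF coverD(1)[OF *(1)]])
  show ?thesis
  proof (rule V.lin_quotient[OF gmF gmM e _ linF])
    show "homog ?Mv j \<subseteq> e ` homog ?Fv j" for j using coverD(2)[OF *(1)] by fastforce
    fix p' assume p: "p = Suc p'"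
    show "lin (vring c A) 1 p' (r + 1) (kerm ?Fv ?Mv e)"
      unfolding kerm_regrade
      by (rule IH[OF p graded_module_cover_kernel[OF M *(1)]]) (use *(3)[OF p] in \<open>simp add: algebra_simps\<close>)
  qed
qed

lemma veronese_lin0:
  assumes "\<And>e. 0 \<le> e \<Longrightarrow> lin (vring c A) 1 p 0 ((selfm A)\<lparr>homog := \<lambda>j. homog A (c * j + e)\<rparr>)"
    "graded_module A (M :: ('r, nat \<Rightarrow> 'r) graded)" "lin A c p (c * r) M"
  shows "lin (vring c A) 1 p r (M\<lparr>homog := \<lambda>j. homog M (c * j)\<rparr>)"
  using assms
proof (induction p arbitrary: r M)
  case 0 show ?case by (rule veronese_lin_step[OF 0]) simp_all
next
  case (Suc p)
  show ?case
    by (rule veronese_lin_step[OF Suc.prems]) (use Suc.IH lin_mono[OF Suc.prems(1)] in auto)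
qed

lemma veronese_lin:
  assumes "\<And>e. 0 \<le> e \<Longrightarrow> lin (vring c A) 1 p 0 ((selfm A)\<lparr>homog := \<lambda>j. homog A (c * j + e)\<rparr>)"
    "graded_module A M" "lin A c p (c * r) M"
  shows "lin (vring c A) 1 p r (M\<lparr>homog := \<lambda>j. homog M (c * j)\<rparr>)"
  by (rule veronese_lin_step[OF assms]) (use veronese_lin0 lin_mono[OF assms(1)] in auto)

lemma lin_selfm: "0 \<le> r \<Longrightarrow> lin A q p r (selfm A)"
proof -
  assume r: "0 \<le> r"
  have "graded_linear A (selfm A) (free A {0 :: nat} (\<lambda>_. 0)) (unit_vec A 0)"
    by (rule graded_linearI) (auto simp: unit_vec_carrier unit_vec_homog, auto simp: free_simps dunit_def)
  then have "lin A q p r (selfm A) \<longleftrightarrow> lin A q p r (free A {0 :: nat} (\<lambda>_. 0))"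
  proof (rule lin_iso[OF graded_module_selfm graded_module_free])
    fix j x assume "unit_vec A (0 :: nat) x = \<zero>\<^bsub>free A {0} (\<lambda>_. 0)\<^esub>"
    from fun_cong[OF this, of 0] show "x = \<zero>\<^bsub>selfm A\<^esub>" by (simp add: dunit_def free_simps)
  next
    show "homog (free A {0} (\<lambda>_. 0)) j \<subseteq> unit_vec A (0 :: nat) ` homog (selfm A) j" for j
    proof
      fix x assume "x \<in> homog (free A {0 :: nat} (\<lambda>_. 0)) j"
      then show "x \<in> unit_vec A (0 :: nat) ` homog (selfm A) j"
        by (intro image_eqI[of _ _ "x 0"]) (auto simp: free_simps dunit_def)
    qed
  qed
  then show ?thesis using lin_free[of "{0}" "\<lambda>_. 0" r q p] r by simp
qed

text \<open>
  The Veronese modules \<open>V\<^sub>e = \<Oplus>\<^sub>j A\<^bsub>cj+e\<^esub>\<close> of a Koszul algebra have linear resolutions: with \<open>N\<close> the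
  second syzygy module of the residue field, the sequence \<open>0 \<rightarrow> N(e) \<rightarrow> A(e - 1)\<^sup>n \<rightarrow> \<mm>(e) \<rightarrow> 0\<close>
  presents \<open>V\<^sub>e\<close> by copies of \<open>V\<^bsub>e-1\<^esub>\<close> as long as \<open>0 < e < c\<close>.
\<close>

lemma veronese_modules_linear:
  fixes N :: "('r, 'n) graded"
  defines "m \<equiv> (selfm A)\<lparr>homog := \<lambda>j. if j \<ge> 1 then homog A j else {\<zero>}\<rparr>"
  assumes c: "1 \<le> c" and neg: "\<And>i. i < 0 \<Longrightarrow> homog A i = {\<zero>}"
    and N: "graded_module A N" "\<And>p. lin A 1 p 0 N"
    and pi: "graded_linear A (selfm A) N \<pi>" "\<And>j. homog N j \<subseteq> \<pi> ` homog A j" "kerm (selfm A) N \<pi> = m"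
    and cov: "cover A (I :: nat set) (\<lambda>_. 1) g m"
  shows "0 \<le> e \<Longrightarrow> lin (vring c A) 1 p 0 ((selfm A)\<lparr>homog := \<lambda>j. homog A (c * j + e)\<rparr>)"
proof -
  interpret V: graded_ring "vring c A" by (rule graded_ring_vring)
  have gmm: "graded_module A m"
    unfolding pi(3)[symmetric] by (intro graded_module_kerm graded_module_selfm N pi)
  \<comment> \<open>The ideal \<open>m\<close> is the kernel of the map from the ring to the residue
    field, so its bound lies one step above the bound 0.\<close>
  have linm: "lin A 1 p 1 m" for p
    unfolding pi(3)[symmetric]
    by (rule lin_kernel[where r' = 0]) (auto intro: graded_module_selfm N pi(1) lin_selfm simp: pi(2))
  let ?F = "free A I (\<lambda>_. 1)"
  \<comment> \<open>The second syzygy of the residue field; \<open>N\<close> itself stands for the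
    residue field here.\<close>
  let ?N2 = "kerm ?F m g"
  have gm2: "graded_module A ?N2" by (rule graded_module_cover_kernel[OF gmm cov])
  have lin2: "lin A 1 p 2 ?N2" for p
    using coverD[OF cov] by (intro lin_kernel[where r' = 1, OF graded_module_free gmm _ _ lin_free linm]) auto
  let ?V = "\<lambda>e. (selfm A)\<lparr>homog := \<lambda>j. homog A (c * j + e)\<rparr>"
  \<comment> \<open>Two nested inductions: on the length \<open>p\<close>, because resolving the
    second syzygy involves all Veronese modules with length \<open>p - 1\<close>, and for fixed
    \<open>p\<close> on the offset, because the free term involves the offset
    \<open>k - 1\<close>.\<close>
  have step: "lin (vring c A) 1 p 0 (?V (int k))" 
    if IH: "\<And>p' e. p = Suc p' \<Longrightarrow> 0 \<le> e \<Longrightarrow> lin (vring c A) 1 p' 0 (?V e)" for p k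
  proof (induction k rule: less_induct)
    case (less k)
    consider "k = 0" | "c \<le> int k" | "0 < k" "int k < c" by linarith
    then show ?case
    proof cases
      case 1
      have "selfm (vring c A) = ?V 0" by (simp add: selfm_def restrict_scalars_def vring_def)
      then show ?thesis using V.lin_selfm[of 0 1 p] 1 by simp
    next
      case 2
      let ?k = "k - nat c"
      have k: "int ?k = int k - c" "?k < k" using 2 c by auto
      \<comment> \<open>Offset \<open>k\<close> is offset \<open>k - c\<close> with the degree
        shifted by one. The bound improves to \<open>-1\<close> and is then weakened to 0.\<close>
      have "?V (int k) = (?V (int ?k))\<lparr>homog := \<lambda>j. homog (?V (int ?k)) (j + 1)\<rparr>"
        by (simp add: k(1) algebra_simps)
      then have "lin (vring c A) 1 p (0 - 1) (?V (int k))"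
        using V.lin_shift[OF less.IH[OF k(2)], of 1] by (simp only:)
      then show ?thesis by (rule lin_mono) auto
    next
      case 3
      \<comment> \<open>For \<open>0 < k < c\<close> the degree \<open>c * j + k\<close> is never
        zero, so the ring and its ideal \<open>m\<close> have the same components there.\<close>
      have V: "m\<lparr>homog := \<lambda>j. homog m (c * j + int k)\<rparr> = ?V (int k)"
      proof -
        have "(if c * j + int k \<ge> 1 then homog A (c * j + int k) else {\<zero>}) = homog A (c * j + int k)" for j
        proof (cases "c * j + int k \<ge> 1")
          case False
          have "c * j + int k \<noteq> 0"
          proof
            assume "c * j + int k = 0"
            then have "int k = c * (- j)" by simp
            then have "0 < c * (- j)" "c * (- j) < c * 1" using 3 by auto
            then have "0 < - j" "- j < 1" using c 
              by (auto simp: zero_less_mult_iff mult_less_cancel_left_pos simp del: mult_minus_right)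
            then show False by simp
          qed
          then show ?thesis using False neg[of "c * j + int k"] by simp
        qed simp
        then show ?thesis by (simp add: m_def)
      qed
      let ?Fv = "?F\<lparr>homog := \<lambda>j. homog ?F (c * j + int k)\<rparr>"
      have gmV: "graded_module (vring c A) (?V (int k))" unfolding V[symmetric] by (rule graded_module_vring[OF gmm])
      have gmF: "graded_module (vring c A) ?Fv" by (rule graded_module_vring[OF graded_module_free])
      have Fv: "?Fv = dsum (selfm A) I (\<lambda>n j. homog A (c * j + int (k - 1)))"
        using 3 by (simp add: free_def dsum_regrade of_nat_diff algebra_simps)
      have linF: "lin (vring c A) 1 p 0 ?Fv"
        unfolding Fv
      proof (rule V.lin_dsum)
        show "lin (vring c A) 1 p 0 (?V (int (k - 1)))" using less.IH[of "k - 1"] 3 by simp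
        show "graded_module (vring c A) (?V (int (k - 1)))" using graded_module_vring[OF graded_module_selfm, where c = c and e = "int (k - 1)"] by simp
      qed (simp add: selfm_module)
      have g: "graded_linear (vring c A) ?Fv (?V (int k)) g"
        unfolding V[symmetric] using graded_linearD(4)[OF coverD(1)[OF cov]] 
        by (simp add: graded_linear_regrade_dom[OF coverD(1)[OF cov]])
      show ?thesis
      proof (rule V.lin_quotient[OF gmF gmV g _ linF])
        show "homog (?V (int k)) j \<subseteq> g ` homog ?Fv j" for j
          unfolding V[symmetric] using coverD(2)[OF cov] by fastforce
        fix p' assume p: "p = Suc p'"
        let ?N3 = "?N2\<lparr>homog := \<lambda>j. homog ?N2 (j + int k)\<rparr>"
        \<comment> \<open>Since \<open>k > 0\<close>, the bound satisfies
          \<open>2 - k \<le> 1 \<le> c\<close>, and slope 1 may be weakened to \<open>c\<close>. So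
          the shifted second syzygy meets the hypothesis of \<open>veronese_lin\<close> with
          \<open>r = 1\<close>, exactly the bound required of a kernel.\<close>
        have "lin A 1 p' (2 - int k) ?N3" by (rule lin_shift[OF lin2])
        then have "lin A c p' (c * 1) ?N3" by (rule lin_mono) (use c 3 in auto)
        from veronese_lin[OF _ _ this] IH[OF p] graded_module.graded_module_shift[OF gm2, of "int k"]
        have "lin (vring c A) 1 p' 1 (?N3\<lparr>homog := \<lambda>j. homog ?N3 (c * j)\<rparr>)" by blast
        then show "lin (vring c A) 1 p' (0 + 1) (kerm ?Fv (?V (int k)) g)"
          unfolding V[symmetric] kerm_regrade by simp
      qed
    qed
  qed
  have "lin (vring c A) 1 p 0 (?V e)" if "0 \<le> e" for p e
    using that
  proof (induction p arbitrary: e)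
    case 0 show ?case using step[of 0 "nat e"] 0 by simp
  next
    case (Suc p)
    have "lin (vring c A) 1 (Suc p) 0 (?V (int (nat e)))" by (rule step) (use Suc.IH in auto)
    then show ?case using Suc.prems by simp
  qed
  then show "0 \<le> e \<Longrightarrow> lin (vring c A) 1 p 0 (?V e)" .
qed

end

subsection \<open>Change of rings\<close>

definition resm :: "('r \<Rightarrow> 's) \<Rightarrow> ('s, 'm) graded \<Rightarrow> ('r, 'm) graded" where
  "resm \<psi> M = \<lparr>carrier = carrier M, monoid.mult = monoid.mult M, one = one M, zero = zero M, add = add M,
      smult = (\<lambda>r x. \<psi> r \<odot>\<^bsub>M\<^esub> x), homog = homog M\<rparr>"

lemma resm_simps [simp]:
  "carrier (resm \<psi> M) = carrier M" "zero (resm \<psi> M) = zero M" "add (resm \<psi> M) = add M"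
  "smult (resm \<psi> M) = (\<lambda>r x. \<psi> r \<odot>\<^bsub>M\<^esub> x)" "homog (resm \<psi> M) = homog M"
  by (simp_all add: resm_def)

lemma resm_a_inv [simp]: "a_inv (resm \<psi> M) = a_inv M"
  by (rule a_inv_cong) simp_all

lemma resm_restrict_scalars: "resm \<psi> (restrict_scalars \<phi> A) = restrict_scalars (\<lambda>x. \<phi> (\<psi> x)) A"
  by (simp add: resm_def restrict_scalars_def)

lemma kerm_resm: "kerm (resm \<psi> M) (resm \<psi> N) f = resm \<psi> (kerm M N f)"
  by (simp add: resm_def kerm_def)

locale graded_hom = A: graded_ring A + B: graded_ring B
  for A :: "('a, 'r, 'z) graded_scheme" and B :: "('b, 's, 'y) graded_scheme" +
  fixes \<psi> :: "'r \<Rightarrow> 's"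
  assumes hom: "\<psi> \<in> ring_hom A B" and hom_homog: "a \<in> homog A i \<Longrightarrow> \<psi> a \<in> homog B i"
begin

lemmas homD = ring_hom_closed[OF hom] ring_hom_mult[OF hom] ring_hom_add[OF hom] ring_hom_one[OF hom]

lemma hom_zero: "\<psi> \<zero>\<^bsub>A\<^esub> = \<zero>\<^bsub>B\<^esub>"
  using ring_hom_zero[OF hom A.ring_axioms B.ring_axioms] .

lemma graded_module_resm:
  assumes "graded_module B M"
  shows "graded_module A (resm \<psi> M)"
proof -
  interpret M: graded_module B M by fact
  have m: "module A (resm \<psi> M)"
    by (rule moduleI[OF A.is_cring abelian_group_cong[OF M.M.abelian_group_axioms]])
      (auto simp: homD M.smult_l_distr M.smult_r_distr M.smult_assoc1)
  show ?thesis
    by (rule graded_moduleI[OF A.graded_ring_axioms m])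
      (auto simp: M.M_homog_carrier M.M_homog_closed intro: M.smult_homog hom_homog)
qed

lemma graded_linear_resm: "graded_linear B M N f \<Longrightarrow> graded_linear A (resm \<psi> M) (resm \<psi> N) f"
  by (rule graded_linearI) (auto simp: graded_linearD homD)

lemma resm_free: "resm \<psi> (free B I s) = dsum (resm \<psi> (selfm B)) I (\<lambda>n j. homog B (j - s n))"
  by (simp add: free_def dsum_def resm_def Let_def)

lemma lin_resm_free:
  fixes I :: "nat set"
  assumes "lin A q p t (resm \<psi> (selfm B))" "\<And>n. n \<in> I \<Longrightarrow> s n \<le> r"
  shows "lin A q p (r + t) (resm \<psi> (free B I s))"
  unfolding resm_free
proof (rule A.lin_dsum)
  interpret S: graded_module A "resm \<psi> (selfm B)" by (rule graded_module_resm[OF B.graded_module_selfm])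
  show "module A (resm \<psi> (selfm B))" by (rule S.module_axioms)
  fix n assume n: "n \<in> I"
  show "graded_module A ((resm \<psi> (selfm B))\<lparr>homog := \<lambda>j. homog B (j - s n)\<rparr>)"
    using S.graded_module_shift[of "- s n"] by simp
  have "lin A q p (t + s n) ((resm \<psi> (selfm B))\<lparr>homog := \<lambda>j. homog B (j - s n)\<rparr>)"
    using A.lin_shift[OF assms(1), of "- s n"] by simp
  then show "lin A q p (r + t) ((resm \<psi> (selfm B))\<lparr>homog := \<lambda>j. homog B (j - s n)\<rparr>)"
    by (rule lin_mono) (use assms(2)[OF n] in auto)
qed

text \<open>A free module over \<open>B\<close> is a direct sum of shifts of \<open>B\<close>, each
  resolved over \<open>A\<close> with constant \<open>t\<close>. Replacing every term of the
  resolution over \<open>B\<close> in this way adds the constants, and \<open>lin_quotient\<close>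
  glues the pieces: an iterated mapping cone in place of a spectral sequence.\<close>

lemma lin_resm_step:
  fixes M :: "('s, 'm) graded"
  assumes B: "lin A q p t (resm \<psi> (selfm B))" and M: "graded_module B M" "lin B q p r M"
    and IH: "\<And>p' M'. p = Suc p' \<Longrightarrow> graded_module B (M' :: ('s, nat \<Rightarrow> 's) graded) \<Longrightarrow> lin B q p' (r + q) M'
       \<Longrightarrow> lin A q p' (r + q + t) (resm \<psi> M')"
  shows "lin A q p (r + t) (resm \<psi> M)"
  using M(2)
proof (rule linE)
  fix I :: "nat set" and s e assume *: "cover B I s e M" "\<And>n. n \<in> I \<Longrightarrow> s n \<le> r"
    "\<And>p'. p = Suc p' \<Longrightarrow> lin B q p' (r + q) (kerm (free B I s) M e)"
  show ?thesis
  proof (rule A.lin_quotient[OF graded_module_resm[OF B.graded_module_free] graded_module_resm[OF M(1)]])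
    show "graded_linear A (resm \<psi> (free B I s)) (resm \<psi> M) e" by (rule graded_linear_resm[OF B.coverD(1)[OF *(1)]])
    show "homog (resm \<psi> M) j \<subseteq> e ` homog (resm \<psi> (free B I s)) j" for j using B.coverD(2)[OF *(1)] by fastforce
    show "lin A q p (r + t) (resm \<psi> (free B I s))" by (rule lin_resm_free[OF B *(2)])
    fix p' assume p: "p = Suc p'"
    show "lin A q p' (r + t + q) (kerm (resm \<psi> (free B I s)) (resm \<psi> M) e)"
      unfolding kerm_resm using IH[OF p B.graded_module_cover_kernel[OF M(1) *(1)] *(3)[OF p]] by (simp add: algebra_simps)
  qed
qed

lemma lin_resm0:
  fixes M :: "('s, nat \<Rightarrow> 's) graded"
  assumes "lin A q p t (resm \<psi> (selfm B))" "graded_module B M" "lin B q p r M"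
  shows "lin A q p (r + t) (resm \<psi> M)"
  using assms
proof (induction p arbitrary: r M)
  case 0 show ?case by (rule lin_resm_step[OF 0]) simp_all
next
  case (Suc p)
  show ?case
    by (rule lin_resm_step[OF Suc.prems]) (use Suc.IH lin_mono[OF Suc.prems(1)] in auto)
qed

lemma lin_resm:
  assumes "lin A q p t (resm \<psi> (selfm B))" "graded_module B M" "lin B q p r M"
  shows "lin A q p (r + t) (resm \<psi> M)"
  by (rule lin_resm_step[OF assms]) (use lin_resm0 lin_mono[OF assms(1)] in auto)

text \<open>The converse of \<open>lin_resm\<close> when \<open>B\<close> has constant 0 over
  \<open>A\<close>. Generators of \<open>M\<close> over \<open>A\<close> also generate it over
  \<open>B\<close>. The resulting syzygy over \<open>B\<close>, viewed over \<open>A\<close>, is the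
  kernel of a surjection between modules with known bounds, so \<open>lin_kernel\<close> applies and
  the induction continues.\<close>

lemma lin_resmD_step:
  fixes M :: "('s, 'm) graded"
  assumes q: "0 \<le> q" and B: "\<And>p. lin A q p 0 (resm \<psi> (selfm B))" and M: "graded_module B M" "lin A q p r (resm \<psi> M)"
    and IH: "\<And>p' M'. p = Suc p' \<Longrightarrow> graded_module B (M' :: ('s, nat \<Rightarrow> 's) graded) \<Longrightarrow> lin A q p' (r + q) (resm \<psi> M')
       \<Longrightarrow> lin B q p' (r + q) M'"
  shows "lin B q p r M"
  using M(2)
proof (rule linE)
  interpret M: graded_module B M by fact
  fix I :: "nat set" and s e assume *: "cover A I s e (resm \<psi> M)" "\<And>n. n \<in> I \<Longrightarrow> s n \<le> r"
    "\<And>p'. p = Suc p' \<Longrightarrow> lin A q p' (r + q) (kerm (free A I s) (resm \<psi> M) e)"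
  have gmM: "graded_module A (resm \<psi> M)" by (rule graded_module_resm[OF M(1)])
  have y: "e (unit_vec A n \<one>\<^bsub>A\<^esub>) \<in> homog M (s n)" if "n \<in> I" for n
    using graded_linearD(4)[OF A.coverD(1)[OF *(1)] A.unit_vec_homog[of "\<one>\<^bsub>A\<^esub>" "s n" s n I]] A.one_homog that by simp
  obtain e' where e': "graded_linear B (free B I s) M e'"
    "\<And>n a. n \<in> I \<Longrightarrow> a \<in> carrier B \<Longrightarrow> e' (unit_vec B n a) = a \<odot>\<^bsub>M\<^esub> e (unit_vec A n \<one>\<^bsub>A\<^esub>)"
    using B.free_lift[OF M(1), of I "\<lambda>n. e (unit_vec A n \<one>\<^bsub>A\<^esub>)" s] y by blast
  let ?t = "\<lambda>x n. \<psi> (x n)"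
  have t: "graded_linear A (free A I s) (resm \<psi> (free B I s)) ?t"
  proof (rule graded_linearI)
    show c: "?t x \<in> carrier (resm \<psi> (free B I s))" if "x \<in> carrier (free A I s)" for x
    proof -
      have "finite {n. ?t x n \<noteq> \<zero>\<^bsub>B\<^esub>}"
        by (rule finite_subset[of _ "{n. x n \<noteq> \<zero>\<^bsub>A\<^esub>}"]) (use that in \<open>auto simp: free_simps hom_zero\<close>)
      then show ?thesis using that by (simp add: free_simps homD)
    qed
    show "?t x \<in> homog (resm \<psi> (free B I s)) j" if "x \<in> homog (free A I s) j" for x j
      using c[OF A.free_homog_carrier[OF that]] that by (simp add: free_simps hom_zero hom_homog)
  qed (auto simp: free_simps homD)
  have tu: "?t (unit_vec A n a) = unit_vec B n (\<psi> a)" for n :: nat and a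
    by (auto simp: dunit_def hom_zero)
  \<comment> \<open>\<open>e\<close> factors through \<open>e'\<close> by applying
    \<open>\<psi>\<close> to the coordinates, so \<open>e'\<close> is surjective in every degree
    because \<open>e\<close> is.\<close>
  have et: "e x = e' (?t x)" if "x \<in> homog (free A I s) j" for x j
  proof (rule A.free_ext[OF gmM A.coverD(1)[OF *(1)] graded_linear_comp[OF t graded_linear_resm[OF e'(1)]] _ that])
    fix n a assume n: "n \<in> I" "a \<in> carrier A"
    show "e (unit_vec A n a) = e' (?t (unit_vec A n a))"
      unfolding tu e'(2)[OF n(1) homD(1)[OF n(2)]]
      by (subst A.unit_vec_smult[OF n(2), of _ I s], subst graded_linearD(3)[OF A.coverD(1)[OF *(1)] n(2)])
        (simp_all add: A.unit_vec_carrier)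
  qed
  have c: "cover B I s e' M"
    unfolding cover_def
  proof (intro conjI allI e'(1) subsetI)
    fix j x assume "x \<in> homog M j"
    then obtain y where y: "y \<in> homog (free A I s) j" "e y = x" using A.coverD(2)[OF *(1), of x j] by auto
    then show "x \<in> e' ` homog (free B I s) j"
      using graded_linearD(4)[OF t y(1)] et[OF y(1)] by (intro image_eqI[of _ _ "?t y"]) auto
  qed
  show ?thesis
  proof (rule linI[OF c *(2)])
    fix p' assume p: "p = Suc p'"
    show "lin B q p' (r + q) (kerm (free B I s) M e')"
    proof (rule IH[OF p B.graded_module_cover_kernel[OF M(1) c]])
      show "lin A q p' (r + q) (resm \<psi> (kerm (free B I s) M e'))"
        unfolding kerm_resm[symmetric]
      proof (rule A.lin_kernel[where r' = r])
        show "lin A q p' (r + q) (resm \<psi> (free B I s))"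
          using lin_resm_free[OF B, of I s "r + q"] *(2) q by fastforce
        show "lin A q (Suc p') r (resm \<psi> M)" using M(2) p by simp
        show "homog (resm \<psi> M) j \<subseteq> e' ` homog (resm \<psi> (free B I s)) j" for j using B.coverD(2)[OF c] by fastforce
      qed (use q in \<open>auto intro: graded_module_resm B.graded_module_free M graded_linear_resm e'\<close>)
    qed
  qed
qed

lemma lin_resmD0:
  fixes M :: "('s, nat \<Rightarrow> 's) graded"
  assumes "0 \<le> q" "\<And>p. lin A q p 0 (resm \<psi> (selfm B))" "graded_module B M" "lin A q p r (resm \<psi> M)"
  shows "lin B q p r M"
  using assms(3,4)
proof (induction p arbitrary: r M)
  case 0 show ?case by (rule lin_resmD_step[OF assms(1,2) 0]) simp_all
next
  case (Suc p)
  show ?case by (rule lin_resmD_step[OF assms(1,2) Suc.prems]) (use Suc.IH in auto)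
qed

lemma lin_resmD:
  assumes "0 \<le> q" "\<And>p. lin A q p 0 (resm \<psi> (selfm B))" "graded_module B M" "lin A q p r (resm \<psi> M)"
  shows "lin B q p r M"
  by (rule lin_resmD_step[OF assms]) (use lin_resmD0 assms(1,2) in auto)

end

subsection \<open>The irrelevant part of a module\<close>

text \<open>The degree \<open>j\<close> part of \<open>\<mm>M\<close>, where \<open>\<mm>\<close> is the irrelevant ideal of \<open>A\<close>.\<close>

inductive_set mpart :: "('a, 'r, 'z) graded_scheme \<Rightarrow> ('r, 'm) graded \<Rightarrow> int \<Rightarrow> 'm set"
  for A and M and j where
  mzero: "\<zero>\<^bsub>M\<^esub> \<in> mpart A M j"
| madd: "\<lbrakk> y \<in> mpart A M j; 0 < i; a \<in> homog A i; x \<in> homog M (j - i) \<rbrakk> \<Longrightarrow> y \<oplus>\<^bsub>M\<^esub> a \<odot>\<^bsub>M\<^esub> x \<in> mpart A M j"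

text \<open>Coefficients have degree 0 only: when \<open>homog A 0\<close> is a field this is a
  linear span, in contrast to the submodule generated by \<open>V\<close>.\<close>

inductive_set cspan :: "('a, 'r, 'z) graded_scheme \<Rightarrow> ('r, 'm) graded \<Rightarrow> 'm set \<Rightarrow> 'm set"
  for A and M and V where
  czero: "\<zero>\<^bsub>M\<^esub> \<in> cspan A M V"
| cadd: "\<lbrakk> y \<in> cspan A M V; a \<in> homog A 0; v \<in> V \<rbrakk> \<Longrightarrow> y \<oplus>\<^bsub>M\<^esub> a \<odot>\<^bsub>M\<^esub> v \<in> cspan A M V"

text \<open>Countable spanning sets over the degree 0 part in every degree, instead of a countable
  set of module generators: in this form the property is inherited by kernels when degree 0 is a
  field, hence by all syzygies.\<close>

definition countably_generated :: "('a, 'r, 'z) graded_scheme \<Rightarrow> ('r, 'm) graded \<Rightarrow> bool" where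
  "countably_generated A M \<longleftrightarrow> (\<forall>j. \<exists>V. countable V \<and> V \<subseteq> homog M j \<and> homog M j \<subseteq> cspan A M V)"

lemma cspan_mono: "V \<subseteq> W \<Longrightarrow> cspan A M V \<subseteq> cspan A M W"
proof
  show "x \<in> cspan A M W" if "V \<subseteq> W" "x \<in> cspan A M V" for x
    using that(2) by induction (use that(1) in \<open>auto intro: cspan.intros\<close>)
qed

context graded_module
begin

lemma mpart_homog: "y \<in> mpart A M j \<Longrightarrow> y \<in> homog M j"
  by (induction rule: mpart.induct) (auto intro!: M_homog_closed smult_homog')

lemma mpart_carrier: "y \<in> mpart A M j \<Longrightarrow> y \<in> carrier M"
  using mpart_homog M_homog_carrier by blast

lemma mpart_add:
  assumes "y \<in> mpart A M j" "z \<in> mpart A M j"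
  shows "y \<oplus>\<^bsub>M\<^esub> z \<in> mpart A M j"
  using assms(2)
proof induction
  case mzero then show ?case using assms(1) mpart_carrier by simp
next
  case (madd z i a x)
  have "y \<oplus>\<^bsub>M\<^esub> (z \<oplus>\<^bsub>M\<^esub> a \<odot>\<^bsub>M\<^esub> x) = (y \<oplus>\<^bsub>M\<^esub> z) \<oplus>\<^bsub>M\<^esub> a \<odot>\<^bsub>M\<^esub> x"
    using mpart_carrier[OF assms(1)] mpart_carrier[OF madd(1)] homog_carrier[OF madd(3)] M_homog_carrier[OF madd(4)]
    by (simp add: M.a_assoc)
  then show ?case using mpart.madd[OF madd(5,2-4)] by simp
qed

lemma cspan_homog: "V \<subseteq> homog M j \<Longrightarrow> x \<in> cspan A M V \<Longrightarrow> x \<in> homog M j"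
proof -
  assume V: "V \<subseteq> homog M j" and x: "x \<in> cspan A M V"
  show ?thesis using x
    by induction (use V in \<open>auto intro!: M_homog_closed smult_homog'\<close>)
qed

lemma cspan_add:
  assumes "V \<subseteq> homog M j" "y \<in> cspan A M V" "z \<in> cspan A M V"
  shows "y \<oplus>\<^bsub>M\<^esub> z \<in> cspan A M V"
  using assms(3)
proof induction
  case czero then show ?case using assms M_homog_carrier[OF cspan_homog[OF assms(1,2)]] by simp
next
  case (cadd z a v)
  have "y \<oplus>\<^bsub>M\<^esub> (z \<oplus>\<^bsub>M\<^esub> a \<odot>\<^bsub>M\<^esub> v) = (y \<oplus>\<^bsub>M\<^esub> z) \<oplus>\<^bsub>M\<^esub> a \<odot>\<^bsub>M\<^esub> v"
    using M_homog_carrier[OF cspan_homog[OF assms(1,2)]] M_homog_carrier[OF cspan_homog[OF assms(1) cadd(1)]] 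
      homog_carrier[OF cadd(2)] M_homog_carrier[of v j] cadd(3) assms(1)
    by (simp add: M.a_assoc subset_iff)
  then show ?case using cspan.cadd[OF cadd(4,2,3)] by simp
qed

lemma cspan_smult:
  assumes "V \<subseteq> homog M j" "b \<in> homog A 0" "z \<in> cspan A M V"
  shows "b \<odot>\<^bsub>M\<^esub> z \<in> cspan A M V"
  using assms(3)
proof induction
  case czero then show ?case using homog_carrier[OF assms(2)] by (simp add: cspan.czero)
next
  case (cadd z a v)
  have "b \<odot>\<^bsub>M\<^esub> (z \<oplus>\<^bsub>M\<^esub> a \<odot>\<^bsub>M\<^esub> v) = b \<odot>\<^bsub>M\<^esub> z \<oplus>\<^bsub>M\<^esub> (b \<otimes> a) \<odot>\<^bsub>M\<^esub> v"
    using M_homog_carrier[OF cspan_homog[OF assms(1) cadd(1)]] homog_carrier[OF assms(2)]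
      homog_carrier[OF cadd(2)] M_homog_carrier[of v j] cadd(3) assms(1)
    by (simp add: smult_r_distr smult_assoc1 subset_iff)
  then show ?case using cspan.cadd[OF cadd(4) _ cadd(3), of "b \<otimes> a"] mult_homog[OF assms(2) cadd(2)] by simp
qed

lemma cspan_incl: "V \<subseteq> homog M j \<Longrightarrow> v \<in> V \<Longrightarrow> v \<in> cspan A M V"
  using cspan.cadd[OF cspan.czero[of M A V] one_homog, of v] M_homog_carrier[of v j] by auto

lemma cspan_insert:
  assumes "V \<subseteq> homog M j" "v \<in> homog M j" "x \<in> cspan A M (insert v V)"
  shows "\<exists>y \<in> cspan A M V. \<exists>a \<in> homog A 0. x = y \<oplus>\<^bsub>M\<^esub> a \<odot>\<^bsub>M\<^esub> v"
  using assms(3)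
proof induction
  case czero
  then show ?case using M_homog_carrier[OF assms(2)] 
    by (intro bexI[of _ "\<zero>\<^bsub>M\<^esub>"] bexI[of _ \<zero>]) (auto intro: cspan.czero homog_zero)
next
  case (cadd x b w)
  then obtain y a where y: "y \<in> cspan A M V" "a \<in> homog A 0" "x = y \<oplus>\<^bsub>M\<^esub> a \<odot>\<^bsub>M\<^esub> v" by blast
  note c = M_homog_carrier[OF cspan_homog[OF assms(1) y(1)]] homog_carrier[OF y(2)] homog_carrier[OF cadd(2)] M_homog_carrier[OF assms(2)]
  show ?case
  proof (cases "w = v")
    case True
    have "x \<oplus>\<^bsub>M\<^esub> b \<odot>\<^bsub>M\<^esub> w = y \<oplus>\<^bsub>M\<^esub> (a \<oplus> b) \<odot>\<^bsub>M\<^esub> v"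
      using c by (simp add: True y(3) smult_l_distr M.a_assoc)
    then show ?thesis using y(1) additive_subgroup.a_closed[OF homog_subgroup y(2) cadd(2)] by blast
  next
    case False
    then have w: "w \<in> V" using cadd(3) by simp
    have "x \<oplus>\<^bsub>M\<^esub> b \<odot>\<^bsub>M\<^esub> w = (y \<oplus>\<^bsub>M\<^esub> b \<odot>\<^bsub>M\<^esub> w) \<oplus>\<^bsub>M\<^esub> a \<odot>\<^bsub>M\<^esub> v"
      using c M_homog_carrier[of w j] w assms(1) by (simp add: y(3) M.a_ac subset_iff)
    then show ?thesis using cspan.cadd[OF y(1) cadd(2) w] y(2) by blast
  qed
qed

lemma mpart_image:
  assumes "graded_module A N" "graded_linear A M N f" "y \<in> mpart A M j"
  shows "f y \<in> mpart A N j"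
  using assms(3)
proof induction
  case mzero
  then show ?case using graded_linear_zero_neg(1)[OF graded_module_axioms assms(1,2)] mpart.mzero[of N A j] by simp
next
  case (madd y i a x)
  have "f (y \<oplus>\<^bsub>M\<^esub> a \<odot>\<^bsub>M\<^esub> x) = f y \<oplus>\<^bsub>N\<^esub> a \<odot>\<^bsub>N\<^esub> f x"
    using mpart_carrier[OF madd(1)] homog_carrier[OF madd(3)] M_homog_carrier[OF madd(4)]
    by (simp add: graded_linearD[OF assms(2)])
  then show ?case using mpart.madd[OF madd(5,2,3) graded_linearD(4)[OF assms(2) madd(4)]] by simp
qed

lemma mpart_lift:
  assumes "graded_module A N" "graded_linear A M N f" "\<And>j. homog N j \<subseteq> f ` homog M j" "y \<in> mpart A N j"
  shows "\<exists>x \<in> mpart A M j. f x = y"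
  using assms(4)
proof induction
  case mzero
  then show ?case using graded_linear_zero_neg(1)[OF graded_module_axioms assms(1,2)] mpart.mzero[of M A j] by blast
next
  case (madd y i a x)
  then obtain y' x' where *: "y' \<in> mpart A M j" "f y' = y" "x' \<in> homog M (j - i)" "f x' = x" using assms(3) by blast
  have "f (y' \<oplus>\<^bsub>M\<^esub> a \<odot>\<^bsub>M\<^esub> x') = y \<oplus>\<^bsub>N\<^esub> a \<odot>\<^bsub>N\<^esub> x"
    using mpart_carrier[OF *(1)] homog_carrier[OF madd(3)] M_homog_carrier[OF *(3)] *(2,4)
    by (simp add: graded_linearD[OF assms(2)])
  then show ?case using mpart.madd[OF *(1) madd(2,3) *(3)] by blast
qed

end

context graded_ring
begin

text \<open>A nonzero coordinate at \<open>n\<close> has degree \<open>j - s n > 0\<close>, so it is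
  itself a coefficient of positive degree in front of a unit vector.\<close>

lemma mpart_free:
  assumes x: "x \<in> homog (free A I s) j" and deg: "\<And>n. n \<in> I \<Longrightarrow> x n \<noteq> \<zero> \<Longrightarrow> s n < j"
  shows "x \<in> mpart A (free A I s) j"
proof -
  let ?I = "{n \<in> I. s n < j}"
  have "x \<in> homog (free A ?I s) j" using x deg by (auto simp: free_simps)
  then show ?thesis
  proof (induction rule: free_homog_induct)
    case zero
    show ?case using mpart.mzero[of "free A I s" A j] by (simp add: free_simps)
  next
    case (add x n a)
    have "x \<oplus>\<^bsub>free A I s\<^esub> a \<odot>\<^bsub>free A I s\<^esub> unit_vec A n \<one> \<in> mpart A (free A I s) j"
      using add(2) by (intro mpart.madd[OF add(4) _ add(3)] unit_vec_homog) (auto simp: one_homog)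
    then show ?case using unit_vec_smult[OF homog_carrier[OF add(3)], of n I s] by (simp add: free_simps)
  qed
qed

lemma mpart_free_bounded:
  "x \<in> homog (free A I s) j \<Longrightarrow> (\<And>n. n \<in> I \<Longrightarrow> s n < j) \<Longrightarrow> x \<in> mpart A (free A I s) j"
  by (rule mpart_free)

lemma mpart_cover_bounded:
  assumes "graded_module A M" "cover A I s e M" "\<And>n. n \<in> I \<Longrightarrow> s n < j" "x \<in> homog M j"
  shows "x \<in> mpart A M j"
proof -
  obtain y where y: "y \<in> homog (free A I s) j" "e y = x" using coverD(2)[OF assms(2,4)] by blast
  show ?thesis
    using graded_module.mpart_image[OF graded_module_free assms(1) coverD(1)[OF assms(2)] mpart_free_bounded[OF y(1) assms(3)]] y(2)
    by simp
qed

section \<open>Covers with generators in prescribed degrees\<close>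

lemma gens_map:
  assumes M: "graded_module A M" and S: "countable S" "\<And>j v. (j, v) \<in> S \<Longrightarrow> v \<in> homog M j"
  obtains I :: "nat set" and s e where "graded_linear A (free A I s) M e"
    "\<And>n. n \<in> I \<Longrightarrow> \<exists>v. (s n, v) \<in> S" "\<And>j v. (j, v) \<in> S \<Longrightarrow> v \<in> e ` homog (free A I s) j"
proof -
  interpret M: graded_module A M by fact
  let ?I = "to_nat_on S ` S" let ?s = "\<lambda>n. fst (from_nat_into S n)" let ?y = "\<lambda>n. snd (from_nat_into S n)"
  have mem: "(?s n, ?y n) \<in> S" if "n \<in> ?I" for n using that S(1) by auto
  obtain e where e: "graded_linear A (free A ?I ?s) M e"
    "\<And>n a. n \<in> ?I \<Longrightarrow> a \<in> carrier A \<Longrightarrow> e (unit_vec A n a) = a \<odot>\<^bsub>M\<^esub> ?y n"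
    using free_lift[OF M, of ?I ?y ?s] S(2)[OF mem] by blast
  show ?thesis
  proof (rule that[OF e(1)])
    show "\<exists>v. (?s n, v) \<in> S" if "n \<in> ?I" for n using mem[OF that] by blast
    fix j v assume v: "(j, v) \<in> S"
    let ?n = "to_nat_on S (j, v)"
    have n: "?n \<in> ?I" "?s ?n = j" "?y ?n = v" using v S(1) by auto
    have "unit_vec A ?n \<one> \<in> homog (free A ?I ?s) j" using n one_homog by (intro unit_vec_homog) auto
    moreover have "e (unit_vec A ?n \<one>) = v" using e(2)[OF n(1) one_closed] n(3) M.M_homog_carrier[OF S(2)[OF v]] by simp
    ultimately show "v \<in> e ` homog (free A ?I ?s) j" by (metis imageI)
  qed
qed

lemma image_cspan:
  assumes "graded_module A M" "graded_module A F" "graded_linear A F M e" "V \<subseteq> e ` homog F j"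
  shows "cspan A M V \<subseteq> e ` homog F j"
proof
  interpret M: graded_module A M by fact
  interpret F: graded_module A F by fact
  note eD = graded_linearD[OF assms(3)] graded_linear_zero_neg[OF assms(2,1,3)]
  fix x assume "x \<in> cspan A M V"
  then show "x \<in> e ` homog F j"
  proof induction
    case czero then show ?case using eD(5)[symmetric] F.M_homog_zero[of j] by (rule image_eqI)
  next
    case (cadd y a v)
    obtain y' v' where *: "y' \<in> homog F j" "e y' = y" "v' \<in> homog F j" "e v' = v" using cadd(3,4) assms(4) by blast
    have "a \<odot>\<^bsub>F\<^esub> v' \<in> homog F j" using F.smult_homog'[OF cadd(2) *(3)] by simp
    moreover from this have "e (y' \<oplus>\<^bsub>F\<^esub> a \<odot>\<^bsub>F\<^esub> v') = y \<oplus>\<^bsub>M\<^esub> a \<odot>\<^bsub>M\<^esub> v"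
      using * F.M_homog_carrier homog_carrier[OF cadd(2)] by (simp add: eD)
    ultimately show ?case using F.M_homog_add[OF *(1)] by (intro image_eqI[of _ e "y' \<oplus>\<^bsub>F\<^esub> a \<odot>\<^bsub>F\<^esub> v'"]) simp_all
  qed
qed

lemma image_mpart:
  assumes "graded_module A M" "graded_module A F" "graded_linear A F M e" "\<And>i. i < j \<Longrightarrow> homog M i \<subseteq> e ` homog F i"
  shows "mpart A M j \<subseteq> e ` homog F j"
proof
  interpret M: graded_module A M by fact
  interpret F: graded_module A F by fact
  note eD = graded_linearD[OF assms(3)] graded_linear_zero_neg[OF assms(2,1,3)]
  fix x assume "x \<in> mpart A M j"
  then show "x \<in> e ` homog F j"
  proof induction
    case mzero then show ?case using eD(5)[symmetric] F.M_homog_zero[of j] by (rule image_eqI)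
  next
    case (madd y i a v)
    obtain y' v' where *: "y' \<in> homog F j" "e y' = y" "v' \<in> homog F (j - i)" "e v' = v" 
      using madd(2,4,5) assms(4)[of "j - i"] by auto
    have "a \<odot>\<^bsub>F\<^esub> v' \<in> homog F j" using F.smult_homog'[OF madd(3) *(3)] by simp
    moreover from this have "e (y' \<oplus>\<^bsub>F\<^esub> a \<odot>\<^bsub>F\<^esub> v') = y \<oplus>\<^bsub>M\<^esub> a \<odot>\<^bsub>M\<^esub> v"
      using *(2,4) F.M_homog_carrier[OF *(1)] F.M_homog_carrier[OF *(3)] F.M_homog_carrier homog_carrier[OF madd(3)] by (simp add: eD)
    ultimately show ?case using F.M_homog_add[OF *(1)] by (intro image_eqI[of _ e "y' \<oplus>\<^bsub>F\<^esub> a \<odot>\<^bsub>F\<^esub> v'"]) simp_all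
  qed
qed

text \<open>For \<open>T = {..r}\<close> this is the graded Nakayama lemma: elements of
  \<open>mpart A M j\<close> only involve components of smaller degree, so induction on
  \<open>j - r\<close> leads back to degrees at most \<open>r\<close>. The descent stops there
  because spanning sets of all these degrees are among the generators.\<close>

lemma cover_exists:
  assumes M: "graded_module A M" "countably_generated A M"
    and T: "T = UNIV \<or> (\<exists>r. T = {..r} \<and> (\<forall>j>r. homog M j \<subseteq> mpart A M j))"
  obtains I :: "nat set" and s e where "cover A I s e M" "\<And>n. n \<in> I \<Longrightarrow> s n \<in> T"
proof -
  have "\<forall>j. \<exists>V. countable V \<and> V \<subseteq> homog M j \<and> homog M j \<subseteq> cspan A M V"
    using M(2) unfolding countably_generated_def .
  from choice[OF this] obtain V where "\<forall>j. countable (V j) \<and> V j \<subseteq> homog M j \<and> homog M j \<subseteq> cspan A M (V j)"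
    by (rule exE)
  then have V: "\<And>j. countable (V j)" "\<And>j. V j \<subseteq> homog M j" "\<And>j. homog M j \<subseteq> cspan A M (V j)" by simp_all
  let ?S = "Sigma T V"
  have S: "countable ?S" "\<And>j v. (j, v) \<in> ?S \<Longrightarrow> v \<in> homog M j" using V(1,2) by auto
  obtain I :: "nat set" and s e where e: "graded_linear A (free A I s) M e"
    "\<And>n. n \<in> I \<Longrightarrow> \<exists>v. (s n, v) \<in> ?S" "\<And>j v. (j, v) \<in> ?S \<Longrightarrow> v \<in> e ` homog (free A I s) j"
    using gens_map[OF M(1) S] by blast
  have T1: "homog M j \<subseteq> e ` homog (free A I s) j" if "j \<in> T" for j
    using image_cspan[OF M(1) graded_module_free e(1), of "V j" j] e(3)[of j] V(3)[of j] that by blast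
  have "homog M j \<subseteq> e ` homog (free A I s) j" for j
    using T
  proof
    assume "T = UNIV" then show ?thesis using T1 by blast
  next
    assume "\<exists>r. T = {..r} \<and> (\<forall>j>r. homog M j \<subseteq> mpart A M j)"
    then obtain r where r: "T = {..r}" "\<And>j. j > r \<Longrightarrow> homog M j \<subseteq> mpart A M j" by blast
    show ?thesis
    proof (induction "nat (j - r)" arbitrary: j rule: less_induct)
      case less
      show ?case
      proof (cases "j \<le> r")
        case True then show ?thesis using T1 r(1) by simp
      next
        case False
        have "mpart A M j \<subseteq> e ` homog (free A I s) j"
        proof (rule image_mpart[OF M(1) graded_module_free e(1)])
          fix i assume "i < j"
          then have "nat (i - r) < nat (j - r)" using False by auto
          then show "homog M i \<subseteq> e ` homog (free A I s) i" by (rule less.hyps)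
        qed
        then show ?thesis using r(2)[of j] False by auto
      qed
    qed
  qed
  then have "cover A I s e M" unfolding cover_def using e(1) by blast
  moreover have "s n \<in> T" if "n \<in> I" for n using e(2)[OF that] by blast
  ultimately show ?thesis using that by blast
qed

section \<open>Countable generation of free modules and of kernels\<close>

lemma countably_generated_free:
  assumes "countably_generated A (selfm A)"
  shows "countably_generated A (free A (I :: nat set) s)"
  unfolding countably_generated_def
proof
  fix j
  interpret F: graded_module A "free A I s" by (rule graded_module_free)
  have "\<forall>j. \<exists>V. countable V \<and> V \<subseteq> homog A j \<and> homog A j \<subseteq> cspan A (selfm A) V"
    using assms unfolding countably_generated_def selfm_simps .
  from choice[OF this] obtain V where "\<forall>j. countable (V j) \<and> V j \<subseteq> homog A j \<and> homog A j \<subseteq> cspan A (selfm A) (V j)"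
    by (rule exE)
  then have V: "\<And>j. countable (V j)" "\<And>j. V j \<subseteq> homog A j" "\<And>j. homog A j \<subseteq> cspan A (selfm A) (V j)" by simp_all
  let ?W = "\<Union>n\<in>I. unit_vec A n ` V (j - s n)"
  have W: "?W \<subseteq> homog (free A I s) j" using V(2) unit_vec_homog[of _ j s] by blast
  have u: "unit_vec A n a \<in> cspan A (free A I s) ?W" if n: "n \<in> I" and a: "a \<in> cspan A (selfm A) (V (j - s n))" for n a
    using a
  proof induction
    case czero
    have "unit_vec A n \<zero>\<^bsub>selfm A\<^esub> = \<zero>\<^bsub>free A I s\<^esub>" by (auto simp: dunit_def free_simps)
    then show ?case using cspan.czero[of "free A I s" A ?W] by simp
  next
    case (cadd y a v)
    have "unit_vec A n y \<oplus>\<^bsub>free A I s\<^esub> a \<odot>\<^bsub>free A I s\<^esub> unit_vec A n v \<in> cspan A (free A I s) ?W"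
      using cadd n by (intro cspan.cadd) auto
    moreover have "unit_vec A n y \<oplus>\<^bsub>free A I s\<^esub> a \<odot>\<^bsub>free A I s\<^esub> unit_vec A n v = unit_vec A n (y \<oplus>\<^bsub>selfm A\<^esub> a \<odot>\<^bsub>selfm A\<^esub> v)"
      using homog_carrier[OF cadd(2)] by (auto simp: free_simps dunit_def)
    ultimately show ?case by simp
  qed
  have "homog (free A I s) j \<subseteq> cspan A (free A I s) ?W"
  proof
    fix x assume "x \<in> homog (free A I s) j"
    then show "x \<in> cspan A (free A I s) ?W"
    proof (induction rule: free_homog_induct)
      case zero
      show ?case using cspan.czero[of "free A I s" A ?W] by (simp add: free_simps)
    next
      case (add x n a)
      then show ?case using u[OF add(2)] V(3) F.cspan_add[OF W add(4)] by blast
    qed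
  qed
  moreover have "countable ?W" using V(1) by auto
  ultimately show "\<exists>V. countable V \<and> V \<subseteq> homog (free A I s) j \<and> homog (free A I s) j \<subseteq> cspan A (free A I s) V"
    using W by blast
qed

lemma cspan_kerm: "cspan A (kerm M N f) V = cspan A M V"
proof (intro equalityI subsetI)
  show "x \<in> cspan A M V" if "x \<in> cspan A (kerm M N f) V" for x
    using that by induction (auto intro: cspan.intros)
  show "x \<in> cspan A (kerm M N f) V" if "x \<in> cspan A M V" for x
    using that
  proof induction
    case czero show ?case using cspan.czero[of "kerm M N f" A V] by simp
  next
    case (cadd y a v) then show ?case using cspan.cadd[of y A "kerm M N f" V a v] by simp
  qed
qed

text \<open>A subspace of a space spanned by \<open>v\<^sub>0, v\<^sub>1, \<dots>\<close> is spanned by one element from each nonempty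
  intersection of it with a coset \<open>v\<^sub>n + span {v\<^sub>0, \<dots>, v\<^bsub>n-1\<^esub>}\<close>.\<close>

lemma countably_generated_kerm:
  assumes units: "\<forall>a \<in> homog A 0. a \<noteq> \<zero> \<longrightarrow> (\<exists>b \<in> homog A 0. b \<otimes> a = \<one>)"
    and M: "graded_module A M" "graded_module A N" "graded_linear A M N f" and cg: "countably_generated A M"
  shows "countably_generated A (kerm M N f)"
  unfolding countably_generated_def
proof
  fix j
  interpret M: graded_module A M by fact
  interpret L: graded_module A "kerm M N f" by (rule graded_module_kerm[OF M])
  let ?W = "homog (kerm M N f) j"
  have WM: "?W \<subseteq> homog M j" by auto
  obtain V where V: "countable V" "V \<subseteq> homog M j" "homog M j \<subseteq> cspan A M V"
    using cg unfolding countably_generated_def by blast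
  \<comment> \<open>Adding zero makes the set nonempty, so that its enumeration has no stray
    values.\<close>
  define v where "v = from_nat_into (insert \<zero>\<^bsub>M\<^esub> V)"
  have "range v = insert \<zero>\<^bsub>M\<^esub> V" unfolding v_def using V(1) by (intro range_from_nat_into) auto
  then have v: "V \<subseteq> range v" "range v \<subseteq> insert \<zero>\<^bsub>M\<^esub> V" by blast+
  have vM: "v n \<in> homog M j" for n
  proof -
    have "v n \<in> insert \<zero>\<^bsub>M\<^esub> V" using v(2) by (rule subsetD) simp
    then show ?thesis using V(2) M.M_homog_zero[of j] by auto
  qed
  define S where "S n = cspan A M (v ` {..<n})" for n :: nat
  have vS: "v ` T \<subseteq> homog M j" for T using vM by blast
  have S_homog: "x \<in> S n \<Longrightarrow> x \<in> homog M j" for x n unfolding S_def by (rule M.cspan_homog[OF vS])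
  have S_mono: "S m \<subseteq> S n" if "m \<le> n" for m n unfolding S_def using that by (intro cspan_mono) auto
  have MS: "\<exists>n. x \<in> S n" if "x \<in> homog M j" for x
  proof -
    have "x \<in> cspan A M V" using that V(3) by blast
    then show ?thesis
    proof induction
      case czero then show ?case unfolding S_def using cspan.czero by blast
    next
      case (cadd y a w)
      then obtain n k where n: "y \<in> S n" "w = v k" using v(1) by blast
      have "y \<in> S (max n (Suc k))" using n(1) S_mono[of n "max n (Suc k)"] by auto
      then have "y \<oplus>\<^bsub>M\<^esub> a \<odot>\<^bsub>M\<^esub> w \<in> S (max n (Suc k))"
        unfolding S_def using cadd(2) n(2) by (intro cspan.cadd) auto
      then show ?case by blast
    qed
  qed
  \<comment> \<open>The chosen element of the subspace in the coset of \<open>v n\<close> modulo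
    \<open>S n\<close>, or zero when there is none. The range of \<open>w\<close> is the countable
    spanning set.\<close>
  define w where "w n = (if \<exists>x\<in>?W. x \<ominus>\<^bsub>M\<^esub> v n \<in> S n then SOME x. x \<in> ?W \<and> x \<ominus>\<^bsub>M\<^esub> v n \<in> S n else \<zero>\<^bsub>M\<^esub>)" for n
  have w: "w n \<in> ?W \<and> w n \<ominus>\<^bsub>M\<^esub> v n \<in> S n" if "\<exists>x\<in>?W. x \<ominus>\<^bsub>M\<^esub> v n \<in> S n" for n
    using someI_ex[of "\<lambda>x. x \<in> ?W \<and> x \<ominus>\<^bsub>M\<^esub> v n \<in> S n"] that by (auto simp: w_def)
  have wW: "w n \<in> ?W" for n
    using w[of n] L.M_homog_zero[of j] by (cases "\<exists>x\<in>?W. x \<ominus>\<^bsub>M\<^esub> v n \<in> S n") (auto simp: w_def)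
  have "x \<in> cspan A M (range w)" if "x \<in> ?W" "x \<in> S n" for x n
    using that
  proof (induction n arbitrary: x)
    case 0
    have "x = \<zero>\<^bsub>M\<^esub>" using 0(2) unfolding S_def by (cases rule: cspan.cases) auto
    then show ?case by (simp add: cspan.czero)
  next
    case (Suc n)
    have "x \<in> cspan A M (insert (v n) (v ` {..<n}))" using Suc.prems(2) unfolding S_def by (simp add: lessThan_Suc)
    from M.cspan_insert[OF vS vM this] obtain y a where y: "y \<in> S n" "a \<in> homog A 0" "x = y \<oplus>\<^bsub>M\<^esub> a \<odot>\<^bsub>M\<^esub> v n"
      unfolding S_def by blast
    note c = M.M_homog_carrier[OF S_homog[OF y(1)]] homog_carrier[OF y(2)] M.M_homog_carrier[OF vM[of n]]
    show ?case
    proof (cases "a = \<zero>")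
      case True
      then have "x = y" using y(3) c by simp
      then show ?thesis using Suc.IH Suc.prems(1) y(1) by simp
    next
      case False
      then obtain b where b: "b \<in> homog A 0" "b \<otimes> a = \<one>" using units y(2) by blast
      \<comment> \<open>Scaling \<open>x\<close> by the inverse of \<open>a\<close> gives an element
        of the subspace in the coset of \<open>v n\<close>, so a nontrivial choice of
        \<open>w n\<close> was possible. Subtracting \<open>a\<close> times \<open>w n\<close> from
        \<open>x\<close> leads into \<open>S n\<close>, where the induction hypothesis
        applies.\<close>
      have "b \<odot>\<^bsub>M\<^esub> x = b \<odot>\<^bsub>M\<^esub> y \<oplus>\<^bsub>M\<^esub> v n"
        using c homog_carrier[OF b(1)] M.smult_assoc1[of b a "v n"] b(2) by (simp add: y(3) M.smult_r_distr)
      then have "b \<odot>\<^bsub>M\<^esub> x \<ominus>\<^bsub>M\<^esub> v n = b \<odot>\<^bsub>M\<^esub> y"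
        using c homog_carrier[OF b(1)] by (simp add: a_minus_def M.M.a_assoc M.M.r_neg)
      moreover have "b \<odot>\<^bsub>M\<^esub> y \<in> S n" unfolding S_def by (rule M.cspan_smult[OF vS b(1) y(1)[unfolded S_def]])
      moreover have "b \<odot>\<^bsub>M\<^esub> x \<in> ?W" using L.smult_homog'[OF b(1) Suc.prems(1), of j] by simp
      ultimately have wn: "w n \<in> ?W" "w n \<ominus>\<^bsub>M\<^esub> v n \<in> S n" using w[of n] by metis+
      let ?s = "w n \<ominus>\<^bsub>M\<^esub> v n" let ?z = "y \<oplus>\<^bsub>M\<^esub> (\<ominus> a) \<odot>\<^bsub>M\<^esub> ?s"
      have ma: "\<ominus> a \<in> homog A 0" using additive_subgroup.a_inv_closed[OF homog_subgroup y(2)] .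
      have cw: "w n \<in> carrier M" using wn(1) WM M.M_homog_carrier by blast
      have cs: "?s \<in> carrier M" using cw c(3) by simp
      have z: "?z \<in> S n"
        unfolding S_def by (intro M.cspan_add[OF vS] M.cspan_smult[OF vS] y(1)[unfolded S_def] ma wn(2)[unfolded S_def])
      have wv: "w n = ?s \<oplus>\<^bsub>M\<^esub> v n" using cw c(3) by (simp add: a_minus_def M.M.a_assoc M.M.l_neg)
      have xz: "x = ?z \<oplus>\<^bsub>M\<^esub> a \<odot>\<^bsub>M\<^esub> w n"
      proof -
        have "?z \<oplus>\<^bsub>M\<^esub> a \<odot>\<^bsub>M\<^esub> w n = y \<oplus>\<^bsub>M\<^esub> (\<ominus>\<^bsub>M\<^esub> (a \<odot>\<^bsub>M\<^esub> ?s) \<oplus>\<^bsub>M\<^esub> (a \<odot>\<^bsub>M\<^esub> ?s \<oplus>\<^bsub>M\<^esub> a \<odot>\<^bsub>M\<^esub> v n))"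
          using c cs by (subst (2) wv) (simp add: M.smult_l_minus M.smult_r_distr M.M.a_assoc)
        also have "\<dots> = x" using c cs by (simp add: y(3) M.M.a_assoc[symmetric] M.M.l_neg)
        finally show ?thesis by simp
      qed
      have "x \<ominus>\<^bsub>M\<^esub> a \<odot>\<^bsub>M\<^esub> w n = ?z"
        using M.M_homog_carrier[OF S_homog[OF z]] c(2) cw by (subst xz) (simp add: a_minus_def M.M.a_assoc M.M.r_neg)
      then have "?z = x \<ominus>\<^bsub>M\<^esub> a \<odot>\<^bsub>M\<^esub> w n" by simp
      also have "\<dots> \<in> ?W" using L.M_homog_diff[OF Suc.prems(1) L.smult_homog'[OF y(2) wn(1)]] by simp
      finally have "?z \<in> cspan A M (range w)" using z Suc.IH by blast
      then have "?z \<oplus>\<^bsub>M\<^esub> a \<odot>\<^bsub>M\<^esub> w n \<in> cspan A M (range w)" by (intro cspan.cadd[OF _ y(2)]) simp_all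
      then show ?thesis using xz by simp
    qed
  qed
  then have "?W \<subseteq> cspan A (kerm M N f) (range w)" unfolding cspan_kerm using MS WM by blast
  moreover have "countable (range w)" by simp
  moreover have "range w \<subseteq> ?W" using wW by blast
  ultimately show "\<exists>V. countable V \<and> V \<subseteq> ?W \<and> ?W \<subseteq> cspan A (kerm M N f) V" by blast
qed

subsection \<open>Comparison of resolutions\<close>

text \<open>The counterpart of \<open>graded_free_resolution\<close> for \<open>free\<close>, with
  exactness stated in each degree. The comparison of resolutions works with this form;
  \<open>resolution_imp_resolves\<close> and \<open>resolves_imp_resolution\<close>
  translate.\<close>

definition resolves :: "('r, 'm) graded \<Rightarrow> (nat \<Rightarrow> nat set) \<Rightarrow> (nat \<Rightarrow> nat \<Rightarrow> int) \<Rightarrow> ((nat \<Rightarrow> 'r) \<Rightarrow> 'm)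
    \<Rightarrow> (nat \<Rightarrow> (nat \<Rightarrow> 'r) \<Rightarrow> (nat \<Rightarrow> 'r)) \<Rightarrow> bool" where
  "resolves M B s e d \<longleftrightarrow> cover A (B 0) (s 0) e M \<and>
     (\<forall>i. graded_linear A (free A (B (Suc i)) (s (Suc i))) (free A (B i) (s i)) (d i)) \<and>
     (\<forall>j. d 0 ` homog (free A (B 1) (s 1)) j = {x \<in> homog (free A (B 0) (s 0)) j. e x = \<zero>\<^bsub>M\<^esub>}) \<and>
     (\<forall>i j. d (Suc i) ` homog (free A (B (Suc (Suc i))) (s (Suc (Suc i)))) j =
        {x \<in> homog (free A (B (Suc i)) (s (Suc i))) j. d i x = \<zero>\<^bsub>free A (B i) (s i)\<^esub>})"

text \<open>Dimension shift: without its zeroth term the complex resolves the first syzygy. The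
  inductions that compare resolutions run along this.\<close>

lemma resolves_shift:
  assumes "resolves M B s e d"
  shows "resolves (kerm (free A (B 0) (s 0)) M e) (\<lambda>i. B (Suc i)) (\<lambda>i. s (Suc i)) (d 0) (\<lambda>i. d (Suc i))"
proof -
  have "graded_linear A (free A (B 1) (s 1)) (kerm (free A (B 0) (s 0)) M e) (d 0)"
    unfolding kerm_def
    using assms graded_linear_regrade_dom[of A "free A (B 1) (s 1)" "free A (B 0) (s 0)" "d 0"
        "homog (free A (B 1) (s 1))" "\<lambda>j. {x \<in> homog (free A (B 0) (s 0)) j. e x = \<zero>\<^bsub>M\<^esub>}"]
    unfolding resolves_def regrade_id by fastforce
  moreover have "\<And>j. d 0 ` homog (free A (B 1) (s 1)) j = {x \<in> homog (free A (B 0) (s 0)) j. e x = \<zero>\<^bsub>M\<^esub>}"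
    using assms unfolding resolves_def by blast
  ultimately show ?thesis
    using assms unfolding resolves_def cover_def by simp
qed

text \<open>Expresses that \<open>x\<close> becomes a boundary after tensoring with the residue
  field: it is a genuine boundary up to an element \<open>w\<close> with coefficients of positive
  degree.\<close>

definition cycles_bound :: "(nat \<Rightarrow> nat set) \<Rightarrow> (nat \<Rightarrow> nat \<Rightarrow> int) \<Rightarrow> (nat \<Rightarrow> (nat \<Rightarrow> 'r) \<Rightarrow> (nat \<Rightarrow> 'r))
    \<Rightarrow> nat \<Rightarrow> int \<Rightarrow> (nat \<Rightarrow> 'r) \<Rightarrow> bool" where
  "cycles_bound B s d i j x \<longleftrightarrow> (\<exists>y \<in> homog (free A (B (Suc i)) (s (Suc i))) j. \<exists>w \<in> mpart A (free A (B i) (s i)) j.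
     x = d i y \<oplus>\<^bsub>free A (B i) (s i)\<^esub> w)"

text \<open>
  If two modules are homotopy equivalent up to maps factoring through free modules, then so are
  their syzygies, now with the homotopy factoring through the free covers themselves.
\<close>

lemma homotopy_step:
  assumes M: "graded_module A M" "graded_module A Z"
    and cov: "cover A I s e M" "cover A I' s' \<pi> Z"
    and u: "graded_linear A M Z u" "graded_linear A Z M v"
    and st: "graded_linear A M (free A J g) h" "graded_linear A (free A J g) M t"
    and htpy: "\<forall>j. \<forall>x \<in> homog M j. x = v (u x) \<oplus>\<^bsub>M\<^esub> t (h x)"
    and al: "graded_linear A (free A I s) (free A I' s') \<alpha>" "\<forall>j. \<forall>x \<in> homog (free A I s) j. \<pi> (\<alpha> x) = u (e x)"
    and be: "graded_linear A (free A I' s') (free A I s) \<beta>" "\<forall>j. \<forall>x \<in> homog (free A I' s') j. e (\<beta> x) = v (\<pi> x)"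
  obtains t' where "graded_linear A (free A I s) (kerm (free A I s) M e) t'"
    "\<forall>j. \<forall>x \<in> homog (kerm (free A I s) M e) j. x = \<beta> (\<alpha> x) \<oplus>\<^bsub>kerm (free A I s) M e\<^esub> t' x"
    "graded_linear A (kerm (free A I s) M e) (kerm (free A I' s') Z \<pi>) \<alpha>"
proof -
  interpret M: graded_module A M by fact
  interpret F: graded_module A "free A I s" by (rule graded_module_free)
  let ?F = "free A I s" let ?N = "kerm ?F M e"
  note e = coverD(1)[OF cov(1)]
  note eD = graded_linearD[OF e] graded_linear_zero_neg[OF graded_module_free M(1) e]
  note uD = graded_linearD[OF u(1)] graded_linear_zero_neg[OF M u(1)]
  note hD = graded_linearD[OF st(1)] graded_linear_zero_neg[OF M(1) graded_module_free st(1)]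
  have surj: "\<And>j. homog M j \<subseteq> e ` homog ?F j" using coverD(2)[OF cov(1)] by blast
  obtain \<tau> where tau: "graded_linear A (free A J g) ?F \<tau>" "\<And>j x. x \<in> homog (free A J g) j \<Longrightarrow> e (\<tau> x) = t x"
    using cover_lift[OF graded_module_free M(1) e surj st(2)] by blast
  \<comment> \<open>\<open>?t\<close> maps into the kernel of \<open>e\<close> because
    \<open>e x\<close> is the sum of \<open>v (u (e x))\<close> and \<open>t (h (e x))\<close>. On
    the kernel \<open>e x\<close> is zero, so the last term of \<open>?t\<close> drops out and the
    identity is \<open>\<beta>\<close> after \<open>\<alpha>\<close> plus \<open>?t\<close>. The new
    homotopy is thus the inclusion into the free cover followed by \<open>?t\<close>.\<close>
  let ?t = "\<lambda>x. (x \<ominus>\<^bsub>?F\<^esub> \<beta> (\<alpha> x)) \<ominus>\<^bsub>?F\<^esub> \<tau> (h (e x))"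
  have ba: "graded_linear A ?F ?F (\<lambda>x. \<beta> (\<alpha> x))" by (rule graded_linear_comp[OF al(1) be(1)])
  have th: "graded_linear A ?F ?F (\<lambda>x. \<tau> (h (e x)))"
    by (rule graded_linear_comp[OF graded_linear_comp[OF e st(1)] tau(1)])
  have t: "graded_linear A ?F ?F ?t"
    by (intro graded_linear_diff graded_module_free graded_linear_id ba th)
  note baD = graded_linearD[OF ba] and thD = graded_linearD[OF th]
  have et: "e (?t x) = \<zero>\<^bsub>M\<^esub>" if x: "x \<in> homog ?F j" for x j
  proof -
    have c: "x \<in> carrier ?F" "\<beta> (\<alpha> x) \<in> carrier ?F" "\<tau> (h (e x)) \<in> carrier ?F"
      using free_homog_carrier[OF x] baD(1) thD(1) by auto
    have 1: "e (\<beta> (\<alpha> x)) = v (u (e x))" using be(2)[rule_format, OF graded_linearD(4)[OF al(1) x]] al(2)[rule_format, OF x] by simp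
    have 2: "e (\<tau> (h (e x))) = t (h (e x))" using tau(2) hD(4) eD(4)[OF x] by blast
    have ex: "e x = v (u (e x)) \<oplus>\<^bsub>M\<^esub> t (h (e x))" by (rule htpy[rule_format, OF eD(4)[OF x]])
    have cc: "v (u (e x)) \<in> carrier M" "t (h (e x)) \<in> carrier M" using 1 2 c eD(1) by metis+
    have "e (?t x) = (e x \<ominus>\<^bsub>M\<^esub> v (u (e x))) \<ominus>\<^bsub>M\<^esub> t (h (e x))"
      using eD(7)[of "x \<ominus>\<^bsub>?F\<^esub> \<beta> (\<alpha> x)" "\<tau> (h (e x))"] eD(7)[of x "\<beta> (\<alpha> x)"] c 1 2 F.M.minus_closed by metis
    also have "\<dots> = \<zero>\<^bsub>M\<^esub>"
      using cc by (subst ex) (simp add: a_minus_def M.M.a_ac M.M.r_neg M.M.l_neg M.M.r_neg1 M.M.r_neg2)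
    finally show ?thesis .
  qed
  have "graded_linear A ?F ?N ?t"
    using graded_linear_regrade_dom[OF t, of "homog ?F" "\<lambda>j. {x \<in> homog ?F j. e x = \<zero>\<^bsub>M\<^esub>}"] et graded_linearD(4)[OF t]
    by (simp add: kerm_def)
  moreover have "x = \<beta> (\<alpha> x) \<oplus>\<^bsub>?N\<^esub> ?t x" if "x \<in> homog ?N j" for x j
  proof -
    have x: "x \<in> homog ?F j" "e x = \<zero>\<^bsub>M\<^esub>" using that by auto
    have c: "x \<in> carrier ?F" "\<beta> (\<alpha> x) \<in> carrier ?F" using free_homog_carrier[OF x(1)] baD(1) by auto
    have z: "\<tau> (h (e x)) = \<zero>\<^bsub>?F\<^esub>"
      using x(2) hD(5) graded_linear_zero_neg(1)[OF graded_module_free graded_module_free tau(1)] by simp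
    have z': "\<ominus>\<^bsub>?F\<^esub> \<zero>\<^bsub>?F\<^esub> = \<zero>\<^bsub>?F\<^esub>" by (rule F.M.minus_equality) simp_all
    have "\<beta> (\<alpha> x) \<oplus>\<^bsub>?F\<^esub> ?t x = \<beta> (\<alpha> x) \<oplus>\<^bsub>?F\<^esub> (x \<oplus>\<^bsub>?F\<^esub> \<ominus>\<^bsub>?F\<^esub> \<beta> (\<alpha> x))" using c by (simp add: z a_minus_def z')
    also have "\<dots> = x" using c by (simp add: F.M.a_ac F.M.r_neg F.M.r_neg1)
    finally show ?thesis by simp
  qed
  moreover have "graded_linear A ?N (kerm (free A I' s') Z \<pi>) \<alpha>"
    unfolding kerm_def
  proof (rule graded_linear_regrade_dom[OF al(1)])
    fix j x assume "x \<in> {x \<in> homog ?F j. e x = \<zero>\<^bsub>M\<^esub>}"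
    then show "\<alpha> x \<in> {x \<in> homog (free A I' s') j. \<pi> x = \<zero>\<^bsub>Z\<^esub>}"
      using graded_linearD(4)[OF al(1)] al(2) uD(5) by auto
  qed
  ultimately show ?thesis by (intro that[of ?t]) blast+
qed

lemma cover_comparison:
  assumes "graded_module A M" "graded_module A Z" "cover A I s e M" "cover A I' s' \<pi> Z" "graded_linear A M Z u"
  obtains \<alpha> where "graded_linear A (free A I s) (free A I' s') \<alpha>" "\<forall>j. \<forall>x \<in> homog (free A I s) j. \<pi> (\<alpha> x) = u (e x)"
proof -
  have "\<And>j. homog Z j \<subseteq> \<pi> ` homog (free A I' s') j" using coverD(2)[OF assms(4)] by blast
  from cover_lift[OF graded_module_free assms(2) coverD(1)[OF assms(4)] this graded_linear_comp[OF coverD(1)[OF assms(3)] assms(5)]]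
  obtain \<alpha> where al: "graded_linear A (free A I s) (free A I' s') \<alpha>"
    "\<And>j x. x \<in> homog (free A I s) j \<Longrightarrow> \<pi> (\<alpha> x) = u (e x)" by blast
  show ?thesis by (rule that[OF al(1)]) (simp add: al(2))
qed

text \<open>\<open>e x\<close> lifts to some \<open>w\<close> in the irrelevant part of the free
  module, and \<open>x - w\<close> lies in the kernel of \<open>e\<close>, which is the image of
  \<open>d 0\<close>. This is the case of homological degree 0, where Tor is \<open>M\<close> modulo
  its irrelevant part.\<close>

lemma boundary_step:
  assumes "resolves M B s e d" "graded_module A M" "x \<in> homog (free A (B 0) (s 0)) j" "e x \<in> mpart A M j"
  shows "cycles_bound B s d 0 j x"
proof -
  interpret F: graded_module A "free A (B 0) (s 0)" by (rule graded_module_free)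
  interpret M: graded_module A M by fact
  have cov: "cover A (B 0) (s 0) e M" using assms(1) unfolding resolves_def by blast
  note e = coverD(1)[OF cov]
  obtain w where w: "w \<in> mpart A (free A (B 0) (s 0)) j" "e w = e x"
    using F.mpart_lift[OF assms(2) e _ assms(4)] coverD(2)[OF cov] by blast
  note c = free_homog_carrier[OF assms(3)] F.mpart_carrier[OF w(1)]
  have "e (x \<ominus>\<^bsub>free A (B 0) (s 0)\<^esub> w) = \<zero>\<^bsub>M\<^esub>"
    using graded_linear_zero_neg(3)[OF graded_module_free assms(2) e c] w(2) graded_linearD(1)[OF e c(1)] 
    by (simp add: a_minus_def M.M.r_neg)
  then have "x \<ominus>\<^bsub>free A (B 0) (s 0)\<^esub> w \<in> d 0 ` homog (free A (B 1) (s 1)) j"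
    using assms(1) F.M_homog_diff[OF assms(3) F.mpart_homog[OF w(1)]] unfolding resolves_def by blast
  then obtain y where y: "y \<in> homog (free A (B 1) (s 1)) j" "d 0 y = x \<ominus>\<^bsub>free A (B 0) (s 0)\<^esub> w" by fastforce
  have "x = d 0 y \<oplus>\<^bsub>free A (B 0) (s 0)\<^esub> w"
    using c unfolding y(2) by (simp add: a_minus_def F.M.a_assoc F.M.l_neg)
  then show ?thesis unfolding cycles_bound_def using y(1) w(1) by auto
qed

text \<open>\<open>B\<close>, \<open>s\<close>, \<open>e\<close>, \<open>d\<close> form an arbitrary
  resolution of \<open>M\<close>, while \<open>Z\<close> has the bounded one; the two modules are
  related up to maps through a free module. Passing to first syzygies on both sides lowers
  \<open>i\<close> and keeps the relation by \<open>homotopy_step\<close>. The premise on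
  \<open>h (e x)\<close> for \<open>i = 0\<close> is what the cycle condition becomes after such a
  shift: then \<open>e\<close> is the old differential and \<open>h\<close> the inclusion of the
  syzygy into the previous term.\<close>

lemma lin_imp_cycles_bound_step:
  fixes M :: "('r, 'm) graded" and Z :: "('r, 'k) graded" and J :: "nat set"
  assumes res: "resolves M B s e d" and M: "graded_module A M" "graded_module A Z" and lin: "lin A q p r Z"
    and u: "graded_linear A M Z u" "graded_linear A Z M v"
    and st: "graded_linear A M (free A J g) h" "graded_linear A (free A J g) M t"
    and htpy: "\<forall>j. \<forall>x \<in> homog M j. x = v (u x) \<oplus>\<^bsub>M\<^esub> t (h x)"
    and ij: "i \<le> p" "r + q * int i < j" and x: "x \<in> homog (free A (B i) (s i)) j"
    and cyc: "i = 0 \<longrightarrow> h (e x) \<in> mpart A (free A J g) j" "\<forall>k. i = Suc k \<longrightarrow> d k x \<in> mpart A (free A (B k) (s k)) j"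
    and IH: "\<And>k p' M' Z' B s e d u v J g h t. i = Suc k \<Longrightarrow> p = Suc p' \<Longrightarrow> resolves M' B s e d \<Longrightarrow> 
      graded_module A (M' :: ('r, nat \<Rightarrow> 'r) graded) \<Longrightarrow> graded_module A (Z' :: ('r, nat \<Rightarrow> 'r) graded) \<Longrightarrow>
      lin A q p' (r + q) Z' \<Longrightarrow> graded_linear A M' Z' u \<Longrightarrow> graded_linear A Z' M' v \<Longrightarrow>
      graded_linear A M' (free A (J :: nat set) g) h \<Longrightarrow> graded_linear A (free A J g) M' t \<Longrightarrow>
      \<forall>j. \<forall>x \<in> homog M' j. x = v (u x) \<oplus>\<^bsub>M'\<^esub> t (h x) \<Longrightarrow>
      x \<in> homog (free A (B k) (s k)) j \<Longrightarrow> (k = 0 \<longrightarrow> h (e x) \<in> mpart A (free A J g) j) \<Longrightarrow>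
      (\<forall>l. k = Suc l \<longrightarrow> d l x \<in> mpart A (free A (B l) (s l)) j) \<Longrightarrow> cycles_bound B s d k j x"
  shows "cycles_bound B s d i j x"
proof -
  interpret M: graded_module A M by fact
  interpret Z: graded_module A Z by fact
  interpret G: graded_module A "free A J g" by (rule graded_module_free)
  have cov: "cover A (B 0) (s 0) e M" using res unfolding resolves_def by blast
  obtain I' :: "nat set" and s' \<pi> where C: "cover A I' s' \<pi> Z" "\<And>n. n \<in> I' \<Longrightarrow> s' n \<le> r"
    "\<And>p'. p = Suc p' \<Longrightarrow> lin A q p' (r + q) (kerm (free A I' s') Z \<pi>)"
    using linE[OF lin] by blast
  show ?thesis
  proof (cases i)
    case 0
    have ex: "e x \<in> homog M j" using graded_linearD(4)[OF coverD(1)[OF cov]] x 0 by simp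
    \<comment> \<open>The generators of \<open>Z\<close> have degree at most \<open>r < j\<close>,
      so in degree \<open>j\<close> all of \<open>Z\<close> is irrelevant part. Together with the
      premise on \<open>h (e x)\<close> this puts both summands of \<open>e x\<close> into the
      irrelevant part of \<open>M\<close>.\<close>
    have "u (e x) \<in> mpart A Z j"
      using C(2) ij(2) 0 graded_linearD(4)[OF u(1) ex] by (intro mpart_cover_bounded[OF M(2) C(1)]) fastforce+
    then have "v (u (e x)) \<in> mpart A M j" by (rule Z.mpart_image[OF M(1) u(2)])
    moreover have "t (h (e x)) \<in> mpart A M j" by (rule G.mpart_image[OF M(1) st(2) cyc(1)[rule_format, OF 0]])
    ultimately have "e x \<in> mpart A M j" using htpy[rule_format, OF ex] M.mpart_add by metis
    then show ?thesis using boundary_step[OF res M(1)] x 0 by simp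
  next
    case (Suc k)
    then obtain p' where p: "p = Suc p'" using ij(1) by (cases p) auto
    obtain \<alpha> where al: "graded_linear A (free A (B 0) (s 0)) (free A I' s') \<alpha>"
      "\<forall>j. \<forall>x \<in> homog (free A (B 0) (s 0)) j. \<pi> (\<alpha> x) = u (e x)"
      using cover_comparison[OF M cov C(1) u(1)] by blast
    obtain \<beta> where be: "graded_linear A (free A I' s') (free A (B 0) (s 0)) \<beta>"
      "\<forall>j. \<forall>x \<in> homog (free A I' s') j. e (\<beta> x) = v (\<pi> x)"
      using cover_comparison[OF M(2,1) C(1) cov u(2)] by blast
    let ?F = "free A (B 0) (s 0)" let ?N = "kerm ?F M e" let ?Y = "kerm (free A I' s') Z \<pi>"
    obtain t' where t': "graded_linear A ?F ?N t'" "\<forall>j. \<forall>x \<in> homog ?N j. x = \<beta> (\<alpha> x) \<oplus>\<^bsub>?N\<^esub> t' x"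
      "graded_linear A ?N ?Y \<alpha>"
      using homotopy_step[OF M cov C(1) u st htpy al be] by blast
    have be': "graded_linear A ?Y ?N \<beta>"
      unfolding kerm_def
    proof (rule graded_linear_regrade_dom[OF be(1)])
      fix j x assume "x \<in> {x \<in> homog (free A I' s') j. \<pi> x = \<zero>\<^bsub>Z\<^esub>}"
      then show "\<beta> x \<in> {x \<in> homog ?F j. e x = \<zero>\<^bsub>M\<^esub>}"
        using graded_linearD(4)[OF be(1)] be(2) graded_linear_zero_neg(1)[OF M(2,1) u(2)] by auto
    qed
    have id: "graded_linear A ?N ?F (\<lambda>x. x)"
      by (rule graded_linearI) auto
    have "cycles_bound (\<lambda>i. B (Suc i)) (\<lambda>i. s (Suc i)) (\<lambda>i. d (Suc i)) k j x"
    proof (rule IH[OF Suc p resolves_shift[OF res] _ _ C(3)[OF p] t'(3) be' id t'(1)])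
      show "graded_module A ?N" by (rule graded_module_cover_kernel[OF M(1) cov])
      show "graded_module A ?Y" by (rule graded_module_cover_kernel[OF M(2) C(1)])
      show "x \<in> homog (free A (B (Suc k)) (s (Suc k))) j" using x Suc by simp
      show "k = 0 \<longrightarrow> d 0 x \<in> mpart A ?F j" using cyc(2) Suc by auto
      show "\<forall>l. k = Suc l \<longrightarrow> d (Suc l) x \<in> mpart A (free A (B (Suc l)) (s (Suc l))) j" using cyc(2) Suc by auto
    qed (rule t'(2))
    then show ?thesis unfolding cycles_bound_def Suc .
  qed
qed

lemma lin_imp_cycles_bound0:
  fixes M :: "('r, nat \<Rightarrow> 'r) graded" and Z :: "('r, nat \<Rightarrow> 'r) graded" and J :: "nat set"
  assumes res: "resolves M B s e d" and M: "graded_module A M" "graded_module A Z" and lin: "lin A q p r Z"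
    and u: "graded_linear A M Z u" "graded_linear A Z M v"
    and st: "graded_linear A M (free A J g) h" "graded_linear A (free A J g) M t"
    and htpy: "\<forall>j. \<forall>x \<in> homog M j. x = v (u x) \<oplus>\<^bsub>M\<^esub> t (h x)"
    and ij: "i \<le> p" "r + q * int i < j" and x: "x \<in> homog (free A (B i) (s i)) j"
    and cyc: "i = 0 \<longrightarrow> h (e x) \<in> mpart A (free A J g) j" "\<forall>k. i = Suc k \<longrightarrow> d k x \<in> mpart A (free A (B k) (s k)) j"
  shows "cycles_bound B s d i j x"
  using assms
proof (induction i arbitrary: p r M Z B s e d u v J g h t)
  case 0
  show ?case by (rule lin_imp_cycles_bound_step[where M = M and B = B and s = s and e = e and d = d and u = u and v = v and h = h and t = t and x = x, OF 0]) simp_all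
next
  case (Suc i)
  note prems = Suc.prems
  show ?case
  proof (rule lin_imp_cycles_bound_step[where M = M and B = B and s = s and e = e and d = d and u = u and v = v and h = h and t = t and x = x, OF prems])
    fix k p' and M' Z' :: "('r, nat \<Rightarrow> 'r) graded" and B s e d u v and J :: "nat set" and g h t
    assume k: "Suc i = Suc k" and p: "p = Suc p'" and a: "resolves M' B s e d" "graded_module A M'" "graded_module A Z'"
      "lin A q p' (r + q) Z'" "graded_linear A M' Z' u" "graded_linear A Z' M' v"
      "graded_linear A M' (free A J g) h" "graded_linear A (free A J g) M' t"
      "\<forall>j. \<forall>x \<in> homog M' j. x = v (u x) \<oplus>\<^bsub>M'\<^esub> t (h x)"
      and b: "x \<in> homog (free A (B k) (s k)) j" "k = 0 \<longrightarrow> h (e x) \<in> mpart A (free A J g) j"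
      "\<forall>l. k = Suc l \<longrightarrow> d l x \<in> mpart A (free A (B l) (s l)) j"
    have "i \<le> p'" "r + q + q * int i < j" using prems(10,11) p by (auto simp: algebra_simps)
    from Suc.IH[OF a(1), OF a(2-), OF this] b k show "cycles_bound B s d k j x" by blast
  qed
qed

text \<open>The comparison starts with \<open>Z = M\<close> and the zero homotopy through the free
  module on the empty basis.\<close>

lemma lin_imp_cycles_bound:
  assumes res: "resolves M B s e d" and M: "graded_module A M" and lin: "lin A q p r M"
    and ij: "i \<le> p" "r + q * int i < j" and x: "x \<in> homog (free A (B i) (s i)) j"
    and cyc: "\<forall>k. i = Suc k \<longrightarrow> d k x \<in> mpart A (free A (B k) (s k)) j"
  shows "cycles_bound B s d i j x"
proof -
  interpret M: graded_module A M by fact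
  let ?G = "free A ({} :: nat set) (\<lambda>_. 0)"
  have st: "graded_linear A M ?G (\<lambda>_. \<zero>\<^bsub>?G\<^esub>)" "graded_linear A ?G M (\<lambda>_. \<zero>\<^bsub>M\<^esub>)"
    by (auto intro!: graded_linearI simp: M.M_homog_zero) (auto simp: free_simps)
  show ?thesis
  proof (rule lin_imp_cycles_bound_step[where M = M and Z = M and B = B and s = s and e = e and d = d and x = x, OF res M M lin graded_linear_id graded_linear_id st _ ij x _ cyc])
    show "\<forall>j. \<forall>x \<in> homog M j. x = x \<oplus>\<^bsub>M\<^esub> \<zero>\<^bsub>M\<^esub>" using M.M_homog_carrier by auto
    show "i = 0 \<longrightarrow> \<zero>\<^bsub>?G\<^esub> \<in> mpart A ?G j" by (simp add: mpart.mzero)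
    fix k p' and M' Z' :: "('r, nat \<Rightarrow> 'r) graded" and B s e d u v and J :: "nat set" and g h t
    assume k: "i = Suc k" and p: "p = Suc p'" and a: "resolves M' B s e d" "graded_module A M'" "graded_module A Z'"
      "lin A q p' (r + q) Z'" "graded_linear A M' Z' u" "graded_linear A Z' M' v"
      "graded_linear A M' (free A J g) h" "graded_linear A (free A J g) M' t"
      "\<forall>j. \<forall>x \<in> homog M' j. x = v (u x) \<oplus>\<^bsub>M'\<^esub> t (h x)"
      and b: "x \<in> homog (free A (B k) (s k)) j" "k = 0 \<longrightarrow> h (e x) \<in> mpart A (free A J g) j"
      "\<forall>l. k = Suc l \<longrightarrow> d l x \<in> mpart A (free A (B l) (s l)) j"
    have "k \<le> p'" "r + q + q * int k < j" using ij k p by (auto simp: algebra_simps)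
    from lin_imp_cycles_bound0[where M = M' and Z = Z' and B = B and s = s and e = e and d = d and u = u and v = v and h = h and t = t, OF a this] b show "cycles_bound B s d k j x" by blast
  qed
qed

text \<open>A resolution of \<open>Z\<close> with the right degrees is constructed along the given
  one of \<open>M\<close>: the vanishing of Tor for \<open>M\<close> shows, by
  \<open>cover_exists\<close>, that \<open>Z\<close> is generated in degrees at most
  \<open>r\<close>, and \<open>homotopy_step\<close> on both sides relates the first syzygies. As
  the bound has to travel from \<open>M\<close> to \<open>Z\<close> and the relation to the
  syzygies, homotopies are carried in both directions; \<open>deg\<close> says that in degrees above
  \<open>r\<close> they take values in irrelevant parts.\<close>

lemma cycles_bound_imp_lin_step:
  fixes M :: "('r, 'm) graded" and Z :: "('r, 'k) graded" and J J2 :: "nat set"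
  assumes units: "\<forall>a \<in> homog A 0. a \<noteq> \<zero> \<longrightarrow> (\<exists>b \<in> homog A 0. b \<otimes> a = \<one>)" and cgA: "countably_generated A (selfm A)"
    and q: "0 \<le> q"
    and res: "resolves M B s e d" and M: "graded_module A M" "graded_module A Z" and cg: "countably_generated A Z"
    and u: "graded_linear A M Z u" "graded_linear A Z M v"
    and st: "graded_linear A M (free A J g) h" "graded_linear A (free A J g) M t"
    and st2: "graded_linear A Z (free A J2 g2) h2" "graded_linear A (free A J2 g2) Z t2"
    and htpy: "\<forall>j. \<forall>x \<in> homog M j. x = v (u x) \<oplus>\<^bsub>M\<^esub> t (h x)"
    and htpy2: "\<forall>j. \<forall>x \<in> homog Z j. x = u (v x) \<oplus>\<^bsub>Z\<^esub> t2 (h2 x)"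
    and deg: "\<forall>j>r. \<forall>x \<in> homog Z j. h (v x) \<in> mpart A (free A J g) j"
      "\<forall>j>r. \<forall>x \<in> homog Z j. h2 x \<in> mpart A (free A J2 g2) j"
    and tor: "\<forall>i j x. i \<le> p \<longrightarrow> r + q * int i < j \<longrightarrow> x \<in> homog (free A (B i) (s i)) j \<longrightarrow>
      (i = 0 \<longrightarrow> h (e x) \<in> mpart A (free A J g) j) \<longrightarrow>
      (\<forall>k. i = Suc k \<longrightarrow> d k x \<in> mpart A (free A (B k) (s k)) j) \<longrightarrow> cycles_bound B s d i j x"
    and IH: "\<And>p' M' Z' B s e d u v J g h t J2 g2 h2 t2. p = Suc p' \<Longrightarrow> resolves M' B s e d \<Longrightarrow> 
      graded_module A (M' :: ('r, nat \<Rightarrow> 'r) graded) \<Longrightarrow> graded_module A (Z' :: ('r, nat \<Rightarrow> 'r) graded) \<Longrightarrow>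
      countably_generated A Z' \<Longrightarrow> graded_linear A M' Z' u \<Longrightarrow> graded_linear A Z' M' v \<Longrightarrow>
      graded_linear A M' (free A (J :: nat set) g) h \<Longrightarrow> graded_linear A (free A J g) M' t \<Longrightarrow>
      graded_linear A Z' (free A (J2 :: nat set) g2) h2 \<Longrightarrow> graded_linear A (free A J2 g2) Z' t2 \<Longrightarrow>
      \<forall>j. \<forall>x \<in> homog M' j. x = v (u x) \<oplus>\<^bsub>M'\<^esub> t (h x) \<Longrightarrow>
      \<forall>j. \<forall>x \<in> homog Z' j. x = u (v x) \<oplus>\<^bsub>Z'\<^esub> t2 (h2 x) \<Longrightarrow>
      \<forall>j>r + q. \<forall>x \<in> homog Z' j. h (v x) \<in> mpart A (free A J g) j \<Longrightarrow>
      \<forall>j>r + q. \<forall>x \<in> homog Z' j. h2 x \<in> mpart A (free A J2 g2) j \<Longrightarrow>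
      \<forall>i j x. i \<le> p' \<longrightarrow> r + q + q * int i < j \<longrightarrow> x \<in> homog (free A (B i) (s i)) j \<longrightarrow>
        (i = 0 \<longrightarrow> h (e x) \<in> mpart A (free A J g) j) \<longrightarrow>
        (\<forall>k. i = Suc k \<longrightarrow> d k x \<in> mpart A (free A (B k) (s k)) j) \<longrightarrow> cycles_bound B s d i j x \<Longrightarrow>
      lin A q p' (r + q) Z'"
  shows "lin A q p r Z"
proof -
  interpret M: graded_module A M by fact
  interpret Z: graded_module A Z by fact
  interpret G2: graded_module A "free A J2 g2" by (rule graded_module_free)
  let ?F = "free A (B 0) (s 0)" let ?N = "kerm ?F M e"
  interpret F: graded_module A ?F by (rule graded_module_free)
  have cov: "cover A (B 0) (s 0) e M" using res unfolding resolves_def by blast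
  note e = coverD(1)[OF cov]
  \<comment> \<open>The lift \<open>x\<close> of \<open>v z\<close> is a boundary modulo the
    irrelevant part, so \<open>v z\<close> lies in the irrelevant part of \<open>M\<close> and
    \<open>u (v z)\<close> in that of \<open>Z\<close>. The remaining summand of \<open>z\<close> is
    handled by \<open>deg\<close>.\<close>
  have "homog Z j \<subseteq> mpart A Z j" if j: "r < j" for j
  proof
    fix z assume z: "z \<in> homog Z j"
    obtain x where x: "x \<in> homog ?F j" "e x = v z" using coverD(2)[OF cov graded_linearD(4)[OF u(2) z]] by blast
    have "cycles_bound B s d 0 j x" using tor[rule_format, of 0 j x] j x deg(1)[rule_format, OF j z] by simp
    then obtain y w where y: "y \<in> homog (free A (B 1) (s 1)) j" "w \<in> mpart A ?F j" "x = d 0 y \<oplus>\<^bsub>?F\<^esub> w"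
      unfolding cycles_bound_def by auto
    have dy: "d 0 y \<in> homog ?F j" "e (d 0 y) = \<zero>\<^bsub>M\<^esub>" using res y(1) unfolding resolves_def by blast+
    have "v z = e w"
      using graded_linearD(2)[OF e F.M_homog_carrier[OF dy(1)] F.mpart_carrier[OF y(2)]] dy(2) x(2) y(3)
        graded_linearD(1)[OF e F.mpart_carrier[OF y(2)]] by simp
    then have "v z \<in> mpart A M j" using F.mpart_image[OF M(1) e y(2)] by simp
    then have "u (v z) \<in> mpart A Z j" by (rule M.mpart_image[OF M(2) u(1)])
    moreover have "t2 (h2 z) \<in> mpart A Z j" by (rule G2.mpart_image[OF M(2) st2(2) deg(2)[rule_format, OF j z]])
    ultimately show "z \<in> mpart A Z j" using htpy2[rule_format, OF z] Z.mpart_add by metis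
  qed
  then obtain I' :: "nat set" and s' \<pi> where C: "cover A I' s' \<pi> Z" "\<And>n. n \<in> I' \<Longrightarrow> s' n \<in> {..r}"
    using cover_exists[OF M(2) cg, of "{..r}"] by blast
  let ?C = "free A I' s'" let ?Y = "kerm ?C Z \<pi>"
  interpret C: graded_module A ?C by (rule graded_module_free)
  show ?thesis
  proof (rule linI[OF C(1)])
    show "n \<in> I' \<Longrightarrow> s' n \<le> r" for n using C(2) by simp
    fix p' assume p: "p = Suc p'"
    obtain \<alpha> where al: "graded_linear A ?F ?C \<alpha>" "\<forall>j. \<forall>x \<in> homog ?F j. \<pi> (\<alpha> x) = u (e x)"
      using cover_comparison[OF M cov C(1) u(1)] by blast
    obtain \<beta> where be: "graded_linear A ?C ?F \<beta>" "\<forall>j. \<forall>x \<in> homog ?C j. e (\<beta> x) = v (\<pi> x)"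
      using cover_comparison[OF M(2,1) C(1) cov u(2)] by blast
    obtain t' where t': "graded_linear A ?F ?N t'" "\<forall>j. \<forall>x \<in> homog ?N j. x = \<beta> (\<alpha> x) \<oplus>\<^bsub>?N\<^esub> t' x"
      "graded_linear A ?N ?Y \<alpha>"
      using homotopy_step[OF M cov C(1) u st htpy al be] by blast
    obtain t2' where t2': "graded_linear A ?C ?Y t2'" "\<forall>j. \<forall>x \<in> homog ?Y j. x = \<alpha> (\<beta> x) \<oplus>\<^bsub>?Y\<^esub> t2' x"
      "graded_linear A ?Y ?N \<beta>"
      using homotopy_step[OF M(2,1) C(1) cov u(2,1) st2 htpy2 be al] by blast
    have id: "graded_linear A (kerm P Q f) P (\<lambda>x. x)" for P :: "('r, nat \<Rightarrow> 'r) graded" and Q :: "('r, 'x) graded" and f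
      by (rule graded_linearI) auto
    have id2: "graded_linear A (kerm P Q f) P (\<lambda>x. x)" for P :: "('r, nat \<Rightarrow> 'r) graded" and Q :: "('r, 'm) graded" and f
      by (rule graded_linearI) auto
    \<comment> \<open>This gives \<open>deg\<close> for the syzygies: an element of
      \<open>?Y\<close> in degree above \<open>r + q\<close> only has coefficients of positive
      degree, because \<open>?C\<close> is generated in degrees at most \<open>r\<close> and
      \<open>q\<close> is nonnegative; \<open>\<beta>\<close> preserves this.\<close>
    have zC: "x \<in> mpart A ?C j" if "r + q < j" "x \<in> homog ?Y j" for j x
      using that C(2) q by (intro mpart_free_bounded) fastforce+
    show "lin A q p' (r + q) ?Y"
    proof (rule IH[OF p resolves_shift[OF res] _ _ _ t'(3) t2'(3) id2 t'(1) id t2'(1) t'(2) t2'(2)])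
      show "graded_module A ?N" by (rule graded_module_cover_kernel[OF M(1) cov])
      show "graded_module A ?Y" by (rule graded_module_cover_kernel[OF M(2) C(1)])
      show "countably_generated A ?Y"
        by (rule countably_generated_kerm[OF units graded_module_free M(2) coverD(1)[OF C(1)] countably_generated_free[OF cgA]])
      show "\<forall>j>r + q. \<forall>x \<in> homog ?Y j. x \<in> mpart A ?C j" using zC by blast
      show "\<forall>j>r + q. \<forall>x \<in> homog ?Y j. \<beta> x \<in> mpart A ?F j"
        using C.mpart_image[OF graded_module_free be(1) zC] by blast
      show "\<forall>i j x. i \<le> p' \<longrightarrow> r + q + q * int i < j \<longrightarrow> x \<in> homog (free A (B (Suc i)) (s (Suc i))) j \<longrightarrow>
        (i = 0 \<longrightarrow> d 0 x \<in> mpart A ?F j) \<longrightarrow>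
        (\<forall>k. i = Suc k \<longrightarrow> d (Suc k) x \<in> mpart A (free A (B (Suc k)) (s (Suc k))) j) \<longrightarrow>
        cycles_bound (\<lambda>i. B (Suc i)) (\<lambda>i. s (Suc i)) (\<lambda>i. d (Suc i)) i j x"
      proof (intro allI impI)
      fix i j x assume i: "i \<le> p'" "r + q + q * int i < j" "x \<in> homog (free A (B (Suc i)) (s (Suc i))) j"
        "i = 0 \<longrightarrow> d 0 x \<in> mpart A ?F j" "\<forall>k. i = Suc k \<longrightarrow> d (Suc k) x \<in> mpart A (free A (B (Suc k)) (s (Suc k))) j"
      have "cycles_bound B s d (Suc i) j x"
      proof (rule tor[rule_format])
        show "d k x \<in> mpart A (free A (B k) (s k)) j" if "Suc i = Suc k" for k
          using i(4,5) that by (cases k) auto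
      qed (use i p in \<open>auto simp: algebra_simps\<close>)
      then show "cycles_bound (\<lambda>i. B (Suc i)) (\<lambda>i. s (Suc i)) (\<lambda>i. d (Suc i)) i j x" unfolding cycles_bound_def .
      qed
    qed
  qed
qed

end

locale connected_ring = graded_ring A for A :: "('a, 'r, 'z) graded_scheme" (structure) +
  assumes neg_homog: "i < 0 \<Longrightarrow> homog A i = {\<zero>}"
    and units: "\<forall>a \<in> homog A 0. a \<noteq> \<zero> \<longrightarrow> (\<exists>b \<in> homog A 0. b \<otimes> a = \<one>)"
    and countable: "countably_generated A (selfm A)"
begin

lemma cycles_bound_imp_lin0:
  fixes M Z :: "('r, nat \<Rightarrow> 'r) graded" and J J2 :: "nat set"
  assumes q: "0 \<le> q" and res: "resolves M B s e d" and M: "graded_module A M" "graded_module A Z" and cg: "countably_generated A Z"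
    and u: "graded_linear A M Z u" "graded_linear A Z M v"
    and st: "graded_linear A M (free A J g) h" "graded_linear A (free A J g) M t"
    and st2: "graded_linear A Z (free A J2 g2) h2" "graded_linear A (free A J2 g2) Z t2"
    and htpy: "\<forall>j. \<forall>x \<in> homog M j. x = v (u x) \<oplus>\<^bsub>M\<^esub> t (h x)"
    and htpy2: "\<forall>j. \<forall>x \<in> homog Z j. x = u (v x) \<oplus>\<^bsub>Z\<^esub> t2 (h2 x)"
    and deg: "\<forall>j>r. \<forall>x \<in> homog Z j. h (v x) \<in> mpart A (free A J g) j"
      "\<forall>j>r. \<forall>x \<in> homog Z j. h2 x \<in> mpart A (free A J2 g2) j"
    and tor: "\<forall>i j x. i \<le> p \<longrightarrow> r + q * int i < j \<longrightarrow> x \<in> homog (free A (B i) (s i)) j \<longrightarrow>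
      (i = 0 \<longrightarrow> h (e x) \<in> mpart A (free A J g) j) \<longrightarrow>
      (\<forall>k. i = Suc k \<longrightarrow> d k x \<in> mpart A (free A (B k) (s k)) j) \<longrightarrow> cycles_bound B s d i j x"
  shows "lin A q p r Z"
  using [[unify_search_bound = 300]] res M cg u st st2 htpy htpy2 deg tor
proof (induction p arbitrary: r M Z B s e d u v J g h t J2 g2 h2 t2)
  case 0
  show ?case
    by (rule cycles_bound_imp_lin_step[OF units countable q, OF 0(1), OF 0(2), OF 0(3-)]) simp
next
  case (Suc p)
  show ?case
  proof (rule cycles_bound_imp_lin_step[OF units countable q, OF Suc.prems(1), OF Suc.prems(2), OF Suc.prems(3-)])
    fix p' and M' Z' :: "('r, nat \<Rightarrow> 'r) graded" and B s e d u v and J :: "nat set" and g h t and J2 :: "nat set" and g2 h2 t2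
    assume "Suc p = Suc p'"
    then have p': "p' = p" by simp
    assume *: "resolves M' B s e d" "graded_module A M'" "graded_module A Z'" "countably_generated A Z'"
      "graded_linear A M' Z' u" "graded_linear A Z' M' v"
      "graded_linear A M' (free A J g) h" "graded_linear A (free A J g) M' t"
      "graded_linear A Z' (free A J2 g2) h2" "graded_linear A (free A J2 g2) Z' t2"
      "\<forall>j. \<forall>x \<in> homog M' j. x = v (u x) \<oplus>\<^bsub>M'\<^esub> t (h x)"
      "\<forall>j. \<forall>x \<in> homog Z' j. x = u (v x) \<oplus>\<^bsub>Z'\<^esub> t2 (h2 x)"
      "\<forall>j>r + q. \<forall>x \<in> homog Z' j. h (v x) \<in> mpart A (free A J g) j"
      "\<forall>j>r + q. \<forall>x \<in> homog Z' j. h2 x \<in> mpart A (free A J2 g2) j"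
      "\<forall>i j x. i \<le> p' \<longrightarrow> r + q + q * int i < j \<longrightarrow> x \<in> homog (free A (B i) (s i)) j \<longrightarrow>
        (i = 0 \<longrightarrow> h (e x) \<in> mpart A (free A J g) j) \<longrightarrow>
        (\<forall>k. i = Suc k \<longrightarrow> d k x \<in> mpart A (free A (B k) (s k)) j) \<longrightarrow> cycles_bound B s d i j x"
    show "lin A q p' (r + q) Z'"
      unfolding p' by (rule Suc.IH[OF *(1), OF *(2), OF *(3-10), OF *(11-)[unfolded p']])
  qed
qed

lemma cycles_bound_imp_lin:
  fixes M :: "('r, 'm) graded"
  assumes q: "0 \<le> q" and res: "resolves M B s e d" and M: "graded_module A M" and cg: "countably_generated A M"
    and tor: "\<And>i j x. i \<le> p \<Longrightarrow> r + q * int i < j \<Longrightarrow> x \<in> homog (free A (B i) (s i)) j \<Longrightarrow>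
      (\<forall>k. i = Suc k \<longrightarrow> d k x \<in> mpart A (free A (B k) (s k)) j) \<Longrightarrow> cycles_bound B s d i j x"
  shows "lin A q p r M"
proof -
  interpret M: graded_module A M by fact
  let ?G = "free A ({} :: nat set) (\<lambda>_. 0)"
  have st: "graded_linear A M ?G (\<lambda>_. \<zero>\<^bsub>?G\<^esub>)" "graded_linear A ?G M (\<lambda>_. \<zero>\<^bsub>M\<^esub>)"
    by (auto intro!: graded_linearI simp: M.M_homog_zero) (auto simp: free_simps)
  have h: "\<forall>j. \<forall>x \<in> homog M j. x = x \<oplus>\<^bsub>M\<^esub> \<zero>\<^bsub>M\<^esub>" using M.M_homog_carrier by auto
  have z: "\<forall>j>r. \<forall>x \<in> homog M j. \<zero>\<^bsub>?G\<^esub> \<in> mpart A ?G j" using mpart.mzero by blast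
  show ?thesis
  proof (rule cycles_bound_imp_lin_step[OF units countable q, OF res, OF M M cg graded_linear_id graded_linear_id st st h h z z])
    show "\<forall>i j x. i \<le> p \<longrightarrow> r + q * int i < j \<longrightarrow> x \<in> homog (free A (B i) (s i)) j \<longrightarrow>
      (i = 0 \<longrightarrow> \<zero>\<^bsub>?G\<^esub> \<in> mpart A ?G j) \<longrightarrow>
      (\<forall>k. i = Suc k \<longrightarrow> d k x \<in> mpart A (free A (B k) (s k)) j) \<longrightarrow> cycles_bound B s d i j x"
      using tor by blast
    fix p' and M' Z' :: "('r, nat \<Rightarrow> 'r) graded" and B s e d u v and J :: "nat set" and g h t and J2 :: "nat set" and g2 h2 t2
    assume *: "resolves M' B s e d" "graded_module A M'" "graded_module A Z'" "countably_generated A Z'"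
      "graded_linear A M' Z' u" "graded_linear A Z' M' v"
      "graded_linear A M' (free A J g) h" "graded_linear A (free A J g) M' t"
      "graded_linear A Z' (free A J2 g2) h2" "graded_linear A (free A J2 g2) Z' t2"
      "\<forall>j. \<forall>x \<in> homog M' j. x = v (u x) \<oplus>\<^bsub>M'\<^esub> t (h x)"
      "\<forall>j. \<forall>x \<in> homog Z' j. x = u (v x) \<oplus>\<^bsub>Z'\<^esub> t2 (h2 x)"
      "\<forall>j>r + q. \<forall>x \<in> homog Z' j. h (v x) \<in> mpart A (free A J g) j"
      "\<forall>j>r + q. \<forall>x \<in> homog Z' j. h2 x \<in> mpart A (free A J2 g2) j"
      "\<forall>i j x. i \<le> p' \<longrightarrow> r + q + q * int i < j \<longrightarrow> x \<in> homog (free A (B i) (s i)) j \<longrightarrow>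
        (i = 0 \<longrightarrow> h (e x) \<in> mpart A (free A J g) j) \<longrightarrow>
        (\<forall>k. i = Suc k \<longrightarrow> d k x \<in> mpart A (free A (B k) (s k)) j) \<longrightarrow> cycles_bound B s d i j x"
    show "lin A q p' (r + q) Z'"
      by (rule cycles_bound_imp_lin0[OF q *(1), OF *(2), OF *(3-)])
  qed
qed

section \<open>Existence of graded free resolutions\<close>

lemma cover_exists_unbounded:
  assumes "graded_module A M" "countably_generated A M"
  shows "\<exists>(I :: nat set) s e. cover A I s e M"
  by (rule cover_exists[OF assms disjI1[OF refl]]) (intro exI)

lemma resolves_exists:
  fixes M :: "('r, 'm) graded"
  assumes M: "graded_module A M" "countably_generated A M"
  obtains B s e d where "resolves M B s e d"
proof -
  obtain B0 :: "nat set" and s0 e0 where c0: "cover A B0 s0 e0 M"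
    using cover_exists_unbounded[OF M] by (elim exE)
  let ?K0 = "kerm (free A B0 s0) M e0"
  define nxt :: "('r, nat \<Rightarrow> 'r) graded \<Rightarrow> nat set \<times> (nat \<Rightarrow> int) \<times> ((nat \<Rightarrow> 'r) \<Rightarrow> (nat \<Rightarrow> 'r))" where 
    "nxt N = (SOME c. cover A (fst c) (fst (snd c)) (snd (snd c)) N)" for N
  \<comment> \<open>The iterated syzygies. From the first one on they all have the type of
    coordinate vectors, so a plain recursion with chosen covers is possible although
    \<open>M\<close> has another type.\<close>
  define K where "K = rec_nat ?K0 (\<lambda>_ N. kerm (free A (fst (nxt N)) (fst (snd (nxt N)))) N (snd (snd (nxt N))))"
  have K_Suc: "K (Suc i) = kerm (free A (fst (nxt (K i))) (fst (snd (nxt (K i))))) (K i) (snd (snd (nxt (K i))))" 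
    and K_0: "K 0 = ?K0" for i by (simp_all add: K_def)
  have nxt: "cover A (fst (nxt N)) (fst (snd (nxt N))) (snd (snd (nxt N))) N" 
    if N: "graded_module A N" "countably_generated A N" for N
  proof -
    obtain I :: "nat set" and s e where c: "cover A I s e N" using cover_exists_unbounded[OF N] by (elim exE)
    have "\<exists>c :: nat set \<times> (nat \<Rightarrow> int) \<times> ((nat \<Rightarrow> 'r) \<Rightarrow> (nat \<Rightarrow> 'r)). cover A (fst c) (fst (snd c)) (snd (snd c)) N" by (rule exI[of _ "(I, s, e)"]) (simp add: c)
    from someI_ex[OF this] show ?thesis unfolding nxt_def .
  qed
  have cgF: "countably_generated A (free A I s)" for I :: "nat set" and s by (rule countably_generated_free[OF countable])
  have K: "graded_module A (K i) \<and> countably_generated A (K i)" for i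
  proof (induction i)
    case 0
    show ?case unfolding K_0 by (rule conjI[OF graded_module_cover_kernel[OF M(1) c0]
      countably_generated_kerm[OF units graded_module_free M(1) coverD(1)[OF c0] cgF]])
  next
    case (Suc i)
    note c = nxt[OF conjunct1[OF Suc] conjunct2[OF Suc]]
    show ?case unfolding K_Suc by (rule conjI[OF graded_module_cover_kernel[OF conjunct1[OF Suc] c]
      countably_generated_kerm[OF units graded_module_free conjunct1[OF Suc] coverD(1)[OF c] cgF]])
  qed
  define B where "B = case_nat B0 (\<lambda>i. fst (nxt (K i)))"
  define s where "s = case_nat s0 (\<lambda>i. fst (snd (nxt (K i))))"
  define d where "d i = snd (snd (nxt (K i)))" for i
  have c: "cover A (B (Suc i)) (s (Suc i)) (d i) (K i)" for i
    using nxt[of "K i"] K[of i] by (simp add: B_def s_def d_def)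
  have K_Suc': "K (Suc i) = kerm (free A (B (Suc i)) (s (Suc i))) (K i) (d i)" for i
    by (simp add: K_Suc B_def s_def d_def)
  have K_0': "K 0 = kerm (free A (B 0) (s 0)) M e0" by (simp add: K_0 B_def s_def)
  \<comment> \<open>Each \<open>K i\<close> is a kernel inside the \<open>i\<close>-th free module
    and so shares its carrier and operations. The target of the map is \<open>M\<close> for
    \<open>i = 0\<close> and a syzygy otherwise, which are different types.\<close>
  have K_cases: "(\<exists>P :: ('r, nat \<Rightarrow> 'r) graded. \<exists>f. K i = kerm (free A (B i) (s i)) P f) \<or> (\<exists>P :: ('r, 'm) graded. \<exists>f. K i = kerm (free A (B i) (s i)) P f)" for i
    using K_0' K_Suc' by (cases i) blast+
  have K_into: "graded_linear A F (free A (B i) (s i)) f" if "graded_linear A F (K i) f" for F :: "('r, nat \<Rightarrow> 'r) graded" and f i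
    using K_cases[of i] graded_linearD[OF that]
    by (intro graded_linearI) auto
  have K_zero: "\<zero>\<^bsub>K i\<^esub> = \<zero>\<^bsub>free A (B i) (s i)\<^esub>" for i using K_cases[of i] by auto
  have im: "d i ` homog (free A (B (Suc i)) (s (Suc i))) j = homog (K i) j" for i j
    using coverD(2)[OF c[of i]] graded_linearD(4)[OF coverD(1)[OF c[of i]]] by blast
  have "resolves M B s e0 d"
    unfolding resolves_def
  proof (intro conjI allI)
    show "cover A (B 0) (s 0) e0 M" using c0 by (simp add: B_def s_def)
    show "graded_linear A (free A (B (Suc i)) (s (Suc i))) (free A (B i) (s i)) (d i)" for i
      by (rule K_into[OF coverD(1)[OF c]])
    show "d 0 ` homog (free A (B 1) (s 1)) j = {x \<in> homog (free A (B 0) (s 0)) j. e0 x = \<zero>\<^bsub>M\<^esub>}" for j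
      using im[of 0 j] by (simp add: K_0')
    show "d (Suc i) ` homog (free A (B (Suc (Suc i))) (s (Suc (Suc i)))) j =
        {x \<in> homog (free A (B (Suc i)) (s (Suc i))) j. d i x = \<zero>\<^bsub>free A (B i) (s i)\<^esub>}" for i j
      using im[of "Suc i" j] by (simp add: K_Suc' K_zero)
  qed
  then show ?thesis using that by blast
qed

end

subsection \<open>Homogeneous components\<close>

inductive_set hspan :: "('a, 'b, 'm) graded_scheme \<Rightarrow> 'b set" for M where
  hzero: "\<zero>\<^bsub>M\<^esub> \<in> hspan M"
| hadd: "\<lbrakk> x \<in> hspan M; h \<in> homog M i \<rbrakk> \<Longrightarrow> x \<oplus>\<^bsub>M\<^esub> h \<in> hspan M"

text \<open>The direct sum condition in terms of additive projections \<open>comp i\<close>, which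
  are easier to compute with than a uniquely existing family;
  \<open>decomposed_of_direct_sum\<close> produces them.\<close>

locale decomposed = abelian_group M for M :: "('a, 'b, 'm) graded_scheme" (structure) +
  fixes comp :: "int \<Rightarrow> 'b \<Rightarrow> 'b"
  assumes subgroup_homog: "additive_subgroup (homog M i) M"
    and carrier_hspan: "x \<in> carrier M \<Longrightarrow> x \<in> hspan M"
    and comp_add: "x \<in> carrier M \<Longrightarrow> y \<in> carrier M \<Longrightarrow> comp i (x \<oplus> y) = comp i x \<oplus> comp i y"
    and comp_same: "x \<in> homog M i \<Longrightarrow> comp i x = x"
    and comp_other: "x \<in> homog M j \<Longrightarrow> i \<noteq> j \<Longrightarrow> comp i x = \<zero>"
begin

lemma homog_in_carrier: "x \<in> homog M i \<Longrightarrow> x \<in> carrier M"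
  using additive_subgroup.a_Hcarr[OF subgroup_homog] .

lemma zero_in_homog: "\<zero> \<in> homog M i"
  using additive_subgroup.zero_closed[OF subgroup_homog] .

lemma hspan_carrier: "x \<in> hspan M \<Longrightarrow> x \<in> carrier M"
  by (induction rule: hspan.induct) (auto intro: homog_in_carrier)

lemma comp_zero: "comp i \<zero> = \<zero>"
  using comp_same[OF zero_in_homog] .

lemma carrier_induct [consumes 1, case_names zero add]:
  assumes "x \<in> carrier M" "P \<zero>" "\<And>x h i. x \<in> carrier M \<Longrightarrow> P x \<Longrightarrow> h \<in> homog M i \<Longrightarrow> P (x \<oplus> h)"
  shows "P x"
  using carrier_hspan[OF assms(1)] by induction (use assms(2,3) hspan_carrier in auto)

lemma comp_homog: "x \<in> carrier M \<Longrightarrow> comp i x \<in> homog M i"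
proof (induction rule: carrier_induct)
  case zero then show ?case by (simp add: comp_zero zero_in_homog)
next
  case (add x h j)
  have "comp i h \<in> homog M i" using comp_same[OF add(2)] comp_other[OF add(2), of i] add(2) zero_in_homog by (cases "i = j") auto
  then show ?case using add homog_in_carrier[OF add(2)] additive_subgroup.a_closed[OF subgroup_homog] by (simp add: comp_add)
qed

lemma comp_carrier: "x \<in> carrier M \<Longrightarrow> comp i x \<in> carrier M"
  using comp_homog homog_in_carrier by blast

lemma sum_of_comps:
  assumes "x \<in> carrier M"
  shows "\<exists>T. finite T \<and> (\<forall>T'. finite T' \<longrightarrow> T \<subseteq> T' \<longrightarrow> x = (\<Oplus>i\<in>T'. comp i x))"
  using assms
proof (induction rule: carrier_induct)
  case zero
  show ?case by (intro exI[of _ "{}"]) (simp add: comp_zero)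
next
  case (add x h j)
  then obtain T where T: "finite T" "\<And>T'. finite T' \<Longrightarrow> T \<subseteq> T' \<Longrightarrow> x = (\<Oplus>i\<in>T'. comp i x)" by blast
  have "x \<oplus> h = (\<Oplus>i\<in>T'. comp i (x \<oplus> h))" if T': "finite T'" "insert j T \<subseteq> T'" for T'
  proof -
    have hc: "h \<in> carrier M" by (rule homog_in_carrier[OF add(2)])
    have "(\<Oplus>i\<in>T'. comp i h) = (\<Oplus>i\<in>T'. if i = j then comp i h else \<zero>)"
      using comp_other[OF add(2)] hc by (intro finsum_cong') (auto intro: comp_carrier)
    also have "\<dots> = h" using T' hc add.finprod_singleton_swap[of j T' "\<lambda>i. comp i h"] comp_same[OF add(2)]
      by (auto intro: comp_carrier)
    finally have h: "(\<Oplus>i\<in>T'. comp i h) = h" .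
    have "(\<Oplus>i\<in>T'. comp i (x \<oplus> h)) = (\<Oplus>i\<in>T'. comp i x \<oplus> comp i h)"
      using add(1) hc by (intro finsum_cong') (auto intro: comp_carrier comp_add)
    also have "\<dots> = (\<Oplus>i\<in>T'. comp i x) \<oplus> (\<Oplus>i\<in>T'. comp i h)"
      using add(1) hc by (intro finsum_addf) (auto intro: comp_carrier)
    also have "\<dots> = x \<oplus> h" using h T(2)[of T'] T' by simp
    finally show ?thesis by simp
  qed
  then show ?case using T(1) by (intro exI[of _ "insert j T"]) auto
qed

lemma mem_of_comps:
  assumes "x \<in> carrier M" "S \<subseteq> carrier M" "\<zero> \<in> S" "\<And>x y. x \<in> S \<Longrightarrow> y \<in> S \<Longrightarrow> x \<oplus> y \<in> S" "\<And>i. comp i x \<in> S"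
  shows "x \<in> S"
proof -
  obtain T where T: "finite T" "x = (\<Oplus>i\<in>T. comp i x)" using sum_of_comps[OF assms(1)] by blast
  have "(\<Oplus>i\<in>T. comp i x) \<in> S"
    using T(1)
  proof induction
    case (insert i F)
    have "(\<lambda>i. comp i x) \<in> F \<rightarrow> carrier M" using assms(1) by (auto intro: comp_carrier)
    then show ?case using insert assms by (simp add: comp_carrier)
  qed (simp add: assms(3))
  then show ?thesis using T(2) by simp
qed

end

text \<open>The projections are read off the uniquely determined family of components. Their
  additivity is again uniqueness: the coordinatewise sum of two such families decomposes the
  sum.\<close>

lemma decomposed_of_direct_sum:
  assumes "abelian_group M" "direct_sum_of_homog M"
  shows "\<exists>c. decomposed M c"
proof -
  interpret abelian_group M by fact
  have sub: "additive_subgroup (homog M i) M" for i using assms(2) by (simp add: direct_sum_of_homog_def)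
  note subD = additive_subgroup.a_Hcarr[OF sub] additive_subgroup.zero_closed[OF sub] additive_subgroup.a_closed[OF sub]
  let ?D = "\<lambda>x f. (\<forall>i. f i \<in> homog M i) \<and> finite {i. f i \<noteq> \<zero>\<^bsub>M\<^esub>} \<and> x = (\<Oplus>\<^bsub>M\<^esub> i\<in>{i. f i \<noteq> \<zero>\<^bsub>M\<^esub>}. f i)"
  have ex1: "\<exists>!f. ?D x f" if "x \<in> carrier M" for x using assms(2) that by (simp add: direct_sum_of_homog_def)
  define c where "c i x = (THE f. ?D x f) i" for i x
  have D: "?D x (\<lambda>i. c i x)" if "x \<in> carrier M" for x
    using theI'[OF ex1[OF that]] unfolding c_def .
  have eq: "c i x = f i" if "x \<in> carrier M" "?D x f" for i x f
  proof -
    have "(THE f. ?D x f) = f" by (rule the1_equality[OF ex1[OF that(1)]]) (rule that(2))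
    then show ?thesis unfolding c_def by simp
  qed
  have "decomposed M c"
  proof (intro decomposed.intro decomposed_axioms.intro)
    fix x i assume x: "x \<in> homog M i"
    let ?f = "\<lambda>j. if j = i then x else \<zero>\<^bsub>M\<^esub>"
    have "{j. ?f j \<noteq> \<zero>\<^bsub>M\<^esub>} = (if x = \<zero>\<^bsub>M\<^esub> then {} else {i})" by auto
    then have "?D x ?f" using x subD by auto
    then show "c i x = x" using eq[OF subD(1)[OF x], of ?f i] by simp
  next
    fix x i k assume x: "x \<in> homog M k" "i \<noteq> k"
    let ?f = "\<lambda>j. if j = k then x else \<zero>\<^bsub>M\<^esub>"
    have "{j. ?f j \<noteq> \<zero>\<^bsub>M\<^esub>} = (if x = \<zero>\<^bsub>M\<^esub> then {} else {k})" by auto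
    then have "?D x ?f" using x subD by auto
    then show "c i x = \<zero>\<^bsub>M\<^esub>" using eq[OF subD(1)[OF x(1)], of ?f i] x(2) by simp
  next
    fix x y i assume xy: "x \<in> carrier M" "y \<in> carrier M"
    let ?f = "\<lambda>i. c i x \<oplus>\<^bsub>M\<^esub> c i y"
    let ?S = "{i. c i x \<noteq> \<zero>\<^bsub>M\<^esub>} \<union> {i. c i y \<noteq> \<zero>\<^bsub>M\<^esub>}"
    have fin: "finite ?S" using D[OF xy(1)] D[OF xy(2)] by simp
    have cc: "c i x \<in> carrier M" "c i y \<in> carrier M" for i using D[OF xy(1)] D[OF xy(2)] subD(1) by blast+
    have sup: "{i. ?f i \<noteq> \<zero>\<^bsub>M\<^esub>} \<subseteq> ?S" by auto
    have x: "x = (\<Oplus>\<^bsub>M\<^esub> i\<in>?S. c i x)"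
    proof -
      have "(\<Oplus>\<^bsub>M\<^esub> i\<in>{i. c i x \<noteq> \<zero>\<^bsub>M\<^esub>}. c i x) = (\<Oplus>\<^bsub>M\<^esub> i\<in>?S. c i x)"
        using fin cc by (intro add.finprod_mono_neutral_cong_left) auto
      then show ?thesis using D[OF xy(1)] by simp
    qed
    have y: "y = (\<Oplus>\<^bsub>M\<^esub> i\<in>?S. c i y)"
    proof -
      have "(\<Oplus>\<^bsub>M\<^esub> i\<in>{i. c i y \<noteq> \<zero>\<^bsub>M\<^esub>}. c i y) = (\<Oplus>\<^bsub>M\<^esub> i\<in>?S. c i y)"
        using fin cc by (intro add.finprod_mono_neutral_cong_left) auto
      then show ?thesis using D[OF xy(2)] by simp
    qed
    have "(\<Oplus>\<^bsub>M\<^esub> i\<in>{i. ?f i \<noteq> \<zero>\<^bsub>M\<^esub>}. ?f i) = (\<Oplus>\<^bsub>M\<^esub> i\<in>?S. ?f i)"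
      using fin cc sup by (intro add.finprod_mono_neutral_cong_left) auto
    also have "\<dots> = (\<Oplus>\<^bsub>M\<^esub> i\<in>?S. c i x) \<oplus>\<^bsub>M\<^esub> (\<Oplus>\<^bsub>M\<^esub> i\<in>?S. c i y)"
      using cc by (intro finsum_addf) auto
    also have "\<dots> = x \<oplus>\<^bsub>M\<^esub> y" using x y by simp
    finally have "?D (x \<oplus>\<^bsub>M\<^esub> y) ?f"
      using finite_subset[OF sup fin] D[OF xy(1)] D[OF xy(2)] subD(3) by auto
    from eq[OF a_closed[OF xy] this] show "c i (x \<oplus>\<^bsub>M\<^esub> y) = c i x \<oplus>\<^bsub>M\<^esub> c i y" .
  next
    fix x assume x: "x \<in> carrier M"
    have "(\<Oplus>\<^bsub>M\<^esub> i\<in>T. c i x) \<in> hspan M" if "finite T" for T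
      using that
    proof induction
      case empty then show ?case by (simp add: hspan.hzero)
    next
      case (insert i T)
      have cc: "c i x \<in> carrier M" for i using D[OF x] subD(1) by blast
      then have "(\<Oplus>\<^bsub>M\<^esub> i\<in>insert i T. c i x) = (\<Oplus>\<^bsub>M\<^esub> i\<in>T. c i x) \<oplus>\<^bsub>M\<^esub> c i x"
        using insert by (simp add: a_comm)
      then show ?case using hspan.hadd[OF insert(3), of "c i x" i] D[OF x] by simp
    qed
    then show "x \<in> hspan M" using D[OF x] by metis
  qed (rule abelian_group_axioms, rule sub)
  then show ?thesis by blast
qed

lemma comp_commute:
  assumes "decomposed M c" "decomposed N c'" "f \<zero>\<^bsub>M\<^esub> = \<zero>\<^bsub>N\<^esub>"
    and "\<And>x y. x \<in> carrier M \<Longrightarrow> y \<in> carrier M \<Longrightarrow> f (x \<oplus>\<^bsub>M\<^esub> y) = f x \<oplus>\<^bsub>N\<^esub> f y"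
    and "\<And>j x. x \<in> homog M j \<Longrightarrow> f x \<in> homog N j" "\<And>x. x \<in> carrier M \<Longrightarrow> f x \<in> carrier N" and "x \<in> carrier M"
  shows "f (c i x) = c' i (f x)"
proof -
  interpret M: decomposed M c by fact
  interpret N: decomposed N c' by fact
  show ?thesis
    using assms(7)
  proof (induction rule: M.carrier_induct)
    case zero then show ?case by (simp add: M.comp_zero N.comp_zero assms(3))
  next
    case (add x h j)
    have hc: "h \<in> carrier M" by (rule M.homog_in_carrier[OF add(2)])
    have "f (c i h) = c' i (f h)"
      using M.comp_same[OF add(2)] M.comp_other[OF add(2), of i] N.comp_same[OF assms(5)[OF add(2)]] 
        N.comp_other[OF assms(5)[OF add(2)], of i] assms(3) by (cases "i = j") auto
    then show ?case using add(1,3) hc by (simp add: M.comp_add N.comp_add assms(4,6) M.comp_carrier)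
  qed
qed

subsection \<open>Graded free resolutions and Tor\<close>

lemma free_module_simps:
  "carrier (free_module A B s) = {x. (\<forall>n. x n \<in> carrier A) \<and> (\<forall>n. n \<notin> B \<longrightarrow> x n = \<zero>\<^bsub>A\<^esub>) \<and> finite {n. x n \<noteq> \<zero>\<^bsub>A\<^esub>}}"
  "zero (free_module A B s) = (\<lambda>_. \<zero>\<^bsub>A\<^esub>)"
  "add (free_module A B s) = (\<lambda>x y n. x n \<oplus>\<^bsub>A\<^esub> y n)"
  "smult (free_module A B s) = (\<lambda>r x n. r \<otimes>\<^bsub>A\<^esub> x n)"
  "homog (free_module A B s) j = homog (free A B s) j"
  by (auto simp: free_module_def Let_def free_simps)

locale decomposed_ring = connected_ring A + A: decomposed A comp
  for A :: "('a, 'r, 'z) graded_scheme" (structure) and comp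
begin

lemma free_module_graded: "graded_module A (free_module A B s)"
proof -
  interpret F: graded_module A "free A B s" by (rule graded_module_free)
  have ag: "abelian_group (free_module A B s)"
  proof (rule abelian_groupI)
    fix x y assume *: "x \<in> carrier (free_module A B s)" "y \<in> carrier (free_module A B s)"
    then have "finite {n. x n \<oplus> y n \<noteq> \<zero>}" using F.M.a_closed[of x y] by (simp add: free_simps free_module_simps)
    then show "x \<oplus>\<^bsub>free_module A B s\<^esub> y \<in> carrier (free_module A B s)" using * by (simp add: free_module_simps)
  next
    fix x assume *: "x \<in> carrier (free_module A B s)"
    have "finite {n. \<ominus> x n \<noteq> \<zero>}" by (rule finite_subset[of _ "{n. x n \<noteq> \<zero>}"]) (use * in \<open>auto simp: free_module_simps\<close>)
    then show "\<exists>y\<in>carrier (free_module A B s). y \<oplus>\<^bsub>free_module A B s\<^esub> x = \<zero>\<^bsub>free_module A B s\<^esub>"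
      using * by (intro bexI[of _ "\<lambda>n. \<ominus> x n"]) (auto simp: free_module_simps l_neg)
  qed (auto simp: free_module_simps a_ac)
  then interpret G: abelian_group "free_module A B s" .
  have inv: "\<ominus>\<^bsub>free_module A B s\<^esub> x = \<ominus>\<^bsub>free A B s\<^esub> x" if x: "x \<in> homog (free A B s) j" for x j
  proof -
    have y: "\<ominus>\<^bsub>free A B s\<^esub> x \<in> homog (free A B s) j" by (rule F.M_homog_neg[OF x])
    show ?thesis
      by (rule G.minus_equality) (use x y F.M.l_neg[OF free_homog_carrier[OF x]] in \<open>auto simp: free_module_simps free_simps\<close>)
  qed
  have m: "module A (free_module A B s)"
  proof (rule moduleI[OF is_cring ag])
    fix a x assume *: "a \<in> carrier A" "x \<in> carrier (free_module A B s)"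
    then have "finite {n. a \<otimes> x n \<noteq> \<zero>}" using F.smult_closed[of a x] by (simp add: free_simps free_module_simps)
    then show "a \<odot>\<^bsub>free_module A B s\<^esub> x \<in> carrier (free_module A B s)" using * by (simp add: free_module_simps)
  qed (auto simp: free_module_simps l_distr r_distr m_assoc)
  show ?thesis
  proof (rule graded_moduleI[OF graded_ring_axioms m])
    show "homog (free_module A B s) j \<subseteq> carrier (free_module A B s)" for j by (auto simp: free_module_simps free_simps)
    show "\<zero>\<^bsub>free_module A B s\<^esub> \<in> homog (free_module A B s) j" for j
      using F.M_homog_zero by (simp add: free_module_simps free_simps(2))
    show "x \<oplus>\<^bsub>free_module A B s\<^esub> y \<in> homog (free_module A B s) j"
      if "x \<in> homog (free_module A B s) j" "y \<in> homog (free_module A B s) j" for x y j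
      using F.M_homog_add[of x j y] that by (simp add: free_module_simps free_simps(3))
    show "\<ominus>\<^bsub>free_module A B s\<^esub> x \<in> homog (free_module A B s) j"
      if "x \<in> homog (free_module A B s) j" for x j
      using F.M_homog_neg[of x j] inv[of x j] that by (simp add: free_module_simps)
    show "a \<odot>\<^bsub>free_module A B s\<^esub> x \<in> homog (free_module A B s) (i + j)"
      if "a \<in> homog A i" "x \<in> homog (free_module A B s) j" for a x i j
      using F.smult_homog[of a i x j] that by (simp add: free_module_simps free_simps(4))
  qed
qed

lemma free_module_decomposed:
  "decomposed (free_module A B s) (\<lambda>j x n. if n \<in> B then comp (j - s n) (x n) else \<zero>)"
proof -
  let ?F = "free_module A B s"
  interpret F: graded_module A ?F by (rule free_module_graded)
  have hc: "x \<in> carrier ?F" if "x \<in> hspan ?F" for x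
    using that by induction (auto simp del: F.M.add.m_closed intro: F.M_homog_carrier F.M.a_closed)
  have add: "x \<oplus>\<^bsub>?F\<^esub> y \<in> hspan ?F" if "x \<in> hspan ?F" "y \<in> hspan ?F" for x y
    using that(2)
  proof induction
    case hzero
    show ?case using that(1) hc[OF that(1)] by simp
  next
    case (hadd y h i)
    have "x \<oplus>\<^bsub>?F\<^esub> (y \<oplus>\<^bsub>?F\<^esub> h) = (x \<oplus>\<^bsub>?F\<^esub> y) \<oplus>\<^bsub>?F\<^esub> h" 
      using F.M_homog_carrier[OF hadd(2)] hc[OF that(1)] hc[OF hadd(1)] by (simp add: F.M.a_assoc)
    then show ?case using hspan.hadd[OF hadd(3,2)] by simp
  qed
  have unit: "unit_vec A n a \<in> hspan ?F" if n: "n \<in> B" and a: "a \<in> carrier A" for n a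
    using a
  proof (induction rule: A.carrier_induct)
    case zero
    have "unit_vec A n \<zero> = \<zero>\<^bsub>?F\<^esub>" by (auto simp: dunit_def free_module_simps)
    then show ?case by (simp add: hspan.hzero)
  next
    case (add a h i)
    have "unit_vec A n (a \<oplus> h) = unit_vec A n a \<oplus>\<^bsub>?F\<^esub> unit_vec A n h" by (auto simp: dunit_def free_module_simps)
    moreover have "unit_vec A n h \<in> homog ?F (i + s n)" unfolding free_module_simps using add(2) n by (intro unit_vec_homog) auto
    ultimately show ?case using hspan.hadd[OF add(3)] by simp
  qed
  show ?thesis
  proof (intro decomposed.intro decomposed_axioms.intro F.M.abelian_group_axioms F.M_homog_subgroup)
    fix x assume x: "x \<in> carrier ?F"
    \<comment> \<open>With the whole carrier as component in every degree,
      \<open>dsum_homog_induct\<close> becomes an induction over arbitrary vectors supported on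
      \<open>B\<close>.\<close>
    then have "x \<in> homog (dsum (selfm A) B (\<lambda>n j. carrier A)) 0" by (auto simp: free_module_simps dsum_homog)
    then show "x \<in> hspan ?F"
    proof (rule dsum_homog_induct[OF selfm_module])
      show "(\<lambda>_. \<zero>\<^bsub>selfm A\<^esub>) \<in> hspan ?F" using hspan.hzero[of ?F] by (simp add: free_module_simps)
      fix x n a assume *: "x \<in> hspan ?F" "n \<in> B" "a \<in> carrier (selfm A)"
      show "x \<oplus>\<^bsub>dsum (selfm A) B (\<lambda>n j. carrier A)\<^esub> unit_vec A n a \<in> hspan ?F"
        using add[OF *(1) unit[OF *(2)], of a] *(3) by (simp add: free_module_simps)
    qed simp
  next
    fix x y i assume "x \<in> carrier ?F" "y \<in> carrier ?F"
    then show "(\<lambda>n. if n \<in> B then comp (i - s n) ((x \<oplus>\<^bsub>?F\<^esub> y) n) else \<zero>) =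
      (\<lambda>n. if n \<in> B then comp (i - s n) (x n) else \<zero>) \<oplus>\<^bsub>?F\<^esub> (\<lambda>n. if n \<in> B then comp (i - s n) (y n) else \<zero>)"
      by (auto simp: free_module_simps A.comp_add)
  next
    fix x i assume "x \<in> homog ?F i"
    then show "(\<lambda>n. if n \<in> B then comp (i - s n) (x n) else \<zero>) = x"
      by (auto simp: free_module_simps free_simps A.comp_same)
  next
    fix x i j assume "x \<in> homog ?F j" "i \<noteq> j"
    then show "(\<lambda>n. if n \<in> B then comp (i - s n) (x n) else \<zero>) = \<zero>\<^bsub>?F\<^esub>"
      by (intro ext) (auto simp: free_module_simps free_simps intro!: A.comp_other)
  qed
qed

text \<open>Projects the carrier of \<open>free\<close> to vectors supported on the basis, that is,
  to the carrier of \<open>free_module\<close>. It fixes homogeneous elements, so inserting it moves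
  maps between the two kinds of free modules without changing them on homogeneous elements.\<close>

definition cut :: "nat set \<Rightarrow> (nat \<Rightarrow> 'r) \<Rightarrow> nat \<Rightarrow> 'r" where
  "cut B x = (\<lambda>n. if n \<in> B then x n else \<zero>)"

lemma cut_linear: "graded_linear A (free A B s) (free_module A B s) (cut B)"
proof (rule graded_linearI)
  fix x assume x: "x \<in> carrier (free A B s)"
  have "finite {n. cut B x n \<noteq> \<zero>}" by (rule finite_subset[of _ "{n. x n \<noteq> \<zero>}"]) (use x in \<open>auto simp: cut_def free_simps\<close>)
  then show "cut B x \<in> carrier (free_module A B s)" using x by (simp add: free_simps free_module_simps) (simp add: cut_def)
next
  fix x j assume "x \<in> homog (free A B s) j"
  moreover from this have "cut B x = x" by (auto simp: cut_def free_simps)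
  ultimately show "cut B x \<in> homog (free_module A B s) j" by (simp add: free_module_simps)
qed (auto simp: cut_def free_simps free_module_simps)

lemma cut_homog: "x \<in> homog (free A B s) j \<Longrightarrow> cut B x = x"
  by (auto simp: cut_def free_simps)

lemma incl_linear: "graded_linear A (free_module A B s) (free A B s) (\<lambda>x. x)"
  by (rule graded_linearI) (auto simp: free_simps free_module_simps)

text \<open>The maps commute with homogeneous components, so a preimage of a homogeneous element can
  be replaced by its component of the same degree: exactness on carriers restricts to every
  degree.\<close>

lemma resolution_imp_resolves:
  assumes M: "graded_module A M" "decomposed M c" and res: "graded_free_resolution A M F"
  shows "resolves M (gens F) (degs F) (\<lambda>x. augm F (cut (gens F 0) x)) (\<lambda>i x. diff F i (cut (gens F (Suc i)) x))"
proof -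
  interpret M: decomposed M c by fact
  let ?T = "\<lambda>i. free_module A (gens F i) (degs F i)"
  let ?c = "\<lambda>i j x n. if n \<in> gens F i then comp (j - degs F i n) (x n) else \<zero>"
  have dec: "decomposed (?T i) (?c i)" for i by (rule free_module_decomposed)
  note gm = free_module_graded
  have e: "graded_linear A (?T 0) M (augm F)" and d: "\<And>i. graded_linear A (?T (Suc i)) (?T i) (diff F i)"
    and eS: "augm F ` carrier (?T 0) = carrier M"
    and ex0: "diff F 0 ` carrier (?T 1) = {x \<in> carrier (?T 0). augm F x = \<zero>\<^bsub>M\<^esub>}"
    and exS: "\<And>i. diff F (Suc i) ` carrier (?T (Suc (Suc i))) = {x \<in> carrier (?T (Suc i)). diff F i x = \<zero>\<^bsub>?T i\<^esub>}"
  proof -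
    note r = res[unfolded graded_free_resolution_def term_at_def]
    note r2 = conjunct2[OF r]
    note r3 = conjunct2[OF r2]
    note r4 = conjunct2[OF r3]
    show "graded_linear A (?T 0) M (augm F)" by (rule conjunct1[OF r])
    show "graded_linear A (?T (Suc i)) (?T i) (diff F i)" for i by (rule conjunct1[OF r2, rule_format])
    show "augm F ` carrier (?T 0) = carrier M" by (rule conjunct1[OF r3])
    show "diff F 0 ` carrier (?T 1) = {x \<in> carrier (?T 0). augm F x = \<zero>\<^bsub>M\<^esub>}" by (rule conjunct1[OF r4])
    show "diff F (Suc i) ` carrier (?T (Suc (Suc i))) = {x \<in> carrier (?T (Suc i)). diff F i x = \<zero>\<^bsub>?T i\<^esub>}" for i
      by (rule conjunct2[OF r4, rule_format])
  qed
  note eD = graded_linearD[OF e] graded_linear_zero_neg[OF gm M(1) e]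
  note dD = graded_linearD[OF d] graded_linear_zero_neg[OF gm gm d]
  note hom = free_module_simps(5)
  have ec: "augm F (?c 0 j x) = c j (augm F x)" if "x \<in> carrier (?T 0)" for j x
    by (rule comp_commute[OF dec M(2)]) (use eD that in auto)
  have dc: "diff F i (?c (Suc i) j x) = ?c i j (diff F i x)" if "x \<in> carrier (?T (Suc i))" for i j x
    by (rule comp_commute[OF dec dec]) (use dD that in auto)
  have hc: "x \<in> carrier (?T i)" if "x \<in> homog (free A (gens F i) (degs F i)) j" for i j x
    using decomposed.homog_in_carrier[OF dec] that unfolding hom by blast
  have im: "diff F i ` homog (free A (gens F (Suc i)) (degs F (Suc i))) j =
     {x \<in> homog (free A (gens F i) (degs F i)) j. x \<in> diff F i ` carrier (?T (Suc i))}" for i j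
  proof (intro equalityI subsetI)
    fix x assume "x \<in> diff F i ` homog (free A (gens F (Suc i)) (degs F (Suc i))) j"
    then show "x \<in> {x \<in> homog (free A (gens F i) (degs F i)) j. x \<in> diff F i ` carrier (?T (Suc i))}"
      using dD(4)[of _ i j] hc unfolding hom by blast
  next
    fix x assume "x \<in> {x \<in> homog (free A (gens F i) (degs F i)) j. x \<in> diff F i ` carrier (?T (Suc i))}"
    then obtain y where y: "x \<in> homog (?T i) j" "x = diff F i y" "y \<in> carrier (?T (Suc i))" unfolding hom by blast
    have "x = ?c i j x" by (rule decomposed.comp_same[OF dec y(1), symmetric])
    also have "\<dots> = diff F i (?c (Suc i) j y)" unfolding y(2) by (rule dc[OF y(3), symmetric])
    finally have "x = diff F i (?c (Suc i) j y)" .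
    then show "x \<in> diff F i ` homog (free A (gens F (Suc i)) (degs F (Suc i))) j"
      using decomposed.comp_homog[OF dec y(3), of j] unfolding hom by blast
  qed
  have cuts: "(\<lambda>x. f (cut (gens F i) x)) ` homog (free A (gens F i) (degs F i)) j = f ` homog (free A (gens F i) (degs F i)) j" for f :: "_ \<Rightarrow> nat \<Rightarrow> 'r" and i j
    by (rule image_cong[OF refl]) (simp add: cut_homog)
  show ?thesis
    unfolding resolves_def cover_def cuts
  proof (intro conjI allI)
    show "graded_linear A (free A (gens F 0) (degs F 0)) M (\<lambda>x. augm F (cut (gens F 0) x))"
      by (rule graded_linear_comp[OF cut_linear e])
    show "graded_linear A (free A (gens F (Suc i)) (degs F (Suc i))) (free A (gens F i) (degs F i)) (\<lambda>x. diff F i (cut (gens F (Suc i)) x))" for i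
      by (rule graded_linear_comp[OF graded_linear_comp[OF cut_linear d] incl_linear])
    show "homog M j \<subseteq> (\<lambda>x. augm F (cut (gens F 0) x)) ` homog (free A (gens F 0) (degs F 0)) j" for j
    proof
      fix x assume x: "x \<in> homog M j"
      have "x \<in> augm F ` carrier (?T 0)" unfolding eS by (rule M.homog_in_carrier[OF x])
      then obtain y where y': "x = augm F y" "y \<in> carrier (?T 0)" by (rule imageE)
      note y = y'(2) y'(1)[symmetric]
      have h: "?c 0 j y \<in> homog (free A (gens F 0) (degs F 0)) j" 
        using decomposed.comp_homog[OF dec y(1), of j] unfolding hom .
      have "augm F (cut (gens F 0) (?c 0 j y)) = x" using ec[OF y(1), of j] y(2) M.comp_same[OF x] cut_homog[OF h] by simp
      then show "x \<in> (\<lambda>x. augm F (cut (gens F 0) x)) ` homog (free A (gens F 0) (degs F 0)) j" using h by blast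
    qed
    show "(\<lambda>x. diff F 0 (cut (gens F (Suc 0)) x)) ` homog (free A (gens F 1) (degs F 1)) j =
        {x \<in> homog (free A (gens F 0) (degs F 0)) j. augm F (cut (gens F 0) x) = \<zero>\<^bsub>M\<^esub>}" for j
      using im[of 0 j] ex0 hc[of _ 0 j] cut_homog[of _ "gens F 0" "degs F 0" j] cuts[of "diff F 0" 1 j] by auto
    show "diff F (Suc i) ` homog (free A (gens F (Suc (Suc i))) (degs F (Suc (Suc i)))) j =
        {x \<in> homog (free A (gens F (Suc i)) (degs F (Suc i))) j.
         diff F i (cut (gens F (Suc i)) x) = \<zero>\<^bsub>free A (gens F i) (degs F i)\<^esub>}" for i j
      using im[of "Suc i" j] exS[of i] hc[of _ "Suc i" j] cut_homog[of _ "gens F (Suc i)" "degs F (Suc i)" j]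
      by (auto simp: free_simps(2) free_module_simps(2))
  qed
qed

text \<open>Every element is a finite sum of its components, and these are again cycles if the
  element is one. Exactness in each degree therefore extends to the carriers.\<close>

lemma resolves_imp_resolution:
  assumes M: "graded_module A M" "decomposed M c" and res: "resolves M B s e d"
  shows "\<exists>F. graded_free_resolution A M F"
proof -
  interpret M: decomposed M c by fact
  let ?T = "\<lambda>i. free_module A (B i) (s i)"
  let ?c = "\<lambda>i j x n. if n \<in> B i then comp (j - s i n) (x n) else \<zero>"
  have dec: "decomposed (?T i) (?c i)" for i by (rule free_module_decomposed)
  note gm = free_module_graded
  note hom = free_module_simps(5)
  let ?d = "\<lambda>i x. cut (B i) (d i x)"
  have cov: "graded_linear A (free A (B 0) (s 0)) M e" "\<And>j. homog M j \<subseteq> e ` homog (free A (B 0) (s 0)) j"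
    and dl: "\<And>i. graded_linear A (free A (B (Suc i)) (s (Suc i))) (free A (B i) (s i)) (d i)"
    and ex0: "\<And>j. d 0 ` homog (free A (B 1) (s 1)) j = {x \<in> homog (free A (B 0) (s 0)) j. e x = \<zero>\<^bsub>M\<^esub>}"
    and exS: "\<And>i j. d (Suc i) ` homog (free A (B (Suc (Suc i))) (s (Suc (Suc i)))) j =
        {x \<in> homog (free A (B (Suc i)) (s (Suc i))) j. d i x = \<zero>\<^bsub>free A (B i) (s i)\<^esub>}"
  proof -
    note r = res[unfolded resolves_def cover_def]
    note r2 = conjunct2[OF r]
    note r3 = conjunct2[OF r2]
    show "graded_linear A (free A (B 0) (s 0)) M e" by (rule conjunct1[OF conjunct1[OF r]])
    show "homog M j \<subseteq> e ` homog (free A (B 0) (s 0)) j" for j by (rule conjunct2[OF conjunct1[OF r], rule_format])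
    show "graded_linear A (free A (B (Suc i)) (s (Suc i))) (free A (B i) (s i)) (d i)" for i by (rule conjunct1[OF r2, rule_format])
    show "d 0 ` homog (free A (B 1) (s 1)) j = {x \<in> homog (free A (B 0) (s 0)) j. e x = \<zero>\<^bsub>M\<^esub>}" for j
      by (rule conjunct1[OF r3, rule_format])
    show "d (Suc i) ` homog (free A (B (Suc (Suc i))) (s (Suc (Suc i)))) j =
        {x \<in> homog (free A (B (Suc i)) (s (Suc i))) j. d i x = \<zero>\<^bsub>free A (B i) (s i)\<^esub>}" for i j
      by (rule conjunct2[OF r3, rule_format])
  qed
  have e: "graded_linear A (?T 0) M e" by (rule graded_linear_comp[OF incl_linear cov(1)])
  have d: "graded_linear A (?T (Suc i)) (?T i) (?d i)" for i
    by (rule graded_linear_comp[OF graded_linear_comp[OF incl_linear dl] cut_linear])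
  note eD = graded_linearD[OF e] graded_linear_zero_neg[OF gm M(1) e]
  note dD = graded_linearD[OF d] graded_linear_zero_neg[OF gm gm d]
  have dh: "?d i x = d i x" if "x \<in> homog (?T (Suc i)) j" for i x j
    using cut_homog[OF graded_linearD(4)[OF dl]] that unfolding hom by blast
  have ec: "e (?c 0 j x) = c j (e x)" if "x \<in> carrier (?T 0)" for j x
    by (rule comp_commute[OF dec M(2)]) (use eD that in auto)
  have dc: "?d i (?c (Suc i) j x) = ?c i j (?d i x)" if "x \<in> carrier (?T (Suc i))" for i j x
    by (rule comp_commute[OF dec dec]) (use dD that in auto)
  have exact: "?d i ` carrier (?T (Suc i)) = {x \<in> carrier (?T i). f x = \<zero>\<^bsub>N\<^esub>}"
    if N: "graded_module A N" "decomposed N cN" and f: "graded_linear A (?T i) N f" 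
      and ex: "\<And>j. ?d i ` homog (?T (Suc i)) j = {x \<in> homog (?T i) j. f x = \<zero>\<^bsub>N\<^esub>}"
    for i f and N :: "('r, 'n) graded" and cN
  proof (intro equalityI subsetI)
    interpret N: decomposed N cN by fact
    interpret T1: decomposed "?T (Suc i)" "?c (Suc i)" by (rule dec)
    interpret T: decomposed "?T i" "?c i" by (rule dec)
    note fD = graded_linearD[OF f] graded_linear_zero_neg[OF gm N(1) f]
    have fd: "f (?d i y) = \<zero>\<^bsub>N\<^esub>" if "y \<in> carrier (?T (Suc i))" for y
      using that
    proof (induction rule: T1.carrier_induct)
      case zero then show ?case using dD(5)[of i] fD(5) by simp
    next
      case (add x h j)
      have "?d i h \<in> {x \<in> homog (?T i) j. f x = \<zero>\<^bsub>N\<^esub>}" unfolding ex[symmetric] by (rule imageI[OF add(2)])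
      then have "f (?d i h) = \<zero>\<^bsub>N\<^esub>" by simp
      moreover have hc: "h \<in> carrier (?T (Suc i))" by (rule T1.homog_in_carrier[OF add(2)])
      moreover have "f (?d i (x \<oplus>\<^bsub>?T (Suc i)\<^esub> h)) = f (?d i x) \<oplus>\<^bsub>N\<^esub> f (?d i h)"
        using dD(2)[OF add(1) hc] fD(2)[OF dD(1)[OF add(1)] dD(1)[OF hc]] by simp
      ultimately show ?case using add(3) by simp
    qed
    show "x \<in> {x \<in> carrier (?T i). f x = \<zero>\<^bsub>N\<^esub>}" if "x \<in> ?d i ` carrier (?T (Suc i))" for x
      using that fd dD(1) by blast
    fix x assume "x \<in> {x \<in> carrier (?T i). f x = \<zero>\<^bsub>N\<^esub>}"
    then have x: "x \<in> carrier (?T i)" "f x = \<zero>\<^bsub>N\<^esub>" by auto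
    show "x \<in> ?d i ` carrier (?T (Suc i))"
    proof (rule T.mem_of_comps[OF x(1)])
      show "?d i ` carrier (?T (Suc i)) \<subseteq> carrier (?T i)" using dD(1) by blast
      show "\<zero>\<^bsub>?T i\<^esub> \<in> ?d i ` carrier (?T (Suc i))" using dD(5)[of i, symmetric] T1.zero_closed by (rule image_eqI)
      show "x \<oplus>\<^bsub>?T i\<^esub> y \<in> ?d i ` carrier (?T (Suc i))" 
        if "x \<in> ?d i ` carrier (?T (Suc i))" "y \<in> ?d i ` carrier (?T (Suc i))" for x y
      proof -
        obtain x' y' where *: "x' \<in> carrier (?T (Suc i))" "y' \<in> carrier (?T (Suc i))" "x = ?d i x'" "y = ?d i y'" using \<open>x \<in> _\<close> \<open>y \<in> _\<close> by blast
        then have "x \<oplus>\<^bsub>?T i\<^esub> y = ?d i (x' \<oplus>\<^bsub>?T (Suc i)\<^esub> y')" using dD(2) by simp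
        then show ?thesis using T1.a_closed[OF *(1,2)] by blast
      qed
      fix j
      have "f (?c i j x) = cN j (f x)"
        by (rule comp_commute[OF dec N(2)]) (use fD x(1) in auto)
      then have "?c i j x \<in> ?d i ` homog (?T (Suc i)) j"
        unfolding ex using T.comp_homog[OF x(1), of j] x(2) N.comp_zero by simp
      then show "?c i j x \<in> ?d i ` carrier (?T (Suc i))" using T1.homog_in_carrier by blast
    qed
  qed
  let ?F = "\<lparr>gens = B, degs = s, diff = ?d, augm = e\<rparr>"
  have im: "?d i ` homog (?T (Suc i)) j = d i ` homog (?T (Suc i)) j" for i j by (rule image_cong[OF refl dh])
  have "graded_free_resolution A M ?F"
    unfolding graded_free_resolution_def term_at_def free_complex.simps
  proof (intro conjI allI e d)
    interpret T0: decomposed "?T 0" "?c 0" by (rule dec)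
    show "e ` carrier (?T 0) = carrier M"
    proof (intro equalityI subsetI)
      fix x assume "x \<in> carrier M"
      then show "x \<in> e ` carrier (?T 0)"
      proof (induction rule: M.carrier_induct)
        case zero then show ?case using eD(5)[symmetric] T0.zero_closed by (rule image_eqI)
      next
        case (add x h i)
        obtain x' where x': "x' \<in> carrier (?T 0)" "e x' = x" using add(3) by blast
        obtain h' where h': "h' \<in> carrier (?T 0)" "e h' = h" using add(2) cov(2)[of i] T0.homog_in_carrier unfolding hom by blast
        have "e (x' \<oplus>\<^bsub>?T 0\<^esub> h') = x \<oplus>\<^bsub>M\<^esub> h" using x' h' eD(2) by simp
        then show ?case using T0.a_closed[OF x'(1) h'(1)] image_eqI[OF sym] by metis
      qed
    qed (use eD in auto)
    show "?d 0 ` carrier (?T 1) = {x \<in> carrier (?T 0). e x = \<zero>\<^bsub>M\<^esub>}"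
    proof -
      have "?d 0 ` carrier (?T (Suc 0)) = {x \<in> carrier (?T 0). e x = \<zero>\<^bsub>M\<^esub>}"
        by (rule exact[OF M e], subst im) (use ex0 in \<open>simp add: hom\<close>)
      then show ?thesis by simp
    qed
    show "?d (Suc i) ` carrier (?T (Suc (Suc i))) = {x \<in> carrier (?T (Suc i)). ?d i x = \<zero>\<^bsub>?T i\<^esub>}" for i
    proof (rule exact[OF gm dec d])
      fix j
      have "(?d i x = \<zero>\<^bsub>?T i\<^esub>) = (d i x = \<zero>\<^bsub>free A (B i) (s i)\<^esub>)" if "x \<in> homog (?T (Suc i)) j" for x
        using dh[OF that] by (simp add: free_simps free_module_simps)
      then show "?d (Suc i) ` homog (?T (Suc (Suc i))) j = {x \<in> homog (?T (Suc i)) j. ?d i x = \<zero>\<^bsub>?T i\<^esub>}"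
        unfolding im using exS[of i j] unfolding hom by auto
    qed
  qed
  then show ?thesis by blast
qed

text \<open>The elements without components in degrees at most 0 form an ideal that contains all
  generators, hence the whole irrelevant ideal. Closure under multiplication rests on the vanishing
  of negative degrees.\<close>

lemma irrelevant_ideal_homog:
  assumes "x \<in> homog A i"
  shows "x \<in> irrelevant_ideal A \<longleftrightarrow> 0 < i \<or> x = \<zero>"
proof -
  let ?J = "{x \<in> carrier A. \<forall>i\<le>0. comp i x = \<zero>}"
  let ?S = "\<Union>i\<in>{0<..}. homog A i"
  have S: "?S \<subseteq> carrier A" using homog_carrier by blast
  have mh: "comp i (h \<otimes> x) = h \<otimes> comp (i - k) x" if "h \<in> homog A k" "x \<in> carrier A" for i k h x
    using that(2)
  proof (induction rule: A.carrier_induct)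
    case zero then show ?case using homog_carrier[OF that(1)] by (simp add: A.comp_zero)
  next
    case (add x g j)
    have hg: "h \<otimes> g \<in> homog A (k + j)" by (rule mult_homog[OF that(1) add(2)])
    have "comp i (h \<otimes> g) = h \<otimes> comp (i - k) g"
    proof (cases "i = k + j")
      case True
      then show ?thesis using A.comp_same[OF hg] A.comp_same[OF add(2)] by simp
    next
      case False
      then show ?thesis using A.comp_other[OF hg] A.comp_other[OF add(2), of "i - k"] homog_carrier[OF that(1)] by auto
    qed
    then show ?case using add(1,3) homog_carrier[OF that(1)] homog_carrier[OF add(2)]
      by (simp add: r_distr A.comp_add A.comp_carrier)
  qed
  have J: "ideal ?J A"
  proof (rule idealI[OF ring_axioms])
    show "subgroup ?J (add_monoid A)"
    proof (rule add.subgroupI)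
      show "?J \<noteq> {}" using A.comp_zero by blast
      fix a assume a: "a \<in> ?J"
      have "comp i (\<ominus> a) = \<zero>" if "i \<le> 0" for i
        using A.comp_add[of a "\<ominus> a" i] a that A.comp_carrier[of "\<ominus> a" i] by (simp add: r_neg A.comp_zero)
      then show "\<ominus> a \<in> ?J" using a by simp
    qed (auto simp: A.comp_add)
    have l: "r \<otimes> x \<in> ?J" if "x \<in> ?J" "r \<in> carrier A" for x r
      using that(2)
    proof (induction rule: A.carrier_induct)
      case zero then show ?case using that(1) by (simp add: A.comp_zero)
    next
      case (add r h k)
      have "comp i (h \<otimes> x) = \<zero>" if "i \<le> 0" for i
      proof (cases "k < 0")
        case True then show ?thesis using add(2) neg_homog[of k] \<open>x \<in> ?J\<close> by (simp add: A.comp_zero)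
      next
        case False then show ?thesis using mh[OF add(2), of x i] \<open>x \<in> ?J\<close> that homog_carrier[OF add(2)] by simp
      qed
      then show ?case using add that(1) homog_carrier[OF add(2)] by (simp add: l_distr A.comp_add)
    qed
    show "x \<in> ?J \<Longrightarrow> r \<in> carrier A \<Longrightarrow> r \<otimes> x \<in> ?J" for x r by (rule l)
    show "x \<otimes> r \<in> ?J" if "x \<in> ?J" "r \<in> carrier A" for x r using l[OF that] that by (simp add: m_comm)
  qed
  have "?S \<subseteq> ?J" using A.comp_other homog_carrier by fastforce
  then have "irrelevant_ideal A \<subseteq> ?J" unfolding irrelevant_ideal_def by (rule genideal_minimal[OF J])
  moreover have "?S \<subseteq> irrelevant_ideal A" unfolding irrelevant_ideal_def by (rule genideal_self[OF S])
  moreover have "\<zero> \<in> irrelevant_ideal A"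
    unfolding irrelevant_ideal_def using additive_subgroup.zero_closed[OF ideal.axioms(1)[OF genideal_ideal[OF S]]] .
  ultimately show ?thesis using A.comp_same[OF assms] assms by (cases "0 < i") force+
qed

lemma irrelevant_ideal_ideal: "ideal (irrelevant_ideal A) A"
  unfolding irrelevant_ideal_def using homog_carrier by (intro genideal_ideal) blast

text \<open>Links the inductive \<open>mpart\<close> with the coordinatewise
  \<open>irrelevant_part\<close>: a homogeneous coordinate lies in the irrelevant ideal exactly if
  it is zero or has positive degree.\<close>

lemma mpart_free_iff:
  assumes w: "w \<in> homog (free A B s) j"
  shows "w \<in> mpart A (free A B s) j \<longleftrightarrow> (\<forall>n. w n \<in> irrelevant_ideal A)"
proof
  interpret m: ideal "irrelevant_ideal A" A by (rule irrelevant_ideal_ideal)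
  interpret F: graded_module A "free A B s" by (rule graded_module_free)
  show "\<forall>n. w n \<in> irrelevant_ideal A" if "w \<in> mpart A (free A B s) j"
    using that
  proof induction
    case mzero then show ?case by (simp add: free_simps)
  next
    case (madd y i a x)
    have "a \<in> irrelevant_ideal A" using irrelevant_ideal_homog[OF madd(3)] madd(2) by simp
    moreover have "x n \<in> carrier A" for n using madd(4) by (simp add: free_simps)
    ultimately show ?case using madd(5) by (simp add: free_simps m.I_r_closed)
  qed
  assume *: "\<forall>n. w n \<in> irrelevant_ideal A"
  show "w \<in> mpart A (free A B s) j"
  proof (rule mpart_free[OF w])
    fix n assume "n \<in> B" "w n \<noteq> \<zero>"
    then show "s n < j" using irrelevant_ideal_homog[of "w n" "j - s n"] * w by (auto simp: free_simps)
  qed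
qed

text \<open>The quotient group is trivial exactly if every cycle of the tensored complex is a
  boundary. Both are given by preimages in the free module; the coset argument uses that the
  boundaries form a subgroup.\<close>

lemma not_Tor_nonzero_iff:
  assumes M: "graded_module A M" "decomposed M c" and F: "F = (SOME F. graded_free_resolution A M F)"
    and res: "graded_free_resolution A M F"
  defines "d \<equiv> \<lambda>i x. diff F i (cut (gens F (Suc i)) x)"
  shows "\<not> Tor_nonzero A M i j \<longleftrightarrow> (\<forall>x \<in> homog (free A (gens F i) (degs F i)) j.
     (\<forall>k. i = Suc k \<longrightarrow> d k x \<in> mpart A (free A (gens F k) (degs F k)) j) \<longrightarrow> cycles_bound (gens F) (degs F) d i j x)"
proof -
  let ?T = "\<lambda>i. free_module A (gens F i) (degs F i)" let ?F = "\<lambda>i. free A (gens F i) (degs F i)"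
  interpret T: graded_module A "?T i" by (rule free_module_graded)
  interpret m: ideal "irrelevant_ideal A" A by (rule irrelevant_ideal_ideal)
  have dl: "graded_linear A (?T (Suc i)) (?T i) (diff F i)" for i
    using res unfolding graded_free_resolution_def term_at_def by blast
  note dD = graded_linearD[OF dl] graded_linear_zero_neg[OF free_module_graded free_module_graded dl]
  note hom = free_module_simps(5)
  have hc: "x \<in> carrier (?T i)" if "x \<in> homog (?F i) j" for i x j
    using that decomposed.homog_in_carrier[OF free_module_decomposed] unfolding hom[symmetric] by blast
  have d: "d i x = diff F i x" if "x \<in> homog (?F (Suc i)) j" for i x j
    unfolding d_def using cut_homog[OF that] by simp
  have ip: "w \<in> irrelevant_part A F i \<longleftrightarrow> w \<in> mpart A (?F i) j" if "w \<in> homog (?F i) j" for w i j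
    using mpart_free_iff[OF that] hc[OF that] by (simp add: irrelevant_part_def term_at_def)
  let ?Z = "tensor_cycles A F i j" and ?B = "tensor_boundaries A F i j"
  have Z: "x \<in> ?Z \<longleftrightarrow> x \<in> homog (?F i) j \<and> (\<forall>k. i = Suc k \<longrightarrow> d k x \<in> mpart A (?F k) j)" for x
  proof -
    have "diff F k x \<in> homog (?F k) j" if "x \<in> homog (?F (Suc k)) j" for k using dD(4)[of x k j] that unfolding hom .
    then show ?thesis using d[of x _ j] ip[of _ _ j] by (cases i) (auto simp: tensor_cycles_def term_at_def hom)
  qed
  have B: "x \<in> ?B \<longleftrightarrow> x \<in> homog (?F i) j \<and> cycles_bound (gens F) (degs F) d i j x" for x
  proof -
    interpret T': graded_module A "?F i" by (rule graded_module_free)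
    \<comment> \<open>The definition of \<open>tensor_boundaries\<close> lets \<open>w\<close> be
      any element of the irrelevant part. As a difference of homogeneous elements of degree
      \<open>j\<close> it is homogeneous, so it belongs to \<open>mpart\<close>.\<close>
    have wh: "w \<in> homog (?F i) j" if "y \<in> homog (?F (Suc i)) j" "w \<in> irrelevant_part A F i" "x \<in> homog (?F i) j" "x = diff F i y \<oplus>\<^bsub>?T i\<^esub> w" for y w
    proof -
      have w: "w \<in> carrier (?T i)" using that(2) by (simp add: irrelevant_part_def term_at_def)
      have dy: "diff F i y \<in> homog (?T i) j" using dD(4)[of y i j] that(1) unfolding hom by simp
      have "w = \<ominus>\<^bsub>?T i\<^esub> diff F i y \<oplus>\<^bsub>?T i\<^esub> x" 
        using w T.M_homog_carrier[OF dy] by (simp add: that(4) T.M.r_neg1)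
      then show ?thesis using T.M_homog_add[OF T.M_homog_neg[OF dy], of x] that(3) by (simp add: hom)
    qed
    have a: "v \<oplus>\<^bsub>?T i\<^esub> w = v \<oplus>\<^bsub>?F i\<^esub> w" for v w by (simp add: free_simps(3) free_module_simps(3))
    have mem: "x \<in> ?B \<longleftrightarrow> x \<in> homog (?F i) j \<and> (\<exists>y\<in>homog (?F (Suc i)) j. \<exists>w\<in>irrelevant_part A F i. x = diff F i y \<oplus>\<^bsub>?T i\<^esub> w)"
      unfolding tensor_boundaries_def term_at_def hom by (rule mem_Collect_eq)
    show ?thesis
    proof
      assume "x \<in> ?B"
      then obtain y w where *: "x \<in> homog (?F i) j" "y \<in> homog (?F (Suc i)) j" "w \<in> irrelevant_part A F i" "x = diff F i y \<oplus>\<^bsub>?T i\<^esub> w"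
        unfolding mem by (elim conjE bexE)
      have "w \<in> mpart A (?F i) j" using ip[OF wh[OF *(2,3,1,4)]] *(3) by simp
      moreover have "x = d i y \<oplus>\<^bsub>?F i\<^esub> w" using *(4) unfolding d[OF *(2)] a .
      ultimately show "x \<in> homog (?F i) j \<and> cycles_bound (gens F) (degs F) d i j x"
        unfolding cycles_bound_def by (intro conjI *(1) bexI[OF _ *(2)] bexI[of _ w])
    next
      assume "x \<in> homog (?F i) j \<and> cycles_bound (gens F) (degs F) d i j x"
      then obtain y w where *: "x \<in> homog (?F i) j" "y \<in> homog (?F (Suc i)) j" "w \<in> mpart A (?F i) j" "x = d i y \<oplus>\<^bsub>?F i\<^esub> w"
        unfolding cycles_bound_def by (elim conjE bexE)
      have "w \<in> irrelevant_part A F i" using ip[OF T'.mpart_homog[OF *(3)]] *(3) by simp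
      moreover have "x = diff F i y \<oplus>\<^bsub>?T i\<^esub> w" using *(4) unfolding d[OF *(2)] a .
      ultimately show "x \<in> ?B" unfolding mem by (intro conjI *(1) bexI[OF _ *(2)] bexI[of _ w])
    qed
  qed
  have dadd: "cycles_bound (gens F) (degs F) d i j (x \<oplus>\<^bsub>?T i\<^esub> x')"
    if cb: "cycles_bound (gens F) (degs F) d i j x" "cycles_bound (gens F) (degs F) d i j x'" for x x'
  proof -
    interpret F: graded_module A "?F i" by (rule graded_module_free)
    interpret F1: graded_module A "?F (Suc i)" by (rule graded_module_free)
    obtain y w where y: "y \<in> homog (?F (Suc i)) j" "w \<in> mpart A (?F i) j" "x = d i y \<oplus>\<^bsub>?F i\<^esub> w"
      using cb(1) unfolding cycles_bound_def by (elim bexE)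
    obtain y' w' where y': "y' \<in> homog (?F (Suc i)) j" "w' \<in> mpart A (?F i) j" "x' = d i y' \<oplus>\<^bsub>?F i\<^esub> w'"
      using cb(2) unfolding cycles_bound_def by (elim bexE)
    note * = y y'
    have yy: "y \<oplus>\<^bsub>?F (Suc i)\<^esub> y' \<in> homog (?F (Suc i)) j" by (rule F1.M_homog_add[OF *(1,4)])
    have dc: "d i y \<in> carrier (?F i)" "d i y' \<in> carrier (?F i)"
      using dD(4)[of _ i j] *(1,4) d[OF *(1)] d[OF *(4)] free_homog_carrier[of _ "gens F i" "degs F i" j] unfolding hom by simp_all
    have "d i (y \<oplus>\<^bsub>?F (Suc i)\<^esub> y') = d i y \<oplus>\<^bsub>?F i\<^esub> d i y'"
      using dD(2)[OF hc[OF *(1)] hc[OF *(4)]] d[OF yy] d[OF *(1)] d[OF *(4)] by (simp add: free_simps(3) free_module_simps(3))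
    moreover have "x \<oplus>\<^bsub>?T i\<^esub> x' = (d i y \<oplus>\<^bsub>?F i\<^esub> d i y') \<oplus>\<^bsub>?F i\<^esub> (w \<oplus>\<^bsub>?F i\<^esub> w')"
    proof -
      have "x \<oplus>\<^bsub>?T i\<^esub> x' = x \<oplus>\<^bsub>?F i\<^esub> x'" by (simp add: free_simps(3) free_module_simps(3))
      then show ?thesis
        using dc F.mpart_carrier[OF *(2)] F.mpart_carrier[OF *(5)] unfolding *(3,6) by (simp add: F.M.a_ac)
    qed
    ultimately show ?thesis unfolding cycles_bound_def using yy F.mpart_add[OF *(2,5)] by metis
  qed
  have Badd: "x \<oplus>\<^bsub>?T i\<^esub> y \<in> ?B" if "x \<in> ?B" "y \<in> ?B" for x y
    using that T.M_homog_add[of x j y] dadd unfolding B hom by blast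
  have Bneg: "\<ominus>\<^bsub>?T i\<^esub> x \<in> ?B" if xB: "x \<in> ?B" for x
  proof -
    have 1: "\<ominus> \<one> \<in> homog A 0" using additive_subgroup.a_inv_closed[OF homog_subgroup one_homog] .
    interpret F: graded_module A "?F i" by (rule graded_module_free)
    interpret F1: graded_module A "?F (Suc i)" by (rule graded_module_free)
    obtain y w where *: "y \<in> homog (?F (Suc i)) j" "w \<in> mpart A (?F i) j" "x = d i y \<oplus>\<^bsub>?F i\<^esub> w" "x \<in> homog (?F i) j"
      using xB unfolding B cycles_bound_def by (elim conjE bexE)
    have xc: "x \<in> carrier (?T i)" by (rule hc[OF *(4)])
    have nx: "\<ominus>\<^bsub>?T i\<^esub> x \<in> homog (?F i) j" using T.M_homog_neg[of x j] *(4) unfolding hom .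
    have dc: "d i y \<in> homog (?F i) j" using dD(4)[of _ i j] *(1) d[OF *(1)] unfolding hom by simp
    have ny: "\<ominus>\<^bsub>?F (Suc i)\<^esub> y \<in> homog (?F (Suc i)) j" by (rule F1.M_homog_neg[OF *(1)])
    have "graded_linear A (?F (Suc i)) (?F i) (d i)"
      unfolding d_def by (rule graded_linear_comp[OF graded_linear_comp[OF cut_linear dl] incl_linear])
    from graded_linear_zero_neg(2)[OF graded_module_free graded_module_free this free_homog_carrier[OF *(1)]]
    have dn: "d i (\<ominus>\<^bsub>?F (Suc i)\<^esub> y) = \<ominus>\<^bsub>?F i\<^esub> d i y" .
    have "w n \<in> irrelevant_ideal A" for n using mpart_free_iff[OF F.mpart_homog[OF *(2)]] *(2) by blast
    moreover have "\<ominus>\<^bsub>?F i\<^esub> w = (\<lambda>n. \<ominus> w n)"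
      using dsum_a_inv[OF selfm_module, of w] F.mpart_carrier[OF *(2)] unfolding free_def by simp
    ultimately have "\<ominus>\<^bsub>?F i\<^esub> w \<in> mpart A (?F i) j"
      using mpart_free_iff[OF F.M_homog_neg[OF F.mpart_homog[OF *(2)]]] m.a_inv_closed by simp
    moreover have "\<ominus>\<^bsub>?T i\<^esub> x = d i (\<ominus>\<^bsub>?F (Suc i)\<^esub> y) \<oplus>\<^bsub>?F i\<^esub> \<ominus>\<^bsub>?F i\<^esub> w"
    proof -
      have "\<ominus>\<^bsub>?T i\<^esub> x = \<ominus>\<^bsub>?F i\<^esub> x"
        using graded_linear_zero_neg(2)[OF free_module_graded graded_module_free incl_linear xc] by simp
      then show ?thesis unfolding dn using *(3) free_homog_carrier[OF dc] F.mpart_carrier[OF *(2)] by (simp add: F.M.minus_add)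
    qed
    ultimately show ?thesis using nx ny unfolding B cycles_bound_def by blast
  qed
  have Bc: "x \<in> carrier (?T i)" if "x \<in> ?B" for x using that hc unfolding B by blast
  have Zc: "x \<in> carrier (?T i)" if "x \<in> ?Z" for x using that hc unfolding Z by blast
  have zB: "\<zero>\<^bsub>?T i\<^esub> \<in> ?B"
  proof -
    interpret F: graded_module A "?F i" by (rule graded_module_free)
    interpret F1: graded_module A "?F (Suc i)" by (rule graded_module_free)
    have "graded_linear A (?F (Suc i)) (?F i) (d i)"
      unfolding d_def by (rule graded_linear_comp[OF graded_linear_comp[OF cut_linear dl] incl_linear])
    from graded_linear_zero_neg(1)[OF graded_module_free graded_module_free this]
    have "\<zero>\<^bsub>?F i\<^esub> = d i \<zero>\<^bsub>?F (Suc i)\<^esub> \<oplus>\<^bsub>?F i\<^esub> \<zero>\<^bsub>?F i\<^esub>" by simp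
    then have "cycles_bound (gens F) (degs F) d i j \<zero>\<^bsub>?F i\<^esub>"
      unfolding cycles_bound_def using F1.M_homog_zero[of j] mpart.mzero[of "?F i" A j] by blast
    then show ?thesis unfolding B using F.M_homog_zero[of j] by (simp add: free_simps(2) free_module_simps(2))
  qed
  have zZ: "\<zero>\<^bsub>?T i\<^esub> \<in> ?Z"
  proof -
    interpret F: graded_module A "?F i" by (rule graded_module_free)
    have "d k \<zero>\<^bsub>?T i\<^esub> \<in> mpart A (?F k) j" if "i = Suc k" for k
      using d[of "\<zero>\<^bsub>?T i\<^esub>" k j] dD(5)[of k] F.M_homog_zero[of j] that mpart.mzero[of "?F k" A j]
      by (simp add: free_simps(2) free_module_simps(2))
    then show ?thesis unfolding Z using F.M_homog_zero[of j] by (simp add: free_simps(2) free_module_simps(2))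
  qed
  let ?coset = "\<lambda>a. {h \<oplus>\<^bsub>?T i\<^esub> a | h. h \<in> ?B}"
  have Tor: "\<not> Tor_nonzero A M i j \<longleftrightarrow> ?coset ` ?Z = {?B}"
  proof -
    have "carrier (Tor A M i j) = ?coset ` ?Z" "one (Tor A M i j) = ?B"
      unfolding Tor_def Let_def F[symmetric] FactGroup_def RCOSETS_def r_coset_def term_at_def by auto
    then show ?thesis unfolding Tor_nonzero_def by simp
  qed
  have "?coset ` ?Z = {?B} \<longleftrightarrow> ?Z \<subseteq> ?B"
  proof
    assume *: "?coset ` ?Z = {?B}"
    show "?Z \<subseteq> ?B"
    proof
      fix a assume a: "a \<in> ?Z"
      have "?coset a \<in> ?coset ` ?Z" by (rule imageI[OF a])
      then have "?coset a = ?B" unfolding * by simp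
      moreover have "a = \<zero>\<^bsub>?T i\<^esub> \<oplus>\<^bsub>?T i\<^esub> a" using Zc[OF a] by simp
      then have "a \<in> ?coset a" using zB by blast
      ultimately show "a \<in> ?B" by simp
    qed
  next
    assume *: "?Z \<subseteq> ?B"
    have coset: "?coset a = ?B" if a: "a \<in> ?B" for a
    proof (intro equalityI subsetI)
      show "x \<in> ?B" if "x \<in> ?coset a" for x using that Badd a by blast
      fix x assume x: "x \<in> ?B"
      have "x = (x \<oplus>\<^bsub>?T i\<^esub> \<ominus>\<^bsub>?T i\<^esub> a) \<oplus>\<^bsub>?T i\<^esub> a" using Bc[OF x] Bc[OF a] by (simp add: T.M.a_assoc T.M.l_neg)
      then show "x \<in> ?coset a" using Badd[OF x Bneg[OF a]] by blast
    qed
    have "?coset a = ?B" if "a \<in> ?Z" for a by (rule coset[OF subsetD[OF * that]])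
    then have "?coset ` ?Z = (\<lambda>_. ?B) ` ?Z" by (rule image_cong[OF refl])
    also have "\<dots> = {?B}" using zZ by (rule image_constant)
    finally show "?coset ` ?Z = {?B}" .
  qed
  then have "\<not> Tor_nonzero A M i j \<longleftrightarrow> (\<forall>x. x \<in> ?Z \<longrightarrow> x \<in> ?B)" by (simp only: Tor subset_iff)
  then show ?thesis unfolding Z B Ball_def by (simp only: imp_conjL conj_imp_eq_imp_imp) blast
qed

text \<open>Both comparison results apply to an arbitrary resolution, in particular to the one
  selected in the definition of Tor. Vanishing above the line \<open>r + q * i\<close> up to
  \<open>p\<close> thus amounts to a resolution with generators on or below this line.\<close>

theorem Tor_vanishing_iff_lin:
  assumes M: "graded_module A M" "decomposed M c" "countably_generated A M"
  shows "0 \<le> q \<Longrightarrow> (\<And>i j. i \<le> p \<Longrightarrow> r + q * int i < j \<Longrightarrow> \<not> Tor_nonzero A M i j) \<Longrightarrow> lin A q p r M"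
    and "lin A q p r M \<Longrightarrow> i \<le> p \<Longrightarrow> r + q * int i < j \<Longrightarrow> \<not> Tor_nonzero A M i j"
proof -
  define F where "F = (SOME F. graded_free_resolution A M F)"
  have "\<exists>F. graded_free_resolution A M F"
    by (rule resolves_exists[OF M(1,3)]) (rule resolves_imp_resolution[OF M(1,2)])
  then have res: "graded_free_resolution A M F" unfolding F_def by (rule someI_ex)
  note Tor = not_Tor_nonzero_iff[OF M(1,2) F_def res]
  note res' = resolution_imp_resolves[OF M(1,2) res]
  show "lin A q p r M" if q: "0 \<le> q" and *: "\<And>i j. i \<le> p \<Longrightarrow> r + q * int i < j \<Longrightarrow> \<not> Tor_nonzero A M i j"
    by (rule cycles_bound_imp_lin[OF q res' M(1,3)]) (use * Tor in blast)
  show "\<not> Tor_nonzero A M i j" if *: "lin A q p r M" "i \<le> p" "r + q * int i < j"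
    unfolding Tor using lin_imp_cycles_bound[OF res' M(1) *] by blast
qed

end

subsection \<open>Graded algebras over a field\<close>

text \<open>The common setting for \<open>D\<close>, its quotients, their Veronese subalgebras and
  polynomial rings. \<open>homog_0\<close> asks for the image of \<open>K\<close> and not for a
  bijection, so that the quotient by the unit ideal is included.\<close>

locale graded_algebra = graded_ring A + D?: decomposed A comp
  for K :: "'k ring" and A :: "('k, 'b) graded" (structure) and comp +
  assumes field_K: "field K" and algebra_KA: "algebra K A"
    and neg_homog': "i < 0 \<Longrightarrow> homog A i = {\<zero>}"
    and homog_0: "homog A 0 = (\<lambda>k. k \<odot>\<^bsub>A\<^esub> \<one>) ` carrier K"
begin

sublocale K: field K by (rule field_K)
sublocale KA: algebra K A by (rule algebra_KA)

lemma smult_eq: "k \<in> carrier K \<Longrightarrow> x \<in> carrier A \<Longrightarrow> k \<odot>\<^bsub>A\<^esub> x = (k \<odot>\<^bsub>A\<^esub> \<one>) \<otimes> x"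
  using KA.smult_assoc2[of k \<one> x] by simp

lemma smult_homog: "k \<in> carrier K \<Longrightarrow> x \<in> homog A i \<Longrightarrow> k \<odot>\<^bsub>A\<^esub> x \<in> homog A i"
  using mult_homog[of "k \<odot>\<^bsub>A\<^esub> \<one>" 0 x i] smult_eq[of k x] homog_carrier[of x i] by (simp add: homog_0)

lemma units': "\<forall>a \<in> homog A 0. a \<noteq> \<zero> \<longrightarrow> (\<exists>b \<in> homog A 0. b \<otimes> a = \<one>)"
proof (intro ballI impI)
  fix a assume a: "a \<in> homog A 0" "a \<noteq> \<zero>"
  then obtain k where k: "k \<in> carrier K" "a = k \<odot>\<^bsub>A\<^esub> \<one>" unfolding homog_0 by blast
  then have "k \<noteq> \<zero>\<^bsub>K\<^esub>" using a(2) by (auto simp: KA.smult_l_null)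
  then have u: "inv\<^bsub>K\<^esub> k \<in> carrier K" "inv\<^bsub>K\<^esub> k \<otimes>\<^bsub>K\<^esub> k = \<one>\<^bsub>K\<^esub>"
    using k(1) K.field_Units by auto
  have "(inv\<^bsub>K\<^esub> k \<odot>\<^bsub>A\<^esub> \<one>) \<otimes> a = inv\<^bsub>K\<^esub> k \<odot>\<^bsub>A\<^esub> a"
    using smult_eq[OF u(1), of a] homog_carrier[OF a(1)] by simp
  also have "\<dots> = \<one>" unfolding k(2) using KA.smult_assoc1[OF u(1) k(1), of \<one>] u(2) by simp
  finally show "\<exists>b \<in> homog A 0. b \<otimes> a = \<one>" using u(1) unfolding homog_0 by blast
qed

lemma decomposed_ring:
  assumes "countably_generated A (selfm A)"
  shows "decomposed_ring A comp"
  by (intro decomposed_ring.intro connected_ring.intro connected_ring_axioms.intro graded_ring_axioms decomposed_axioms neg_homog' units' assms)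

end

lemma decomposed_cong:
  assumes "decomposed M c" "carrier N = carrier M" "add N = add M" "zero N = zero M" "homog N = homog M"
  shows "decomposed N c"
proof -
  interpret M: decomposed M c by fact
  have hs: "hspan N = hspan M"
  proof (intro equalityI subsetI)
    show "x \<in> hspan M" if "x \<in> hspan N" for x
      using that
    proof induction
      case hzero then show ?case using hspan.hzero[of M] by (simp add: assms)
    next
      case (hadd x h i) then show ?case using hspan.hadd[of x M h i] by (simp add: assms)
    qed
    show "x \<in> hspan N" if "x \<in> hspan M" for x
      using that
    proof induction
      case hzero then show ?case using hspan.hzero[of N] by (simp add: assms)
    next
      case (hadd x h i) then show ?case using hspan.hadd[of x N h i] by (simp add: assms)
    qed
  qed
  have ag: "abelian_group N" by (rule abelian_group_cong[OF M.abelian_group_axioms]) (simp_all add: assms)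
  have "additive_subgroup (homog N i) N" for i
    using additive_subgroup.a_Hcarr[OF M.subgroup_homog] additive_subgroup.zero_closed[OF M.subgroup_homog]
      additive_subgroup.a_closed[OF M.subgroup_homog] additive_subgroup.a_inv_closed[OF M.subgroup_homog] 
      a_inv_cong[OF assms(2-4)]
    by (intro additive_subgroupI'[OF ag]) (auto simp: assms)
  then show ?thesis
    by (intro decomposed.intro decomposed_axioms.intro ag)
      (auto simp: assms hs M.carrier_hspan M.comp_add M.comp_same M.comp_other)
qed

lemma countably_generated_image:
  assumes "graded_module A M" "graded_module A N" "graded_linear A M N f" "\<And>j. homog N j \<subseteq> f ` homog M j" "countably_generated A M"
  shows "countably_generated A N"
  unfolding countably_generated_def
proof
  fix j
  interpret M: graded_module A M by fact
  interpret N: graded_module A N by fact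
  obtain V where V: "countable V" "V \<subseteq> homog M j" "homog M j \<subseteq> cspan A M V"
    using assms(5) unfolding countably_generated_def by (elim allE[of _ j] exE conjE)
  have f: "f x \<in> cspan A N (f ` V)" if "x \<in> cspan A M V" for x
    using that
  proof induction
    case czero
    then show ?case using graded_linear_zero_neg(1)[OF assms(1-3)] cspan.czero[of N A "f ` V"] by simp
  next
    case (cadd y a v)
    have "f (y \<oplus>\<^bsub>M\<^esub> a \<odot>\<^bsub>M\<^esub> v) = f y \<oplus>\<^bsub>N\<^esub> a \<odot>\<^bsub>N\<^esub> f v"
      using M.M_homog_carrier[OF M.cspan_homog[OF V(2) cadd(1)]] M.M_homog_carrier[of v j] V(2) cadd(3) M.homog_carrier[OF cadd(2)]
      by (simp add: graded_linearD[OF assms(3)] subset_iff)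
    then show ?case using cspan.cadd[OF cadd(4,2), of "f v"] cadd(3) by simp
  qed
  show "\<exists>V. countable V \<and> V \<subseteq> homog N j \<and> homog N j \<subseteq> cspan A N V"
  proof (intro exI conjI)
    show "countable (f ` V)" using V(1) by simp
    show "f ` V \<subseteq> homog N j" using V(2) graded_linearD(4)[OF assms(3)] by blast
    show "homog N j \<subseteq> cspan A N (f ` V)" using assms(4)[of j] V(3) f by blast
  qed
qed

subsection \<open>Standard graded algebras\<close>

primrec words :: "('a, 'r, 'z) graded_scheme \<Rightarrow> 'r set \<Rightarrow> nat \<Rightarrow> 'r set" where
  "words A S 0 = {\<one>\<^bsub>A\<^esub>}"
| "words A S (Suc n) = (\<lambda>(s, w). s \<otimes>\<^bsub>A\<^esub> w) ` (S \<times> words A S n)"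

lemma finite_words: "finite S \<Longrightarrow> finite (words A S n)"
  by (induction n) auto

context graded_ring
begin

lemma words_homog: "S \<subseteq> homog A 1 \<Longrightarrow> words A S n \<subseteq> homog A (int n)"
  using one_homog mult_homog[of _ 1 _ "int _"] by (induction n) (auto, force)

lemma words_carrier: "S \<subseteq> homog A 1 \<Longrightarrow> w \<in> words A S n \<Longrightarrow> w \<in> carrier A"
  using words_homog homog_carrier by blast

lemma words_mult:
  assumes S: "S \<subseteq> homog A 1"
  shows "u \<in> words A S m \<Longrightarrow> v \<in> words A S n \<Longrightarrow> u \<otimes> v \<in> words A S (m + n)"
proof (induction m arbitrary: u)
  case 0 then show ?case using words_carrier[OF S 0(2)] by simp
next
  case (Suc m)
  then obtain s w where *: "u = s \<otimes> w" "s \<in> S" "w \<in> words A S m" by auto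
  have "u \<otimes> v = s \<otimes> (w \<otimes> v)"
    using * S homog_carrier[of s 1] words_carrier[OF S *(3)] words_carrier[OF S Suc(3)] by (simp add: m_assoc subset_iff)
  then show ?case using Suc.IH[OF *(3) Suc(3)] *(2) by auto
qed

lemma words_split:
  assumes S: "S \<subseteq> homog A 1"
  shows "w \<in> words A S (m + n) \<Longrightarrow> \<exists>u \<in> words A S m. \<exists>v \<in> words A S n. w = u \<otimes> v"
proof (induction m arbitrary: w)
  case 0 then show ?case using words_carrier[OF S] by auto
next
  case (Suc m)
  then obtain s x where *: "w = s \<otimes> x" "s \<in> S" "x \<in> words A S (m + n)" by auto
  obtain u v where **: "u \<in> words A S m" "v \<in> words A S n" "x = u \<otimes> v" using Suc.IH[OF *(3)] by blast
  have "w = (s \<otimes> u) \<otimes> v" using * ** S homog_carrier[of s 1] words_carrier[OF S **(1)] words_carrier[OF S **(2)] by (simp add: m_assoc subset_iff)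
  moreover have "s \<otimes> u \<in> words A S (Suc m)" using *(2) **(1) by auto
  ultimately show ?case using **(2) by blast
qed

end

inductive_set spansum :: "('a, 'r, 'z) graded_scheme \<Rightarrow> 'r set \<Rightarrow> 'r set" for A and S where
  szero: "\<zero>\<^bsub>A\<^esub> \<in> spansum A S"
| sadd: "\<lbrakk> x \<in> spansum A S; h \<in> cspan A (selfm A) (words A S n) \<rbrakk> \<Longrightarrow> x \<oplus>\<^bsub>A\<^esub> h \<in> spansum A S"

locale standard_generators = graded_ring A + D?: decomposed A comp for A :: "('a, 'b, 'z) graded_scheme" (structure) and comp +
  fixes S
  assumes S: "S \<subseteq> homog A 1" and gen: "generate_ring A (homog A 0 \<union> S) = carrier A"
    and neg_homog': "i < 0 \<Longrightarrow> homog A i = {\<zero>}"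
begin

sublocale M: graded_module A "selfm A" by (rule graded_module_selfm)

lemma WS: "words A S n \<subseteq> homog (selfm A) (int n)"
  using words_homog[OF S] by simp

lemma cs_homog: "h \<in> cspan A (selfm A) (words A S n) \<Longrightarrow> h \<in> homog A (int n)"
  using M.cspan_homog[OF WS] by simp

lemma cs_carrier: "h \<in> cspan A (selfm A) (words A S n) \<Longrightarrow> h \<in> carrier A"
  using cs_homog homog_carrier by blast

lemma sp_carrier: "x \<in> spansum A S \<Longrightarrow> x \<in> carrier A"
  by (induction rule: spansum.induct) (auto intro: cs_carrier)

lemma cs_word_mult:
  assumes w: "w \<in> words A S m" and h: "h \<in> cspan A (selfm A) (words A S n)"
  shows "w \<otimes> h \<in> cspan A (selfm A) (words A S (m + n))"
  using h
proof induction
  case czero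
  then show ?case using words_carrier[OF S w] cspan.czero[of "selfm A"] by simp
next
  case (cadd y a v)
  have "w \<otimes> (y \<oplus>\<^bsub>selfm A\<^esub> a \<odot>\<^bsub>selfm A\<^esub> v) = w \<otimes> y \<oplus>\<^bsub>selfm A\<^esub> a \<odot>\<^bsub>selfm A\<^esub> (w \<otimes> v)"
    using words_carrier[OF S w] cs_carrier[OF cadd(1)] homog_carrier[OF cadd(2)] words_carrier[OF S cadd(3)]
    by (simp add: r_distr m_lcomm)
  then show ?case using cspan.cadd[OF cadd(4,2) words_mult[OF S w cadd(3)]] by simp
qed

lemma cs_mult:
  assumes g: "g \<in> cspan A (selfm A) (words A S m)" and h: "h \<in> cspan A (selfm A) (words A S n)"
  shows "g \<otimes> h \<in> cspan A (selfm A) (words A S (m + n))"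
  using g
proof induction
  case czero
  then show ?case using cs_carrier[OF h] cspan.czero[of "selfm A"] by simp
next
  case (cadd y a v)
  have "(y \<oplus>\<^bsub>selfm A\<^esub> a \<odot>\<^bsub>selfm A\<^esub> v) \<otimes> h = y \<otimes> h \<oplus>\<^bsub>selfm A\<^esub> a \<odot>\<^bsub>selfm A\<^esub> (v \<otimes> h)"
    using cs_carrier[OF h] cs_carrier[OF cadd(1)] homog_carrier[OF cadd(2)] words_carrier[OF S cadd(3)]
    by (simp add: l_distr m_assoc)
  then show ?case
    using M.cspan_add[OF WS cadd(4) M.cspan_smult[OF WS cadd(2) cs_word_mult[OF cadd(3) h]]] by simp
qed

lemma sp_add: "x \<in> spansum A S \<Longrightarrow> y \<in> spansum A S \<Longrightarrow> x \<oplus> y \<in> spansum A S"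
proof -
  assume x: "x \<in> spansum A S" and y: "y \<in> spansum A S"
  show ?thesis using y
  proof induction
    case szero then show ?case using x sp_carrier[OF x] by simp
  next
    case (sadd y h n)
    have "x \<oplus> (y \<oplus> h) = (x \<oplus> y) \<oplus> h" using sp_carrier[OF x] sp_carrier[OF sadd(1)] cs_carrier[OF sadd(2)] by (simp add: a_assoc)
    then show ?case using spansum.sadd[OF sadd(3,2)] by simp
  qed
qed

lemma sp_incl: "h \<in> cspan A (selfm A) (words A S n) \<Longrightarrow> h \<in> spansum A S"
  using spansum.sadd[OF spansum.szero, of h A S n] cs_carrier by simp

lemma sp_mult: 
  assumes x: "x \<in> spansum A S" and y: "y \<in> spansum A S"
  shows "x \<otimes> y \<in> spansum A S"
  using x
proof induction
  case szero then show ?case using sp_carrier[OF y] spansum.szero by simp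
next
  case (sadd x h n)
  have "h \<otimes> y \<in> spansum A S"
    using y
  proof induction
    case szero then show ?case using cs_carrier[OF sadd(2)] spansum.szero by simp
  next
    case (sadd y' g m)
    then show ?case using spansum.sadd[OF sadd(3) cs_mult[OF \<open>h \<in> cspan A (selfm A) (words A S n)\<close> sadd(2)]]
      cs_carrier[OF \<open>h \<in> cspan A (selfm A) (words A S n)\<close>] sp_carrier[OF sadd(1)] cs_carrier[OF sadd(2)] by (simp add: r_distr)
  qed
  then show ?case using sp_add[OF sadd(3)] sp_carrier[OF y] sp_carrier[OF sadd(1)] cs_carrier[OF sadd(2)] by (simp add: l_distr)
qed

text \<open>\<open>spansum A S\<close> is closed under the ring operations and contains degree 0 and
  \<open>S\<close>, hence everything that these generate.\<close>

lemma carrier_spansum: "carrier A \<subseteq> spansum A S"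
proof
  fix x assume "x \<in> carrier A"
  then have "x \<in> generate_ring A (homog A 0 \<union> S)" using gen by simp
  then show "x \<in> spansum A S"
  proof induction
    case one
    show ?case using M.cspan_incl[OF WS[of 0], of \<one>] sp_incl[of \<one> 0] by simp
  next
    case (incl h)
    then show ?case
    proof
      assume h: "h \<in> homog A 0"
      have "h \<odot>\<^bsub>selfm A\<^esub> \<one> \<in> cspan A (selfm A) (words A S 0)"
        using M.cspan_smult[OF WS[of 0] h M.cspan_incl[OF WS[of 0], of \<one>]] by simp
      then show ?case using sp_incl[of h 0] homog_carrier[OF h] by simp
    next
      assume h: "h \<in> S"
      then have "h \<in> words A S 1" using S homog_carrier[of h 1] by (auto intro!: image_eqI[of _ _ "(h, \<one>)"])
      then show ?case using sp_incl[of h 1] M.cspan_incl[OF WS[of 1]] by blast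
    qed
  next
    case (a_inv h)
    have "\<ominus> \<one> \<in> cspan A (selfm A) (words A S 0)"
      using M.cspan_smult[OF WS[of 0] additive_subgroup.a_inv_closed[OF homog_subgroup one_homog] M.cspan_incl[OF WS[of 0], of \<one>]] by simp
    then have "(\<ominus> \<one>) \<otimes> h \<in> spansum A S" by (intro sp_mult sp_incl[of _ 0] a_inv)
    then show ?case using sp_carrier[OF a_inv(2)] by (simp add: l_minus)
  qed (auto intro: sp_add sp_mult)
qed

text \<open>Take the degree \<open>n\<close> component of an expansion into words: words of length
  \<open>m\<close> have degree \<open>m\<close>, so only those of length \<open>n\<close>
  survive.\<close>

lemma homog_span: "homog A (int n) \<subseteq> cspan A (selfm A) (words A S n)"
proof
  have "comp (int n) x \<in> cspan A (selfm A) (words A S n)" if "x \<in> spansum A S" for x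
    using that
  proof induction
    case szero then show ?case using cspan.czero[of "selfm A"] by (simp add: D.comp_zero)
  next
    case (sadd x h m)
    have "comp (int n) h \<in> cspan A (selfm A) (words A S n)"
      using sadd(2) D.comp_same[OF cs_homog[OF sadd(2)]] D.comp_other[OF cs_homog[OF sadd(2)], of "int n"] cspan.czero[of "selfm A"]
      by (cases "m = n") auto
    then show ?case using M.cspan_add[OF WS sadd(3)] sp_carrier[OF sadd(1)] cs_carrier[OF sadd(2)] by (simp add: D.comp_add)
  qed
  moreover fix x assume "x \<in> homog A (int n)"
  ultimately show "x \<in> cspan A (selfm A) (words A S n)" using D.comp_same[of x "int n"] carrier_spansum homog_carrier by fastforce
qed

lemma countably_generated_selfm:
  assumes "finite S"
  shows "countably_generated A (selfm A)"
  unfolding countably_generated_def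
proof
  fix j
  show "\<exists>V. countable V \<and> V \<subseteq> homog (selfm A) j \<and> homog (selfm A) j \<subseteq> cspan A (selfm A) V"
  proof (cases "j < 0")
    case True
    then show ?thesis using neg_homog'[OF True] cspan.czero[of "selfm A" A "{}"] by (intro exI[of _ "{}"]) auto
  next
    case False
    then show ?thesis using homog_span[of "nat j"] WS[of "nat j"] countable_finite[OF finite_words[OF assms, of A "nat j"]]
      by (intro exI[of _ "words A S (nat j)"]) auto
  qed
qed

text \<open>A word of positive length is a generator times a shorter word, so the irrelevant ideal
  is generated in degree 1. This supplies the cover \<open>g\<close> in
  \<open>veronese_modules_linear\<close>.\<close>

lemma cover_irrelevant:
  assumes "finite S"
  shows "\<exists>(I :: nat set) g. cover A I (\<lambda>_. 1) g ((selfm A)\<lparr>homog := \<lambda>j. if j \<ge> 1 then homog A j else {\<zero>}\<rparr>)"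
proof -
  let ?m = "(selfm A)\<lparr>homog := \<lambda>j. if j \<ge> 1 then homog A j else {\<zero>}\<rparr>"
  have gmm: "graded_module A ?m"
  proof (rule graded_moduleI[OF graded_ring_axioms])
    fix i j a x assume a: "a \<in> homog A i" and x: "x \<in> homog ?m j"
    show "a \<odot>\<^bsub>?m\<^esub> x \<in> homog ?m (i + j)"
    proof (cases "j \<ge> 1 \<and> i \<ge> 0")
      case True
      then show ?thesis using mult_homog[OF a, of x j] x by simp
    next
      case False
      then have "x = \<zero> \<or> a = \<zero>" using x a neg_homog'[of i] by (auto split: if_splits)
      then have "a \<otimes> x = \<zero>" using homog_carrier[OF a] x homog_carrier by (auto split: if_splits)
      then show ?thesis using homog_zero by simp
    qed
  qed (use M.M_homog_closed in \<open>auto simp: selfm_module homog_carrier homog_zero\<close>)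
  interpret m: graded_module A ?m by (rule gmm)
  have c: "countable ({1 :: int} \<times> S)" using assms by (intro countable_finite) simp
  have h: "v \<in> homog ?m j" if "(j, v) \<in> {1 :: int} \<times> S" for j v using that S by auto
  obtain I :: "nat set" and s g where g: "graded_linear A (free A I s) ?m g"
    "\<And>n. n \<in> I \<Longrightarrow> \<exists>v. (s n, v) \<in> {1} \<times> S" "\<And>j v. (j, v) \<in> {1} \<times> S \<Longrightarrow> v \<in> g ` homog (free A I s) j"
    by (rule gens_map[OF gmm c h]) (assumption, rule that)
  \<comment> \<open>The values of \<open>s\<close> outside \<open>I\<close> do not enter
    \<open>free\<close>, so \<open>s\<close> may be replaced by the constant 1.\<close>
  have f: "free A I s = free A I (\<lambda>_. 1)"
    using g(2) by (simp add: free_def dsum_def Let_def cong: ball_cong)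
  interpret F: graded_module A "free A I s" by (rule graded_module_free)
  note gD = graded_linearD[OF g(1)]
  have words: "words A S (Suc n) \<subseteq> g ` homog (free A I s) (int (Suc n))" for n
  proof
    fix x assume "x \<in> words A S (Suc n)"
    then obtain t w where *: "x = t \<otimes> w" "t \<in> S" "w \<in> words A S n" by auto
    obtain y where y: "y \<in> homog (free A I s) 1" "g y = t" using g(3)[of 1 t] *(2) by auto
    have w: "w \<in> homog A (int n)" using words_homog[OF S] *(3) by blast
    have "g (w \<odot>\<^bsub>free A I s\<^esub> y) = x"
      using gD(3)[OF homog_carrier[OF w] free_homog_carrier[OF y(1)]] y(2) * S homog_carrier[of t 1] homog_carrier[OF w]
      by (simp add: m_comm subset_iff)
    then show "x \<in> g ` homog (free A I s) (int (Suc n))"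
      using F.smult_homog'[OF w y(1), of "int (Suc n)"] by (intro image_eqI[of _ _ "w \<odot>\<^bsub>free A I s\<^esub> y"]) auto
  qed
  have "homog ?m j \<subseteq> g ` homog (free A I s) j" for j
  proof (cases "j \<ge> 1")
    case False
    then show ?thesis using graded_linear_zero_neg(1)[OF graded_module_free gmm g(1)] F.M_homog_zero[of j]
      by (auto intro!: image_eqI[of _ _ "\<zero>\<^bsub>free A I s\<^esub>"])
  next
    case True
    then have n': "j = int (Suc (nat (j - 1)))" by simp
    define n where "n = nat (j - 1)"
    have n: "j = int (Suc n)" using n' unfolding n_def .
    have "cspan A (selfm A) (words A S (Suc n)) = cspan A ?m (words A S (Suc n))"
    proof (intro equalityI subsetI)
      show "x \<in> cspan A ?m (words A S (Suc n))" if "x \<in> cspan A (selfm A) (words A S (Suc n))" for x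
        using that
      proof induction
        case czero show ?case using cspan.czero[of ?m] by simp
      next
        case (cadd y a v) then show ?case using cspan.cadd[of y A ?m _ a v] by simp
      qed
      show "x \<in> cspan A (selfm A) (words A S (Suc n))" if "x \<in> cspan A ?m (words A S (Suc n))" for x
        using that
      proof induction
        case czero show ?case using cspan.czero[of "selfm A"] by simp
      next
        case (cadd y a v) then show ?case using cspan.cadd[of y A "selfm A" _ a v] by simp
      qed
    qed
    then show ?thesis using image_cspan[OF gmm graded_module_free g(1) words[of n]] homog_span[of "Suc n"] True unfolding n by auto
  qed
  then have "cover A I s g ?m" unfolding cover_def using g(1) by blast
  then show ?thesis unfolding f cover_def by blast
qed

end

subsection \<open>Quotients\<close>

lemma quot_algebra_simps:
  "carrier (quot_algebra A J) = carrier (A Quot J)" "monoid.mult (quot_algebra A J) = monoid.mult (A Quot J)"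
  "one (quot_algebra A J) = one (A Quot J)" "zero (quot_algebra A J) = zero (A Quot J)" "add (quot_algebra A J) = add (A Quot J)"
  "smult (quot_algebra A J) = (\<lambda>a C. \<Union>x\<in>C. J +>\<^bsub>A\<^esub> (a \<odot>\<^bsub>A\<^esub> x))"
  "homog (quot_algebra A J) = (\<lambda>i. (\<lambda>x. J +>\<^bsub>A\<^esub> x) ` homog A i)"
  by (simp_all add: quot_algebra_def)

locale graded_quotient = graded_algebra K A comp for K :: "'k ring" and A :: "('k, 'b) graded" (structure) and comp +
  fixes J
  assumes ideal_J: "ideal J A" and comp_J: "x \<in> J \<Longrightarrow> comp i x \<in> J"
begin

sublocale J: ideal J A by (rule ideal_J)

abbreviation "Q \<equiv> quot_algebra A J"
abbreviation "pr \<equiv> \<lambda>x. J +> x"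

lemma Q_cring: "cring (A Quot J)"
  by (rule J.quotient_is_cring[OF is_cring])

lemma Q_hom: "pr \<in> ring_hom A (A Quot J)" by (rule J.rcos_ring_hom)

lemma Q_homD:
  "x \<in> carrier A \<Longrightarrow> pr x \<in> carrier Q" "x \<in> carrier A \<Longrightarrow> y \<in> carrier A \<Longrightarrow> pr (x \<otimes> y) = pr x \<otimes>\<^bsub>Q\<^esub> pr y"
  "x \<in> carrier A \<Longrightarrow> y \<in> carrier A \<Longrightarrow> pr (x \<oplus> y) = pr x \<oplus>\<^bsub>Q\<^esub> pr y" "pr \<one> = \<one>\<^bsub>Q\<^esub>"
  using ring_hom_closed[OF Q_hom] ring_hom_mult[OF Q_hom] ring_hom_add[OF Q_hom] ring_hom_one[OF Q_hom]
  by (simp_all add: quot_algebra_simps)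

lemma Q_surj: "C \<in> carrier Q \<Longrightarrow> \<exists>x \<in> carrier A. C = pr x"
  by (auto simp: quot_algebra_simps FactRing_def A_RCOSETS_def')

lemma pr_eq_zero: "x \<in> carrier A \<Longrightarrow> pr x = \<zero>\<^bsub>Q\<^esub> \<longleftrightarrow> x \<in> J"
  using J.a_rcos_const J.rcos_const_imp_mem by (auto simp: quot_algebra_simps FactRing_def)

lemma Q_ring: "cring Q"
proof -
  interpret Q: cring "A Quot J" by (rule Q_cring)
  have "abelian_group Q" by (rule abelian_group_cong[OF Q.abelian_group_axioms]) (simp_all add: quot_algebra_simps)
  then show ?thesis 
    by (intro cringI comm_monoidI) (simp_all add: quot_algebra_simps Q.m_assoc Q.l_distr, simp add: Q.m_comm)
qed

sublocale Qr: cring Q by (rule Q_ring)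

lemma pr_zero: "pr \<zero> = \<zero>\<^bsub>Q\<^esub>" using pr_eq_zero[of \<zero>] J.zero_closed by simp

lemma pr_neg: "x \<in> carrier A \<Longrightarrow> pr (\<ominus> x) = \<ominus>\<^bsub>Q\<^esub> pr x"
  using Q_homD(3)[of "\<ominus> x" x] pr_zero Q_homD(1) by (intro Qr.minus_equality[symmetric]) (auto simp: l_neg)

lemma Q_graded_ring: "graded_ring Q"
proof (intro graded_ring.intro Q_ring graded_ring_axioms.intro)
  show "additive_subgroup (homog Q i) Q" for i
  proof (rule additive_subgroupI'[OF Qr.abelian_group_axioms])
    show "homog Q i \<subseteq> carrier Q" using Q_homD(1) homog_carrier by (auto simp: quot_algebra_simps(7))
    show "\<zero>\<^bsub>Q\<^esub> \<in> homog Q i" using homog_zero[of i] pr_zero by (auto simp: quot_algebra_simps(7) intro: image_eqI[of _ _ \<zero>])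
    fix C assume "C \<in> homog Q i"
    then obtain x where x: "x \<in> homog A i" "C = pr x" by (auto simp: quot_algebra_simps(7))
    show "\<ominus>\<^bsub>Q\<^esub> C \<in> homog Q i"
      using pr_neg[OF homog_carrier[OF x(1)]] additive_subgroup.a_inv_closed[OF homog_subgroup x(1)] x(2)
      by (auto simp: quot_algebra_simps(7))
    fix C' assume "C' \<in> homog Q i"
    then obtain y where y: "y \<in> homog A i" "C' = pr y" by (auto simp: quot_algebra_simps(7))
    show "C \<oplus>\<^bsub>Q\<^esub> C' \<in> homog Q i"
      using Q_homD(3)[OF homog_carrier[OF x(1)] homog_carrier[OF y(1)]] additive_subgroup.a_closed[OF homog_subgroup x(1) y(1)] x(2) y(2)
      by (metis (no_types, lifting) imageI quot_algebra_simps(7))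
  qed
  show "\<one>\<^bsub>Q\<^esub> \<in> homog Q 0" using one_homog Q_homD(4) by (auto simp: quot_algebra_simps(7) intro: image_eqI[of _ _ \<one>])
  fix C C' i j assume "C \<in> homog Q i" "C' \<in> homog Q j"
  then obtain x y where x: "x \<in> homog A i" "C = pr x" and y: "y \<in> homog A j" "C' = pr y" by (auto simp: quot_algebra_simps(7))
  then show "C \<otimes>\<^bsub>Q\<^esub> C' \<in> homog Q (i + j)"
    using Q_homD(2)[OF homog_carrier[OF x(1)] homog_carrier[OF y(1)]] mult_homog[OF x(1) y(1)]
    by (metis (no_types, lifting) imageI quot_algebra_simps(7))
qed

text \<open>The component of an arbitrary representative; \<open>Qcomp_pr\<close> shows independence
  of the choice, as components of elements of \<open>J\<close> lie in \<open>J\<close>.\<close>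

definition Qcomp :: "int \<Rightarrow> 'b set \<Rightarrow> 'b set" where
  "Qcomp i C = pr (comp i (SOME x. x \<in> carrier A \<and> C = pr x))"

lemma Qcomp_pr:
  assumes x: "x \<in> carrier A"
  shows "Qcomp i (pr x) = pr (comp i x)"
proof -
  define y where "y = (SOME y. y \<in> carrier A \<and> pr x = pr y)"
  have y: "y \<in> carrier A \<and> pr x = pr y" unfolding y_def by (rule someI[of _ x]) (use x in simp)
  let ?z = "x \<oplus> \<ominus> y"
  have "pr ?z = pr y \<oplus>\<^bsub>Q\<^esub> \<ominus>\<^bsub>Q\<^esub> pr y" using Q_homD(3)[of x "\<ominus> y"] pr_neg[of y] x y by simp
  then have "?z \<in> J" using pr_eq_zero[of ?z] x y Q_homD(1)[of y] by (simp add: Qr.r_neg)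
  then have "comp i ?z \<in> J" by (rule comp_J)
  then have z: "pr (comp i ?z) = \<zero>\<^bsub>Q\<^esub>" using pr_eq_zero x y D.comp_carrier by simp
  have "x = ?z \<oplus> y" using x y by (simp add: a_assoc l_neg)
  then have "comp i x = comp i ?z \<oplus> comp i y" using D.comp_add[of ?z y i] x y by simp
  then have "pr (comp i x) = pr (comp i y)" using z Q_homD(3)[of "comp i ?z" "comp i y"] Q_homD(1)[of "comp i y"] x y D.comp_carrier by simp
  then show ?thesis unfolding Qcomp_def y_def by simp
qed

lemma Q_decomposed: "decomposed Q Qcomp"
proof (intro decomposed.intro decomposed_axioms.intro Qr.abelian_group_axioms)
  show "additive_subgroup (homog Q i) Q" for i using graded_ring.homog_subgroup[OF Q_graded_ring] .
  show "C \<in> hspan Q" if C: "C \<in> carrier Q" for C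
  proof -
    obtain x where x: "x \<in> carrier A" "C = pr x" using Q_surj[OF C] by blast
    have "pr x \<in> hspan Q"
      using x(1)
    proof (induction rule: D.carrier_induct)
      case zero show ?case unfolding pr_zero by (rule hspan.hzero)
    next
      case (add x h i)
      then show ?case using hspan.hadd[OF add(3), of "pr h" i] Q_homD(3)[OF add(1) homog_carrier[OF add(2)]] 
        by (simp add: quot_algebra_simps(7))
    qed
    then show ?thesis using x(2) by simp
  qed
  show "Qcomp i (C \<oplus>\<^bsub>Q\<^esub> C') = Qcomp i C \<oplus>\<^bsub>Q\<^esub> Qcomp i C'" if CC: "C \<in> carrier Q" "C' \<in> carrier Q" for C C' i
  proof -
    obtain x where x: "x \<in> carrier A" "C = pr x" using Q_surj[OF CC(1)] by blast
    obtain y where y: "y \<in> carrier A" "C' = pr y" using Q_surj[OF CC(2)] by blast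
    show ?thesis using x y Qcomp_pr[of "x \<oplus> y" i] Qcomp_pr[of x i] Qcomp_pr[of y i] Q_homD(3)[of x y] 
      Q_homD(3)[of "comp i x" "comp i y"] D.comp_carrier by (simp add: D.comp_add)
  qed
  show "Qcomp i C = C" if C: "C \<in> homog Q i" for C i
  proof -
    obtain x where x: "x \<in> homog A i" "C = pr x" using C by (auto simp: quot_algebra_simps(7))
    then show ?thesis using Qcomp_pr[OF homog_carrier[OF x(1)], of i] D.comp_same[OF x(1)] by simp
  qed
  show "Qcomp i C = \<zero>\<^bsub>Q\<^esub>" if C: "C \<in> homog Q j" "i \<noteq> j" for C i j
  proof -
    obtain x where x: "x \<in> homog A j" "C = pr x" using C by (auto simp: quot_algebra_simps(7))
    then show ?thesis using Qcomp_pr[OF homog_carrier[OF x(1)], of i] D.comp_other[OF x(1) C(2)] pr_zero by simp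
  qed
qed

text \<open>Scalar multiplication on the quotient is defined as a union over all representatives.
  Each of them yields the same coset because \<open>J\<close> is stable under scalars.\<close>

lemma Q_smult:
  assumes k: "k \<in> carrier K" and x: "x \<in> carrier A"
  shows "k \<odot>\<^bsub>Q\<^esub> pr x = pr (k \<odot>\<^bsub>A\<^esub> x)"
proof -
  have "pr (k \<odot>\<^bsub>A\<^esub> y) = pr (k \<odot>\<^bsub>A\<^esub> x)" if y: "y \<in> pr x" for y
  proof -
    obtain j where j: "j \<in> J" "y = j \<oplus> x" using y by (auto simp: a_r_coset_def')
    have "(k \<odot>\<^bsub>A\<^esub> \<one>) \<otimes> j \<in> J" using J.I_l_closed[OF j(1)] k by simp
    then have kj: "k \<odot>\<^bsub>A\<^esub> j \<in> J" using smult_eq[OF k, of j] J.a_Hcarr[OF j(1)] by simp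
    have "k \<odot>\<^bsub>A\<^esub> y = k \<odot>\<^bsub>A\<^esub> j \<oplus> k \<odot>\<^bsub>A\<^esub> x" using j k x J.a_Hcarr[OF j(1)] by (simp add: KA.smult_r_distr)
    then show ?thesis using Q_homD(3)[of "k \<odot>\<^bsub>A\<^esub> j" "k \<odot>\<^bsub>A\<^esub> x"] pr_eq_zero[of "k \<odot>\<^bsub>A\<^esub> j"] kj k x J.a_Hcarr[OF j(1)]
      Q_homD(1)[of "k \<odot>\<^bsub>A\<^esub> x"] by simp
  qed
  moreover have "x \<in> pr x" using J.a_rcos_self[OF x] .
  ultimately show ?thesis unfolding quot_algebra_simps(6) by blast
qed

lemma Q_graded_algebra: "graded_algebra K Q Qcomp"
proof (intro graded_algebra.intro Q_graded_ring Q_decomposed graded_algebra_axioms.intro field_K)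
  have m: "module K Q"
  proof (rule moduleI[OF K.is_cring Qr.abelian_group_axioms])
    fix a C assume a: "a \<in> carrier K" and "C \<in> carrier Q"
    then obtain x where x: "x \<in> carrier A" "C = pr x" using Q_surj by blast
    show "a \<odot>\<^bsub>Q\<^esub> C \<in> carrier Q" using Q_smult[OF a x(1)] Q_homD(1) a x by simp
    fix b assume b: "b \<in> carrier K"
    show "(a \<oplus>\<^bsub>K\<^esub> b) \<odot>\<^bsub>Q\<^esub> C = a \<odot>\<^bsub>Q\<^esub> C \<oplus>\<^bsub>Q\<^esub> b \<odot>\<^bsub>Q\<^esub> C"
      using a b x by (simp add: Q_smult KA.smult_l_distr Q_homD)
    show "(a \<otimes>\<^bsub>K\<^esub> b) \<odot>\<^bsub>Q\<^esub> C = a \<odot>\<^bsub>Q\<^esub> (b \<odot>\<^bsub>Q\<^esub> C)"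
      using a b x by (simp add: Q_smult KA.smult_assoc1)
  next
    fix a C C' assume a: "a \<in> carrier K" and "C \<in> carrier Q" "C' \<in> carrier Q"
    then obtain x y where x: "x \<in> carrier A" "C = pr x" and y: "y \<in> carrier A" "C' = pr y" using Q_surj[of C] Q_surj[of C'] by blast
    have "a \<odot>\<^bsub>Q\<^esub> (pr x \<oplus>\<^bsub>Q\<^esub> pr y) = pr (a \<odot>\<^bsub>A\<^esub> (x \<oplus> y))" using a x y Q_smult[of a "x \<oplus> y"] by (simp add: Q_homD)
    also have "\<dots> = a \<odot>\<^bsub>Q\<^esub> pr x \<oplus>\<^bsub>Q\<^esub> a \<odot>\<^bsub>Q\<^esub> pr y" using a x y by (simp add: KA.smult_r_distr Q_homD Q_smult)
    finally show "a \<odot>\<^bsub>Q\<^esub> (C \<oplus>\<^bsub>Q\<^esub> C') = a \<odot>\<^bsub>Q\<^esub> C \<oplus>\<^bsub>Q\<^esub> a \<odot>\<^bsub>Q\<^esub> C'" using x y by simp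
  next
    fix C assume "C \<in> carrier Q"
    then obtain x where x: "x \<in> carrier A" "C = pr x" using Q_surj by blast
    show "\<one>\<^bsub>K\<^esub> \<odot>\<^bsub>Q\<^esub> C = C" using x by (simp add: Q_smult)
  qed
  have "algebra_axioms K Q"
  proof
    fix a C C' assume a: "a \<in> carrier K" and "C \<in> carrier Q" "C' \<in> carrier Q"
    then obtain x y where x: "x \<in> carrier A" "C = pr x" and y: "y \<in> carrier A" "C' = pr y" using Q_surj[of C] Q_surj[of C'] by blast
    have "(a \<odot>\<^bsub>Q\<^esub> pr x) \<otimes>\<^bsub>Q\<^esub> pr y = pr ((a \<odot>\<^bsub>A\<^esub> x) \<otimes> y)" using a x y by (simp add: Q_smult Q_homD)
    also have "\<dots> = a \<odot>\<^bsub>Q\<^esub> pr (x \<otimes> y)" using a x y by (simp add: KA.smult_assoc2 Q_smult)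
    finally show "(a \<odot>\<^bsub>Q\<^esub> C) \<otimes>\<^bsub>Q\<^esub> C' = a \<odot>\<^bsub>Q\<^esub> (C \<otimes>\<^bsub>Q\<^esub> C')" using x y by (simp add: Q_homD)
  qed
  then show "algebra K Q" by (intro algebra.intro m Q_ring)
  show "homog Q i = {\<zero>\<^bsub>Q\<^esub>}" if "i < 0" for i
    using neg_homog'[OF that] pr_zero by (simp add: quot_algebra_simps(7))
  show "homog Q 0 = (\<lambda>k. k \<odot>\<^bsub>Q\<^esub> \<one>\<^bsub>Q\<^esub>) ` carrier K"
    unfolding quot_algebra_simps(7) homog_0 image_image Q_homD(4)[symmetric] using Q_smult by (intro image_cong) auto
qed

lemma pr_graded_hom: "graded_hom A Q pr"
proof (intro graded_hom.intro graded_ring_axioms Q_graded_ring graded_hom_axioms.intro)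
  show "pr \<in> ring_hom A Q" using Q_homD by (intro ring_hom_memI) auto
qed (simp add: quot_algebra_simps(7))

lemma quot_module_eq: "quot_module A J = resm pr (selfm Q)"
  by (simp add: quot_module_def resm_def selfm_def restrict_scalars_def)

lemma quot_module_facts:
  shows "graded_module A (quot_module A J)" "decomposed (quot_module A J) Qcomp"
    "graded_linear A (selfm A) (quot_module A J) pr" "homog (quot_module A J) j = pr ` homog A j"
    "carrier (quot_module A J) = carrier Q" "zero (quot_module A J) = zero Q"
proof -
  interpret h: graded_hom A Q pr by (rule pr_graded_hom)
  show "graded_module A (quot_module A J)" unfolding quot_module_eq
    by (rule h.graded_module_resm[OF graded_ring.graded_module_selfm[OF Q_graded_ring]])
  show "decomposed (quot_module A J) Qcomp" 
    by (rule decomposed_cong[OF Q_decomposed]) (simp_all add: quot_module_eq)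
  show "graded_linear A (selfm A) (quot_module A J) pr"
    by (rule graded_linearI) (auto simp: quot_module_eq Q_homD quot_algebra_simps(7))
qed (simp_all add: quot_module_eq quot_algebra_simps(7))

end

text \<open>The elements of \<open>Idl T\<close> all of whose components lie in \<open>Idl T\<close>
  form an ideal. It contains the homogeneous set \<open>T\<close> and therefore equals
  \<open>Idl T\<close>.\<close>

lemma (in graded_algebra) homogeneous_ideal_comp:
  assumes "T \<subseteq> (\<Union>i. homog A i)" "x \<in> Idl T"
  shows "comp i x \<in> Idl T"
proof -
  have T: "T \<subseteq> carrier A" using assms(1) homog_carrier by blast
  interpret I: ideal "Idl T" A by (rule genideal_ideal[OF T])
  let ?J = "{x \<in> Idl T. \<forall>i. comp i x \<in> Idl T}"
  have mh: "comp i (h \<otimes> x) = h \<otimes> comp (i - k) x" if "h \<in> homog A k" "x \<in> carrier A" for i k h x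
    using that(2)
  proof (induction rule: D.carrier_induct)
    case zero then show ?case using homog_carrier[OF that(1)] by (simp add: D.comp_zero)
  next
    case (add x g j)
    have hg: "h \<otimes> g \<in> homog A (k + j)" by (rule mult_homog[OF that(1) add(2)])
    have "comp i (h \<otimes> g) = h \<otimes> comp (i - k) g"
    proof (cases "i = k + j")
      case True
      then show ?thesis using D.comp_same[OF hg] D.comp_same[OF add(2)] by simp
    next
      case False
      then show ?thesis using D.comp_other[OF hg] D.comp_other[OF add(2), of "i - k"] homog_carrier[OF that(1)] by auto
    qed
    then show ?case using add(1,3) homog_carrier[OF that(1)] homog_carrier[OF add(2)]
      by (simp add: r_distr D.comp_add D.comp_carrier)
  qed
  have "ideal ?J A"
  proof (rule idealI[OF ring_axioms])
    show "subgroup ?J (add_monoid A)"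
    proof (rule add.subgroupI)
      show "?J \<noteq> {}" using D.comp_zero I.zero_closed by (auto intro: exI[of _ \<zero>])
      fix a assume a: "a \<in> ?J"
      then have ac: "a \<in> carrier A" using I.a_Hcarr by simp
      have "comp i (\<ominus> a) = \<ominus> comp i a" for i
        using D.comp_add[of "\<ominus> a" a i] ac D.comp_carrier[of "\<ominus> a" i] D.comp_carrier[of a i] 
        by (intro minus_equality[symmetric]) (auto simp: l_neg D.comp_zero)
      then show "\<ominus> a \<in> ?J" using a I.a_inv_closed by simp
    qed (auto simp: D.comp_add I.a_Hcarr I.a_closed)
    have l: "r \<otimes> x \<in> ?J" if "x \<in> ?J" "r \<in> carrier A" for x r
      using that(2)
    proof (induction rule: D.carrier_induct)
      case zero then show ?case using that(1) I.a_Hcarr I.zero_closed by (simp add: D.comp_zero)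
    next
      case (add r h k)
      have xc: "x \<in> carrier A" using that(1) I.a_Hcarr by simp
      have "comp i (h \<otimes> x) \<in> Idl T" for i
        using mh[OF add(2) xc, of i] I.I_l_closed[of "comp (i - k) x" h] that(1) homog_carrier[OF add(2)] by simp
      moreover have "h \<otimes> x \<in> Idl T" using I.I_l_closed that(1) homog_carrier[OF add(2)] by simp
      ultimately show ?case using add(1,3) xc homog_carrier[OF add(2)] I.a_closed by (simp add: l_distr D.comp_add)
    qed
    show "x \<in> ?J \<Longrightarrow> r \<in> carrier A \<Longrightarrow> r \<otimes> x \<in> ?J" for x r by (rule l)
    show "x \<otimes> r \<in> ?J" if "x \<in> ?J" "r \<in> carrier A" for x r using l[OF that] that I.a_Hcarr by (simp add: m_comm)
  qed
  moreover have "T \<subseteq> ?J"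
  proof
    fix t assume t: "t \<in> T"
    then obtain k where k: "t \<in> homog A k" using assms(1) by blast
    have tI: "t \<in> Idl T" using genideal_self[OF T] t by blast
    have "comp i t \<in> Idl T" for i using D.comp_same[OF k] D.comp_other[OF k, of i] tI I.zero_closed by (cases "i = k") auto
    then show "t \<in> ?J" using tI by simp
  qed
  ultimately have "Idl T \<subseteq> ?J" by (rule genideal_minimal)
  then show ?thesis using assms(2) by blast
qed

lemma (in graded_algebra) graded_quotient_homogeneous:
  assumes "homogeneous_ideal J A"
  shows "graded_quotient K A comp J"
proof (intro graded_quotient.intro graded_algebra_axioms graded_quotient_axioms.intro)
  show "ideal J A" using assms by (simp add: homogeneous_ideal_def)
  have J: "J = Idl (J \<inter> (\<Union>i. homog A i))" using assms by (simp add: homogeneous_ideal_def)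
  show "comp i x \<in> J" if "x \<in> J" for x i
    using homogeneous_ideal_comp[of "J \<inter> (\<Union>i. homog A i)" x i] that unfolding J[symmetric] by blast
qed

lemma (in graded_algebra) graded_quotient_irrelevant: "graded_quotient K A comp (irrelevant_ideal A)"
proof (intro graded_quotient.intro graded_algebra_axioms graded_quotient_axioms.intro)
  show "ideal (irrelevant_ideal A) A" unfolding irrelevant_ideal_def using homog_carrier by (intro genideal_ideal) blast
  show "comp i x \<in> irrelevant_ideal A" if "x \<in> irrelevant_ideal A" for x i
    using homogeneous_ideal_comp[of "\<Union>i\<in>{0<..}. homog A i" x i] that unfolding irrelevant_ideal_def by blast
qed

subsection \<open>Veronese subalgebras\<close>

lemma veronese_simps:
  "carrier (veronese c A) = {\<Oplus>\<^bsub>A\<^esub> i\<in>S. f i | S f. finite S \<and> (\<forall>i\<in>S. f i \<in> homog A (int c * i))}"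
  "monoid.mult (veronese c A) = monoid.mult A" "one (veronese c A) = one A" "zero (veronese c A) = zero A"
  "add (veronese c A) = add A" "smult (veronese c A) = smult A" "homog (veronese c A) i = homog A (int c * i)"
  by (simp_all add: veronese_def)

context graded_algebra
begin

text \<open>Replaces the explicit finite sums by the inductive \<open>hspan\<close>, so that closure
  under the operations can be shown by induction.\<close>

lemma veronese_carrier: "carrier (veronese c A) = hspan (veronese c A)"
proof (intro equalityI subsetI)
  fix x assume "x \<in> carrier (veronese c A)"
  then obtain S f where S: "finite S" "\<forall>i\<in>S. f i \<in> homog A (int c * i)" "x = (\<Oplus>i\<in>S. f i)"
    unfolding veronese_simps by blast
  have "(\<Oplus>i\<in>S. f i) \<in> hspan (veronese c A)"
    using S(1,2)
  proof induction
    case empty then show ?case using hspan.hzero[of "veronese c A"] by (simp add: veronese_simps)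
  next
    case (insert i S)
    have c: "f \<in> S \<rightarrow> carrier A" "f i \<in> carrier A" using insert.prems homog_carrier by auto
    then have "(\<Oplus>i\<in>insert i S. f i) = (\<Oplus>i\<in>S. f i) \<oplus>\<^bsub>veronese c A\<^esub> f i"
      using insert.hyps by (simp add: veronese_simps a_comm)
    then show ?case using hspan.hadd[of _ "veronese c A" "f i" i] insert by (simp add: veronese_simps)
  qed
  then show "x \<in> hspan (veronese c A)" using S(3) by simp
next
  fix x assume "x \<in> hspan (veronese c A)"
  then show "x \<in> carrier (veronese c A)"
  proof induction
    case hzero
    show ?case unfolding veronese_simps by (intro CollectI exI[of _ "{}"]) auto
  next
    case (hadd x h k)
    then obtain S f where S: "finite S" "\<forall>i\<in>S. f i \<in> homog A (int c * i)" "x = (\<Oplus>i\<in>S. f i)"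
      unfolding veronese_simps by blast
    have h: "h \<in> homog A (int c * k)" using hadd(2) by (simp add: veronese_simps)
    let ?g = "\<lambda>i. if i \<in> S then f i else \<zero>" let ?h = "\<lambda>i. if i = k then h else \<zero>"
    let ?T = "insert k S"
    have gc: "?g i \<in> homog A (int c * i)" "?h i \<in> homog A (int c * i)" for i using S(2) h homog_zero by auto
    have g: "x = (\<Oplus>i\<in>?T. ?g i)" unfolding S(3)
      using S homog_carrier[of "f _"] by (intro add.finprod_mono_neutral_cong_left) auto
    have hh: "h = (\<Oplus>i\<in>?T. ?h i)" 
      using add.finprod_singleton_swap[of k ?T "\<lambda>_. h"] S(1) homog_carrier[OF h] by simp
    have "x \<oplus> h = (\<Oplus>i\<in>?T. ?g i \<oplus> ?h i)"
    proof -
      have "?g \<in> ?T \<rightarrow> carrier A" "?h \<in> ?T \<rightarrow> carrier A" using homog_carrier[OF gc(1)] homog_carrier[OF gc(2)] by blast+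
      from finsum_addf[OF this] show ?thesis using g hh by simp
    qed
    moreover have "?g i \<oplus> ?h i \<in> homog A (int c * i)" for i
      using additive_subgroup.a_closed[OF homog_subgroup gc(1) gc(2)] .
    ultimately show ?case unfolding veronese_simps using S(1) 
      by (intro CollectI exI[of _ ?T] exI[of _ "\<lambda>i. ?g i \<oplus> ?h i"]) auto
  qed
qed

lemma veronese_carrier_subset: "x \<in> carrier (veronese c A) \<Longrightarrow> x \<in> carrier A"
  unfolding veronese_carrier by (induction rule: hspan.induct) (auto simp: veronese_simps intro: homog_carrier)

lemma veronese_homog_carrier: "x \<in> homog A (int c * i) \<Longrightarrow> x \<in> carrier (veronese c A)"
  unfolding veronese_carrier using hspan.hadd[OF hspan.hzero[of "veronese c A"], of x i] homog_carrier by (simp add: veronese_simps)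

lemma veronese_add: "x \<in> carrier (veronese c A) \<Longrightarrow> y \<in> carrier (veronese c A) \<Longrightarrow> x \<oplus> y \<in> carrier (veronese c A)"
proof -
  assume x: "x \<in> carrier (veronese c A)" and y: "y \<in> carrier (veronese c A)"
  have "x \<oplus> y \<in> hspan (veronese c A)"
    using y unfolding veronese_carrier
  proof induction
    case hzero then show ?case using x veronese_carrier_subset[OF x] by (simp add: veronese_carrier[symmetric] veronese_simps(4))
  next
    case (hadd y h i)
    have "y \<in> carrier A" using hadd(1) veronese_carrier_subset[of y c] unfolding veronese_carrier by blast
    then have "x \<oplus> (y \<oplus> h) = (x \<oplus> y) \<oplus> h" using veronese_carrier_subset[OF x] homog_carrier hadd(2) by (simp add: a_assoc veronese_simps)
    then show ?case using hspan.hadd[OF hadd(3,2)] by (simp add: veronese_simps)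
  qed
  then show ?thesis unfolding veronese_carrier .
qed

lemma veronese_mult_homog: "h \<in> homog A (int c * k) \<Longrightarrow> x \<in> carrier (veronese c A) \<Longrightarrow> h \<otimes> x \<in> carrier (veronese c A)"
proof -
  assume h: "h \<in> homog A (int c * k)" and x: "x \<in> carrier (veronese c A)"
  show ?thesis using x[unfolded veronese_carrier]
  proof induction
    case hzero then show ?case using homog_carrier[OF h] veronese_homog_carrier[OF homog_zero, of c] by (simp add: veronese_simps)
  next
    case (hadd y g i)
    have y: "y \<in> carrier A" using hadd(1) veronese_carrier_subset[of y c] unfolding veronese_carrier by blast
    have g: "g \<in> homog A (int c * i)" using hadd(2) by (simp add: veronese_simps)
    have "h \<otimes> g \<in> carrier (veronese c A)"
      using mult_homog[OF h g] by (intro veronese_homog_carrier[of _ c "k + i"]) (simp add: algebra_simps)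
    then show ?case using veronese_add[OF hadd(3)] y homog_carrier[OF g] homog_carrier[OF h] by (simp add: veronese_simps r_distr)
  qed
qed

lemma veronese_mult: "x \<in> carrier (veronese c A) \<Longrightarrow> y \<in> carrier (veronese c A) \<Longrightarrow> x \<otimes> y \<in> carrier (veronese c A)"
proof -
  assume x: "x \<in> carrier (veronese c A)" and y: "y \<in> carrier (veronese c A)"
  show ?thesis using x[unfolded veronese_carrier]
  proof induction
    case hzero then show ?case using veronese_carrier_subset[OF y] veronese_homog_carrier[OF homog_zero, of c] by (simp add: veronese_simps)
  next
    case (hadd x g i)
    have xc: "x \<in> carrier A" using hadd(1) veronese_carrier_subset[of x c] unfolding veronese_carrier by blast
    have g: "g \<in> homog A (int c * i)" using hadd(2) by (simp add: veronese_simps)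
    show ?case using veronese_add[OF hadd(3) veronese_mult_homog[OF g y]] xc homog_carrier[OF g] veronese_carrier_subset[OF y] 
      by (simp add: veronese_simps l_distr)
  qed
qed

lemma veronese_smult: "k \<in> carrier K \<Longrightarrow> x \<in> carrier (veronese c A) \<Longrightarrow> k \<odot>\<^bsub>A\<^esub> x \<in> carrier (veronese c A)"
  using veronese_mult_homog[of "k \<odot>\<^bsub>A\<^esub> \<one>" c 0 x] smult_eq[of k x] veronese_carrier_subset[of x c] homog_0 by simp

lemma veronese_graded_algebra:
  assumes c: "1 \<le> c"
  shows "graded_algebra K (veronese c A) (\<lambda>i. comp (int c * i))"
proof -
  let ?V = "veronese c A"
  note sub = veronese_carrier_subset[of _ c]
  have neg: "\<ominus> x \<in> carrier ?V" if "x \<in> carrier ?V" for x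
    using veronese_smult[of "\<ominus>\<^bsub>K\<^esub> \<one>\<^bsub>K\<^esub>" x c] that sub[OF that] by (simp add: KA.smult_l_minus)
  have one: "\<one> \<in> carrier ?V" using veronese_homog_carrier[of \<one> c 0] one_homog by simp
  have zero: "\<zero> \<in> carrier ?V" using veronese_homog_carrier[OF homog_zero, of c] .
  have ag: "abelian_group ?V"
  proof (rule abelian_groupI)
    fix x assume x: "x \<in> carrier ?V"
    show "\<exists>y\<in>carrier ?V. y \<oplus>\<^bsub>?V\<^esub> x = \<zero>\<^bsub>?V\<^esub>"
      using neg[OF x] sub[OF x] by (intro bexI[of _ "\<ominus> x"]) (auto simp: veronese_simps(4,5) l_neg)
  qed (auto simp: veronese_simps(4,5) zero intro: veronese_add a_assoc a_comm l_zero[OF sub] sub)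
  then interpret V: abelian_group ?V .
  have cr: "cring ?V"
    by (intro cringI ag comm_monoidI) (auto simp: veronese_simps(2,3,5) one intro: veronese_mult m_assoc m_comm l_distr l_one[OF sub] sub)
  have subg: "additive_subgroup (homog ?V i) ?V" for i
  proof (rule additive_subgroupI'[OF ag])
    fix x assume x: "x \<in> homog ?V i"
    then have xA: "x \<in> homog A (int c * i)" by (simp add: veronese_simps)
    have "\<ominus>\<^bsub>?V\<^esub> x = \<ominus> x"
      by (rule V.minus_equality) (use veronese_homog_carrier[OF xA] neg homog_carrier[OF xA] in \<open>auto simp: veronese_simps(4,5) l_neg\<close>)
    then show "\<ominus>\<^bsub>?V\<^esub> x \<in> homog ?V i" using additive_subgroup.a_inv_closed[OF homog_subgroup xA] by (simp add: veronese_simps(7))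
  qed (use additive_subgroup.a_closed[OF homog_subgroup] homog_zero in \<open>auto simp: veronese_simps(4,5,7) intro: veronese_homog_carrier\<close>)
  have gr: "graded_ring ?V"
  proof (intro graded_ring.intro graded_ring_axioms.intro cr subg)
    show "x \<otimes>\<^bsub>?V\<^esub> y \<in> homog ?V (i + j)" if "x \<in> homog ?V i" "y \<in> homog ?V j" for x y i j
      using mult_homog[of x "int c * i" y "int c * j"] that by (simp add: veronese_simps(2,7) algebra_simps)
  qed (simp add: veronese_simps(3,7) one_homog)
  have dec: "decomposed ?V (\<lambda>i. comp (int c * i))"
  proof (intro decomposed.intro decomposed_axioms.intro ag subg)
    show "x \<in> carrier ?V \<Longrightarrow> x \<in> hspan ?V" for x by (simp add: veronese_carrier)
  \<comment> \<open>\<open>c \<ge> 1\<close> keeps the degrees \<open>c * i\<close> distinct for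
    distinct \<open>i\<close>.\<close>
  qed (use c in \<open>auto simp: veronese_simps(4,5,7) sub D.comp_add D.comp_same intro: D.comp_other\<close>)
  have m: "module K ?V"
    by (rule moduleI[OF K.is_cring ag])
      (auto simp: veronese_simps(5,6) intro: veronese_smult KA.smult_l_distr KA.smult_r_distr KA.smult_assoc1 KA.smult_one sub)
  have "algebra_axioms K ?V"
    by standard (auto simp: veronese_simps(2,6) KA.smult_assoc2 sub)
  then have al: "algebra K ?V" by (intro algebra.intro m cr)
  show ?thesis
  proof (intro graded_algebra.intro graded_algebra_axioms.intro gr dec field_K al)
    show "homog ?V i = {\<zero>\<^bsub>?V\<^esub>}" if "i < 0" for i
      using neg_homog'[of "int c * i"] that c by (simp add: veronese_simps(4,7) mult_pos_neg)
    show "homog ?V 0 = (\<lambda>k. k \<odot>\<^bsub>?V\<^esub> \<one>\<^bsub>?V\<^esub>) ` carrier K" by (simp add: veronese_simps(3,6,7) homog_0)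
  qed
qed

end

subsection \<open>Polynomial rings\<close>

text \<open>The ring \<open>poly_algebra\<close> with an arbitrary set of variables: to compare
  presentations, variables are adjoined one at a time and the presentations are put on disjoint sets
  of variables.\<close>

definition mpoly :: "('k, 'z) ring_scheme \<Rightarrow> nat set \<Rightarrow> ('k, nat multiset \<Rightarrow> 'k) graded" where
  "mpoly K Xs =
     (let C = ring.indexed_pset K Xs (carrier K)
      in \<lparr>carrier = C,
          monoid.mult = (\<lambda>p q m. \<Oplus>\<^bsub>K\<^esub> a\<in>{a. a \<subseteq># m}. p a \<otimes>\<^bsub>K\<^esub> q (m - a)),
          one = ring.indexed_const K \<one>\<^bsub>K\<^esub>,
          zero = ring.indexed_const K \<zero>\<^bsub>K\<^esub>,
          add = ring.indexed_padd K,
          smult = (\<lambda>a p m. a \<otimes>\<^bsub>K\<^esub> p m),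
          homog = (\<lambda>j. {p \<in> C. \<forall>m. p m \<noteq> \<zero>\<^bsub>K\<^esub> \<longrightarrow> int (size m) = j})\<rparr>)"

lemma mpoly_poly_algebra: "poly_algebra K n = mpoly K {..<n}"
  by (simp add: poly_algebra_def mpoly_def)

lemma finite_submultisets: "finite {a. a \<subseteq># (m :: 'c multiset)}"
proof (induction m)
  case (add x m)
  have "{a. a \<subseteq># add_mset x m} \<subseteq> {a. a \<subseteq># m} \<union> add_mset x ` {a. a \<subseteq># m}"
  proof
    fix a assume a: "a \<in> {a. a \<subseteq># add_mset x m}"
    show "a \<in> {a. a \<subseteq># m} \<union> add_mset x ` {a. a \<subseteq># m}"
    proof (cases "x \<in># a")
      case True
      then obtain b where "a = add_mset x b" by (metis insert_DiffM)
      then show ?thesis using a by auto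
    next
      case False
      have "a \<subseteq># m"
      proof (rule mset_subset_eqI)
        fix y
        have "count a y \<le> count (add_mset x m) y" by (rule mset_subset_eq_count) (use a in simp)
        then show "count a y \<le> count m y" using False by (cases "y = x") (auto simp: not_in_iff)
      qed
      then show ?thesis by simp
    qed
  qed
  then show ?case using add finite_subset by blast
qed simp

locale mpoly_ring = field K for K :: "'k ring" (structure)
begin

definition kmod :: "('k, 'k) graded" where
  "kmod = \<lparr>carrier = carrier K, monoid.mult = monoid.mult K, one = \<one>, zero = \<zero>, add = add K, smult = monoid.mult K, homog = (\<lambda>_. carrier K)\<rparr>"

lemma kmod_simps [simp]:
  "carrier kmod = carrier K" "zero kmod = \<zero>" "add kmod = add K" "smult kmod = monoid.mult K"
  by (simp_all add: kmod_def)

lemma kmod_module: "module K kmod"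
proof (rule moduleI[OF is_cring])
  show "abelian_group kmod" by (rule abelian_group_cong[OF abelian_group_axioms]) simp_all
qed (auto simp: l_distr r_distr m_assoc)

abbreviation mon :: "nat multiset \<Rightarrow> 'k \<Rightarrow> nat multiset \<Rightarrow> 'k" where
  "mon m a \<equiv> dunit kmod m a"

lemma mon_apply: "mon m a = (\<lambda>k. if k = m then a else \<zero>)"
  unfolding dunit_def kmod_simps ..

text \<open>Polynomials supported on \<open>U\<close>, as a direct sum of copies of \<open>K\<close>
  indexed by monomials, so that \<open>dsum_homog_induct\<close> yields induction over monomials.
  The degree of this direct sum is a dummy, and 0 stands for it throughout.\<close>

abbreviation psum :: "nat multiset set \<Rightarrow> ('k, nat multiset \<Rightarrow> 'k) graded" where
  "psum U \<equiv> dsum kmod U (\<lambda>m j. carrier K)"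

abbreviation monset :: "nat set \<Rightarrow> nat multiset set" where
  "monset Xs \<equiv> {m. set_mset m \<subseteq> Xs}"

lemma psum_homog: "homog (psum U) j = {p. (\<forall>m. p m \<in> carrier K) \<and> finite {m. p m \<noteq> \<zero>} \<and> (\<forall>m. m \<notin> U \<longrightarrow> p m = \<zero>)}"
  by (auto simp: dsum_homog)

lemma psum_induct [consumes 1, case_names zero add]:
  assumes "p \<in> homog (psum U) 0" "P (\<lambda>_. \<zero>)"
    "\<And>p m a. p \<in> homog (psum U) 0 \<Longrightarrow> P p \<Longrightarrow> m \<in> U \<Longrightarrow> a \<in> carrier K \<Longrightarrow> P (\<lambda>k. p k \<oplus> mon m a k)"
  shows "P p"
  using dsum_homog_induct[OF kmod_module assms(1), of P] assms(2,3) by simp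

text \<open>The rules for polynomials preserve finite support on monomials in \<open>Xs\<close>.
  Conversely, monomials arise from constants by multiplying with variables, and every finitely
  supported function is a sum of monomials.\<close>

lemma mpoly_carrier: "carrier (mpoly K Xs) = homog (psum (monset Xs)) 0"
proof (intro equalityI subsetI)
  fix p assume "p \<in> carrier (mpoly K Xs)"
  then have "p \<in> indexed_pset Xs (carrier K)" by (simp add: mpoly_def Let_def)
  then show "p \<in> homog (psum (monset Xs)) 0"
  proof induction
    case (indexed_const k)
    have "finite {m. indexed_const k m \<noteq> \<zero>}" by (rule finite_subset[of _ "{{#}}"]) (auto simp: indexed_const_def)
    then show ?case using indexed_const by (auto simp: psum_homog indexed_const_def)
  next
    case (indexed_padd P Q)
    have "finite {m. P m \<oplus> Q m \<noteq> \<zero>}"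
      by (rule finite_subset[of _ "{m. P m \<noteq> \<zero>} \<union> {m. Q m \<noteq> \<zero>}"]) (use indexed_padd in \<open>auto simp: psum_homog\<close>)
    then show ?case using indexed_padd by (auto simp: psum_homog indexed_padd_def)
  next
    case (indexed_pmult P i)
    have "finite {m. indexed_pmult P i m \<noteq> \<zero>}"
      by (rule finite_subset[of _ "(\<lambda>m. add_mset i m) ` {m. P m \<noteq> \<zero>}"])
        (use indexed_pmult in \<open>auto simp: psum_homog indexed_pmult_def intro!: image_eqI[of _ _ "_ - {#i#}"]\<close>)
    moreover have "indexed_pmult P i m = \<zero>" if "\<not> set_mset m \<subseteq> Xs" for m
    proof (cases "i \<in># m")
      case True
      then have "set_mset m = insert i (set_mset (m - {#i#}))" by (metis insert_DiffM set_mset_add_mset_insert)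
      then have "\<not> set_mset (m - {#i#}) \<subseteq> Xs" using that indexed_pmult(2) by auto
      then show ?thesis using indexed_pmult(3) by (simp add: psum_homog indexed_pmult_def)
    qed (simp add: indexed_pmult_def)
    ultimately show ?case using indexed_pmult by (auto simp: psum_homog indexed_pmult_def)
  qed
next
  fix p assume "p \<in> homog (psum (monset Xs)) 0"
  then have "p \<in> indexed_pset Xs (carrier K)"
  proof (induction rule: psum_induct)
    case zero
    show ?case using indexed_pset.indexed_const[of \<zero> "carrier K" Xs] by (simp add: indexed_zero_def)
  next
    case (add p m a)
    have "mon m a \<in> indexed_pset Xs (carrier K)"
      using add(2)
    proof (induction m)
      case empty
      then show ?case using indexed_pset.indexed_const[OF add(3), of Xs] by (simp add: indexed_const_def mon_apply)
    next
      case (add i m)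
      have "indexed_pmult (mon m a) i = mon (add_mset i m) a"
        by (intro ext) (auto simp: indexed_pmult_def mon_apply)
      then show ?case using indexed_pset.indexed_pmult[OF add(1), of i] add(2) by simp
    qed
    then show ?case using indexed_pset.indexed_padd[OF add(4)] by (simp add: indexed_padd_def)
  qed
  then show "p \<in> carrier (mpoly K Xs)" by (simp add: mpoly_def Let_def)
qed

lemma mpoly_simps:
  "one (mpoly K Xs) = mon {#} \<one>" "zero (mpoly K Xs) = (\<lambda>_. \<zero>)" "add (mpoly K Xs) = (\<lambda>p q m. p m \<oplus> q m)"
  "smult (mpoly K Xs) = (\<lambda>a p m. a \<otimes> p m)"
  "homog (mpoly K Xs) j = {p \<in> carrier (mpoly K Xs). \<forall>m. p m \<noteq> \<zero> \<longrightarrow> int (size m) = j}"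
  by (simp_all add: mpoly_def Let_def indexed_const_def mon_apply indexed_zero_def indexed_padd_def fun_eq_iff)

lemma mpoly_homog: "homog (mpoly K Xs) j = homog (psum {m. set_mset m \<subseteq> Xs \<and> int (size m) = j}) 0"
  unfolding mpoly_simps mpoly_carrier psum_homog by auto

lemma mpoly_carrierD: "p \<in> carrier (mpoly K Xs) \<Longrightarrow> p m \<in> carrier K" "p \<in> carrier (mpoly K Xs) \<Longrightarrow> finite {m. p m \<noteq> \<zero>}"
  by (auto simp: mpoly_carrier psum_homog)

definition pmul :: "(nat multiset \<Rightarrow> 'k) \<Rightarrow> (nat multiset \<Rightarrow> 'k) \<Rightarrow> nat multiset \<Rightarrow> 'k" where
  "pmul p q m = (\<Oplus>a\<in>{a. a \<subseteq># m}. p a \<otimes> q (m - a))"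

lemma mpoly_mult: "monoid.mult (mpoly K Xs) = pmul"
  by (intro ext) (simp add: mpoly_def Let_def pmul_def)

lemma pmul_add_left: "(\<And>m. p m \<in> carrier K) \<Longrightarrow> (\<And>m. p' m \<in> carrier K) \<Longrightarrow> (\<And>m. q m \<in> carrier K) \<Longrightarrow>
  pmul (\<lambda>m. p m \<oplus> p' m) q = (\<lambda>m. pmul p q m \<oplus> pmul p' q m)"
  by (intro ext) (simp add: pmul_def l_distr finsum_addf Pi_def)

lemma pmul_add_right: "(\<And>m. p m \<in> carrier K) \<Longrightarrow> (\<And>m. q m \<in> carrier K) \<Longrightarrow> (\<And>m. q' m \<in> carrier K) \<Longrightarrow>
  pmul p (\<lambda>m. q m \<oplus> q' m) = (\<lambda>m. pmul p q m \<oplus> pmul p q' m)"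
  by (intro ext) (simp add: pmul_def r_distr finsum_addf Pi_def)

lemma pmul_zero: "(\<And>m. q m \<in> carrier K) \<Longrightarrow> pmul (\<lambda>_. \<zero>) q = (\<lambda>_. \<zero>)" "(\<And>m. p m \<in> carrier K) \<Longrightarrow> pmul p (\<lambda>_. \<zero>) = (\<lambda>_. \<zero>)"
  by (intro ext, simp add: pmul_def)+

lemma pmul_closed: "(\<And>m. p m \<in> carrier K) \<Longrightarrow> (\<And>m. q m \<in> carrier K) \<Longrightarrow> pmul p q m \<in> carrier K"
  unfolding pmul_def by (intro finsum_closed) simp

lemma pmul_mon_left:
  assumes "a \<in> carrier K" "\<And>m. q m \<in> carrier K"
  shows "pmul (mon m a) q k = (if m \<subseteq># k then a \<otimes> q (k - m) else \<zero>)"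
proof (cases "m \<subseteq># k")
  case True
  have "pmul (mon m a) q k = (\<Oplus>b\<in>{b. b \<subseteq># k}. if b = m then a \<otimes> q (k - b) else \<zero>)"
    unfolding pmul_def mon_apply using assms by (intro finsum_cong') auto
  also have "\<dots> = a \<otimes> q (k - m)"
    using add.finprod_singleton_swap[of m "{b. b \<subseteq># k}" "\<lambda>b. a \<otimes> q (k - b)"] finite_submultisets True assms by auto
  finally show ?thesis using True by simp
next
  case False
  have "pmul (mon m a) q k = (\<Oplus>b\<in>{b. b \<subseteq># k}. \<zero>)"
    unfolding pmul_def mon_apply using assms False by (intro finsum_cong') auto
  then show ?thesis using False by simp
qed

lemma pmul_mon: "a \<in> carrier K \<Longrightarrow> b \<in> carrier K \<Longrightarrow> pmul (mon m a) (mon n b) = mon (m + n) (a \<otimes> b)"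
  by (rule ext, subst pmul_mon_left) (auto simp: mon_apply)

lemma mon_carrier: "a \<in> carrier K \<Longrightarrow> mon m a k \<in> carrier K"
  by (simp add: mon_apply)

lemma psum_add: "p \<in> homog (psum U) 0 \<Longrightarrow> q \<in> homog (psum U) 0 \<Longrightarrow> (\<lambda>m. p m \<oplus> q m) \<in> homog (psum U) 0"
proof -
  assume *: "p \<in> homog (psum U) 0" "q \<in> homog (psum U) 0"
  have "finite {m. p m \<oplus> q m \<noteq> \<zero>}"
    by (rule finite_subset[of _ "{m. p m \<noteq> \<zero>} \<union> {m. q m \<noteq> \<zero>}"]) (use * in \<open>auto simp: psum_homog\<close>)
  then show ?thesis using * by (auto simp: psum_homog)
qed

lemma psum_mon: "a \<in> carrier K \<Longrightarrow> m \<in> U \<Longrightarrow> mon m a \<in> homog (psum U) 0"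
  by (auto simp: psum_homog mon_apply)

lemma psum_D: "p \<in> homog (psum U) 0 \<Longrightarrow> p m \<in> carrier K"
  by (simp add: psum_homog)

lemma psum_zero: "(\<lambda>_. \<zero>) \<in> homog (psum U) 0"
  by (simp add: psum_homog)

text \<open>Multiplication is bilinear, so induction over the monomials of both factors reduces the
  claim to products of two monomials. Commutativity and associativity below are treated
  alike.\<close>

lemma psum_mult:
  assumes p: "p \<in> homog (psum U) 0" and q: "q \<in> homog (psum V) 0" and W: "\<And>m n. m \<in> U \<Longrightarrow> n \<in> V \<Longrightarrow> m + n \<in> W"
  shows "pmul p q \<in> homog (psum W) 0"
  using p
proof (induction rule: psum_induct)
  case zero then show ?case using psum_D[OF q] psum_zero by (simp add: pmul_zero)
next
  case (add p m a)
  have "pmul (mon m a) q \<in> homog (psum W) 0"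
    using q
  proof (induction rule: psum_induct)
    case zero then show ?case using mon_carrier[OF add(3)] psum_zero by (simp add: pmul_zero)
  next
    case (add q n b)
    then show ?case using \<open>m \<in> U\<close> \<open>a \<in> carrier K\<close> psum_D[OF add(1)] W
      by (simp add: pmul_add_right mon_carrier pmul_mon) (intro psum_add psum_mon, auto)
  qed
  then show ?case using add psum_D[OF add(1)] psum_D[OF q] by (simp add: pmul_add_left mon_carrier psum_add)
qed

lemma psum_mono: "U \<subseteq> V \<Longrightarrow> homog (psum U) 0 \<subseteq> homog (psum V) 0"
  by (auto simp: psum_homog)

lemma pmul_comm:
  assumes p: "p \<in> homog (psum U) 0" and q: "q \<in> homog (psum U) 0"
  shows "pmul p q = pmul q p"
  using p
proof (induction rule: psum_induct)
  case zero then show ?case using psum_D[OF q] by (simp add: pmul_zero)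
next
  case (add p m a)
  have "pmul (mon m a) q = pmul q (mon m a)"
    using q
  proof (induction rule: psum_induct)
    case zero then show ?case using mon_carrier[OF add(3)] by (simp add: pmul_zero)
  next
    case (add q n b)
    then show ?case using \<open>a \<in> carrier K\<close> psum_D[OF add(1)]
      by (simp add: pmul_add_right pmul_add_left mon_carrier pmul_mon add.commute m_comm)
  qed
  then show ?case using add psum_D[OF add(1)] psum_D[OF q] by (simp add: pmul_add_left pmul_add_right mon_carrier)
qed

lemma pmul_assoc:
  assumes p: "p \<in> homog (psum U) 0" and q: "q \<in> homog (psum U) 0" and r: "r \<in> homog (psum U) 0"
  shows "pmul (pmul p q) r = pmul p (pmul q r)"
proof -
  have c: "pmul x y m \<in> carrier K" if "\<And>m. x m \<in> carrier K" "\<And>m. y m \<in> carrier K" for x y m by (rule pmul_closed[OF that])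
  note D = psum_D mon_carrier c
  have 1: "pmul (pmul (mon m a) (mon n b)) r = pmul (mon m a) (pmul (mon n b) r)" if "a \<in> carrier K" "b \<in> carrier K" for m n a b
    using r
  proof (induction rule: psum_induct)
    case zero then show ?case using that by (simp add: pmul_zero D)
  next
    case (add r k d)
    then show ?case using that psum_D[OF add(1)] by (simp add: pmul_add_right D pmul_mon add.assoc m_assoc)
  qed
  have 2: "pmul (pmul (mon m a) q) r = pmul (mon m a) (pmul q r)" if "a \<in> carrier K" for m a
    using q
  proof (induction rule: psum_induct)
    case zero then show ?case using that psum_D[OF r] by (simp add: pmul_zero D)
  next
    case (add q n b)
    then show ?case using that psum_D[OF add(1)] psum_D[OF r] 1[OF that add(3)] by (simp add: pmul_add_right pmul_add_left D)
  qed
  show ?thesis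
    using p
  proof (induction rule: psum_induct)
    case zero then show ?case using psum_D[OF r] psum_D[OF q] by (simp add: pmul_zero D)
  next
    case (add p m a)
    then show ?case using psum_D[OF add(1)] psum_D[OF r] psum_D[OF q] 2[OF add(3)] by (simp add: pmul_add_left D)
  qed
qed

lemma mpoly_cring: "cring (mpoly K Xs)"
proof (intro cringI comm_monoidI)
  let ?P = "mpoly K Xs"
  show "abelian_group ?P"
  proof (rule abelian_groupI)
    fix p assume p: "p \<in> carrier ?P"
    have "finite {m. \<ominus> p m \<noteq> \<zero>}" by (rule finite_subset[of _ "{m. p m \<noteq> \<zero>}"]) (use p in \<open>auto simp: mpoly_carrier psum_homog\<close>)
    then show "\<exists>q\<in>carrier ?P. q \<oplus>\<^bsub>?P\<^esub> p = \<zero>\<^bsub>?P\<^esub>"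
      using p by (intro bexI[of _ "\<lambda>m. \<ominus> p m"]) (auto simp: mpoly_simps mpoly_carrier psum_homog l_neg)
  qed (auto simp: mpoly_simps(2,3) mpoly_carrier psum_zero intro: psum_add, auto simp: psum_homog a_ac)
  have U: "m \<in> monset Xs \<Longrightarrow> n \<in> monset Xs \<Longrightarrow> m + n \<in> monset Xs" for m n :: "nat multiset" by auto
  show "p \<otimes>\<^bsub>?P\<^esub> q \<in> carrier ?P" if "p \<in> carrier ?P" "q \<in> carrier ?P" for p q
    using psum_mult[OF that[unfolded mpoly_carrier], of "monset Xs"] U unfolding mpoly_carrier mpoly_mult by blast
  show "\<one>\<^bsub>?P\<^esub> \<in> carrier ?P" unfolding mpoly_simps mpoly_carrier by (intro psum_mon) auto
  show "p \<otimes>\<^bsub>?P\<^esub> q \<otimes>\<^bsub>?P\<^esub> r = p \<otimes>\<^bsub>?P\<^esub> (q \<otimes>\<^bsub>?P\<^esub> r)" if "p \<in> carrier ?P" "q \<in> carrier ?P" "r \<in> carrier ?P" for p q r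
    using pmul_assoc that unfolding mpoly_carrier mpoly_mult by blast
  show "p \<otimes>\<^bsub>?P\<^esub> q = q \<otimes>\<^bsub>?P\<^esub> p" if "p \<in> carrier ?P" "q \<in> carrier ?P" for p q
    using pmul_comm that unfolding mpoly_carrier mpoly_mult by blast
  show "\<one>\<^bsub>?P\<^esub> \<otimes>\<^bsub>?P\<^esub> p = p" if "p \<in> carrier ?P" for p
    using that by (intro ext) (simp add: mpoly_simps mpoly_mult pmul_mon_left mpoly_carrierD)
  show "(p \<oplus>\<^bsub>?P\<^esub> q) \<otimes>\<^bsub>?P\<^esub> r = p \<otimes>\<^bsub>?P\<^esub> r \<oplus>\<^bsub>?P\<^esub> q \<otimes>\<^bsub>?P\<^esub> r"
    if "p \<in> carrier ?P" "q \<in> carrier ?P" "r \<in> carrier ?P" for p q r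
    using that by (simp add: mpoly_mult mpoly_simps(3) pmul_add_left mpoly_carrierD)
qed

definition pcomp :: "int \<Rightarrow> (nat multiset \<Rightarrow> 'k) \<Rightarrow> nat multiset \<Rightarrow> 'k" where
  "pcomp j p = (\<lambda>m. if int (size m) = j then p m else \<zero>)"

lemma mpoly_graded_algebra: "graded_algebra K (mpoly K Xs) pcomp"
proof -
  let ?P = "mpoly K Xs"
  interpret P: cring ?P by (rule mpoly_cring)
  have inv: "\<ominus>\<^bsub>?P\<^esub> p = (\<lambda>m. \<ominus> p m)" if "p \<in> carrier ?P" for p
  proof (rule P.minus_equality[OF _ that])
    have "finite {m. \<ominus> p m \<noteq> \<zero>}" by (rule finite_subset[of _ "{m. p m \<noteq> \<zero>}"]) (use that in \<open>auto simp: mpoly_carrier psum_homog\<close>)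
    then show "(\<lambda>m. \<ominus> p m) \<in> carrier ?P" using that by (auto simp: mpoly_carrier psum_homog)
  qed (use mpoly_carrierD[OF that] in \<open>auto simp: mpoly_simps l_neg\<close>)
  have sub: "additive_subgroup (homog ?P i) ?P" for i
  proof (rule additive_subgroupI'[OF P.abelian_group_axioms])
    show "p \<oplus>\<^bsub>?P\<^esub> q \<in> homog ?P i" if "p \<in> homog ?P i" "q \<in> homog ?P i" for p q
      using psum_add that unfolding mpoly_homog mpoly_simps by blast
    show "\<ominus>\<^bsub>?P\<^esub> p \<in> homog ?P i" if "p \<in> homog ?P i" for p
    proof -
      have p: "p \<in> carrier ?P" "\<And>m. p m \<noteq> \<zero> \<Longrightarrow> int (size m) = i" using that by (auto simp: mpoly_simps(5))
      have "int (size m) = i" if "\<ominus> p m \<noteq> \<zero>" for m using that p(2)[of m] by (cases "p m = \<zero>") auto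
      then show ?thesis using inv[OF p(1)] P.a_inv_closed[OF p(1)] by (simp add: mpoly_simps(5))
    qed
  qed (auto simp: mpoly_simps(2,5) psum_zero mpoly_carrier)
  have gr: "graded_ring ?P"
  proof (intro graded_ring.intro graded_ring_axioms.intro mpoly_cring sub)
    show "\<one>\<^bsub>?P\<^esub> \<in> homog ?P 0" unfolding mpoly_simps(1) mpoly_homog by (intro psum_mon) auto
    show "p \<otimes>\<^bsub>?P\<^esub> q \<in> homog ?P (i + j)" if "p \<in> homog ?P i" "q \<in> homog ?P j" for p q i j
      using that unfolding mpoly_homog mpoly_mult by (rule psum_mult) auto
  qed
  have dec: "decomposed ?P pcomp"
  proof (intro decomposed.intro decomposed_axioms.intro sub P.abelian_group_axioms)
    fix p assume "p \<in> carrier ?P"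
    then show "p \<in> hspan ?P"
      unfolding mpoly_carrier
    proof (induction rule: psum_induct)
      case zero show ?case using hspan.hzero[of ?P] by (simp add: mpoly_simps)
    next
      case (add p m a)
      have "mon m a \<in> homog ?P (int (size m))" unfolding mpoly_homog using add by (intro psum_mon) auto
      then show ?case using hspan.hadd[OF add(4)] by (simp add: mpoly_simps(3))
    qed
  next
    show "pcomp i x = x" if "x \<in> homog ?P i" for x i using that unfolding pcomp_def mpoly_simps(5) by force
    show "pcomp i x = \<zero>\<^bsub>?P\<^esub>" if "x \<in> homog ?P j" "i \<noteq> j" for x i j using that unfolding pcomp_def mpoly_simps(2,5) by force
  qed (auto simp: pcomp_def mpoly_simps(3))
  have m: "module K ?P"
  proof (rule moduleI[OF is_cring P.abelian_group_axioms])
    fix a p assume a: "a \<in> carrier K" "p \<in> carrier ?P"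
    have "finite {m. a \<otimes> p m \<noteq> \<zero>}" by (rule finite_subset[of _ "{m. p m \<noteq> \<zero>}"]) (use a in \<open>auto simp: mpoly_carrier psum_homog\<close>)
    then show "a \<odot>\<^bsub>?P\<^esub> p \<in> carrier ?P" using a by (auto simp: mpoly_simps(4) mpoly_carrier psum_homog)
  qed (auto simp: mpoly_simps(3,4) mpoly_carrierD l_distr r_distr m_assoc)
  have sm: "a \<odot>\<^bsub>?P\<^esub> p = pmul (mon {#} a) p" if "a \<in> carrier K" "p \<in> carrier ?P" for a p
    using that by (intro ext) (simp add: mpoly_simps(4) pmul_mon_left mpoly_carrierD)
  have "algebra_axioms K ?P"
  proof
    fix a p q assume a: "a \<in> carrier K" "p \<in> carrier ?P" "q \<in> carrier ?P"
    have "mon {#} a \<in> carrier ?P" unfolding mpoly_carrier using a by (intro psum_mon) auto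
    then show "(a \<odot>\<^bsub>?P\<^esub> p) \<otimes>\<^bsub>?P\<^esub> q = a \<odot>\<^bsub>?P\<^esub> (p \<otimes>\<^bsub>?P\<^esub> q)"
      using a sm[OF a(1,2)] sm[OF a(1), of "p \<otimes>\<^bsub>?P\<^esub> q"] P.m_assoc[of "mon {#} a" p q] P.m_closed[OF a(2,3)] by (simp add: mpoly_mult)
  qed
  then have al: "algebra K ?P" by (intro algebra.intro m mpoly_cring)
  show ?thesis
  proof (intro graded_algebra.intro graded_algebra_axioms.intro gr dec al field_axioms)
    show "homog ?P i = {\<zero>\<^bsub>?P\<^esub>}" if "i < 0" for i
      using that psum_zero[of "monset Xs"] by (auto simp: mpoly_simps(2,5) mpoly_carrier)
    have k: "k \<odot>\<^bsub>?P\<^esub> \<one>\<^bsub>?P\<^esub> = mon {#} k" if "k \<in> carrier K" for k using that by (auto simp: mpoly_simps mon_apply)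
    show "homog ?P 0 = (\<lambda>k. k \<odot>\<^bsub>?P\<^esub> \<one>\<^bsub>?P\<^esub>) ` carrier K"
    proof (intro equalityI subsetI)
      fix p assume p: "p \<in> homog ?P 0"
      then have "p = mon {#} (p {#})" by (intro ext) (auto simp: mpoly_simps(5) mon_apply)
      moreover have "p {#} \<in> carrier K" using p mpoly_carrierD(1)[of p Xs "{#}"] by (simp add: mpoly_simps(5))
      ultimately show "p \<in> (\<lambda>k. k \<odot>\<^bsub>?P\<^esub> \<one>\<^bsub>?P\<^esub>) ` carrier K" using k by (intro image_eqI[of _ _ "p {#}"]) simp_all
    next
      fix p assume "p \<in> (\<lambda>k. k \<odot>\<^bsub>?P\<^esub> \<one>\<^bsub>?P\<^esub>) ` carrier K"
      then obtain k' where "k' \<in> carrier K" "p = mon {#} k'" using k by (elim imageE) simp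
      then show "p \<in> homog ?P 0" unfolding mpoly_homog by (simp only:) (intro psum_mon, auto)
    qed
  qed
qed

lemma countable_multisets: "countable (UNIV :: nat multiset set)"
proof -
  have "(UNIV :: nat multiset set) = range mset" using surj_mset by blast
  then show ?thesis by (metis countable_image countableI_type)
qed

lemma mpoly_countable: "countably_generated (mpoly K Xs) (selfm (mpoly K Xs))"
  unfolding countably_generated_def
proof
  fix j
  let ?P = "mpoly K Xs"
  interpret G: graded_algebra K ?P pcomp by (rule mpoly_graded_algebra)
  interpret M: graded_module ?P "selfm ?P" by (rule G.graded_module_selfm)
  let ?U = "{m. set_mset m \<subseteq> Xs \<and> int (size m) = j}"
  let ?V = "(\<lambda>m. mon m \<one>) ` ?U"
  have V: "?V \<subseteq> homog (selfm ?P) j" unfolding selfm_simps mpoly_homog by (auto intro: psum_mon)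
  have "homog (selfm ?P) j \<subseteq> cspan ?P (selfm ?P) ?V"
  proof
    fix p assume "p \<in> homog (selfm ?P) j"
    then have "p \<in> homog (psum ?U) 0" by (simp add: mpoly_homog)
    then show "p \<in> cspan ?P (selfm ?P) ?V"
    proof (induction rule: psum_induct)
      case zero then show ?case using cspan.czero[of "selfm ?P" ?P ?V] by (simp add: mpoly_simps)
    next
      case (add p m a)
      have "mon {#} a \<in> homog ?P 0" unfolding mpoly_homog using add by (intro psum_mon) auto
      from cspan.cadd[OF add(4) this, of "mon m \<one>"] add(2,3)
      show ?case by (simp add: mpoly_mult pmul_mon mpoly_simps(3))
    qed
  qed
  moreover have "countable ?V" using countable_subset[OF subset_UNIV countable_multisets] by auto
  ultimately show "\<exists>V. countable V \<and> V \<subseteq> homog (selfm ?P) j \<and> homog (selfm ?P) j \<subseteq> cspan ?P (selfm ?P) V"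
    using V by blast
qed

end

subsection \<open>Evaluation homomorphisms\<close>

context graded_algebra
begin

sublocale MP: mpoly_ring K by (rule mpoly_ring.intro[OF field_K])

definition apow :: "(nat \<Rightarrow> 'b) \<Rightarrow> nat multiset \<Rightarrow> 'b" where
  "apow a m = (\<Otimes>i\<in>set_mset m. a i [^] count m i)"

lemma apow_superset:
  assumes "\<And>i. a i \<in> carrier A" "finite T" "set_mset m \<subseteq> T"
  shows "apow a m = (\<Otimes>i\<in>T. a i [^] count m i)"
  unfolding apow_def
  using assms by (intro finprod_mono_neutral_cong_left) (auto simp: not_in_iff)

lemma apow_add:
  assumes "\<And>i. a i \<in> carrier A"
  shows "apow a (m + n) = apow a m \<otimes> apow a n"
proof -
  let ?T = "set_mset m \<union> set_mset n"
  have "apow a (m + n) = (\<Otimes>i\<in>?T. a i [^] count m i \<otimes> a i [^] count n i)"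
    using assms apow_superset[OF assms, of ?T "m + n"] by (simp add: nat_pow_mult)
  also have "\<dots> = (\<Otimes>i\<in>?T. a i [^] count m i) \<otimes> (\<Otimes>i\<in>?T. a i [^] count n i)"
    using assms by (intro finprod_multf) auto
  also have "\<dots> = apow a m \<otimes> apow a n"
    using apow_superset[OF assms, of ?T m] apow_superset[OF assms, of ?T n] by simp
  finally show ?thesis .
qed

lemma apow_empty [simp]: "apow a {#} = \<one>"
  by (simp add: apow_def)

lemma apow_single [simp]: "a i \<in> carrier A \<Longrightarrow> apow a {#i#} = a i"
  by (simp add: apow_def)

lemma apow_homog:
  assumes a: "range a \<subseteq> homog A 1"
  shows "apow a m \<in> homog A (int (size m))"
proof (induction m)
  case (add i m)
  have a': "a i \<in> homog A 1" for i using a by blast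
  have "apow a (add_mset i m) = a i \<otimes> apow a m"
    using apow_add[of a "{#i#}" m] homog_carrier[OF a'] by simp
  then show ?case using mult_homog[OF a' add, of i] by simp
qed (simp add: one_homog)

lemma apow_carrier: "range a \<subseteq> homog A 1 \<Longrightarrow> apow a m \<in> carrier A"
  using homog_carrier[OF apow_homog] .

definition ev :: "(nat \<Rightarrow> 'b) \<Rightarrow> (nat multiset \<Rightarrow> 'k) \<Rightarrow> 'b" where
  "ev a p = lincomb K A (apow a) p"

lemma ev_zero: "ev a (\<lambda>_. \<zero>\<^bsub>K\<^esub>) = \<zero>"
  by (simp add: ev_def lincomb_def)

lemma mon_carrier': "m \<in> MP.monset Xs \<Longrightarrow> k \<in> carrier K \<Longrightarrow> MP.mon m k \<in> carrier (mpoly K Xs)"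
  unfolding MP.mpoly_carrier by (rule MP.psum_mon)

context
  fixes a :: "nat \<Rightarrow> 'b"
  assumes a: "range a \<subseteq> homog A 1"
begin

lemma gen_carrier: "a i \<in> carrier A"
  using a homog_carrier by blast

lemma ev_mon: "k \<in> carrier K \<Longrightarrow> ev a (MP.mon m k) = k \<odot>\<^bsub>A\<^esub> apow a m"
  unfolding ev_def MP.mon_apply by (rule KA.lincomb_unit) (auto intro: apow_carrier[OF a])

lemma ev_closed: "p \<in> carrier (mpoly K Xs) \<Longrightarrow> ev a p \<in> carrier A"
  unfolding ev_def using MP.mpoly_carrierD apow_carrier[OF a] by (intro KA.lincomb_closed) auto

lemma ev_add:
  assumes "p \<in> carrier (mpoly K Xs)" "q \<in> carrier (mpoly K Xs)"
  shows "ev a (\<lambda>m. p m \<oplus>\<^bsub>K\<^esub> q m) = ev a p \<oplus> ev a q"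
  unfolding ev_def using assms MP.mpoly_carrierD apow_carrier[OF a] by (intro KA.lincomb_add) auto

lemma ev_smult:
  assumes "k \<in> carrier K" "p \<in> carrier (mpoly K Xs)"
  shows "ev a (\<lambda>m. k \<otimes>\<^bsub>K\<^esub> p m) = k \<odot>\<^bsub>A\<^esub> ev a p"
  unfolding ev_def using assms MP.mpoly_carrierD apow_carrier[OF a] by (intro KA.lincomb_smult) auto

lemma ev_mult:
  assumes p: "p \<in> carrier (mpoly K Xs)" and q: "q \<in> carrier (mpoly K Xs)"
  shows "ev a (MP.pmul p q) = ev a p \<otimes> ev a q"
proof -
  interpret S: cring "mpoly K Xs" by (rule MP.mpoly_cring)
  note pc = S.m_closed[unfolded MP.mpoly_mult]
  note D = MP.mpoly_carrierD(1)
  have 1: "ev a (MP.pmul (MP.mon m k) q) = (k \<odot>\<^bsub>A\<^esub> apow a m) \<otimes> ev a q" if m: "m \<in> MP.monset Xs" "k \<in> carrier K" for m k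
    using q unfolding MP.mpoly_carrier
  proof (induction rule: MP.psum_induct)
    case zero then show ?case using m apow_carrier[OF a] by (simp add: ev_zero MP.pmul_zero MP.mon_carrier)
  next
    case (add q n l)
    note q = add(1)[folded MP.mpoly_carrier]
    note mon = mon_carrier'[OF m] mon_carrier'[OF add(2,3)]
    have "ev a (MP.pmul (MP.mon m k) (MP.mon n l)) = (k \<odot>\<^bsub>A\<^esub> apow a m) \<otimes> (l \<odot>\<^bsub>A\<^esub> apow a n)"
      using m(2) add(3) apow_carrier[OF a] apow_add[of a m n, OF gen_carrier]
      by (simp add: MP.pmul_mon ev_mon KA.smult_assoc2 m_comm[of _ "l \<odot>\<^bsub>A\<^esub> _"] m_comm[of "apow a n"] KA.smult_assoc1[symmetric] K.m_comm[of l])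
    then show ?case 
      using add(4) ev_add[OF pc[OF mon(1) q] pc[OF mon(1,2)]] ev_add[OF q mon(2)] ev_mon[OF add(3)] m(2)
        ev_closed[OF q] apow_carrier[OF a] D[OF mon(1)] D[OF mon(2)] D[OF q] add(3)
      by (simp add: MP.pmul_add_right r_distr)
  qed
  show ?thesis
    using p unfolding MP.mpoly_carrier
  proof (induction rule: MP.psum_induct)
    case zero then show ?case using ev_closed[OF q] D[OF q] by (simp add: ev_zero MP.pmul_zero)
  next
    case (add p n l)
    note p = add(1)[folded MP.mpoly_carrier]
    note mon = mon_carrier'[OF add(2,3)]
    show ?case 
      using add(4) ev_add[OF pc[OF p q] pc[OF mon q]] ev_add[OF p mon] ev_mon[OF add(3)] 1[OF add(2,3)]
        ev_closed[OF q] ev_closed[OF p] apow_carrier[OF a] D[OF mon] D[OF q] D[OF p] add(3)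
      by (simp add: MP.pmul_add_left l_distr)
  qed
qed

lemma ev_homog: "p \<in> homog (mpoly K Xs) j \<Longrightarrow> ev a p \<in> homog A j"
  unfolding MP.mpoly_homog
proof (induction rule: MP.psum_induct)
  case zero then show ?case by (simp add: ev_zero homog_zero)
next
  case (add p m k)
  have "p \<in> carrier (mpoly K UNIV)" "MP.mon m k \<in> carrier (mpoly K UNIV)"
    using MP.psum_mono[of "{m. set_mset m \<subseteq> Xs \<and> int (size m) = j}" "MP.monset UNIV"] add(1,3) mon_carrier'[of m UNIV k] 
    unfolding MP.mpoly_carrier by auto
  from ev_add[OF this] show ?case
    using add ev_mon[OF add(3)] smult_homog[OF add(3) apow_homog[OF a, of m]] additive_subgroup.a_closed[OF homog_subgroup] by simp
qed

lemma ev_graded_hom: "graded_hom (mpoly K Xs) A (ev a)"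
proof (intro graded_hom.intro graded_hom_axioms.intro graded_ring_axioms graded_algebra.axioms(1)[OF MP.mpoly_graded_algebra])
  show "ev a \<in> ring_hom (mpoly K Xs) A"
  proof (rule ring_hom_memI)
    show "ev a \<one>\<^bsub>mpoly K Xs\<^esub> = \<one>" unfolding MP.mpoly_simps using ev_mon[of "\<one>\<^bsub>K\<^esub>" "{#}"] by simp
  qed (simp_all add: MP.mpoly_mult ev_mult MP.mpoly_simps(3) ev_add ev_closed)
qed (rule ev_homog)

lemma ev_linear: "graded_linear K (mpoly K Xs) A (ev a)"
  by (rule graded_linearI) (auto intro: ev_closed ev_homog simp: MP.mpoly_simps(3,4) ev_add ev_smult)

text \<open>Agreement on variables spreads to monomials by multiplicativity and to polynomials by
  linearity. Every presentation is thereby an evaluation \<open>ev a\<close>.\<close>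

lemma ev_unique:
  assumes h: "\<phi> \<in> ring_hom (mpoly K Xs) A" and s: "\<And>k p. k \<in> carrier K \<Longrightarrow> p \<in> carrier (mpoly K Xs) \<Longrightarrow> \<phi> (k \<odot>\<^bsub>mpoly K Xs\<^esub> p) = k \<odot>\<^bsub>A\<^esub> \<phi> p"
    and x: "\<And>i. i \<in> Xs \<Longrightarrow> \<phi> (MP.mon {#i#} \<one>\<^bsub>K\<^esub>) = a i" and p: "p \<in> carrier (mpoly K Xs)"
  shows "\<phi> p = ev a p"
proof -
  have m1: "\<phi> (MP.mon m \<one>\<^bsub>K\<^esub>) = apow a m" if "m \<in> MP.monset Xs" for m
    using that
  proof (induction m)
    case empty then show ?case using ring_hom_one[OF h] by (simp add: MP.mpoly_simps)
  next
    case (add i m)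
    then have i: "i \<in> Xs" "m \<in> MP.monset Xs" by auto
    have e: "MP.mon (add_mset i m) \<one>\<^bsub>K\<^esub> = MP.mon {#i#} \<one>\<^bsub>K\<^esub> \<otimes>\<^bsub>mpoly K Xs\<^esub> MP.mon m \<one>\<^bsub>K\<^esub>"
      by (simp add: MP.mpoly_mult MP.pmul_mon)
    show ?case unfolding e using ring_hom_mult[OF h mon_carrier' mon_carrier', of "{#i#}" "\<one>\<^bsub>K\<^esub>" m "\<one>\<^bsub>K\<^esub>"] i add.IH[OF i(2)] x[OF i(1)]
       apow_add[of a "{#i#}" m, OF gen_carrier] gen_carrier by simp
  qed
  have m: "\<phi> (MP.mon m k) = ev a (MP.mon m k)" if "m \<in> MP.monset Xs" "k \<in> carrier K" for m k
  proof -
    have "MP.mon m k = k \<odot>\<^bsub>mpoly K Xs\<^esub> MP.mon m \<one>\<^bsub>K\<^esub>" using that by (auto simp: MP.mpoly_simps MP.mon_apply)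
    then have "\<phi> (MP.mon m k) = k \<odot>\<^bsub>A\<^esub> \<phi> (MP.mon m \<one>\<^bsub>K\<^esub>)" using s[OF that(2) mon_carrier'[OF that(1)], of "\<one>\<^bsub>K\<^esub>"] by simp
    then show ?thesis using m1[OF that(1)] ev_mon[OF that(2)] by simp
  qed
  show ?thesis
    using p unfolding MP.mpoly_carrier
  proof (induction rule: MP.psum_induct)
    case zero 
    have "\<phi> \<zero>\<^bsub>mpoly K Xs\<^esub> = \<zero>"
      using ring_hom_zero[OF h] cring.axioms(1)[OF MP.mpoly_cring] ring_axioms by blast
    then show ?case by (simp add: ev_zero MP.mpoly_simps)
  next
    case (add p n l)
    note p = add(1)[folded MP.mpoly_carrier]
    note mon = mon_carrier'[OF add(2,3)]
    show ?case using ring_hom_add[OF h p mon] ev_add[OF p mon] add(4) m[OF add(2,3)] by (simp add: MP.mpoly_simps(3))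
  qed
qed

end

lemma ev_cong:
  assumes "range a \<subseteq> homog A 1" "range b \<subseteq> homog A 1" "\<And>i. i \<in> Xs \<Longrightarrow> a i = b i" "p \<in> carrier (mpoly K Xs)"
  shows "ev a p = ev b p"
proof -
  interpret E: graded_hom "mpoly K Xs" A "ev a" by (rule ev_graded_hom[OF assms(1)])
  show ?thesis
    by (rule ev_unique[OF assms(2) E.hom graded_linearD(3)[OF ev_linear[OF assms(1)]] _ assms(4)])
      (use assms(3) gen_carrier[OF assms(1)] gen_carrier[OF assms(2)] ev_mon[OF assms(1)] in \<open>simp_all add: KA.smult_one\<close>)
qed

end

subsection \<open>Independence of the polynomial presentation\<close>

context mpoly_ring
begin

lemma mpoly_mono: "Xs \<subseteq> Ys \<Longrightarrow> homog (mpoly K Xs) j \<subseteq> homog (mpoly K Ys) j" "Xs \<subseteq> Ys \<Longrightarrow> carrier (mpoly K Xs) \<subseteq> carrier (mpoly K Ys)"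
  unfolding mpoly_homog mpoly_carrier by (rule psum_mono, blast)+

lemma mon_homog: "set_mset m \<subseteq> Xs \<Longrightarrow> a \<in> carrier K \<Longrightarrow> int (size m) = j \<Longrightarrow> mon m a \<in> homog (mpoly K Xs) j"
  unfolding mpoly_homog by (rule psum_mon) auto

lemma mpoly_homog_carrier: "p \<in> homog (mpoly K Xs) j \<Longrightarrow> p \<in> carrier (mpoly K Xs)"
  by (simp add: mpoly_simps)

text \<open>The coefficient of \<open>(x\<^sub>v - l) q\<close> at \<open>m + {v}\<close> is \<open>q m\<close> if \<open>m\<close> has maximal degree in \<open>x\<^sub>v\<close> among the
  monomials of \<open>q\<close>.\<close>

lemma nonzerodivisor:
  assumes v: "v \<notin> Xs" and l: "l \<in> carrier (mpoly K Xs)" and q: "q \<in> carrier (mpoly K Ys)"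
    and eq: "pmul (mon {#v#} \<one>) q = pmul l q"
  shows "q = (\<lambda>_. \<zero>)"
proof (rule ccontr)
  assume "q \<noteq> (\<lambda>_. \<zero>)"
  let ?U = "{m. q m \<noteq> \<zero>}" let ?D = "(\<lambda>m. count m v) ` ?U"
  have U: "finite ?U" "?U \<noteq> {}" using mpoly_carrierD(2)[OF q] \<open>q \<noteq> _\<close> by auto
  then have "Max ?D \<in> ?D" by (intro Max_in) auto
  then obtain m where m: "q m \<noteq> \<zero>" "count m v = Max ?D" by auto
  \<comment> \<open>Monomials of \<open>l\<close> do not contain \<open>v\<close>, so the
    complementary monomial has degree \<open>Max ?D + 1\<close> in \<open>v\<close> and its
    coefficient in \<open>q\<close> vanishes.\<close>
  have "l a \<otimes> q (add_mset v m - a) = \<zero>" if "a \<subseteq># add_mset v m" for a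
  proof (cases "l a = \<zero>")
    case False
    then have "set_mset a \<subseteq> Xs" using l by (auto simp: mpoly_carrier psum_homog)
    then have "count (add_mset v m - a) v = Suc (Max ?D)" using v m(2) not_in_iff[of v a] by auto
    then have "q (add_mset v m - a) = \<zero>" using Max_ge[of ?D "count (add_mset v m - a) v"] U(1) by fastforce
    then show ?thesis using mpoly_carrierD(1)[OF l] by simp
  qed (use mpoly_carrierD(1)[OF q] in simp)
  then have "pmul l q (add_mset v m) = (\<Oplus>a\<in>{a. a \<subseteq># add_mset v m}. \<zero>)"
    unfolding pmul_def by (intro finsum_cong') auto
  moreover have "pmul (mon {#v#} \<one>) q (add_mset v m) = q m"
    using mpoly_carrierD(1)[OF q] by (simp add: pmul_mon_left)
  ultimately show False using eq m(1) by simp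
qed

text \<open>\<open>mpoly K Xs\<close> is the quotient of the larger ring by \<open>?y\<close>, the
  new variable minus the linear form \<open>a v\<close>. As \<open>?y\<close> is a nonzerodivisor of
  degree 1, multiplication by it resolves the quotient in one step, with generators in degrees 0 and
  1.\<close>

lemma lin_adjoin:
  assumes v: "v \<notin> Xs" and a: "range a \<subseteq> homog (mpoly K Xs) 1" and ax: "\<And>i. i \<in> Xs \<Longrightarrow> a i = mon {#i#} \<one>"
  shows "lin (mpoly K (insert v Xs)) 1 p 0 (resm (graded_algebra.ev K (mpoly K Xs) a) (selfm (mpoly K Xs)))"
proof -
  let ?T = "mpoly K (insert v Xs)" and ?S = "mpoly K Xs"
  interpret S: graded_algebra K ?S pcomp by (rule mpoly_graded_algebra)
  interpret T: graded_algebra K ?T pcomp by (rule mpoly_graded_algebra)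
  let ?s = "S.ev a" let ?x = "\<lambda>i. mon {#i#} \<one>" let ?y = "?x v \<ominus>\<^bsub>?T\<^esub> a v"
  interpret H: graded_hom ?T ?S ?s by (rule S.ev_graded_hom[OF a])
  interpret TM: graded_module ?T "selfm ?T" by (rule T.graded_module_selfm)
  have ops: "add ?S = add ?T" "monoid.mult ?S = monoid.mult ?T" "zero ?S = zero ?T" "one ?S = one ?T" "smult ?S = smult ?T"
    by (simp_all add: mpoly_simps mpoly_mult)
  have sub: "homog ?S j \<subseteq> homog ?T j" "carrier ?S \<subseteq> carrier ?T" for j using mpoly_mono[of Xs "insert v Xs"] by auto
  have s_id: "?s p = p" if "p \<in> carrier ?S" for p
    by (rule S.ev_unique[OF a _ _ _ that, symmetric, where \<phi> = "\<lambda>x. x"]) (use ax in \<open>auto simp: ring_hom_def\<close>)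
  have sT: "?s p \<in> homog ?T j" if "p \<in> homog ?T j" for p j using H.hom_homog[OF that] sub by blast
  have x: "?x i \<in> homog ?T 1" if "i \<in> insert v Xs" for i using that by (intro mon_homog) auto
  have av: "a v \<in> homog ?S 1" "a v \<in> homog ?T 1" using a sub by auto
  have s_x: "?s (?x i) = a i" if "i \<in> insert v Xs" for i
    using S.ev_mon[OF a, of "\<one>" "{#i#}"] S.gen_carrier[OF a] by (simp add: S.KA.smult_one)
  have y: "?y \<in> homog ?T 1" using TM.M_homog_diff[of "?x v" 1 "a v"] x av by (simp add: a_minus_def)
  note yc = T.homog_carrier[OF y]
  have y_mult: "?y \<otimes>\<^bsub>?T\<^esub> q = ?x v \<otimes>\<^bsub>?T\<^esub> q \<ominus>\<^bsub>?T\<^esub> a v \<otimes>\<^bsub>?T\<^esub> q" if "q \<in> carrier ?T" for q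
    using that T.homog_carrier[OF x, of v] T.homog_carrier[OF av(2)] by (simp add: T.minus_eq T.l_distr T.l_minus)
  have y_inj: "q = \<zero>\<^bsub>?T\<^esub>" if "q \<in> carrier ?T" "?y \<otimes>\<^bsub>?T\<^esub> q = \<zero>\<^bsub>?T\<^esub>" for q
  proof -
    have "?x v \<otimes>\<^bsub>?T\<^esub> q = a v \<otimes>\<^bsub>?T\<^esub> q"
      using that y_mult[OF that(1)] T.homog_carrier[OF x, of v] T.homog_carrier[OF av(2)] by simp
    from nonzerodivisor[OF v S.homog_carrier[OF av(1)] that(1) this[unfolded mpoly_mult]]
    show ?thesis by (simp add: mpoly_simps)
  qed
  \<comment> \<open>The factor \<open>e\<close> is 1 for the new variable and 0 for the old ones;
    this treats both cases uniformly below.\<close>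
  have gen: "\<exists>e \<in> homog ?T 0. ?x i = a i \<oplus>\<^bsub>?T\<^esub> ?y \<otimes>\<^bsub>?T\<^esub> e" if i: "i \<in> insert v Xs" for i
  proof (cases "i = v")
    case True
    have "?x v = a v \<oplus>\<^bsub>?T\<^esub> ?y \<otimes>\<^bsub>?T\<^esub> \<one>\<^bsub>?T\<^esub>"
      using T.homog_carrier[OF x, of v] T.homog_carrier[OF av(2)]
      by (simp add: T.minus_eq T.l_neg T.r_neg T.a_assoc[symmetric] T.a_comm[of "a v" "?x v"])
       (simp add: T.r_neg T.a_assoc)
    then show ?thesis using True T.one_homog by blast
  next
    case False
    then have "?x i = a i \<oplus>\<^bsub>?T\<^esub> ?y \<otimes>\<^bsub>?T\<^esub> \<zero>\<^bsub>?T\<^esub>" using i ax[of i] yc T.homog_carrier[OF x, of i] by simp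
    then show ?thesis using T.homog_zero by blast
  qed
  \<comment> \<open>A polynomial differs from its image under the substitution by a multiple of
    \<open>?y\<close>, with cofactor of degree one less. For a product of a variable
    \<open>x\<close> with value \<open>a\<close> and a monomial \<open>m\<close> with value
    \<open>s\<close> this follows from \<open>x m - a s = (x - a) s + x (m - s)\<close>.\<close>
  have dec_mon: "\<exists>q\<in>homog ?T (int (size m) - 1). mon m k = ?s (mon m k) \<oplus>\<^bsub>?T\<^esub> ?y \<otimes>\<^bsub>?T\<^esub> q"
    if "m \<in> monset (insert v Xs)" "k \<in> carrier K" for m k
    using that(1)
  proof (induction m)
    case empty
    have "mon {#} k \<in> carrier ?S" using that(2) mon_homog[of "{#}" Xs k 0] S.homog_carrier by simp
    then have "mon {#} k = ?s (mon {#} k) \<oplus>\<^bsub>?T\<^esub> ?y \<otimes>\<^bsub>?T\<^esub> \<zero>\<^bsub>?T\<^esub>"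
      using s_id[of "mon {#} k"] sub(2) yc by auto
    then show ?case using T.homog_zero by blast
  next
    case (add i m)
    then have i: "i \<in> insert v Xs" "m \<in> monset (insert v Xs)" by auto
    obtain q where q: "q \<in> homog ?T (int (size m) - 1)" "mon m k = ?s (mon m k) \<oplus>\<^bsub>?T\<^esub> ?y \<otimes>\<^bsub>?T\<^esub> q" using add.IH[OF i(2)] ..
    obtain e where e: "e \<in> homog ?T 0" "?x i = a i \<oplus>\<^bsub>?T\<^esub> ?y \<otimes>\<^bsub>?T\<^esub> e" using gen[OF i(1)] ..
    have mk: "mon m k \<in> homog ?T (int (size m))" using i that(2) by (intro mon_homog) auto
    let ?sm = "?s (mon m k)"
    note sm = sT[OF mk]
    have ai: "a i \<in> carrier ?T" using S.gen_carrier[OF a] sub by blast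
    note c = T.homog_carrier[OF q(1)] T.homog_carrier[OF e(1)] yc T.homog_carrier[OF sm] T.homog_carrier[OF x[OF i(1)]] ai
    have eq: "mon (add_mset i m) k = ?x i \<otimes>\<^bsub>?T\<^esub> mon m k" using that(2) by (simp add: mpoly_mult pmul_mon)
    have s_eq: "?s (mon (add_mset i m) k) = a i \<otimes>\<^bsub>?T\<^esub> ?sm"
      unfolding eq using H.homD(2)[OF T.homog_carrier[OF x[OF i(1)]] T.homog_carrier[OF mk]] s_x[OF i(1)] by (simp add: ops)
    let ?q = "e \<otimes>\<^bsub>?T\<^esub> ?sm \<oplus>\<^bsub>?T\<^esub> ?x i \<otimes>\<^bsub>?T\<^esub> q"
    have "?x i \<otimes>\<^bsub>?T\<^esub> mon m k = ?x i \<otimes>\<^bsub>?T\<^esub> ?sm \<oplus>\<^bsub>?T\<^esub> ?x i \<otimes>\<^bsub>?T\<^esub> (?y \<otimes>\<^bsub>?T\<^esub> q)"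
      by (subst q(2)) (use c in \<open>simp add: T.r_distr\<close>)
    also have "?x i \<otimes>\<^bsub>?T\<^esub> ?sm = a i \<otimes>\<^bsub>?T\<^esub> ?sm \<oplus>\<^bsub>?T\<^esub> ?y \<otimes>\<^bsub>?T\<^esub> (e \<otimes>\<^bsub>?T\<^esub> ?sm)"
      by (subst e(2)) (use c in \<open>simp add: T.l_distr T.m_assoc\<close>)
    also have "?x i \<otimes>\<^bsub>?T\<^esub> (?y \<otimes>\<^bsub>?T\<^esub> q) = ?y \<otimes>\<^bsub>?T\<^esub> (?x i \<otimes>\<^bsub>?T\<^esub> q)"
      using c by (intro T.m_lcomm) auto
    finally have "mon (add_mset i m) k = ?s (mon (add_mset i m) k) \<oplus>\<^bsub>?T\<^esub> ?y \<otimes>\<^bsub>?T\<^esub> ?q"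
      unfolding eq[symmetric] s_eq using c by (simp add: T.a_assoc T.r_distr)
    moreover have "?q \<in> homog ?T (int (size (add_mset i m)) - 1)"
      using T.mult_homog[OF e(1) sm] T.mult_homog[OF x[OF i(1)] q(1)] additive_subgroup.a_closed[OF T.homog_subgroup]
      by simp
    ultimately show ?case by blast
  qed
  have dec: "\<exists>q\<in>homog ?T (j - 1). p = ?s p \<oplus>\<^bsub>?T\<^esub> ?y \<otimes>\<^bsub>?T\<^esub> q" if "p \<in> homog ?T j" for p j
    using that unfolding mpoly_homog
  proof (induction rule: psum_induct)
    case zero
    have "(\<lambda>_. \<zero>) = ?s (\<lambda>_. \<zero>) \<oplus>\<^bsub>?T\<^esub> ?y \<otimes>\<^bsub>?T\<^esub> \<zero>\<^bsub>?T\<^esub>"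
      using H.hom_zero T.r_null[OF yc] T.r_zero[OF T.zero_closed] unfolding ops(3) by (simp only: mpoly_simps(2))
    then show ?case using T.homog_zero unfolding mpoly_homog by blast
  next
    case (add p m k)
    have p: "p \<in> homog ?T j" using add(1) unfolding mpoly_homog .
    have mk: "mon m k \<in> homog ?T j" using add by (intro mon_homog) auto
    obtain q where q: "q \<in> homog ?T (j - 1)" "p = ?s p \<oplus>\<^bsub>?T\<^esub> ?y \<otimes>\<^bsub>?T\<^esub> q" using add(4) unfolding mpoly_homog ..
    obtain q' where q': "q' \<in> homog ?T (j - 1)" "mon m k = ?s (mon m k) \<oplus>\<^bsub>?T\<^esub> ?y \<otimes>\<^bsub>?T\<^esub> q'" 
      using dec_mon[of m k] add(2,3) by auto
    note c = T.homog_carrier[OF q(1)] T.homog_carrier[OF q'(1)] yc T.homog_carrier[OF sT[OF p]] T.homog_carrier[OF sT[OF mk]]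
    have s: "?s (p \<oplus>\<^bsub>?T\<^esub> mon m k) = ?s p \<oplus>\<^bsub>?T\<^esub> ?s (mon m k)"
      using H.homD(3)[OF T.homog_carrier[OF p] T.homog_carrier[OF mk]] by (simp add: ops)
    have "p \<oplus>\<^bsub>?T\<^esub> mon m k = (?s p \<oplus>\<^bsub>?T\<^esub> ?y \<otimes>\<^bsub>?T\<^esub> q) \<oplus>\<^bsub>?T\<^esub> (?s (mon m k) \<oplus>\<^bsub>?T\<^esub> ?y \<otimes>\<^bsub>?T\<^esub> q')"
      using q(2) q'(2) by simp
    also have "\<dots> = ?s (p \<oplus>\<^bsub>?T\<^esub> mon m k) \<oplus>\<^bsub>?T\<^esub> ?y \<otimes>\<^bsub>?T\<^esub> (q \<oplus>\<^bsub>?T\<^esub> q')"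
      unfolding s using c by (simp add: T.r_distr T.a_ac)
    finally show ?case using additive_subgroup.a_closed[OF T.homog_subgroup q(1) q'(1)] unfolding mpoly_homog mpoly_simps(3) by blast
  qed
  let ?M = "resm ?s (selfm ?S)"
  have gM: "graded_module ?T ?M" by (rule H.graded_module_resm[OF S.graded_module_selfm])
  have lin_s: "graded_linear ?T (selfm ?T) ?M ?s"
    by (rule graded_linearI) (auto simp: resm_simps H.homD H.hom_homog)
  note gk = graded_module_kerm[OF TM.graded_module_axioms gM lin_s]
  show ?thesis
  proof (rule T.lin_quotient[OF TM.graded_module_axioms gM lin_s])
    show "homog ?M j \<subseteq> ?s ` homog (selfm ?T) j" for j
      using s_id sub(1)[of j] S.homog_carrier[of _ j] by (auto simp: resm_simps intro!: image_eqI)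
    show "lin ?T 1 p 0 (selfm ?T)" by (rule T.lin_selfm) simp
    fix p'
    let ?N = "(selfm ?T)\<lparr>homog := \<lambda>j. homog ?T (j + - 1)\<rparr>"
    \<comment> \<open>Multiplication by \<open>?y\<close> identifies the ring, shifted by one
      degree, with the kernel of the substitution.\<close>
    have u: "graded_linear ?T ?N (kerm (selfm ?T) ?M ?s) (\<lambda>q. ?y \<otimes>\<^bsub>?T\<^esub> q)"
    proof (rule graded_linearI)
      fix j q assume "q \<in> homog ?N j"
      then have q: "q \<in> homog ?T (j - 1)" by simp
      have "?s ?y = \<zero>\<^bsub>?S\<^esub>"
      proof -
        have "?s ?y \<oplus>\<^bsub>?S\<^esub> ?s (a v) = ?s (?y \<oplus>\<^bsub>?T\<^esub> a v)" using H.homD(3) yc T.homog_carrier[OF av(2)] by simp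
        also have "?y \<oplus>\<^bsub>?T\<^esub> a v = ?x v" using T.homog_carrier[OF av(2)] T.homog_carrier[OF x, of v] 
          by (simp add: T.minus_eq T.a_assoc T.l_neg)
        finally have "?s ?y \<oplus>\<^bsub>?S\<^esub> a v = a v" using s_x[of v] s_id[OF S.homog_carrier[OF av(1)]] by simp
        then show ?thesis using S.homog_carrier[OF av(1)] H.homD(1)[OF yc] S.add.r_cancel_one by metis
      qed
      then have "?s (?y \<otimes>\<^bsub>?T\<^esub> q) = \<zero>\<^bsub>?S\<^esub>"
        using H.homD(2)[OF yc T.homog_carrier[OF q]] H.homD(1)[OF T.homog_carrier[OF q]] by simp
      then show "?y \<otimes>\<^bsub>?T\<^esub> q \<in> homog (kerm (selfm ?T) ?M ?s) j" using T.mult_homog[OF y q] by (simp add: resm_simps)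
    qed (use yc in \<open>auto simp: T.r_distr intro: T.m_lcomm\<close>)
    have "lin ?T 1 p' (0 - - 1) ?N" using T.lin_shift[OF T.lin_selfm[OF order.refl], of 1 p' "- 1"] by simp
    moreover have "lin ?T 1 p' (0 + 1) ?N \<longleftrightarrow> lin ?T 1 p' (0 + 1) (kerm (selfm ?T) ?M ?s)"
    proof (rule T.lin_iso[OF T.graded_module_selfm_shift gk u])
      show "q = \<zero>\<^bsub>?N\<^esub>" if "q \<in> homog ?N j" "?y \<otimes>\<^bsub>?T\<^esub> q = \<zero>\<^bsub>kerm (selfm ?T) ?M ?s\<^esub>" for j q
        using y_inj[of q] that T.homog_carrier[of q "j - 1"] by simp
      show "homog (kerm (selfm ?T) ?M ?s) j \<subseteq> (\<lambda>q. ?y \<otimes>\<^bsub>?T\<^esub> q) ` homog ?N j" for j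
      proof
        fix p assume "p \<in> homog (kerm (selfm ?T) ?M ?s) j"
        then have p: "p \<in> homog ?T j" "?s p = \<zero>\<^bsub>?T\<^esub>" by (auto simp: resm_simps ops)
        obtain q where q: "q \<in> homog ?T (j - 1)" "p = ?s p \<oplus>\<^bsub>?T\<^esub> ?y \<otimes>\<^bsub>?T\<^esub> q" using dec[OF p(1)] ..
        then have "p = ?y \<otimes>\<^bsub>?T\<^esub> q" using p(2) yc T.homog_carrier[OF q(1)] by simp
        then show "p \<in> (\<lambda>q. ?y \<otimes>\<^bsub>?T\<^esub> q) ` homog ?N j" using q(1) by simp
      qed
    qed
    ultimately show "lin ?T 1 p' (0 + 1) (kerm (selfm ?T) ?M ?s)" by simp
  qed
qed

end

lemma resm_selfm: "resm f (selfm A) = restrict_scalars f A"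
  by (simp add: resm_def selfm_def restrict_scalars_def)

lemma (in graded_hom) graded_module_restrict: "graded_module A (restrict_scalars \<psi> B)"
  using graded_module_resm[OF B.graded_module_selfm] by (simp add: resm_selfm)

lemma lin_restrict_cong:
  assumes "graded_hom S A f" "graded_hom S A g" "\<And>p. p \<in> carrier S \<Longrightarrow> f p = g p"
  shows "lin S q p r (restrict_scalars f A) \<longleftrightarrow> lin S q p r (restrict_scalars g A)"
proof -
  interpret f: graded_hom S A f by fact
  interpret g: graded_hom S A g by fact
  have "graded_linear S (restrict_scalars f A) (restrict_scalars g A) (\<lambda>x. x)"
    by (rule graded_linearI) (simp_all add: assms(3))
  then show ?thesis by (rule f.A.lin_iso[OF f.graded_module_restrict g.graded_module_restrict]) simp_all
qed

context graded_algebra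
begin

text \<open>Substituting \<open>l\<close> for the variable \<open>v\<close> maps the larger ring
  onto the smaller one, and \<open>ev a\<close> factors through this map. By
  \<open>lin_adjoin\<close> the smaller ring has constant 0 over the larger, so the bound passes in
  both directions, by \<open>lin_resm\<close> and \<open>lin_resmD\<close>.\<close>

lemma lin_insert:
  assumes a: "range a \<subseteq> homog A 1" and v: "v \<notin> Xs" and l: "l \<in> homog (mpoly K Xs) 1" "ev a l = a v"
  shows "lin (mpoly K Xs) 1 p r (restrict_scalars (ev a) A) \<longleftrightarrow> lin (mpoly K (insert v Xs)) 1 p r (restrict_scalars (ev a) A)"
proof -
  let ?T = "mpoly K (insert v Xs)" and ?S = "mpoly K Xs"
  interpret S: graded_algebra K ?S MP.pcomp by (rule MP.mpoly_graded_algebra)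
  define b where "b = (\<lambda>i. if i \<in> Xs then MP.mon {#i#} \<one>\<^bsub>K\<^esub> else if i = v then l else \<zero>\<^bsub>?S\<^esub>)"
  have b: "range b \<subseteq> homog ?S 1"
    using l(1) S.homog_zero MP.mon_homog[of "{#_#}" Xs] unfolding b_def by auto
  have bx: "b i = MP.mon {#i#} \<one>\<^bsub>K\<^esub>" if "i \<in> Xs" for i using that by (simp add: b_def)
  note L = MP.lin_adjoin[OF v b bx]
  interpret H: graded_hom ?T ?S "S.ev b" by (rule S.ev_graded_hom[OF b])
  interpret E: graded_hom ?S A "ev a" by (rule ev_graded_hom[OF a])
  interpret ET: graded_hom ?T A "ev a" by (rule ev_graded_hom[OF a])
  have C: "graded_hom ?T A (\<lambda>x. ev a (S.ev b x))"
    by (intro graded_hom.intro graded_hom_axioms.intro H.A.graded_ring_axioms graded_ring_axioms E.hom_homog H.hom_homog)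
      (auto simp: ring_hom_def H.homD E.homD)
  have eq: "ev a (S.ev b p) = ev a p" if "p \<in> carrier ?T" for p
  proof (rule ev_unique[OF a graded_hom.hom[OF C] _ _ that])
    show "ev a (S.ev b (k \<odot>\<^bsub>?T\<^esub> p)) = k \<odot>\<^bsub>A\<^esub> ev a (S.ev b p)" if "k \<in> carrier K" "p \<in> carrier ?T" for k p
      using graded_linearD(3)[OF S.ev_linear[OF b] that] graded_linearD(3)[OF ev_linear[OF a] that(1) H.homD(1)[OF that(2)]] by simp
    fix i assume i: "i \<in> insert v Xs"
    have "S.ev b (MP.mon {#i#} \<one>\<^bsub>K\<^esub>) = b i"
      using S.ev_mon[OF b, of "\<one>\<^bsub>K\<^esub>" "{#i#}"] S.gen_carrier[OF b] by (simp add: S.KA.smult_one)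
    moreover have "ev a (b i) = a i"
      using i l v ev_mon[OF a, of "\<one>\<^bsub>K\<^esub>" "{#i#}"] gen_carrier[OF a] by (auto simp: b_def KA.smult_one)
    ultimately show "ev a (S.ev b (MP.mon {#i#} \<one>\<^bsub>K\<^esub>)) = a i" by simp
  qed
  have "lin ?T 1 p r (restrict_scalars (ev a) A) \<longleftrightarrow> lin ?T 1 p r (restrict_scalars (\<lambda>x. ev a (S.ev b x)) A)"
    using lin_restrict_cong[OF ET.graded_hom_axioms C, of 1 p r] eq by simp
  also have "\<dots> \<longleftrightarrow> lin ?T 1 p r (resm (S.ev b) (restrict_scalars (ev a) A))" by (simp add: resm_restrict_scalars)
  also have "\<dots> \<longleftrightarrow> lin ?S 1 p r (restrict_scalars (ev a) A)"
    using H.lin_resm[OF L E.graded_module_restrict, of p r] H.lin_resmD[OF _ L E.graded_module_restrict, of p r] by auto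
  finally show ?thesis ..
qed

text \<open>Surjectivity in degree 1 supplies, for each variable to be adjoined, a linear form in
  the present variables with the same value.\<close>

definition spans :: "nat set \<Rightarrow> (nat \<Rightarrow> 'b) \<Rightarrow> bool" where
  "spans Xs a \<longleftrightarrow> homog A 1 \<subseteq> ev a ` homog (mpoly K Xs) 1"

lemma spans_mono: "spans Xs a \<Longrightarrow> Xs \<subseteq> Ys \<Longrightarrow> spans Ys a"
  unfolding spans_def using MP.mpoly_mono(1)[of Xs Ys 1] by blast

lemma lin_Un:
  assumes a: "range a \<subseteq> homog A 1" and s: "spans Xs a" and F: "finite F" "F \<inter> Xs = {}"
  shows "lin (mpoly K Xs) 1 p r (restrict_scalars (ev a) A) \<longleftrightarrow> lin (mpoly K (Xs \<union> F)) 1 p r (restrict_scalars (ev a) A)"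
  using F
proof (induction F)
  case (insert v F)
  have "a v \<in> ev a ` homog (mpoly K (Xs \<union> F)) 1"
    using spans_mono[OF s, of "Xs \<union> F"] a unfolding spans_def by blast
  then obtain l where "l \<in> homog (mpoly K (Xs \<union> F)) 1" "ev a l = a v" by (elim imageE) simp
  from lin_insert[OF a _ this, of p r] show ?case using insert by simp
qed simp

text \<open>Both sides are compared with the ring on \<open>Xs \<union> Ys\<close>, which arises
  from either by adjoining variables whose values are already attained by linear forms.\<close>

lemma lin_exchange:
  assumes a: "range a \<subseteq> homog A 1" and s: "spans Xs a" "spans Ys a" and F: "finite Xs" "finite Ys" "Xs \<inter> Ys = {}"
  shows "lin (mpoly K Xs) 1 p r (restrict_scalars (ev a) A) \<longleftrightarrow> lin (mpoly K Ys) 1 p r (restrict_scalars (ev a) A)"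
  using lin_Un[OF a s(1) F(2), of p r] lin_Un[OF a s(2) F(1), of p r] F(3) by (simp add: Un_commute Int_commute)

lemma spans_transfer:
  assumes a: "range a \<subseteq> homog A 1" and b: "range b \<subseteq> homog A 1" and s: "spans Ys b" and ab: "\<And>i. i \<in> Ys \<Longrightarrow> \<exists>j\<in>Xs. a j = b i"
  shows "spans Xs a"
  unfolding spans_def
proof
  interpret X: graded_algebra K "mpoly K Xs" MP.pcomp by (rule MP.mpoly_graded_algebra)
  interpret Y: graded_algebra K "mpoly K Ys" MP.pcomp by (rule MP.mpoly_graded_algebra)
  fix x assume "x \<in> homog A 1"
  then obtain l where l: "l \<in> homog (mpoly K Ys) 1" "x = ev b l" using s unfolding spans_def by blast
  have "ev b l \<in> ev a ` homog (mpoly K Xs) 1"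
    using l(1) unfolding MP.mpoly_homog[of Ys]
  proof (induction rule: MP.psum_induct)
    case zero
    have "ev b (\<lambda>_. \<zero>\<^bsub>K\<^esub>) = ev a \<zero>\<^bsub>mpoly K Xs\<^esub>" by (simp add: ev_zero MP.mpoly_simps)
    then show ?case using X.homog_zero by blast
  next
    case (add p m k)
    have p: "p \<in> carrier (mpoly K Ys)" using add(1)[folded MP.mpoly_homog] by (rule MP.mpoly_homog_carrier)
    have "size m = 1" "set_mset m \<subseteq> Ys" using add(2) by auto
    moreover obtain i where "m = {#i#}" using size_1_singleton_mset[OF \<open>size m = 1\<close>] by (elim exE)
    ultimately have i: "m = {#i#}" "i \<in> Ys" by simp_all
    obtain j where j: "j \<in> Xs" "a j = b i" using ab[OF i(2)] ..
    obtain q where q: "q \<in> homog (mpoly K Xs) 1" "ev b p = ev a q" using add(4) by (elim imageE)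
    have mk: "MP.mon {#j#} k \<in> homog (mpoly K Xs) 1" "MP.mon m k \<in> carrier (mpoly K Ys)"
      using j i add(3) MP.mon_homog[of m Ys k] MP.mpoly_homog_carrier by (auto intro: MP.mon_homog)
    have "ev b (\<lambda>n. p n \<oplus>\<^bsub>K\<^esub> MP.mon m k n) = ev a (\<lambda>n. q n \<oplus>\<^bsub>K\<^esub> MP.mon {#j#} k n)"
      using ev_add[OF b p mk(2)] ev_add[OF a MP.mpoly_homog_carrier[OF q(1)] MP.mpoly_homog_carrier[OF mk(1)]]
        ev_mon[OF a add(3), of "{#j#}"] ev_mon[OF b add(3), of "{#i#}"] q(2) i j gen_carrier[OF a, of j] gen_carrier[OF b, of i] by simp
    moreover have "(\<lambda>n. q n \<oplus>\<^bsub>K\<^esub> MP.mon {#j#} k n) \<in> homog (mpoly K Xs) 1"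
      using additive_subgroup.a_closed[OF X.homog_subgroup q(1) mk(1)] by (simp add: MP.mpoly_simps(3))
    ultimately show ?case by blast
  qed
  then show "x \<in> ev a ` homog (mpoly K Xs) 1" using l(2) by simp
qed

text \<open>The variable sets \<open>{..<n}\<close> and \<open>{..<m}\<close> overlap, so a copy of
  the second presentation on fresh variables \<open>{N..<N + m}\<close> is interposed, and
  \<open>lin_exchange\<close> is applied once on each side.\<close>

lemma lin_presentation:
  assumes a: "range a \<subseteq> homog A 1" "spans {..<n} a" and b: "range b \<subseteq> homog A 1" "spans {..<m} b"
  shows "lin (mpoly K {..<n}) 1 p r (restrict_scalars (ev a) A) \<longleftrightarrow> lin (mpoly K {..<m}) 1 p r (restrict_scalars (ev b) A)"
proof -
  define N where "N = max n m"
  let ?Z = "{N..<N + m}"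
  \<comment> \<open>\<open>d\<close> extends \<open>a\<close> and \<open>d'\<close> extends
    \<open>b\<close> by the same copy of \<open>b\<close> on the fresh variables. There are two
    extensions because \<open>a\<close> and \<open>b\<close> may disagree on common indices.\<close>
  define d where "d = (\<lambda>i. if i < n then a i else if N \<le> i then b (i - N) else \<zero>)"
  define d' where "d' = (\<lambda>i. if i < m then b i else if N \<le> i then b (i - N) else \<zero>)"
  have d: "range d \<subseteq> homog A 1" "range d' \<subseteq> homog A 1" using a(1) b(1) homog_zero unfolding d_def d'_def by auto
  have da: "d i = a i" if "i \<in> {..<n}" for i using that by (simp add: d_def)
  have db: "d' i = b i" if "i \<in> {..<m}" for i using that by (simp add: d'_def)
  have dd: "d i = d' i" if "i \<in> ?Z" for i using that by (simp add: d'_def d_def N_def)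
  have z: "\<exists>j\<in>?Z. d j = b i" if "i \<in> {..<m}" for i
    using that by (intro bexI[of _ "N + i"]) (auto simp: d_def N_def)
  have sp: "spans {..<n} d" "spans {..<m} d'" "spans ?Z d" "spans ?Z d'"
    using spans_transfer[OF d(1) a, of "{..<n}"] spans_transfer[OF d(2) b, of "{..<m}"] da db
      spans_transfer[OF d(1) b, of ?Z] spans_transfer[OF d(2) b, of ?Z] z dd by metis+
  have disj: "{..<n} \<inter> ?Z = {}" "{..<m} \<inter> ?Z = {}" by (auto simp: N_def)
  have "lin (mpoly K {..<n}) 1 p r (restrict_scalars (ev a) A) \<longleftrightarrow> lin (mpoly K {..<n}) 1 p r (restrict_scalars (ev d) A)"
    by (rule lin_restrict_cong[OF ev_graded_hom[OF a(1)] ev_graded_hom[OF d(1)]]) (rule ev_cong[OF a(1) d(1) da[symmetric]])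
  also have "\<dots> \<longleftrightarrow> lin (mpoly K ?Z) 1 p r (restrict_scalars (ev d) A)"
    by (rule lin_exchange[OF d(1) sp(1,3) _ _ disj(1)]) simp_all
  also have "\<dots> \<longleftrightarrow> lin (mpoly K ?Z) 1 p r (restrict_scalars (ev d') A)"
    by (rule lin_restrict_cong[OF ev_graded_hom[OF d(1)] ev_graded_hom[OF d(2)]]) (rule ev_cong[OF d dd])
  also have "\<dots> \<longleftrightarrow> lin (mpoly K {..<m}) 1 p r (restrict_scalars (ev d') A)"
    by (rule lin_exchange[OF d(2) sp(4,2) _ _ disj(2)[unfolded Int_commute[of "{..<m}"]]]) simp_all
  also have "\<dots> \<longleftrightarrow> lin (mpoly K {..<m}) 1 p r (restrict_scalars (ev b) A)"
    by (rule lin_restrict_cong[OF ev_graded_hom[OF d(2)] ev_graded_hom[OF b(1)]]) (rule ev_cong[OF d(2) b(1) db])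
  finally show ?thesis .
qed

end

subsection \<open>The Green-Lazarsfeld index\<close>

lemma top_degree_le: "top_degree R M i \<le> ereal x \<longleftrightarrow> (\<forall>j. Tor_nonzero R M i j \<longrightarrow> real_of_int j \<le> x)"
  by (auto simp: top_degree_def SUP_le_iff)

context graded_algebra
begin

text \<open>\<open>\<phi>\<close> commutes with components, so any preimage of an element of degree
  \<open>j\<close> can be replaced by its component of degree \<open>j\<close>.\<close>

lemma hom_surj_homog:
  assumes "graded_hom B A \<phi>" "decomposed B c" "carrier A \<subseteq> \<phi> ` carrier B"
  shows "homog A j \<subseteq> \<phi> ` homog B j"
proof
  interpret H: graded_hom B A \<phi> by fact
  interpret B: decomposed B c by fact
  fix x assume x: "x \<in> homog A j"
  then obtain p where p: "p \<in> carrier B" "x = \<phi> p" using assms(3) homog_carrier by blast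
  have "\<phi> (c j p) = comp j (\<phi> p)"
    by (rule comp_commute[where f = \<phi>, OF assms(2) decomposed_axioms H.hom_zero]) (simp_all add: H.homD H.hom_homog p(1))
  then have "x = \<phi> (c j p)" using p(2) D.comp_same[OF x] by simp
  then show "x \<in> \<phi> ` homog B j" using B.comp_homog[OF p(1), of j] by blast
qed

text \<open>The condition in the index bounds degrees by \<open>i + 1\<close>, the line of slope 1
  with constant 1; this is \<open>lin\<close> with \<open>q = 1\<close> and
  \<open>r = 1\<close>.\<close>

lemma presentation_lin:
  assumes H: "graded_hom (mpoly K Xs) A \<phi>" and surj: "carrier A \<subseteq> \<phi> ` carrier (mpoly K Xs)"
  shows "(\<forall>i\<le>p. top_degree (mpoly K Xs) (restrict_scalars \<phi> A) i \<le> ereal (real (i + 1)))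
    \<longleftrightarrow> lin (mpoly K Xs) 1 p 1 (restrict_scalars \<phi> A)"
proof -
  let ?P = "mpoly K Xs" let ?M = "restrict_scalars \<phi> A"
  interpret P: graded_algebra K ?P MP.pcomp by (rule MP.mpoly_graded_algebra)
  interpret PR: decomposed_ring ?P MP.pcomp by (rule P.decomposed_ring[OF MP.mpoly_countable])
  interpret H: graded_hom ?P A \<phi> by (rule H)
  have lin: "graded_linear ?P (selfm ?P) ?M \<phi>"
    by (rule graded_linearI) (simp_all add: H.homD H.hom_homog)
  have dec: "decomposed ?M comp" by (rule decomposed_cong[OF decomposed_axioms]) simp_all
  have cg: "countably_generated ?P ?M"
    by (rule countably_generated_image[OF P.graded_module_selfm H.graded_module_restrict lin _ MP.mpoly_countable])
      (use hom_surj_homog[OF H P.decomposed_axioms surj] in simp)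
  note Tor = PR.Tor_vanishing_iff_lin[OF H.graded_module_restrict dec cg, of 1 p 1]
  have "(\<forall>i\<le>p. top_degree ?P ?M i \<le> ereal (real (i + 1)))
      \<longleftrightarrow> (\<forall>i j. i \<le> p \<longrightarrow> 1 + 1 * int i < j \<longrightarrow> \<not> Tor_nonzero ?P ?M i j)"
    unfolding top_degree_le by (auto simp: not_le not_less) (smt (verit) of_int_less_iff of_int_of_nat_eq of_int_add of_int_1)+
  also have "\<dots> \<longleftrightarrow> lin ?P 1 p 1 ?M" using Tor by auto
  finally show ?thesis .
qed

lemma spans_of_surj:
  assumes "range a \<subseteq> homog A 1" "carrier A \<subseteq> ev a ` carrier (mpoly K Xs)"
  shows "spans Xs a"
  unfolding spans_def
  by (rule hom_surj_homog[OF ev_graded_hom[OF assms(1)] graded_algebra.axioms(2)[OF MP.mpoly_graded_algebra] assms(2)])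

text \<open>The presentation picked in the definition is the evaluation at the images of its
  variables, so \<open>lin_presentation\<close> replaces it by any given one.\<close>

lemma gl_index_eq:
  assumes a: "range a \<subseteq> homog A 1" and surj: "carrier A \<subseteq> ev a ` carrier (mpoly K {..<n})"
  shows "gl_index K A = Sup {enat p | p. lin (mpoly K {..<n}) 1 p 1 (restrict_scalars (ev a) A)}"
proof -
  let ?G = "\<lambda>(n, \<phi>). graded_presentation K A n \<phi>"
  interpret E: graded_hom "mpoly K {..<n}" A "ev a" by (rule ev_graded_hom[OF a])
  have ex: "?G (n, ev a)"
    using E.hom ev_linear[OF a] surj E.homD(1) by (auto simp: graded_presentation_def mpoly_poly_algebra)
  obtain m \<phi> where eq: "Eps ?G = (m, \<phi>)" by (cases "Eps ?G")
  have "?G (Eps ?G)" by (rule someI[of ?G, OF ex])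
  then have G: "graded_presentation K A m \<phi>" unfolding eq by simp
  let ?P = "mpoly K {..<m}"
  interpret P: graded_algebra K ?P MP.pcomp by (rule MP.mpoly_graded_algebra)
  have hom: "\<phi> \<in> ring_hom ?P A" and lin: "graded_linear K ?P A \<phi>" and s: "carrier A \<subseteq> \<phi> ` carrier ?P"
    using G by (auto simp: graded_presentation_def mpoly_poly_algebra)
  have H: "graded_hom ?P A \<phi>"
    by (intro graded_hom.intro graded_hom_axioms.intro P.graded_ring_axioms graded_ring_axioms hom graded_linearD(4)[OF lin])
  define b where "b = (\<lambda>i. if i < m then \<phi> (MP.mon {#i#} \<one>\<^bsub>K\<^esub>) else \<zero>)"
  have b: "range b \<subseteq> homog A 1"
    using graded_linearD(4)[OF lin MP.mon_homog[of "{#_#}"]] homog_zero by (auto simp: b_def)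
  have \<phi>: "\<phi> p = ev b p" if "p \<in> carrier ?P" for p
    by (rule ev_unique[OF b hom graded_linearD(3)[OF lin] _ that]) (simp_all add: b_def)
  have sb: "carrier A \<subseteq> ev b ` carrier ?P" using s image_cong[OF refl \<phi>, of "carrier ?P"] by simp
  have "(\<forall>i\<le>p. top_degree ?P (restrict_scalars \<phi> A) i \<le> ereal (real (i + 1)))
      \<longleftrightarrow> lin (mpoly K {..<n}) 1 p 1 (restrict_scalars (ev a) A)" for p
    using presentation_lin[OF H s, of p] lin_restrict_cong[OF H ev_graded_hom[OF b] \<phi>, of 1 p 1]
      lin_presentation[OF b spans_of_surj[OF b sb] a spans_of_surj[OF a surj], of p 1] by simp
  then show ?thesis unfolding gl_index_def eq by (simp add: mpoly_poly_algebra)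
qed

text \<open>The words of length \<open>c\<close> are elements of degree 1 of the Veronese algebra.
  They generate it, since a word of length \<open>c * k\<close> splits into \<open>k\<close> of them
  and such words span degree \<open>c * k\<close> of \<open>A\<close>.\<close>

lemma veronese_presentation:
  assumes SG: "standard_generators A comp S" and S: "finite S" and c: "1 \<le> c"
  obtains n a where "range a \<subseteq> homog (veronese c A) 1"
    "carrier (veronese c A) \<subseteq> graded_algebra.ev K (veronese c A) a ` carrier (mpoly K {..<n})"
proof -
  let ?V = "veronese c A"
  interpret V: graded_algebra K ?V "\<lambda>i. comp (int c * i)" by (rule veronese_graded_algebra[OF c])
  interpret G: standard_generators A comp S by (rule SG)
  obtain n and f :: "nat \<Rightarrow> 'b" where W: "words A S c = f ` {i. i < n}"
    using finite_imp_nat_seg_image_inj_on[OF finite_words[OF S, of A c]] by (elim exE conjE)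
  let ?P = "mpoly K {..<n}"
  define a where "a = (\<lambda>i. if i < n then f i else \<zero>)"
  have Wh: "words A S c \<subseteq> homog ?V 1" using words_homog[OF G.S, of c] by (simp add: veronese_simps)
  have a: "range a \<subseteq> homog ?V 1" using Wh W homog_zero[of "int c * 1"] by (auto simp: a_def veronese_simps(7))
  interpret E: graded_hom ?P ?V "V.ev a" by (rule V.ev_graded_hom[OF a])
  let ?I = "V.ev a ` carrier ?P"
  have zero: "\<zero> \<in> ?I" using E.hom_zero by (intro image_eqI[of _ _ "\<zero>\<^bsub>?P\<^esub>"]) (auto simp: veronese_simps)
  have add: "x \<oplus> y \<in> ?I" if "x \<in> ?I" "y \<in> ?I" for x y
  proof -
    obtain p q where "p \<in> carrier ?P" "q \<in> carrier ?P" "x = V.ev a p" "y = V.ev a q" using \<open>x \<in> ?I\<close> \<open>y \<in> ?I\<close> by (elim imageE)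
    then show ?thesis using E.homD(3)[of p q] by (intro image_eqI[of _ _ "p \<oplus>\<^bsub>?P\<^esub> q"]) (auto simp: veronese_simps(5))
  qed
  have mult: "x \<otimes> y \<in> ?I" if "x \<in> ?I" "y \<in> ?I" for x y
  proof -
    obtain p q where "p \<in> carrier ?P" "q \<in> carrier ?P" "x = V.ev a p" "y = V.ev a q" using \<open>x \<in> ?I\<close> \<open>y \<in> ?I\<close> by (elim imageE)
    then show ?thesis using E.homD(2)[of p q] by (intro image_eqI[of _ _ "p \<otimes>\<^bsub>?P\<^esub> q"]) (auto simp: veronese_simps(2))
  qed
  have smult: "k \<odot>\<^bsub>A\<^esub> x \<in> ?I" if "k \<in> carrier K" "x \<in> ?I" for k x
  proof -
    obtain p where p: "p \<in> carrier ?P" "x = V.ev a p" using \<open>x \<in> ?I\<close> by (elim imageE)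
    interpret P: graded_algebra K ?P MP.pcomp by (rule MP.mpoly_graded_algebra)
    show ?thesis using graded_linearD(3)[OF V.ev_linear[OF a] that(1) p(1)] p P.KA.smult_closed[OF that(1) p(1)]
      by (intro image_eqI[of _ _ "k \<odot>\<^bsub>?P\<^esub> p"]) (auto simp: veronese_simps(6))
  qed
  have gens: "words A S c \<subseteq> ?I"
  proof
    fix w assume "w \<in> words A S c"
    then obtain i where i: "i < n" "w = f i" unfolding W by auto
    have "V.ev a (MP.mon {#i#} \<one>\<^bsub>K\<^esub>) = w"
      using V.ev_mon[OF a, of "\<one>\<^bsub>K\<^esub>" "{#i#}"] V.gen_carrier[OF a, of i] i by (simp add: V.KA.smult_one a_def)
    moreover have "MP.mon {#i#} \<one>\<^bsub>K\<^esub> \<in> carrier ?P" by (rule MP.mpoly_homog_carrier[OF MP.mon_homog]) (use i in auto)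
    ultimately show "w \<in> ?I" by blast
  qed
  have words: "words A S (c * k) \<subseteq> ?I" for k
  proof (induction k)
    case 0
    then show ?case using E.homD(4) by (auto simp: veronese_simps(3) intro!: image_eqI[of _ _ "\<one>\<^bsub>?P\<^esub>"])
  next
    case (Suc k)
    show ?case
    proof
      fix w assume "w \<in> words A S (c * Suc k)"
      then have "w \<in> words A S (c + c * k)" by simp
      from words_split[OF G.S this] obtain u v where "u \<in> words A S c" "v \<in> words A S (c * k)" "w = u \<otimes> v" by (elim bexE)
      then show "w \<in> ?I" using mult[OF subsetD[OF gens] subsetD[OF Suc]] by simp
    qed
  qed
  have cs: "x \<in> ?I" if "x \<in> cspan A (selfm A) (words A S (c * k))" for x k
    using that
  proof induction
    case czero then show ?case using zero by simp
  next
    case (cadd y b v)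
    obtain k' where k': "k' \<in> carrier K" "b = k' \<odot>\<^bsub>A\<^esub> \<one>" using cadd(2) unfolding homog_0 by (elim imageE)
    have "b \<otimes> v = k' \<odot>\<^bsub>A\<^esub> v" using smult_eq[OF k'(1), of v] words_carrier[OF G.S cadd(3)] k'(2) by simp
    then show ?case using add[OF cadd(4) smult[OF k'(1) subsetD[OF words cadd(3)]]] by simp
  qed
  have hom: "homog ?V i \<subseteq> ?I" for i
  proof (cases "i < 0")
    case True then show ?thesis using V.neg_homog'[OF True] zero by (simp add: veronese_simps)
  next
    case False
    then obtain k where k: "i = int k" by (metis nonneg_int_cases not_less)
    have "homog ?V i = homog A (int (c * k))" unfolding k by (simp add: veronese_simps)
    then show ?thesis using G.homog_span[of "c * k"] cs by blast
  qed
  have "carrier ?V \<subseteq> ?I"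
  proof
    fix x assume "x \<in> carrier ?V"
    then have "x \<in> hspan ?V" unfolding veronese_carrier .
    then show "x \<in> ?I"
    proof induction
      case hzero then show ?case using zero by (simp add: veronese_simps)
    next
      case (hadd x h i)
      then show ?case using add[of x h] hom[of i] by (auto simp: veronese_simps(5))
    qed
  qed
  then show ?thesis using that a by blast
qed

end

subsection \<open>Veronese subalgebras of quotients\<close>

context graded_quotient
begin

context
  fixes c :: nat
  assumes c: "1 \<le> c"
begin

interpretation V: graded_algebra K "veronese c A" "\<lambda>i. comp (int c * i)" by (rule veronese_graded_algebra[OF c])
interpretation QA: graded_algebra K Q Qcomp by (rule Q_graded_algebra)
interpretation U: graded_algebra K "veronese c Q" "\<lambda>i. Qcomp (int c * i)" by (rule QA.veronese_graded_algebra[OF c])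

lemma pr_veronese: "x \<in> carrier (veronese c A) \<Longrightarrow> pr x \<in> carrier (veronese c Q)"
  unfolding veronese_carrier
proof (induction rule: hspan.induct)
  case hzero then show ?case using U.zero_closed pr_zero by (simp add: veronese_simps)
next
  case (hadd x h i)
  have x: "x \<in> carrier (veronese c A)" using hadd(1) unfolding veronese_carrier .
  have h: "h \<in> homog A (int c * i)" using hadd(2) by (simp add: veronese_simps)
  then have "pr h \<in> homog (veronese c Q) i" by (simp add: veronese_simps quot_algebra_simps(7))
  then show ?case using U.a_closed[OF hadd(3) U.homog_carrier] Q_homD(3)[OF veronese_carrier_subset[OF x] homog_carrier[OF h]]
    by (simp add: veronese_simps(5))
qed

lemma pr_veronese_surj: "carrier (veronese c Q) \<subseteq> pr ` carrier (veronese c A)"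
proof
  fix C assume "C \<in> carrier (veronese c Q)"
  then have "C \<in> hspan (veronese c Q)" unfolding QA.veronese_carrier .
  then show "C \<in> pr ` carrier (veronese c A)"
  proof induction
    case hzero then show ?case using V.zero_closed pr_zero by (intro image_eqI[of _ _ \<zero>]) (auto simp: veronese_simps)
  next
    case (hadd C H i)
    obtain x where x: "x \<in> carrier (veronese c A)" "C = pr x" using hadd(3) by (elim imageE)
    obtain h where h: "h \<in> homog A (int c * i)" "H = pr h" using hadd(2) by (auto simp: veronese_simps(7) quot_algebra_simps(7))
    show ?case using Q_homD(3)[OF veronese_carrier_subset[OF x(1)] homog_carrier[OF h(1)]] x(2) h(2) veronese_add[OF x(1) veronese_homog_carrier[OF h(1)]]
      by (intro image_eqI[of _ _ "x \<oplus> h"]) (auto simp: veronese_simps(5))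
  qed
qed

lemma ev_pr:
  assumes a: "range a \<subseteq> homog (veronese c A) 1"
  shows "range (\<lambda>i. pr (a i)) \<subseteq> homog (veronese c Q) 1"
    and "p \<in> carrier (mpoly K Xs) \<Longrightarrow> U.ev (\<lambda>i. pr (a i)) p = pr (V.ev a p)"
proof -
  show b: "range (\<lambda>i. pr (a i)) \<subseteq> homog (veronese c Q) 1"
    using a by (auto simp: veronese_simps(7) quot_algebra_simps(7))
  interpret E: graded_hom "mpoly K Xs" "veronese c A" "V.ev a" by (rule V.ev_graded_hom[OF a])
  have sub: "V.ev a p \<in> carrier A" if "p \<in> carrier (mpoly K Xs)" for p using veronese_carrier_subset[OF E.homD(1)[OF that]] .
  have hom: "(\<lambda>p. pr (V.ev a p)) \<in> ring_hom (mpoly K Xs) (veronese c Q)"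
    by (rule ring_hom_memI) (use Q_homD sub E.homD pr_veronese in \<open>auto simp: veronese_simps(2,3,5)\<close>)
  show "U.ev (\<lambda>i. pr (a i)) p = pr (V.ev a p)" if p: "p \<in> carrier (mpoly K Xs)" for p
  proof (rule U.ev_unique[OF b hom _ _ p, symmetric])
    show "pr (V.ev a (k \<odot>\<^bsub>mpoly K Xs\<^esub> p)) = k \<odot>\<^bsub>veronese c Q\<^esub> pr (V.ev a p)" if "k \<in> carrier K" "p \<in> carrier (mpoly K Xs)" for k p
      using graded_linearD(3)[OF V.ev_linear[OF a] that] Q_smult[OF that(1) sub[OF that(2)]] by (simp add: veronese_simps(6))
    show "pr (V.ev a (MP.mon {#i#} \<one>\<^bsub>K\<^esub>)) = pr (a i)" for i
      using V.ev_mon[OF a, of "\<one>\<^bsub>K\<^esub>" "{#i#}"] V.gen_carrier[OF a, of i] by (simp add: V.KA.smult_one)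
  qed
qed

lemma ev_pr_surj:
  assumes a: "range a \<subseteq> homog (veronese c A) 1" and s: "carrier (veronese c A) \<subseteq> V.ev a ` carrier (mpoly K Xs)"
  shows "carrier (veronese c Q) \<subseteq> U.ev (\<lambda>i. pr (a i)) ` carrier (mpoly K Xs)"
proof
  fix C assume "C \<in> carrier (veronese c Q)"
  then obtain x where x: "x \<in> carrier (veronese c A)" "C = pr x" using pr_veronese_surj by blast
  then obtain p where "p \<in> carrier (mpoly K Xs)" "x = V.ev a p" using s by blast
  then show "C \<in> U.ev (\<lambda>i. pr (a i)) ` carrier (mpoly K Xs)" using ev_pr(2)[OF a, of p Xs] x(2) by auto
qed

text \<open>Change of rings along the presentation: the module has constant 0 over the Veronese
  ring, which has constant \<open>r\<close> over the polynomial ring, and the constants add.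
  \<open>veronese\<close> and \<open>vring\<close> differ only in their carriers, so
  \<open>lin_iso\<close> with the identity map passes between them.\<close>

lemma lin_veronese_quotient:
  assumes a: "range a \<subseteq> homog (veronese c A) 1"
    and L: "lin (vring c A) 1 p 0 ((quot_module A J)\<lparr>homog := \<lambda>j. homog (quot_module A J) (int c * j)\<rparr>)"
    and lin: "lin (mpoly K Xs) 1 p r (restrict_scalars (V.ev a) (veronese c A))"
  shows "lin (mpoly K Xs) 1 p r (restrict_scalars (U.ev (\<lambda>i. pr (a i))) (veronese c Q))"
proof -
  let ?P = "mpoly K Xs" and ?f = "V.ev a" and ?R = "vring c A"
  let ?b = "\<lambda>i. pr (a i)"
  let ?M = "(quot_module A J)\<lparr>homog := \<lambda>j. homog (quot_module A J) (int c * j)\<rparr>"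
  interpret E: graded_hom ?P "veronese c A" ?f by (rule V.ev_graded_hom[OF a])
  interpret EU: graded_hom ?P "veronese c Q" "U.ev ?b" by (rule U.ev_graded_hom[OF ev_pr(1)[OF a]])
  note sub = veronese_carrier_subset[of _ c]
  interpret R: graded_ring ?R by (rule graded_ring_vring)
  interpret H: graded_hom ?P ?R ?f
    by (intro graded_hom.intro graded_hom_axioms.intro E.A.graded_ring_axioms R.graded_ring_axioms)
      (use E.homD E.hom_homog sub in \<open>auto simp: ring_hom_def veronese_simps(2,3,5,7)\<close>)
  have gM: "graded_module ?R ?M" using graded_module_vring[OF quot_module_facts(1), of c 0] by simp
  have i1: "graded_linear ?P (restrict_scalars ?f (veronese c A)) (resm ?f (selfm ?R)) (\<lambda>x. x)"
    by (rule graded_linearI) (auto simp: resm_simps veronese_simps(2,5,7) sub)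
  have "lin ?P 1 p r (restrict_scalars ?f (veronese c A)) \<longleftrightarrow> lin ?P 1 p r (resm ?f (selfm ?R))"
    by (rule E.A.lin_iso[OF E.graded_module_restrict H.graded_module_resm[OF R.graded_module_selfm] i1])
      (auto simp: resm_simps veronese_simps(4,7))
  then have "lin ?P 1 p (0 + r) (resm ?f ?M)" using H.lin_resm[OF _ gM L] lin by blast
  moreover have i2: "graded_linear ?P (restrict_scalars (U.ev ?b) (veronese c Q)) (resm ?f ?M) (\<lambda>x. x)"
    by (rule graded_linearI)
     (auto simp: resm_simps veronese_simps(2,5,7) QA.veronese_carrier_subset quot_module_eq ev_pr(2)[OF a])
  have "lin ?P 1 p r (restrict_scalars (U.ev ?b) (veronese c Q)) \<longleftrightarrow> lin ?P 1 p r (resm ?f ?M)"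
    by (rule E.A.lin_iso[OF EU.graded_module_restrict H.graded_module_resm[OF gM] i2])
      (auto simp: resm_simps veronese_simps(4,7) quot_module_eq)
  ultimately show ?thesis by simp
qed

end

end

subsection \<open>Koszul algebras\<close>

lemma standard_graded_algebraD:
  assumes "standard_graded_algebra K (A :: ('k, 'b) graded)"
  obtains comp S where "graded_algebra (K :: 'k ring) A comp" "standard_generators A comp S" "finite S"
proof -
  interpret S: standard_graded_algebra K A by fact
  interpret KA: algebra K A by (rule S.algebra)
  note cr = algebra.axioms(2)[OF S.algebra]
  have sub: "additive_subgroup (homog A i) A" for i using S.decomposition by (simp add: direct_sum_of_homog_def)
  obtain comp where dec: "decomposed A comp" using decomposed_of_direct_sum[OF ring.axioms(1)[OF cring.axioms(1)[OF cr]] S.decomposition] ..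
  have h0: "homog A 0 = (\<lambda>k. k \<odot>\<^bsub>A\<^esub> \<one>\<^bsub>A\<^esub>) ` carrier K" using S.degree_zero by (simp add: bij_betw_def)
  have "\<one>\<^bsub>A\<^esub> \<in> homog A 0" unfolding h0 by (intro image_eqI[of _ _ "\<one>\<^bsub>K\<^esub>"]) (simp_all add: KA.smult_one)
  then have gr: "graded_ring A"
    by (intro graded_ring.intro graded_ring_axioms.intro cr sub S.homog_mult) simp_all
  obtain S where "finite S" "S \<subseteq> homog A 1" "generate_ring A (homog A 0 \<union> S) = carrier A"
    using S.generated_in_degree_one by (elim exE conjE)
  then show ?thesis
    by (intro that[of comp S] graded_algebra.intro graded_algebra_axioms.intro standard_generators.intro standard_generators_axioms.intro
      gr dec S.field S.algebra h0 S.nonneg_degrees)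
qed

text \<open>Since \<open>t0 \<le> 0\<close>, subtracting it from \<open>t\<close> does not decrease
  \<open>t\<close>, so the bound on the quotient also bounds \<open>x / i\<close>. The comparison
  stays in the extended reals as \<open>t\<close> and \<open>t0\<close> may be infinite.\<close>

lemma ereal_slope_bound:
  assumes "(t - t0) / ereal (real i) \<le> ereal (real c)" "0 < i" "t0 \<le> 0" "ereal x \<le> t"
  shows "x \<le> real c * real i"
proof -
  have "ereal x - 0 \<le> t - t0" using assms(3,4) by (intro ereal_minus_mono) auto
  then have "(ereal x - 0) / ereal (real i) \<le> (t - t0) / ereal (real i)"
    using assms(2) by (intro ereal_divide_right_mono) auto
  then have "ereal (x / real i) \<le> (t - t0) / ereal (real i)" using assms(2) by simp
  from order.trans[OF this assms(1)] show ?thesis using assms(2) by (simp add: divide_le_eq)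
qed

theorem theorem5p2:
  fixes K :: "'k ring" and D :: "('k, 'b) graded" and I :: "'b set" and c :: nat
  assumes "field K"
    and "koszul K D"
    and "homogeneous_ideal I D"
    and "c \<ge> 1"
    and "ereal (real c) \<ge> slope D (quot_module D I)"
  shows "gl_index K (veronese c (quot_algebra D I)) \<ge> gl_index K (veronese c D)"
proof -
  have std: "standard_graded_algebra K D" and koszul: "\<And>i j. j \<noteq> int i \<Longrightarrow> \<not> Tor_nonzero D (residue_module D) i j"
    using assms(2) by (auto simp: koszul_def)
  obtain comp S where "graded_algebra K D comp" and SG: "standard_generators D comp S" and S: "finite S"
    by (rule standard_graded_algebraD[OF std])
  then interpret D: graded_algebra K D comp by blast
  interpret SG: standard_generators D comp S by (rule SG)
  note cg = SG.countably_generated_selfm[OF S]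
  interpret DR: decomposed_ring D comp by (rule D.decomposed_ring[OF cg])
  have quot_cg: "countably_generated D (quot_module D J)" if "graded_quotient K D comp J" for J
  proof -
    interpret X: graded_quotient K D comp J by fact
    show ?thesis
      by (rule countably_generated_image[OF D.graded_module_selfm X.quot_module_facts(1,3) _ cg]) (simp add: X.quot_module_facts(4))
  qed
  interpret Q: graded_quotient K D comp I by (rule D.graded_quotient_homogeneous[OF assms(3)])
  interpret m: graded_quotient K D comp "irrelevant_ideal D" by (rule D.graded_quotient_irrelevant)
  let ?N = "residue_module D" and ?M = "quot_module D I"
  note N = m.quot_module_facts[folded residue_module_def]
  note M = Q.quot_module_facts

  \<comment> \<open>Tor of the residue field vanishes off the diagonal, in particular above the line
    of slope 1 through 0.\<close>
  have linN: "lin D 1 p 0 ?N" for p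
    by (rule DR.Tor_vanishing_iff_lin(1)[OF N(1,2) quot_cg[OF m.graded_quotient_axioms, folded residue_module_def]])
      (simp, rule koszul, simp)
  have ker: "kerm (selfm D) ?N (\<lambda>x. irrelevant_ideal D +>\<^bsub>D\<^esub> x) = (selfm D)\<lparr>homog := \<lambda>j. if j \<ge> 1 then homog D j else {\<zero>\<^bsub>D\<^esub>}\<rparr>"
  proof -
    have "{x \<in> homog D j. irrelevant_ideal D +>\<^bsub>D\<^esub> x = \<zero>\<^bsub>?N\<^esub>} = (if j \<ge> 1 then homog D j else {\<zero>\<^bsub>D\<^esub>})" for j
    proof -
      have "irrelevant_ideal D +>\<^bsub>D\<^esub> x = \<zero>\<^bsub>?N\<^esub> \<longleftrightarrow> 0 < j \<or> x = \<zero>\<^bsub>D\<^esub>" if "x \<in> homog D j" for x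
        unfolding N(6) m.pr_eq_zero[OF D.homog_carrier[OF that]] by (rule DR.irrelevant_ideal_homog[OF that])
      then show ?thesis using D.homog_zero[of j] by auto
    qed
    then show ?thesis by (simp add: kerm_def)
  qed
  obtain J :: "nat set" and g where cov: "cover D J (\<lambda>_. 1) g ((selfm D)\<lparr>homog := \<lambda>j. if j \<ge> 1 then homog D j else {\<zero>\<^bsub>D\<^esub>}\<rparr>)"
    using SG.cover_irrelevant[OF S] by (elim exE)
  have ver: "lin (vring c D) 1 p 0 ((selfm D)\<lparr>homog := \<lambda>j. homog D (int c * j + e)\<rparr>)" if "0 \<le> e" for p e
    by (rule D.veronese_modules_linear[OF _ D.neg_homog' N(1) linN N(3) _ ker cov that]) (use assms(4) N(4) in auto)

  have linM: "lin D (int c) p 0 ?M" for p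
  proof (rule DR.Tor_vanishing_iff_lin(1)[OF M(1,2) quot_cg[OF Q.graded_quotient_axioms]])
    fix i j assume ij: "0 + int c * int i < j"
    \<comment> \<open>The quotient is generated by the class of 1 in degree 0, so its Tor in
      homological degree 0 vanishes in positive degrees. This case is separate because the slope
      only sees \<open>i > 0\<close>; it also yields the bound
      \<open>top_degree D ?M 0 \<le> 0\<close>, which turns the slope condition into a bound on the
      other top degrees.\<close>
    have "lin D (int c) 0 0 ?M"
      by (rule D.lin_quotient[OF D.graded_module_selfm M(1,3)]) (simp_all add: M(4) D.lin_selfm)
    from DR.Tor_vanishing_iff_lin(2)[OF M(1,2) quot_cg[OF Q.graded_quotient_axioms] this, of 0]
    have t0: "\<not> Tor_nonzero D ?M 0 j" if "0 < j" for j using that by simp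
    show "\<not> Tor_nonzero D ?M i j"
    proof
      assume t: "Tor_nonzero D ?M i j"
      then have i: "0 < i" using t0[of j] ij by (cases "i = 0") auto
      have "top_degree D ?M 0 \<le> ereal 0" unfolding top_degree_le using t0 by (auto simp: not_less[symmetric])
      moreover have "ereal (real_of_int j) \<le> top_degree D ?M i" unfolding top_degree_def using t by (intro SUP_upper) simp
      moreover have "(top_degree D ?M i - top_degree D ?M 0) / ereal (real i) \<le> slope D ?M"
        unfolding slope_def using i by (intro SUP_upper) simp
      ultimately have "real_of_int j \<le> real c * real i"
        using assms(5) i by (intro ereal_slope_bound[of _ "top_degree D ?M 0"]) (auto simp: zero_ereal_def)
      then have "real_of_int j \<le> real_of_int (int c * int i)" by simp
      then show False using ij by linarith
    qed
  qed simp
  have linV: "lin (vring c D) 1 p 0 (?M\<lparr>homog := \<lambda>j. homog ?M (int c * j)\<rparr>)" for p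
    by (rule D.veronese_lin[OF ver M(1)]) (simp_all add: linM)

  interpret V: graded_algebra K "veronese c D" "\<lambda>i. comp (int c * i)" by (rule D.veronese_graded_algebra[OF assms(4)])
  interpret QA: graded_algebra K "quot_algebra D I" Q.Qcomp by (rule Q.Q_graded_algebra)
  interpret U: graded_algebra K "veronese c (quot_algebra D I)" "\<lambda>i. Q.Qcomp (int c * i)" by (rule QA.veronese_graded_algebra[OF assms(4)])
  obtain n a where a: "range a \<subseteq> homog (veronese c D) 1" "carrier (veronese c D) \<subseteq> V.ev a ` carrier (mpoly K {..<n})"
    by (rule D.veronese_presentation[OF SG S assms(4)])
  show ?thesis
    \<comment> \<open>The polynomial ring of the Veronese algebra of \<open>D\<close> also presents
      that of the quotient, by composing with the projection. Each \<open>p\<close> admissible for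
      the former is admissible for the latter, and the suprema compare accordingly.\<close>
    unfolding V.gl_index_eq[OF a] U.gl_index_eq[OF Q.ev_pr(1)[OF assms(4) a(1)] Q.ev_pr_surj[OF assms(4) a]]
    by (intro Sup_subset_mono) (use Q.lin_veronese_quotient[OF assms(4) a(1) linV] in auto)
qed

end
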